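(* Let $\widetilde{M}$ be a Hadamard manifold and $\pi:\widetilde{M}\to M$ a Riemannian covering. For each $x\in M$ let $\tilde{x}\in\widetilde{M}$ denote an arbitrary lift of $x$. Suppose that $f:M\to M$ is a homeomorphism that is isotopic to the identity, that $F:\widetilde{M}\to\widetilde{M}$ is a lift of $f$ that commutes with all covering transformations, and that $\mu$ is an $f$-invariant Borel probability measure on $M$ satisfying $$\int_M d(\tilde{x},F\tilde{x})\,\mathrm{d}\mu(x)<+\infty .$$ Then for $\mu$-almost every $x\in M$ there exists a unique rotation vector $v_F(x)\in T_xM$.
   Context: A Hadamard manifold is a complete, connected and simply connected Riemannian manifold with non-positive sectional curvature. A Riemannian covering is a covering map $\pi:\widetilde{M}\to M$ between Riemannian manifolds that is a local isometry at all points. $d$ denotes the Riemannian distance. Since $F$ commutes with all covering transformations (which are isometries), $d(\tilde{x},F\tilde{x})$ does not depend on the chosen lift $\tilde{x}$ of $x$. Rotation vector: let $\pi:\widetilde{M}\to M$ be a Riemannian covering, $f:M\to M$ a homeomorphism and $F:\widetilde{M}\to\widetilde{M}$ a lift of $f$. A rotation vector $v_F(x)$ of a point $x\in M$ is a vector in $T_xM$ such that for any lift $\tilde{x}$ of $x$ one has $d(\tilde{\alpha}(n),F^n\tilde{x})=o(n)$ when $n\to+\infty$, where $\tilde{\alpha}$ is the lift starting at $\tilde{x}$ of the geodesic $\alpha:[0,+\infty)\to M$, $\alpha(t)=\exp_x(t\,v_F(x))$. *)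

theory Defs
  imports "HOL-Probability.Probability" "HOL-Library.Landau_Symbols"
begin

section \<open>Smooth maps between Euclidean spaces\<close>

text \<open>In finite dimension, being \<open>C\<^sup>k\<^sup>+\<^sup>1\<close> on an open set is the same as being differentiable
  with all directional derivatives of class \<open>C\<^sup>k\<close>. Only used for open \<open>S\<close>.\<close>

primrec C_on :: "nat \<Rightarrow> 'a::euclidean_space set \<Rightarrow> ('a \<Rightarrow> 'b::real_normed_vector) \<Rightarrow> bool" where
  "C_on 0 S f \<longleftrightarrow> continuous_on S f"
| "C_on (Suc k) S f \<longleftrightarrow>
     f differentiable_on S \<and> (\<forall>v. C_on k S (\<lambda>x. frechet_derivative f (at x) v))"

definition smooth_on :: "'a::euclidean_space set \<Rightarrow> ('a \<Rightarrow> 'b::real_normed_vector) \<Rightarrow> bool" where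
  "smooth_on S f \<longleftrightarrow> (\<forall>k. C_on k S f)"


section \<open>Smooth and Riemannian manifolds\<close>

text \<open>A manifold is a whole type \<open>'m\<close> with its topology (Hausdorff and second countable through the
  type classes), and \<open>'e\<close> is its model space, so that the dimension is \<open>DIM('e)\<close>.
  A chart is a pair of an open set and a coordinate map; the values of the
  coordinate map outside of that set are irrelevant.\<close>

type_synonym ('m, 'e) chart = "'m set \<times> ('m \<Rightarrow> 'e)"

abbreviation chart_dom :: "('m, 'e) chart \<Rightarrow> 'm set" where "chart_dom \<equiv> fst"

abbreviation coord :: "('m, 'e) chart \<Rightarrow> 'm \<Rightarrow> 'e" where "coord \<equiv> snd"

abbreviation chart_inv :: "('m, 'e) chart \<Rightarrow> 'e \<Rightarrow> 'm" where
  "chart_inv c \<equiv> inv_into (chart_dom c) (coord c)"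

text \<open>\<open>coord_rep c c' h\<close> is the expression of the map \<open>h\<close> in the chart \<open>c\<close> of its source and
  the chart \<open>c'\<close> of its target.\<close>

definition coord_rep ::
    "('m, 'e) chart \<Rightarrow> ('n, 'f) chart \<Rightarrow> ('m \<Rightarrow> 'n) \<Rightarrow> 'e \<Rightarrow> 'f" where
  "coord_rep c c' h = coord c' \<circ> h \<circ> chart_inv c"

definition is_chart :: "('m::topological_space, 'e::euclidean_space) chart \<Rightarrow> bool" where
  "is_chart c \<longleftrightarrow> open (chart_dom c) \<and> open (coord c ` chart_dom c) \<and>
     homeomorphism (chart_dom c) (coord c ` chart_dom c) (coord c) (chart_inv c)"

definition smooth_atlas :: "('m::topological_space, 'e::euclidean_space) chart set \<Rightarrow> bool" where
  "smooth_atlas \<A> \<longleftrightarrow>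
     (\<forall>c\<in>\<A>. is_chart c) \<and> (\<Union>c\<in>\<A>. chart_dom c) = UNIV \<and>
     (\<forall>c\<in>\<A>. \<forall>c'\<in>\<A>. smooth_on (coord c ` (chart_dom c \<inter> chart_dom c')) (coord_rep c c' id))"

text \<open>The metric tensor is given by its local expressions: \<open>metric_at R c p u v\<close> is the inner
  product of the coordinate vectors \<open>u\<close> and \<open>v\<close> at the point with coordinates \<open>p\<close> in the chart \<open>c\<close>.\<close>

record ('m, 'e) riemannian =
  charts :: "('m, 'e) chart set"
  metric_at :: "('m, 'e) chart \<Rightarrow> 'e \<Rightarrow> 'e \<Rightarrow> 'e \<Rightarrow> real"

definition riemannian_manifold ::
    "('m::{t2_space, second_countable_topology}, 'e::euclidean_space) riemannian \<Rightarrow> bool" where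
  "riemannian_manifold R \<longleftrightarrow> smooth_atlas (charts R) \<and>
     (\<forall>c\<in>charts R.
        (\<forall>p\<in>coord c ` chart_dom c.
           bilinear (metric_at R c p) \<and>
           (\<forall>u v. metric_at R c p u v = metric_at R c p v u) \<and>
           (\<forall>u. u \<noteq> 0 \<longrightarrow> metric_at R c p u u > 0)) \<and>
        (\<forall>u v. smooth_on (coord c ` chart_dom c) (\<lambda>p. metric_at R c p u v))) \<and>
     (\<forall>c\<in>charts R. \<forall>c'\<in>charts R. \<forall>x\<in>chart_dom c \<inter> chart_dom c'. \<forall>u v.
        let D = frechet_derivative (coord_rep c c' id) (at (coord c x))
        in metric_at R c' (coord c' x) (D u) (D v) = metric_at R c (coord c x) u v)"

text \<open>A tangent vector at \<open>x\<close> is the family of its components in all charts around \<open>x\<close>,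
  normalized to \<open>0\<close> at all other arguments so that equality of tangent vectors is equality
  of functions.\<close>

definition tangent_space ::
    "('m, 'e::euclidean_space) riemannian \<Rightarrow> 'm \<Rightarrow> (('m, 'e) chart \<Rightarrow> 'e) set" where
  "tangent_space R x = {v.
     (\<forall>c\<in>charts R. \<forall>c'\<in>charts R. x \<in> chart_dom c \<inter> chart_dom c' \<longrightarrow>
        v c' = frechet_derivative (coord_rep c c' id) (at (coord c x)) (v c)) \<and>
     (\<forall>c. c \<notin> charts R \<or> x \<notin> chart_dom c \<longrightarrow> v c = 0)}"

definition tangent_scale ::
    "real \<Rightarrow> (('m, 'e::real_vector) chart \<Rightarrow> 'e) \<Rightarrow> ('m, 'e) chart \<Rightarrow> 'e" where
  "tangent_scale t v = (\<lambda>c. t *\<^sub>R v c)"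


section \<open>Riemannian distance\<close>

definition C1_curve_on ::
    "('m::topological_space, 'e::euclidean_space) riemannian \<Rightarrow> real \<Rightarrow> real \<Rightarrow> (real \<Rightarrow> 'm) \<Rightarrow> bool"
  where
  "C1_curve_on R a b \<gamma> \<longleftrightarrow> continuous_on {a..b} \<gamma> \<and>
     (\<forall>c\<in>charts R. \<exists>v. continuous_on ({a..b} \<inter> \<gamma> -` chart_dom c) v \<and>
        (\<forall>t\<in>{a..b} \<inter> \<gamma> -` chart_dom c.
           ((coord c \<circ> \<gamma>) has_vector_derivative v t) (at t within {a..b})))"

definition piecewise_C1_curve ::
    "('m::topological_space, 'e::euclidean_space) riemannian \<Rightarrow> (real \<Rightarrow> 'm) \<Rightarrow> bool" where
  "piecewise_C1_curve R \<gamma> \<longleftrightarrow> (\<exists>P. finite P \<and> {0, 1} \<subseteq> P \<and> P \<subseteq> {0..1} \<and>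
     (\<forall>a\<in>P. \<forall>b\<in>P. a < b \<and> P \<inter> {a<..<b} = {} \<longrightarrow> C1_curve_on R a b \<gamma>))"

text \<open>The speed does not depend on the choice of the chart; at the finitely many break points of
  a piecewise \<open>C\<^sup>1\<close> curve its value is irrelevant.\<close>

definition speed ::
    "('m, 'e::euclidean_space) riemannian \<Rightarrow> (real \<Rightarrow> 'm) \<Rightarrow> real \<Rightarrow> real" where
  "speed R \<gamma> t =
     (let c = SOME c. c \<in> charts R \<and> \<gamma> t \<in> chart_dom c;
          v = vector_derivative (coord c \<circ> \<gamma>) (at t)
      in sqrt (metric_at R c (coord c (\<gamma> t)) v v))"

definition curve_length ::
    "('m, 'e::euclidean_space) riemannian \<Rightarrow> (real \<Rightarrow> 'm) \<Rightarrow> real" where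
  "curve_length R \<gamma> = integral {0..1} (speed R \<gamma>)"

text \<open>Meaningful on connected manifolds, where the set of curves is nonempty.\<close>

definition riem_dist ::
    "('m::topological_space, 'e::euclidean_space) riemannian \<Rightarrow> 'm \<Rightarrow> 'm \<Rightarrow> real" where
  "riem_dist R x y = Inf {curve_length R \<gamma> | \<gamma>. piecewise_C1_curve R \<gamma> \<and> \<gamma> 0 = x \<and> \<gamma> 1 = y}"


section \<open>Levi-Civita connection, geodesics, exponential map\<close>

text \<open>\<open>christoffel R c p u v\<close> is the covariant derivative at \<open>p\<close>, along the vector \<open>u\<close>, of the vector
  field with constant coordinates \<open>v\<close>; it is determined by the Koszul formula. In coordinates,
  it is the vector \<open>\<Sum> \<Gamma>\<^sup>k\<^sub>i\<^sub>j u\<^sup>i v\<^sup>j \<partial>\<^sub>k\<close>.\<close>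

definition christoffel ::
    "('m, 'e::euclidean_space) riemannian \<Rightarrow> ('m, 'e) chart \<Rightarrow> 'e \<Rightarrow> 'e \<Rightarrow> 'e \<Rightarrow> 'e" where
  "christoffel R c p u v = (THE z. \<forall>w. metric_at R c p z w =
     (frechet_derivative (\<lambda>q. metric_at R c q v w) (at p) u
      + frechet_derivative (\<lambda>q. metric_at R c q u w) (at p) v
      - frechet_derivative (\<lambda>q. metric_at R c q u v) (at p) w) / 2)"

text \<open>The geodesic equation in a chart, \<open>x'' + \<Gamma>\<^sub>x(x', x') = 0\<close>, with \<open>v\<close> in the role of \<open>x'\<close>.\<close>

definition geodesic_on ::
    "('m::topological_space, 'e::euclidean_space) riemannian \<Rightarrow> real set \<Rightarrow> (real \<Rightarrow> 'm) \<Rightarrow> bool"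
  where
  "geodesic_on R I \<gamma> \<longleftrightarrow> continuous_on I \<gamma> \<and>
     (\<forall>c\<in>charts R. \<exists>v. \<forall>t\<in>I \<inter> \<gamma> -` chart_dom c.
        ((coord c \<circ> \<gamma>) has_vector_derivative v t) (at t within I) \<and>
        (v has_vector_derivative - christoffel R c (coord c (\<gamma> t)) (v t) (v t)) (at t within I))"

definition riem_exp ::
    "('m::topological_space, 'e::euclidean_space) riemannian \<Rightarrow> 'm \<Rightarrow> (('m, 'e) chart \<Rightarrow> 'e) \<Rightarrow> 'm"
  where
  "riem_exp R x v = (THE y. \<exists>\<gamma>. geodesic_on R {0..1} \<gamma> \<and> \<gamma> 0 = x \<and>
     (\<forall>c\<in>charts R. x \<in> chart_dom c \<longrightarrow>
        ((coord c \<circ> \<gamma>) has_vector_derivative v c) (at 0 within {0..1})) \<and>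
     \<gamma> 1 = y)"


section \<open>Curvature and Hadamard manifolds\<close>

text \<open>\<open>curvature R c p u v w\<close> is \<open>R(u,v)w = \<nabla>\<^sub>u\<nabla>\<^sub>v w - \<nabla>\<^sub>v\<nabla>\<^sub>u w\<close> for vector fields with constant
  coordinates (whose Lie brackets vanish). With this sign convention round spheres
  have positive sectional curvature.\<close>

definition curvature ::
    "('m, 'e::euclidean_space) riemannian \<Rightarrow> ('m, 'e) chart \<Rightarrow> 'e \<Rightarrow> 'e \<Rightarrow> 'e \<Rightarrow> 'e \<Rightarrow> 'e" where
  "curvature R c p u v w =
     frechet_derivative (\<lambda>q. christoffel R c q v w) (at p) u
     - frechet_derivative (\<lambda>q. christoffel R c q u w) (at p) v
     + christoffel R c p u (christoffel R c p v w)
     - christoffel R c p v (christoffel R c p u w)"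

definition sectional_curvature ::
    "('m, 'e::euclidean_space) riemannian \<Rightarrow> ('m, 'e) chart \<Rightarrow> 'e \<Rightarrow> 'e \<Rightarrow> 'e \<Rightarrow> real" where
  "sectional_curvature R c p u v =
     metric_at R c p (curvature R c p u v v) u /
     (metric_at R c p u u * metric_at R c p v v - (metric_at R c p u v)\<^sup>2)"

definition nonpositively_curved :: "('m, 'e::euclidean_space) riemannian \<Rightarrow> bool" where
  "nonpositively_curved R \<longleftrightarrow>
     (\<forall>c\<in>charts R. \<forall>p\<in>coord c ` chart_dom c. \<forall>u v.
        u \<noteq> v \<and> independent {u, v} \<longrightarrow> sectional_curvature R c p u v \<le> 0)"

definition hadamard_manifold ::
    "('m::{t2_space, second_countable_topology}, 'e::euclidean_space) riemannian \<Rightarrow> bool" where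
  "hadamard_manifold R \<longleftrightarrow> riemannian_manifold R \<and>
     connected (UNIV :: 'm set) \<and> simply_connected (UNIV :: 'm set) \<and>
     Metric_space.mcomplete UNIV (riem_dist R) \<and> nonpositively_curved R"


section \<open>Riemannian coverings\<close>

definition smooth_map_on ::
    "('m::topological_space, 'e::euclidean_space) riemannian \<Rightarrow>
     ('n::topological_space, 'f::euclidean_space) riemannian \<Rightarrow> 'm set \<Rightarrow> ('m \<Rightarrow> 'n) \<Rightarrow> bool" where
  "smooth_map_on R R' V h \<longleftrightarrow> continuous_on V h \<and>
     (\<forall>c\<in>charts R. \<forall>c'\<in>charts R'.
        smooth_on (coord c ` (chart_dom c \<inter> V \<inter> h -` chart_dom c')) (coord_rep c c' h))"

definition local_isometry_at ::
    "('m::topological_space, 'e::euclidean_space) riemannian \<Rightarrow>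
     ('n::topological_space, 'e) riemannian \<Rightarrow> ('m \<Rightarrow> 'n) \<Rightarrow> 'm \<Rightarrow> bool" where
  "local_isometry_at R R' h x \<longleftrightarrow> (\<exists>V. open V \<and> x \<in> V \<and> open (h ` V) \<and> inj_on h V \<and>
     smooth_map_on R R' V h \<and> smooth_map_on R' R (h ` V) (inv_into V h) \<and>
     (\<forall>y\<in>V. \<forall>c\<in>charts R. \<forall>c'\<in>charts R'. y \<in> chart_dom c \<and> h y \<in> chart_dom c' \<longrightarrow>
        (\<forall>u v. let D = frechet_derivative (coord_rep c c' h) (at (coord c y))
               in metric_at R' c' (coord c' (h y)) (D u) (D v) = metric_at R c (coord c y) u v)))"

definition riemannian_covering ::
    "('c::{t2_space, second_countable_topology}, 'e::euclidean_space) riemannian \<Rightarrow>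
     ('m::{t2_space, second_countable_topology}, 'e) riemannian \<Rightarrow> ('c \<Rightarrow> 'm) \<Rightarrow> bool" where
  "riemannian_covering Rt R \<pi> \<longleftrightarrow> riemannian_manifold Rt \<and> riemannian_manifold R \<and>
     covering_space UNIV \<pi> UNIV \<and> (\<forall>x. local_isometry_at Rt R \<pi> x)"

definition covering_transformation ::
    "('c::topological_space \<Rightarrow> 'm) \<Rightarrow> ('c \<Rightarrow> 'c) \<Rightarrow> bool" where
  "covering_transformation \<pi> \<tau> \<longleftrightarrow> (\<exists>\<tau>'. homeomorphism UNIV UNIV \<tau> \<tau>') \<and> \<pi> \<circ> \<tau> = \<pi>"

definition lift_of :: "('c::topological_space \<Rightarrow> 'm) \<Rightarrow> ('m \<Rightarrow> 'm) \<Rightarrow> ('c \<Rightarrow> 'c) \<Rightarrow> bool" where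
  "lift_of \<pi> f F \<longleftrightarrow> continuous_on UNIV F \<and> \<pi> \<circ> F = f \<circ> \<pi>"

definition isotopic_to_id :: "('m::topological_space \<Rightarrow> 'm) \<Rightarrow> bool" where
  "isotopic_to_id f \<longleftrightarrow>
     homotopic_with (\<lambda>h. \<exists>k. homeomorphism UNIV UNIV h k) euclidean euclidean id f"


section \<open>Rotation vectors\<close>

text \<open>\<open>\<alpha>\<close> is the (unique) lift starting at \<open>xt\<close> of the geodesic \<open>t \<mapsto> exp\<^sub>x(t v)\<close> on \<open>[0,\<infinity>)\<close>.\<close>

definition is_rotation_vector ::
    "('c::topological_space, 'e::euclidean_space) riemannian \<Rightarrow>
     ('m::topological_space, 'e) riemannian \<Rightarrow> ('c \<Rightarrow> 'm) \<Rightarrow> ('c \<Rightarrow> 'c) \<Rightarrow>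
     'm \<Rightarrow> (('m, 'e) chart \<Rightarrow> 'e) \<Rightarrow> bool" where
  "is_rotation_vector Rt R \<pi> F x v \<longleftrightarrow> v \<in> tangent_space R x \<and>
     (\<forall>xt. \<pi> xt = x \<longrightarrow>
        (\<exists>\<alpha>. continuous_on {0..} \<alpha> \<and> \<alpha> 0 = xt \<and>
             (\<forall>t\<ge>0. \<pi> (\<alpha> t) = riem_exp R x (tangent_scale t v)) \<and>
             (\<lambda>n. riem_dist Rt (\<alpha> (real n)) ((F ^^ n) xt)) \<in> o(\<lambda>n. real n)))"

end

theory Submission
  imports Defs
begin

text \<open>Let \<open>E\<close> be the exponential map of the Hadamard manifold at a lift \<open>o\<close> of \<open>x\<close>. By the theorem of
  Cartan--Hadamard, \<open>E\<close> is bijective and does not decrease distances, and applying this at the points of a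
  geodesic gives the comparison of triangles with flat ones.

  The displacements \<open>a n x\<close>, the distance from \<open>o\<close> to \<open>y n = (F ^^ n) o\<close>, form a subadditive cocycle over
  \<open>f\<close>. Let \<open>A x\<close> be the upper limit of \<open>a n x / n\<close>. As observed by Karlsson and Margulis, the maximal ergodic
  theorem and the leader lemma of Riesz imply that for almost every \<open>x\<close> and every \<open>\<beta> < A x\<close> there are a
  constant \<open>C\<close> and infinitely many \<open>n\<close> with \<open>\<beta> * k - C \<le> a n x - a (n - k) ((f ^^ k) x)\<close> for all \<open>k \<le> n\<close>.
  Since \<open>a (n - k) ((f ^^ k) x)\<close> is the distance from \<open>y k\<close> to \<open>y n\<close>, comparison shows that the geodesic
  from \<open>o\<close> to \<open>y n\<close> stays close to the points \<open>y k\<close>: if \<open>u\<close> is a limit of its directions as \<open>n\<close> grows, then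
  the distance from \<open>E (\<beta> * k * u)\<close> to \<open>y k\<close> is asymptotically at most \<open>k * sqrt ((A x)\<^sup>2 - \<beta>\<^sup>2)\<close>. The vectors
  \<open>\<beta> * u\<close> converge to the rotation vector as \<open>\<beta>\<close> tends to \<open>A x\<close>. It is unique because \<open>E\<close> does not
  decrease distances, and it does not depend on the lift because covering transformations are isometries.\<close>

section \<open>Lifting through local homeomorphisms\<close>

text \<open>A manifold is given chart by chart, so every notion has to be compared between charts.
  Chart changes and the covering map are both local isometries; the locale
  \<open>isometry_patch\<close> treats them together. Curvature enters through Jacobi fields: if it
  is nonpositive, their norms are convex functions of time, which bounds the derivative of
  \<open>E\<close> from below. Hence \<open>E\<close> has local inverses that do not increase
  lengths, lifts of segments through \<open>E\<close> cannot escape to infinity, and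
  \<open>E\<close> behaves like a covering map; simple connectivity then makes it injective. The
  base point is a locale parameter because the comparison of triangles and the isometry of covering
  transformations use the exponential maps at two points at the same time. The leaders give a drift
  at each rate \<open>\<beta>\<close> strictly below \<open>A x\<close> only. For
  \<open>\<beta> = A x - \<eta>\<close> the squared error is of order
  \<open>A x * \<eta> * k\<^sup>2\<close>, which is arbitrarily small relative to
  \<open>k\<^sup>2\<close>. The vectors obtained for different \<open>\<beta>\<close> track the same
  orbit, and the convexity of the distance between two geodesics from \<open>o\<close> turns this
  into a Cauchy sequence.\<close>

definition locally_inj :: "('a::topological_space \<Rightarrow> 'b) \<Rightarrow> bool" where
  "locally_inj p \<longleftrightarrow> (\<forall>a. \<exists>V. open V \<and> a \<in> V \<and> inj_on p V)"

definition local_section :: "('a::topological_space \<Rightarrow> 'b::topological_space) \<Rightarrow> 'a \<Rightarrow> 'b set \<Rightarrow> ('b \<Rightarrow> 'a) \<Rightarrow> bool" where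
  "local_section p a B \<sigma> \<longleftrightarrow> open B \<and> p a \<in> B \<and> continuous_on B \<sigma> \<and> \<sigma> (p a) = a \<and> (\<forall>y\<in>B. p (\<sigma> y) = y)"

text \<open>The set where the two lifts agree is open because \<open>p\<close> is locally injective,
  its complement is open because the space is Hausdorff, and \<open>T\<close> is connected.\<close>

lemma lift_unique:
  fixes p :: "'a::t2_space \<Rightarrow> 'b" and g h :: "'c::topological_space \<Rightarrow> 'a"
  assumes p: "locally_inj p" and T: "connected T" "a \<in> T" "x \<in> T"
    and g: "continuous_on T g" and h: "continuous_on T h"
    and eq: "\<And>t. t \<in> T \<Longrightarrow> p (g t) = p (h t)" and ga: "g a = h a"
  shows "g x = h x"
proof (rule connected_induction_simple[OF T(1,2,3), where P = "\<lambda>t. g t = h t"])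
  show "g a = h a" by (rule ga)
  fix t assume t: "t \<in> T"
  show "\<exists>S. openin (top_of_set T) S \<and> t \<in> S \<and> (\<forall>x\<in>S. \<forall>y\<in>S. g x = h x \<longrightarrow> g y = h y)"
  proof (cases "g t = h t")
    case True
    obtain V where V: "open V" "g t \<in> V" "inj_on p V" using p unfolding locally_inj_def by blast
    let ?S = "(T \<inter> g -` V) \<inter> (T \<inter> h -` V)"
    have "openin (top_of_set T) ?S"
      by (rule openin_Int[OF continuous_openin_preimage_gen[OF g V(1)] continuous_openin_preimage_gen[OF h V(1)]])
    moreover have "t \<in> ?S" using True V t by auto
    moreover have "\<forall>x\<in>?S. \<forall>y\<in>?S. g x = h x \<longrightarrow> g y = h y"
      using V(3) eq by (auto simp: inj_on_def)
    ultimately show ?thesis by blast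
  next
    case False
    then obtain U V where UV: "open U" "open V" "g t \<in> U" "h t \<in> V" "U \<inter> V = {}"
      using hausdorff[OF False] by blast
    let ?S = "(T \<inter> g -` U) \<inter> (T \<inter> h -` V)"
    have "openin (top_of_set T) ?S"
      by (rule openin_Int[OF continuous_openin_preimage_gen[OF g UV(1)] continuous_openin_preimage_gen[OF h UV(2)]])
    moreover have "t \<in> ?S" using UV t by auto
    moreover have "\<forall>x\<in>?S. g x \<noteq> h x" using UV by auto
    ultimately show ?thesis by blast
  qed
qed

text \<open>Shrinking \<open>B\<close> until the section takes its values in a set where
  \<open>p\<close> is injective makes the section a left inverse of \<open>p\<close> as
  well.\<close>

lemma local_section_shrink:
  assumes "locally_inj p" "local_section p a B \<sigma>"
  obtains B' V where "local_section p a B' \<sigma>" "B' \<subseteq> B" "open V" "a \<in> V" "inj_on p V" "\<sigma> ` B' \<subseteq> V"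
    "\<And>z. z \<in> V \<Longrightarrow> p z \<in> B' \<Longrightarrow> \<sigma> (p z) = z"
proof -
  obtain V where V: "open V" "a \<in> V" "inj_on p V" using assms(1) unfolding locally_inj_def by blast
  have B: "open B" "p a \<in> B" "continuous_on B \<sigma>" "\<sigma> (p a) = a" "\<And>y. y \<in> B \<Longrightarrow> p (\<sigma> y) = y"
    using assms(2) unfolding local_section_def by auto
  let ?B = "B \<inter> \<sigma> -` V"
  have o: "open ?B" using B V continuous_open_preimage by blast
  have "local_section p a ?B \<sigma>"
    unfolding local_section_def using B V o continuous_on_subset[OF B(3)] by auto
  moreover have "\<And>z. z \<in> V \<Longrightarrow> p z \<in> ?B \<Longrightarrow> \<sigma> (p z) = z"
    using V(3) B(5) by (metis Int_iff inj_on_def vimage_eq)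
  ultimately show ?thesis using that[of ?B V] V by auto
qed

lemma tendsto_imp_ev_within:
  assumes "continuous (at x within S) f" "open V" "f x \<in> V"
  shows "eventually (\<lambda>u. f u \<in> V) (at x within S)"
  using assms by (simp add: continuous_within topological_tendstoD)

text \<open>The lift at \<open>u\<close> is the end point of the lift of the segment from \<open>a0\<close> to \<open>u\<close>; its
  continuity is propagated along the segment.\<close>

lemma convex_lift:
  fixes p :: "'a::t2_space \<Rightarrow> 'b::t2_space" and h :: "'v::real_normed_vector \<Rightarrow> 'b"
  assumes p: "locally_inj p" and sec: "\<And>a. \<exists>B \<sigma>. local_section p a B \<sigma>"
    and S: "convex S" "a0 \<in> S" and h: "continuous_on S h" and c0: "p c0 = h a0"
    and lft: "\<And>u. u \<in> S \<Longrightarrow> \<exists>l. continuous_on {0..1::real} l \<and> l 0 = c0 \<and>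
      (\<forall>s\<in>{0..1}. p (l s) = h (a0 + s *\<^sub>R (u - a0)))"
  obtains g where "continuous_on S g" "g a0 = c0" "\<And>u. u \<in> S \<Longrightarrow> p (g u) = h u"
proof -
  obtain l where l: "\<And>u. u \<in> S \<Longrightarrow> continuous_on {0..1::real} (l u)" "\<And>u. u \<in> S \<Longrightarrow> l u 0 = c0"
    "\<And>u s. u \<in> S \<Longrightarrow> s \<in> {0..1} \<Longrightarrow> p (l u s) = h (a0 + s *\<^sub>R (u - a0))"
    using lft by metis
  let ?x = "\<lambda>s u. a0 + s *\<^sub>R (u - a0)"
  have xS: "?x s u \<in> S" if "u \<in> S" "s \<in> {0..1}" for s u
  proof -
    have "?x s u = (1 - s) *\<^sub>R a0 + s *\<^sub>R u" by (simp add: algebra_simps)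
    with that S show ?thesis by (simp add: convexD_alt)
  qed
  have cont: "continuous (at u0 within S) (\<lambda>u. l u 1)" if u0: "u0 \<in> S" for u0
  proof (rule connected_induction_simple[of "{0..1::real}" 0 1 "\<lambda>s. continuous (at u0 within S) (\<lambda>u. l u s)"])
    show "continuous (at u0 within S) (\<lambda>u. l u 0)"
      by (rule continuous_transform_within[where f="\<lambda>_. c0" and \<delta>=1]) (use l u0 in auto)
    fix s0 :: real assume s0: "s0 \<in> {0..1}"
    obtain B1 \<sigma> where sB1: "local_section p (l u0 s0) B1 \<sigma>" using sec by blast
    obtain B V where sB: "local_section p (l u0 s0) B \<sigma>" "open V" "l u0 s0 \<in> V" "inj_on p V" "\<sigma> ` B \<subseteq> V"
      "\<And>z. z \<in> V \<Longrightarrow> p z \<in> B \<Longrightarrow> \<sigma> (p z) = z"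
      using local_section_shrink[OF p sB1] by metis
    have B: "open B" "p (l u0 s0) \<in> B" "continuous_on B \<sigma>" "\<And>y. y \<in> B \<Longrightarrow> p (\<sigma> y) = y"
      using sB(1) unfolding local_section_def by auto
    have "continuous_on ({0..1} \<times> S) (\<lambda>(s,u). h (?x s u))"
      unfolding case_prod_unfold
      by (rule continuous_on_compose2[OF h]) (use xS in \<open>auto intro!: continuous_intros\<close>)
    then obtain W where W: "openin (top_of_set ({0..1} \<times> S)) W"
       "W = ({0..1} \<times> S) \<inter> (\<lambda>(s,u). h (?x s u)) -` B"
      using continuous_openin_preimage_gen[OF _ B(1)] by blast
    have "(s0,u0) \<in> W" using W B(2) u0 s0 l(3) by auto
    then obtain d1 where d1: "d1 > 0" "\<And>z. z \<in> {0..1} \<times> S \<Longrightarrow> dist z (s0,u0) < d1 \<Longrightarrow> z \<in> W"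
      using W(1) unfolding openin_euclidean_subtopology_iff by (metis (no_types, lifting))
    have "openin (top_of_set {0..1}) ({0..1} \<inter> l u0 -` V)"
      using l(1)[OF u0] sB(2) continuous_openin_preimage_gen by blast
    moreover have "s0 \<in> {0..1} \<inter> l u0 -` V" using s0 sB by auto
    ultimately obtain d2 where d2: "d2 > 0" "\<And>s. s \<in> {0..1} \<Longrightarrow> dist s s0 < d2 \<Longrightarrow> l u0 s \<in> V"
      unfolding openin_euclidean_subtopology_iff by (metis (no_types, lifting) IntD2 vimageD)
    define d where "d = min (d1/2) d2"
    have d: "d > 0" using d1 d2 by (auto simp: d_def)
    define I where "I = {0..1} \<inter> ball s0 d"
    have Iconv: "connected I" unfolding I_def by (intro convex_connected convex_Int) auto
    have W': "h (?x s u) \<in> B" if "s \<in> I" "u \<in> S" "dist u u0 < d" for s u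
    proof -
      have "dist (s,u) (s0,u0) \<le> dist s s0 + dist u u0" by (simp add: dist_Pair_Pair real_sqrt_sum_squares_triangle_ineq sqrt_sum_squares_le_sum)
      also have "\<dots> < d1" using that by (auto simp: I_def d_def dist_commute)
      finally have "(s,u) \<in> W" using d1 that by (auto simp: I_def)
      then show ?thesis using W by auto
    qed
    show "\<exists>T. openin (top_of_set {0..1}) T \<and> s0 \<in> T \<and> (\<forall>s\<in>T. \<forall>s'\<in>T.
            continuous (at u0 within S) (\<lambda>u. l u s) \<longrightarrow> continuous (at u0 within S) (\<lambda>u. l u s'))"
    proof (intro exI[of _ I] conjI ballI impI)
      show "openin (top_of_set {0..1}) I" unfolding I_def by (auto intro: openin_open_Int)
      show "s0 \<in> I" using s0 d by (auto simp: I_def)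
      fix s s' assume s: "s \<in> I" "s' \<in> I" and P: "continuous (at u0 within S) (\<lambda>u. l u s)"
      have V0: "l u0 s \<in> V" using s d2 by (auto simp: I_def d_def dist_commute)
      have "eventually (\<lambda>u. l u s \<in> V) (at u0 within S)"
        using tendsto_imp_ev_within[OF P sB(2)] V0 by simp
      then obtain e where e: "e > 0" "\<And>u. u \<in> S \<Longrightarrow> dist u u0 < e \<Longrightarrow> l u s \<in> V"
        unfolding eventually_at using V0 by metis
      \<comment> \<open>Over the interval \<open>I\<close> both sides lift the same path, and they
        agree at \<open>s\<close> because \<open>l u s\<close> lies in \<open>V\<close>. So near
        \<open>s0\<close> all lifts are given by the one continuous section.\<close>
      have eq: "l u s' = \<sigma> (h (?x s' u))" if u: "u \<in> S" "dist u u0 < min d e" for u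
      proof (rule lift_unique[OF p Iconv s(1) s(2)])
        show "continuous_on I (l u)" using l(1)[OF u(1)] by (rule continuous_on_subset) (auto simp: I_def)
        show "continuous_on I (\<lambda>s. \<sigma> (h (?x s u)))"
        proof (rule continuous_on_compose2[OF B(3)])
          show "continuous_on I (\<lambda>s. h (?x s u))"
            by (rule continuous_on_compose2[OF h]) (use xS u in \<open>auto intro!: continuous_intros simp: I_def\<close>)
          show "(\<lambda>s. h (?x s u)) ` I \<subseteq> B" using W' u by auto
        qed
        fix t assume "t \<in> I"
        then show "p (l u t) = p (\<sigma> (h (?x t u)))"
          using u W'[of t u] B(4) l(3)[of u t] by (auto simp: I_def)
      next
        have "l u s \<in> V" using e u by auto
        moreover have "p (l u s) = h (?x s u)" using l(3) u s by (auto simp: I_def)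
        ultimately show "l u s = \<sigma> (h (?x s u))" using sB(6)[of "l u s"] W' u s by auto
      qed
      have hc: "continuous (at u0 within S) (\<lambda>u. h (?x s' u))"
      proof -
        have "continuous_on S (\<lambda>u. h (?x s' u))"
          by (rule continuous_on_compose2[OF h]) (use xS s in \<open>auto intro!: continuous_intros simp: I_def\<close>)
        then show ?thesis using u0 by (simp add: continuous_on_eq_continuous_within)
      qed
      have c2: "continuous (at u0 within S) (\<lambda>u. \<sigma> (h (?x s' u)))"
      proof -
        have "isCont \<sigma> (h (?x s' u0))" using B(1,3) W'[OF s(2) u0] d by (simp add: continuous_on_eq_continuous_at)
        then show ?thesis by (intro continuous_within_compose3[OF _ hc, of \<sigma>])
      qed
      show "continuous (at u0 within S) (\<lambda>u. l u s')"
        by (rule continuous_transform_within[OF c2, of "min d e"]) (use d e u0 eq in auto)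
    qed
  qed auto
  show ?thesis
  proof (rule that[of "\<lambda>u. l u 1"])
    show "continuous_on S (\<lambda>u. l u 1)" using cont by (simp add: continuous_on_eq_continuous_within)
    have "l a0 1 = c0"
    proof (rule lift_unique[OF p, of "{0..1::real}" 0 1])
      show "p (l a0 t) = p c0" if "t \<in> {0..1}" for t using that l(3)[OF S(2)] c0 by auto
    qed (use l S in auto)
    then show "l a0 1 = c0" .
    show "p (l u 1) = h u" if "u \<in> S" for u using l(3)[OF that, of 1] by auto
  qed
qed

text \<open>Weaker than being evenly covered: there are sections on the same set \<open>B\<close>
  through all points over it, but no disjoint sheets. Covering maps and, later, the exponential map
  both provide such sets.\<close>

definition section_nbhd :: "('a::topological_space \<Rightarrow> 'b::topological_space) \<Rightarrow> 'b set \<Rightarrow> bool" where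
  "section_nbhd p B \<longleftrightarrow> open B \<and> (\<forall>a. p a \<in> B \<longrightarrow> (\<exists>\<sigma>. local_section p a B \<sigma>))"

text \<open>Connectedness of the interval: near each time \<open>P\<close> holds everywhere or
  nowhere, so it spreads from \<open>0\<close>.\<close>

lemma real_interval_chain:
  fixes b :: real
  assumes P0: "P 0" and b: "0 \<le> b"
    and step: "\<And>t. t \<in> {0..b} \<Longrightarrow> \<exists>e>0. \<forall>s\<in>{0..b}. \<forall>s'\<in>{0..b}. \<bar>s - t\<bar> < e \<longrightarrow> \<bar>s' - t\<bar> < e \<longrightarrow> P s \<longrightarrow> P s'"
    and t: "t \<in> {0..b}"
  shows "P t"
proof (rule connected_induction_simple[of "{0..b}" 0 t P])
  fix a assume "a \<in> {0..b}"
  then obtain e where e: "e > 0" "\<forall>s\<in>{0..b}. \<forall>s'\<in>{0..b}. \<bar>s - a\<bar> < e \<longrightarrow> \<bar>s' - a\<bar> < e \<longrightarrow> P s \<longrightarrow> P s'"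
    using step by blast
  show "\<exists>T. openin (top_of_set {0..b}) T \<and> a \<in> T \<and> (\<forall>x\<in>T. \<forall>y\<in>T. P x \<longrightarrow> P y)"
    using e \<open>a \<in> {0..b}\<close> by (intro exI[of _ "{0..b} \<inter> ball a e"]) (auto intro: openin_open_Int simp: dist_real_def abs_minus_commute)
qed (use assms in auto)

text \<open>The existence of a lift up to a given time spreads: near \<open>t\<close> the path stays
  in one set \<open>B\<close>, and a lift that has reached \<open>B\<close> is continued by the
  section through its end point.\<close>

lemma sections_path_lift:
  fixes p :: "'a::t2_space \<Rightarrow> 'b::t2_space" and \<gamma> :: "real \<Rightarrow> 'b"
  assumes sec: "\<And>b. \<exists>B. b \<in> B \<and> section_nbhd p B"
    and \<gamma>: "continuous_on {0..1} \<gamma>" and a: "p a = \<gamma> 0"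
  obtains l where "continuous_on {0..1} l" "l 0 = a" "\<And>t. t \<in> {0..1} \<Longrightarrow> p (l t) = \<gamma> t"
proof -
  define P where "P t \<longleftrightarrow> (\<exists>l. continuous_on {0..t} l \<and> l 0 = a \<and> (\<forall>s\<in>{0..t}. p (l s) = \<gamma> s))" for t :: real
  have "P 1"
  proof (rule real_interval_chain[of P 1 1])
    show "P 0" unfolding P_def by (rule exI[of _ "\<lambda>_. a"]) (use a in auto)
    fix t :: real assume t: "t \<in> {0..1}"
    obtain B where B: "\<gamma> t \<in> B" "section_nbhd p B" using sec by blast
    have oB: "open B" using B by (auto simp: section_nbhd_def)
    have "openin (top_of_set {0..1}) ({0..1} \<inter> \<gamma> -` B)"
      using \<gamma> oB continuous_openin_preimage_gen by blast
    then obtain e where e: "e > 0" "\<And>s. s \<in> {0..1} \<Longrightarrow> dist s t < e \<Longrightarrow> \<gamma> s \<in> B"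
      unfolding openin_euclidean_subtopology_iff using t B(1)
      by (metis (no_types, lifting) IntD2 IntI vimageD vimageI)
    show "\<exists>e>0. \<forall>s\<in>{0..1}. \<forall>s'\<in>{0..1}. \<bar>s - t\<bar> < e \<longrightarrow> \<bar>s' - t\<bar> < e \<longrightarrow> P s \<longrightarrow> P s'"
    proof (intro exI[of _ e] conjI ballI impI)
      fix s s' assume s: "s \<in> {0..1}" "s' \<in> {0..1}" "\<bar>s - t\<bar> < e" "\<bar>s' - t\<bar> < e" "P s"
      from s(5) obtain l where l: "continuous_on {0..s} l" "l 0 = a" "\<forall>s\<in>{0..s}. p (l s) = \<gamma> s"
        unfolding P_def by blast
      show "P s'"
      proof (cases "s' \<le> s")
        case True
        then show ?thesis unfolding P_def using l by (intro exI[of _ l]) (auto intro: continuous_on_subset)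
      next
        case False
        have "p (l s) \<in> B" using e s l(3) by (auto simp: dist_real_def)
        then obtain \<sigma> where sg: "local_section p (l s) B \<sigma>" using B unfolding section_nbhd_def by blast
        let ?l = "\<lambda>r. if r \<le> s then l r else \<sigma> (\<gamma> r)"
        have g: "\<gamma> r \<in> B" if "r \<in> {s..s'}" for r using that s e(2)[of r] by (auto simp: dist_real_def)
        have sgp: "\<sigma> (\<gamma> s) = l s" "\<And>y. y \<in> B \<Longrightarrow> p (\<sigma> y) = y" "continuous_on B \<sigma>"
          using sg l(3) s unfolding local_section_def by auto
        have "continuous_on ({0..s} \<union> {s..s'}) ?l"
        proof (rule continuous_on_If)
          show "continuous_on {s..s'} (\<lambda>r. \<sigma> (\<gamma> r))"
            by (rule continuous_on_compose2[OF sgp(3)])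
               (use g s continuous_on_subset[OF \<gamma>] in auto)
        qed (use l sgp in auto)
        moreover have "{0..s} \<union> {s..s'} = {0..s'}" using s False by auto
        ultimately show ?thesis unfolding P_def
          using l s g sgp by (intro exI[of _ ?l]) auto
      qed
    qed (use e in auto)
  qed auto
  then show ?thesis unfolding P_def using that by blast
qed

lemma section_nbhd_imp_local_section:
  assumes "\<And>b. \<exists>B. b \<in> B \<and> section_nbhd p B"
  shows "\<exists>B \<sigma>. local_section p a B \<sigma>"
  using assms[of "p a"] unfolding section_nbhd_def by blast

lemma convex_lift_sections:
  fixes p :: "'a::t2_space \<Rightarrow> 'b::t2_space" and h :: "'v::real_normed_vector \<Rightarrow> 'b"
  assumes p: "locally_inj p" and sec: "\<And>b. \<exists>B. b \<in> B \<and> section_nbhd p B"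
    and S: "convex S" "a0 \<in> S" and h: "continuous_on S h" and c0: "p c0 = h a0"
  obtains g where "continuous_on S g" "g a0 = c0" "\<And>u. u \<in> S \<Longrightarrow> p (g u) = h u"
proof (rule convex_lift[OF p _ S h c0])
  show "\<exists>B \<sigma>. local_section p a B \<sigma>" for a using section_nbhd_imp_local_section[OF sec] .
  fix u assume u: "u \<in> S"
  have "continuous_on {0..1::real} (\<lambda>s. h (a0 + s *\<^sub>R (u - a0)))"
  proof (rule continuous_on_compose2[OF h])
    have "a0 + s *\<^sub>R (u - a0) = (1 - s) *\<^sub>R a0 + s *\<^sub>R u" for s by (simp add: algebra_simps)
    then show "(\<lambda>s. a0 + s *\<^sub>R (u - a0)) ` {0..1} \<subseteq> S" using S u by (auto simp: convexD_alt)
  qed (auto intro!: continuous_intros)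
  from sections_path_lift[OF sec this, of c0] c0
  obtain l where "continuous_on {0..1} l" "l 0 = c0" "\<And>t. t \<in> {0..1} \<Longrightarrow> p (l t) = h (a0 + t *\<^sub>R (u - a0))"
    by (metis add.right_neutral scaleR_zero_left)
  then show "\<exists>l. continuous_on {0..1::real} l \<and> l 0 = c0 \<and> (\<forall>s\<in>{0..1}. p (l s) = h (a0 + s *\<^sub>R (u - a0)))"
    by blast
qed (use that in blast)

text \<open>If \<open>p a = p b\<close>, the segment from \<open>a\<close> to \<open>b\<close> is
  mapped to a loop. Its contraction lifts to the square, and the lift shows that the segment starts
  and ends at the same point.\<close>

lemma simply_connected_lift_injective:
  fixes p :: "'a::real_normed_vector \<Rightarrow> 'b::t2_space"
  assumes p: "locally_inj p" "continuous_on UNIV p" and sec: "\<And>b. \<exists>B. b \<in> B \<and> section_nbhd p B"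
    and sc: "simply_connected (UNIV :: 'b set)"
  shows "inj p"
proof (rule injI)
  fix a b assume ab: "p a = p b"
  define c where "c t = a + t *\<^sub>R (b - a)" for t :: real
  have cc: "continuous_on UNIV c" unfolding c_def by (intro continuous_intros)
  have pc: "path (p \<circ> c)" unfolding path_def
    by (rule continuous_on_compose) (use cc p(2) in \<open>auto intro: continuous_on_subset\<close>)
  define q where "q = (\<lambda>t::real. p a)"
  have "path q" unfolding q_def path_def by auto
  with sc pc ab have "homotopic_loops UNIV (p \<circ> c) q"
    unfolding simply_connected_def by (auto simp: pathstart_def pathfinish_def c_def q_def)
  then obtain H where H: "continuous_on ({0..1::real} \<times> {0..1::real}) H"
    "\<And>x. x \<in> {0..1} \<Longrightarrow> H (0,x) = p (c x)" "\<And>x. x \<in> {0..1} \<Longrightarrow> H (1,x) = p a"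
    "\<And>t. t \<in> {0..1} \<Longrightarrow> H (t,0) = H (t,1)"
    unfolding homotopic_loops by (auto simp: q_def pathstart_def pathfinish_def)
  have "convex ({0..1::real} \<times> {0..1::real})" by (intro convex_Times) auto
  then obtain K where K: "continuous_on ({0..1::real} \<times> {0..1::real}) K" "K (0,0) = a"
     "\<And>u. u \<in> {0..1::real} \<times> {0..1::real} \<Longrightarrow> p (K u) = H u"
    using convex_lift_sections[OF p(1) sec _ _ H(1), of "(0,0)" a] H(2)[of 0] by (auto simp: c_def)
  have sl: "continuous_on {0..1} (\<lambda>t. K (0,t))" "continuous_on {0..1} (\<lambda>t. K (1,t))"
     "continuous_on {0..1} (\<lambda>t. K (t,0))" "continuous_on {0..1} (\<lambda>t. K (t,1))"
    by (rule continuous_on_compose2[OF K(1)]; auto intro!: continuous_intros)+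
  have "K (0,1) = c 1"
    by (rule lift_unique[OF p(1), of "{0..1}" 0 1 "\<lambda>t. K (0,t)" c])
       (use sl K H(2) cc in \<open>auto simp: c_def intro: continuous_on_subset\<close>)
  moreover have K1: "K (1,1) = K (1,0)"
    by (rule lift_unique[OF p(1), of "{0..1}" 0 1 "\<lambda>t. K (1,t)" "\<lambda>_. K (1,0)"])
       (use sl K H(3) in auto)
  \<comment> \<open>The homotopy moves the base point of the loop, so these two sides of the square
    need not be constant. But they lift the same path and agree at time \<open>1\<close>, where the
    loop has become constant.\<close>
  moreover have "K (0,1) = K (0,0)"
    by (rule lift_unique[OF p(1), of "{0..1}" 1 0 "\<lambda>t. K (t,1)" "\<lambda>t. K (t,0)"])
       (use sl K H(4) K1 in auto)
  ultimately show "a = b" using K(2) by (simp add: c_def)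
qed

section \<open>Continuously differentiable maps\<close>

text \<open>The derivative is carried along as a function, so that the rules below compute it.
  Continuity in each fixed direction amounts to continuity of the derivative in finite
  dimension.\<close>

definition C1D :: "'a::euclidean_space set \<Rightarrow> ('a \<Rightarrow> 'b::real_normed_vector) \<Rightarrow> ('a \<Rightarrow> 'a \<Rightarrow> 'b) \<Rightarrow> bool" where
  "C1D S f f' \<longleftrightarrow> (\<forall>x\<in>S. (f has_derivative f' x) (at x)) \<and> (\<forall>v. continuous_on S (\<lambda>x. f' x v))"

definition C1_on :: "'a::euclidean_space set \<Rightarrow> ('a \<Rightarrow> 'b::real_normed_vector) \<Rightarrow> bool" where
  "C1_on S f \<longleftrightarrow> (\<exists>f'. C1D S f f')"

lemma C1D_C1: "C1D S f f' \<Longrightarrow> C1_on S f"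
  by (auto simp: C1_on_def)

lemma C1D_derivative: "C1D S f f' \<Longrightarrow> x \<in> S \<Longrightarrow> (f has_derivative f' x) (at x)"
  by (auto simp: C1D_def)

lemma C1D_linear: "C1D S f f' \<Longrightarrow> x \<in> S \<Longrightarrow> linear (f' x)"
  by (meson C1D_derivative has_derivative_linear)

lemma C1D_continuous: "C1D S f f' \<Longrightarrow> continuous_on S f"
  by (meson C1D_derivative continuous_at_imp_continuous_on has_derivative_continuous)

lemma C1_on_continuous: "C1_on S f \<Longrightarrow> continuous_on S f"
  by (auto simp: C1_on_def intro: C1D_continuous)

lemma C1D_subset: "C1D S f f' \<Longrightarrow> T \<subseteq> S \<Longrightarrow> C1D T f f'"
  by (auto simp: C1D_def intro: continuous_on_subset)

lemma C1_on_subset: "C1_on S f \<Longrightarrow> T \<subseteq> S \<Longrightarrow> C1_on T f"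
  by (auto simp: C1_on_def intro: C1D_subset)

lemma C1D_cong:
  assumes "open S" "\<And>x. x \<in> S \<Longrightarrow> f x = g x" "C1D S f f'"
  shows "C1D S g f'"
  unfolding C1D_def
proof (intro conjI ballI)
  fix x assume "x \<in> S"
  then show "(g has_derivative f' x) (at x)"
    using has_derivative_transform_within_open[OF C1D_derivative[OF assms(3)] assms(1)] assms(2) by blast
qed (use assms in \<open>auto simp: C1D_def\<close>)

lemma C1_on_cong: "open S \<Longrightarrow> (\<And>x. x \<in> S \<Longrightarrow> f x = g x) \<Longrightarrow> C1_on S f \<Longrightarrow> C1_on S g"
  unfolding C1_on_def using C1D_cong by blast

lemma C1_on_frechet:
  assumes "C1_on S f"
  shows "C1D S f (\<lambda>x. frechet_derivative f (at x))"
proof -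
  obtain f' where f': "C1D S f f'" using assms by (auto simp: C1_on_def)
  have eq: "frechet_derivative f (at x) = f' x" if "x \<in> S" for x
    using C1D_derivative[OF f' that] frechet_derivative_at by metis
  have "continuous_on S (\<lambda>x. frechet_derivative f (at x) v)" for v
    by (rule continuous_on_eq[of _ "\<lambda>x. f' x v"]) (use f' eq in \<open>auto simp: C1D_def\<close>)
  with f' eq show ?thesis by (auto simp: C1D_def)
qed

lemma linear_basis_expand:
  fixes f :: "'a::euclidean_space \<Rightarrow> 'b::real_vector"
  assumes "linear f"
  shows "f v = (\<Sum>b\<in>Basis. (v \<bullet> b) *\<^sub>R f b)"
proof -
  have "f (\<Sum>b\<in>Basis. (v \<bullet> b) *\<^sub>R b) = (\<Sum>b\<in>Basis. (v \<bullet> b) *\<^sub>R f b)"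
    by (simp add: linear_sum[OF assms] linear_scale[OF assms])
  then show ?thesis by (simp add: euclidean_representation)
qed

text \<open>Expanding \<open>w x\<close> in the standard basis reduces joint continuity to that of
  the columns of \<open>A x\<close>.\<close>

lemma continuous_on_linear_family:
  fixes A :: "'x::topological_space \<Rightarrow> 'a::euclidean_space \<Rightarrow> 'b::real_normed_vector"
  assumes lin: "\<And>x. x \<in> S \<Longrightarrow> linear (A x)" and A: "\<And>b. b \<in> Basis \<Longrightarrow> continuous_on S (\<lambda>x. A x b)"
    and w: "continuous_on S w"
  shows "continuous_on S (\<lambda>x. A x (w x))"
proof -
  have "continuous_on S (\<lambda>x. \<Sum>b\<in>Basis. (w x \<bullet> b) *\<^sub>R A x b)"
    using A w by (auto intro!: continuous_intros)
  moreover have "(\<Sum>b\<in>Basis. (w x \<bullet> b) *\<^sub>R A x b) = A x (w x)" if "x \<in> S" for x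
    using linear_basis_expand[OF lin[OF that], of "w x"] by simp
  ultimately show ?thesis by (simp cong: continuous_on_cong)
qed

lemma C1D_const: "C1D S (\<lambda>x. c) (\<lambda>x v. 0)"
  by (auto simp: C1D_def)

lemma C1D_linear_map: "bounded_linear f \<Longrightarrow> C1D S f (\<lambda>x. f)"
  by (auto simp: C1D_def bounded_linear_imp_has_derivative)

lemma C1D_bilinear:
  assumes p: "bounded_bilinear bp" and f: "C1D S f f'" and g: "C1D S g g'"
  shows "C1D S (\<lambda>x. bp (f x) (g x)) (\<lambda>x v. bp (f x) (g' x v) + bp (f' x v) (g x))"
  unfolding C1D_def
proof (intro conjI ballI allI)
  show "((\<lambda>x. bp (f x) (g x)) has_derivative (\<lambda>v. bp (f x) (g' x v) + bp (f' x v) (g x))) (at x)"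
    if "x \<in> S" for x using bounded_bilinear.FDERIV[OF p C1D_derivative[OF f that] C1D_derivative[OF g that]] .
  show "continuous_on S (\<lambda>x. bp (f x) (g' x v) + bp (f' x v) (g x))" for v
    using f g C1D_continuous[OF f] C1D_continuous[OF g] unfolding C1D_def
    by (intro continuous_on_add bounded_bilinear.continuous_on[OF p]) auto
qed

lemma C1D_add: "C1D S f f' \<Longrightarrow> C1D S g g' \<Longrightarrow> C1D S (\<lambda>x. f x + g x) (\<lambda>x v. f' x v + g' x v)"
  by (auto simp: C1D_def intro!: has_derivative_add continuous_on_add)

lemma C1D_sum: "(\<And>i. i \<in> I \<Longrightarrow> C1D S (f i) (f' i)) \<Longrightarrow> C1D S (\<lambda>x. \<Sum>i\<in>I. f i x) (\<lambda>x v. \<Sum>i\<in>I. f' i x v)"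
  by (auto simp: C1D_def intro!: has_derivative_sum continuous_on_sum)

lemma C1D_Pair: "C1D S f f' \<Longrightarrow> C1D S g g' \<Longrightarrow> C1D S (\<lambda>x. (f x, g x)) (\<lambda>x v. (f' x v, g' x v))"
  by (auto simp: C1D_def intro!: has_derivative_Pair continuous_on_Pair)

lemma C1D_compose:
  fixes g :: "'b::euclidean_space \<Rightarrow> 'c::real_normed_vector"
  assumes f: "C1D S f f'" and g: "C1D T g g'" and im: "\<And>x. x \<in> S \<Longrightarrow> f x \<in> T"
  shows "C1D S (\<lambda>x. g (f x)) (\<lambda>x v. g' (f x) (f' x v))"
  unfolding C1D_def
proof (intro conjI ballI allI)
  show "((\<lambda>x. g (f x)) has_derivative (\<lambda>v. g' (f x) (f' x v))) (at x)" if "x \<in> S" for x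
    using has_derivative_compose[OF C1D_derivative[OF f that] C1D_derivative[OF g im[OF that]]] .
  show "continuous_on S (\<lambda>x. g' (f x) (f' x v))" for v
  proof (rule continuous_on_linear_family)
    show "linear (g' (f x))" if "x \<in> S" for x using C1D_linear[OF g im[OF that]] .
    show "continuous_on S (\<lambda>x. g' (f x) b)" for b
      by (rule continuous_on_compose2[of T "\<lambda>y. g' y b"]) (use g im C1D_continuous[OF f] in \<open>auto simp: C1D_def\<close>)
    show "continuous_on S (\<lambda>x. f' x v)" using f by (auto simp: C1D_def)
  qed
qed

lemma C1_on_const: "C1_on S (\<lambda>x. c)"
  using C1D_const C1D_C1 by blast
lemma C1_on_linear_map: "bounded_linear f \<Longrightarrow> C1_on S f"
  using C1D_linear_map C1D_C1 by blast
lemma C1_on_bilinear: "bounded_bilinear bp \<Longrightarrow> C1_on S f \<Longrightarrow> C1_on S g \<Longrightarrow> C1_on S (\<lambda>x. bp (f x) (g x))"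
  using C1D_bilinear unfolding C1_on_def by blast
lemmas C1_on_scaleR = C1_on_bilinear[OF bounded_bilinear_scaleR]
lemmas C1_on_mult = C1_on_bilinear[OF bounded_bilinear_mult]
lemmas C1_on_inner = C1_on_bilinear[OF bounded_bilinear_inner]
lemma C1_on_add: "C1_on S f \<Longrightarrow> C1_on S g \<Longrightarrow> C1_on S (\<lambda>x. f x + g x)"
  using C1D_add unfolding C1_on_def by blast
lemma C1_on_Pair: "C1_on S f \<Longrightarrow> C1_on S g \<Longrightarrow> C1_on S (\<lambda>x. (f x, g x))"
  using C1D_Pair unfolding C1_on_def by blast
lemma C1_on_sum: "(\<And>i. i \<in> I \<Longrightarrow> C1_on S (f i)) \<Longrightarrow> C1_on S (\<lambda>x. \<Sum>i\<in>I. f i x)"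
  unfolding C1_on_def using C1D_sum by metis
lemma C1_on_compose:
  fixes g :: "'b::euclidean_space \<Rightarrow> 'c::real_normed_vector"
  shows "C1_on S f \<Longrightarrow> C1_on T g \<Longrightarrow> (\<And>x. x \<in> S \<Longrightarrow> f x \<in> T) \<Longrightarrow> C1_on S (\<lambda>x. g (f x))"
  unfolding C1_on_def using C1D_compose by metis
lemma C1_on_uminus: "C1_on S f \<Longrightarrow> C1_on S (\<lambda>x. - f x)"
  using C1_on_scaleR[OF C1_on_const, of S f "-1"] by simp
lemma C1_on_diff: "C1_on S f \<Longrightarrow> C1_on S g \<Longrightarrow> C1_on S (\<lambda>x. f x - g x)"
  using C1_on_add[OF _ C1_on_uminus, of S f g] by simp

lemma C1_on_inverse:
  fixes f :: "'a::euclidean_space \<Rightarrow> real"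
  assumes "C1_on S f" "\<And>x. x \<in> S \<Longrightarrow> f x \<noteq> 0"
  shows "C1_on S (\<lambda>x. inverse (f x))"
proof -
  have "C1D (- {0::real}) inverse (\<lambda>x v. - (inverse x * v * inverse x))"
    unfolding C1D_def by (auto intro!: has_derivative_inverse' continuous_intros)
  from C1_on_compose[OF assms(1) C1D_C1[OF this]] assms(2) show ?thesis by auto
qed

lemma smooth_on_C1: "open S \<Longrightarrow> smooth_on S f \<Longrightarrow> C1_on S f"
proof -
  assume S: "open S" and "smooth_on S f"
  then have "C_on 1 S f" by (simp add: smooth_on_def)
  then have f: "f differentiable_on S" "\<And>v. continuous_on S (\<lambda>x. frechet_derivative f (at x) v)" by auto
  have "(f has_derivative frechet_derivative f (at x)) (at x)" if "x \<in> S" for x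
    using f(1) S that by (meson differentiable_on_eq_differentiable_at frechet_derivative_works)
  with f(2) have "C1D S f (\<lambda>x. frechet_derivative f (at x))" unfolding C1D_def by blast
  then show "C1_on S f" by (rule C1D_C1)
qed

lemma smooth_on_derivative: "smooth_on S f \<Longrightarrow> smooth_on S (\<lambda>x. frechet_derivative f (at x) v)"
  unfolding smooth_on_def by (metis C_on.simps(2))

subsection \<open>Symmetry of the second derivative\<close>

text \<open>The second difference is the increment over \<open>{0..s}\<close> of a function of one
  variable whose derivative compares \<open>f' _ v\<close> at two points near \<open>x\<close>.
  Differentiability of \<open>f' _ v\<close> at \<open>x\<close> controls this comparison, and the
  mean value inequality does the rest.\<close>

lemma second_difference_bound:
  fixes f :: "'a::euclidean_space \<Rightarrow> 'b::real_normed_vector"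
  assumes S: "open S" "x \<in> S" and f: "\<And>y. y \<in> S \<Longrightarrow> (f has_derivative f' y) (at y)"
    and h: "((\<lambda>y. f' y v) has_derivative D) (at x)" and eta: "\<eta> > 0"
  shows "\<exists>d>0. \<forall>s. 0 < s \<and> s < d \<longrightarrow>
    norm (f (x + s *\<^sub>R v + s *\<^sub>R w) - f (x + s *\<^sub>R v) - f (x + s *\<^sub>R w) + f x - s\<^sup>2 *\<^sub>R D w) \<le> \<eta> * s\<^sup>2"
proof -
  obtain r where r: "r > 0" "ball x r \<subseteq> S" using S open_contains_ball by blast
  define N where "N = norm v + norm w + 1"
  have N: "N > 0" unfolding N_def by (smt (verit) norm_ge_zero)
  define \<epsilon> where "\<epsilon> = \<eta> / (2 * N)"
  have \<epsilon>: "\<epsilon> > 0" using eta N by (simp add: \<epsilon>_def)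
  obtain d0 where d0: "d0 > 0" "\<And>y. norm (y - x) < d0 \<Longrightarrow> norm (f' y v - f' x v - D (y - x)) \<le> \<epsilon> * norm (y - x)"
    using h \<epsilon> unfolding has_derivative_at_alt by meson
  have lD: "linear D" using h has_derivative_linear by blast
  show ?thesis
  proof (intro exI[of _ "min d0 r / N"] conjI allI impI)
    show "0 < min d0 r / N" using d0 r N by auto
    fix s :: real assume s: "0 < s \<and> s < min d0 r / N"
    then have sN: "s * N < min d0 r" using N by (simp add: pos_less_divide_eq)
    have nb: "norm (t *\<^sub>R v + c *\<^sub>R w) \<le> s * N" if "t \<in> {0..s}" "c \<in> {0..s}" for t c
    proof -
      have "norm (t *\<^sub>R v + c *\<^sub>R w) \<le> t * norm v + c * norm w"
        by (rule order_trans[OF norm_triangle_ineq]) (use that in auto)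
      also have "\<dots> \<le> s * norm v + s * norm w" using that by (intro add_mono mult_right_mono) auto
      also have "\<dots> \<le> s * N" using s unfolding N_def by (simp add: algebra_simps)
      finally show ?thesis .
    qed
    define g where "g t = f (x + t *\<^sub>R v + s *\<^sub>R w) - f (x + t *\<^sub>R v) - t *\<^sub>R (s *\<^sub>R D w)" for t
    define g' where "g' t = f' (x + t *\<^sub>R v + s *\<^sub>R w) v - f' (x + t *\<^sub>R v) v - s *\<^sub>R D w" for t
    have inS: "x + t *\<^sub>R v + c *\<^sub>R w \<in> S" if "t \<in> {0..s}" "c \<in> {0..s}" for t c
      using nb[OF that] sN r(2) by (auto simp: dist_norm norm_minus_commute add.assoc subset_iff)
    have der: "(g has_vector_derivative g' t) (at t within {0..s})" if t: "t \<in> {0..s}" for t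
    proof -
      have A: "((\<lambda>t. f (x + t *\<^sub>R v + c *\<^sub>R w)) has_derivative (\<lambda>h. f' (x + t *\<^sub>R v + c *\<^sub>R w) (h *\<^sub>R v))) (at t within {0..s})"
        if c: "c \<in> {0..s}" for c
        by (rule has_derivative_compose[where f="\<lambda>t. x + t *\<^sub>R v + c *\<^sub>R w" and g=f, OF _ f[OF inS[OF t c]]]) (auto intro!: derivative_eq_intros)
      have B: "((\<lambda>t. f (x + t *\<^sub>R v + c *\<^sub>R w)) has_vector_derivative f' (x + t *\<^sub>R v + c *\<^sub>R w) v) (at t within {0..s})"
        if c: "c \<in> {0..s}" for c
        using A[OF c] has_derivative_linear[OF f[OF inS[OF t c]]]
        by (simp add: has_vector_derivative_def linear_scale)
      show ?thesis unfolding g_def g'_def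
        using B[of s] B[of 0] s by (auto intro!: derivative_eq_intros has_vector_derivative_diff)
    qed
    have bd: "norm (g' t) \<le> \<eta> * s" if t: "t \<in> {0..s}" for t
    proof -
      let ?a = "t *\<^sub>R v + s *\<^sub>R w" and ?b = "t *\<^sub>R v"
      have na: "norm ?a \<le> s * N" "norm ?b \<le> s * N" using nb[OF t, of s] nb[OF t, of 0] s by auto
      have e: "norm (f' (x + ?a) v - f' x v - D ?a) \<le> \<epsilon> * norm ?a" "norm (f' (x + ?b) v - f' x v - D ?b) \<le> \<epsilon> * norm ?b"
        using d0(2)[of "x + ?a"] d0(2)[of "x + ?b"] na sN by auto
      have e3: "g' t = (f' (x + ?a) v - f' x v - D ?a) - (f' (x + ?b) v - f' x v - D ?b)"
        by (simp add: g'_def linear_add[OF lD] linear_scale[OF lD] add.assoc)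
      have "norm (g' t) \<le> \<epsilon> * norm ?a + \<epsilon> * norm ?b"
        unfolding e3 by (rule order_trans[OF norm_triangle_ineq4 add_mono[OF e]])
      also have "\<dots> \<le> \<epsilon> * (s * N) + \<epsilon> * (s * N)" using na \<epsilon> by (intro add_mono mult_left_mono) auto
      also have "\<dots> = \<eta> * s" using N by (simp add: \<epsilon>_def)
      finally show ?thesis .
    qed
    have "norm (g s - g 0) \<le> (\<eta> * s) * norm (s - 0)"
    proof (rule differentiable_bound[of "{0..s}" g "\<lambda>t h. h *\<^sub>R g' t"])
      show "(g has_derivative (\<lambda>h. h *\<^sub>R g' t)) (at t within {0..s})" if "t \<in> {0..s}" for t
        using der[OF that] by (simp add: has_vector_derivative_def)
      show "onorm (\<lambda>h. h *\<^sub>R g' t) \<le> \<eta> * s" if "t \<in> {0..s}" for t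
        by (rule onorm_le) (use bd[OF that] in \<open>simp add: mult.commute mult_left_mono\<close>)
    qed (use s in auto)
    moreover have "g s - g 0 = f (x + s *\<^sub>R v + s *\<^sub>R w) - f (x + s *\<^sub>R v) - f (x + s *\<^sub>R w) + f x - s\<^sup>2 *\<^sub>R D w"
      by (simp add: g_def power2_eq_square)
    ultimately show "norm (f (x + s *\<^sub>R v + s *\<^sub>R w) - f (x + s *\<^sub>R v) - f (x + s *\<^sub>R w) + f x - s\<^sup>2 *\<^sub>R D w) \<le> \<eta> * s\<^sup>2"
      using s by (simp add: power2_eq_square)
  qed
qed

text \<open>The second difference is symmetric in \<open>v\<close> and \<open>w\<close>, and both
  \<open>D w\<close> and \<open>E v\<close> are its limit after division by
  \<open>s\<^sup>2\<close>.\<close>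

lemma second_derivative_symmetric:
  fixes f :: "'a::euclidean_space \<Rightarrow> 'b::real_normed_vector"
  assumes S: "open S" "x \<in> S" and f: "\<And>y. y \<in> S \<Longrightarrow> (f has_derivative f' y) (at y)"
    and v: "((\<lambda>y. f' y v) has_derivative D) (at x)" and w: "((\<lambda>y. f' y w) has_derivative E) (at x)"
  shows "D w = E v"
proof -
  have "norm (D w - E v) \<le> 2 * \<eta>" if eta: "\<eta> > 0" for \<eta>
  proof -
    define \<Delta> where "\<Delta> s = f (x + s *\<^sub>R v + s *\<^sub>R w) - f (x + s *\<^sub>R v) - f (x + s *\<^sub>R w) + f x" for s :: real
    have sym: "\<Delta> s = f (x + s *\<^sub>R w + s *\<^sub>R v) - f (x + s *\<^sub>R w) - f (x + s *\<^sub>R v) + f x" for s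
      by (simp add: \<Delta>_def algebra_simps)
    obtain d1 where d1: "d1 > 0" "\<And>s. 0 < s \<Longrightarrow> s < d1 \<Longrightarrow> norm (\<Delta> s - s\<^sup>2 *\<^sub>R D w) \<le> \<eta> * s\<^sup>2"
      using second_difference_bound[OF S f v eta, of w] unfolding \<Delta>_def by blast
    obtain d2 where d2: "d2 > 0" "\<And>s. 0 < s \<Longrightarrow> s < d2 \<Longrightarrow> norm (\<Delta> s - s\<^sup>2 *\<^sub>R E v) \<le> \<eta> * s\<^sup>2"
      using second_difference_bound[OF S f w eta, of v] unfolding sym by blast
    define s where "s = min d1 d2 / 2"
    have s: "0 < s" "s < d1" "s < d2" using d1 d2 by (auto simp: s_def)
    have "norm (s\<^sup>2 *\<^sub>R (D w - E v)) = norm ((\<Delta> s - s\<^sup>2 *\<^sub>R E v) - (\<Delta> s - s\<^sup>2 *\<^sub>R D w))"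
      by (simp add: algebra_simps)
    also have "\<dots> \<le> \<eta> * s\<^sup>2 + \<eta> * s\<^sup>2" using d1(2)[of s] d2(2)[of s] s by (smt (verit) norm_triangle_ineq4)
    finally show ?thesis using s by (simp add: mult.commute)
  qed
  then have "norm (D w - E v) \<le> 0"
    by (metis (no_types, opaque_lifting) dense_le_bounded field_sum_of_halves half_gt_zero mult_2 not_le order_less_irrefl order_refl)
  then show ?thesis by simp
qed

subsection \<open>Uniform bounds on compact sets\<close>

lemma linear_norm_bound:
  fixes f :: "'a::euclidean_space \<Rightarrow> 'b::real_normed_vector" and c :: real
  assumes "linear f" "\<And>b. b \<in> Basis \<Longrightarrow> norm (f b) \<le> c"
  shows "norm (f v) \<le> (DIM('a) * c) * norm v"
proof -
  have "norm (f v) = norm (\<Sum>b\<in>Basis. (v \<bullet> b) *\<^sub>R f b)" using linear_basis_expand[OF assms(1)] by metis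
  also have "\<dots> \<le> (\<Sum>b\<in>(Basis::'a set). c * norm v)"
  proof (rule sum_norm_le)
    fix b :: 'a assume b: "b \<in> Basis"
    have "norm ((v \<bullet> b) *\<^sub>R f b) = \<bar>v \<bullet> b\<bar> * norm (f b)" by simp
    also have "\<dots> \<le> norm v * c" using Basis_le_norm[OF b] assms(2)[OF b] by (intro mult_mono) auto
    finally show "norm ((v \<bullet> b) *\<^sub>R f b) \<le> c * norm v" by (simp add: mult.commute)
  qed
  finally show ?thesis by simp
qed

lemma C1D_bound_compact:
  assumes f: "C1D S f f'" and K: "compact K" "K \<subseteq> S"
  obtains L where "L \<ge> 0" "\<And>x v. x \<in> K \<Longrightarrow> norm (f' x v) \<le> L * norm v"
proof -
  have "\<exists>c. \<forall>x\<in>K. norm (f' x b) \<le> c" for b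
  proof -
    have "continuous_on K (\<lambda>x. f' x b)" using f K by (auto simp: C1D_def intro: continuous_on_subset)
    then have "bounded ((\<lambda>x. f' x b) ` K)" using K compact_continuous_image compact_imp_bounded by blast
    then show ?thesis by (auto simp: bounded_iff)
  qed
  then obtain c where c: "\<And>x b. x \<in> K \<Longrightarrow> norm (f' x b) \<le> c b" by metis
  define C where "C = (\<Sum>b\<in>Basis. \<bar>c b\<bar>)"
  have C: "norm (f' x b) \<le> C" if "x \<in> K" "b \<in> Basis" for x b
  proof -
    have "c b \<le> \<bar>c b\<bar>" by simp
    also have "\<dots> \<le> C" unfolding C_def by (rule member_le_sum) (use that in auto)
    finally show ?thesis using c[OF that(1), of b] by simp
  qed
  show ?thesis
  proof (rule that[of "DIM('a) * C"])
    show "0 \<le> DIM('a) * C" by (simp add: C_def sum_nonneg)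
    show "norm (f' x v) \<le> DIM('a) * C * norm v" if "x \<in> K" for x v
      using linear_norm_bound[OF C1D_linear[OF f] C, of x v] that K(2) by auto
  qed
qed

lemma C1D_uniform_compact:
  assumes f: "C1D S f f'" and K: "compact K" "K \<subseteq> S" and eta: "\<eta> > 0"
  obtains d where "d > 0" "\<And>x y v. x \<in> K \<Longrightarrow> y \<in> K \<Longrightarrow> dist x y < d \<Longrightarrow> norm (f' x v - f' y v) \<le> \<eta> * norm v"
proof -
  define \<epsilon> where "\<epsilon> = \<eta> / DIM('a)"
  have \<epsilon>: "\<epsilon> > 0" using eta by (simp add: \<epsilon>_def)
  have "\<exists>d>0. \<forall>x\<in>K. \<forall>y\<in>K. dist x y < d \<longrightarrow> norm (f' x b - f' y b) \<le> \<epsilon>" for b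
  proof -
    have "continuous_on K (\<lambda>x. f' x b)" using f K by (auto simp: C1D_def intro: continuous_on_subset)
    then have "uniformly_continuous_on K (\<lambda>x. f' x b)" using K compact_uniformly_continuous by blast
    then show ?thesis using \<epsilon> unfolding uniformly_continuous_on_def dist_norm
      by (meson less_imp_le norm_minus_commute)
  qed
  then obtain d where d: "\<And>b. d b > 0" "\<And>b x y. x \<in> K \<Longrightarrow> y \<in> K \<Longrightarrow> dist x y < d b \<Longrightarrow> norm (f' x b - f' y b) \<le> \<epsilon>"
    by metis
  show ?thesis
  proof (rule that[of "Min (d ` (Basis :: 'a set))"])
    show "0 < Min (d ` (Basis :: 'a set))" using d by (subst Min_gr_iff) auto
    fix x y :: 'a and v :: 'a assume xy: "x \<in> K" "y \<in> K" "dist x y < Min (d ` Basis)"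
    have "norm (f' x v - f' y v) \<le> (DIM('a) * \<epsilon>) * norm v"
    proof (rule linear_norm_bound[of "\<lambda>v. f' x v - f' y v"])
      show "linear (\<lambda>v. f' x v - f' y v)"
        using C1D_linear[OF f] xy K by (intro linear_compose_sub) auto
      show "norm (f' x b - f' y b) \<le> \<epsilon>" if "b \<in> Basis" for b
        using d(2)[OF xy(1,2)] xy(3) that by (auto simp: Min_gr_iff)
    qed
    then show "norm (f' x v - f' y v) \<le> \<eta> * norm v" by (simp add: \<epsilon>_def)
  qed
qed

lemma C1D_lipschitz_convex:
  assumes f: "C1D S f f'" and K: "convex K" "K \<subseteq> S" and L: "\<And>x v. x \<in> K \<Longrightarrow> norm (f' x v) \<le> L * norm v"
    and xy: "x \<in> K" "y \<in> K"
  shows "norm (f x - f y) \<le> L * norm (x - y)"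
proof (rule differentiable_bound[OF K(1) _ _ xy])
  show "(f has_derivative f' z) (at z within K)" if "z \<in> K" for z
    using C1D_derivative[OF f] K that by (meson has_derivative_at_withinI subsetD)
  show "onorm (f' z) \<le> L" if "z \<in> K" for z by (rule onorm_le) (use L[OF that] in auto)
qed

lemma C1D_linearization:
  assumes f: "C1D S f f'" and K: "convex K" "K \<subseteq> S" and x: "x \<in> K" and xh: "x + h \<in> K"
    and d: "\<And>y v. y \<in> K \<Longrightarrow> dist y x < d \<Longrightarrow> norm (f' y v - f' x v) \<le> \<eta> * norm v" and h: "norm h < d"
  shows "norm (f (x + h) - f x - f' x h) \<le> \<eta> * norm h"
proof -
  have seg: "closed_segment x (x + h) \<subseteq> K" using K x xh by (simp add: closed_segment_subset)
  have "norm (f (x + h) - f x - f' x ((x + h) - x)) \<le> norm ((x + h) - x) * \<eta>"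
  proof (rule differentiable_bound_linearization[of x "x + h" "closed_segment x (x+h)"])
    show "x + t *\<^sub>R (x + h - x) \<in> closed_segment x (x + h)" if "t \<in> {0..1}" for t
      using that by (auto simp: closed_segment_def algebra_simps intro!: exI[of _ t])
    show "(f has_derivative f' z) (at z within closed_segment x (x + h))" if "z \<in> closed_segment x (x + h)" for z
      using C1D_derivative[OF f] K seg that by (meson has_derivative_at_withinI subsetD)
    show "onorm (f' z - f' x) \<le> \<eta>" if z: "z \<in> closed_segment x (x + h)" for z
    proof (rule onorm_le)
      have "dist z x \<le> norm h" using z by (auto simp: dist_norm closed_segment_def algebra_simps mult_left_le_one_le)
      then show "norm ((f' z - f' x) v) \<le> \<eta> * norm v" for v using d[of z v] z seg h by auto
    qed
  qed auto
  then show ?thesis by (simp add: mult.commute)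
qed

section \<open>Ordinary differential equations\<close>

lemma vector_derivative_bound:
  fixes u :: "real \<Rightarrow> 'a::real_normed_vector"
  assumes u: "\<And>t. t \<in> {a..b} \<Longrightarrow> (u has_vector_derivative u' t) (at t within {a..b})"
    and B: "\<And>t. t \<in> {a..b} \<Longrightarrow> norm (u' t) \<le> B" and st: "s \<in> {a..b}" "t \<in> {a..b}"
  shows "norm (u t - u s) \<le> B * \<bar>t - s\<bar>"
proof -
  have "norm (u t - u s) \<le> B * norm (t - s)"
  proof (rule differentiable_bound[of "{a..b}" u "\<lambda>t h. h *\<^sub>R u' t"])
    show "(u has_derivative (\<lambda>h. h *\<^sub>R u' t)) (at t within {a..b})" if "t \<in> {a..b}" for t
      using u[OF that] by (simp add: has_vector_derivative_def)
    show "onorm (\<lambda>h. h *\<^sub>R u' t) \<le> B" if "t \<in> {a..b}" for t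
      by (rule onorm_le) (use mult_right_mono[OF B[OF that] abs_ge_zero] in \<open>simp add: mult.commute\<close>)
  qed (use st in auto)
  then show ?thesis by simp
qed

text \<open>The smallness of \<open>(b - a) * L\<close> replaces the exponential of Gronwall's inequality.\<close>

lemma short_time_bound:
  fixes u :: "real \<Rightarrow> 'a::real_normed_vector"
  assumes u: "\<And>t. t \<in> {a..b} \<Longrightarrow> (u has_vector_derivative u' t) (at t within {a..b})"
    and B: "\<And>t. t \<in> {a..b} \<Longrightarrow> norm (u' t) \<le> L * norm (u t) + \<delta>"
    and L: "0 \<le> L" "0 \<le> \<delta>" "(b - a) * L \<le> 1/2" and st: "s \<in> {a..b}" "t \<in> {a..b}"
  shows "norm (u t) \<le> 2 * norm (u s) + 2 * (b - a) * \<delta>"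
proof -
  have cont: "continuous_on {a..b} u"
    using u has_vector_derivative_continuous continuous_on_eq_continuous_within by blast
  have "\<exists>m\<in>{a..b}. \<forall>t\<in>{a..b}. norm (u t) \<le> norm (u m)"
    by (rule continuous_attains_sup) (use st cont in \<open>auto intro!: continuous_intros\<close>)
  then obtain m where m: "m \<in> {a..b}" "\<And>t. t \<in> {a..b} \<Longrightarrow> norm (u t) \<le> norm (u m)"
    by blast
  have "norm (u m - u s) \<le> (L * norm (u m) + \<delta>) * \<bar>m - s\<bar>"
  proof (rule vector_derivative_bound[OF u _ st(1) m(1)])
    show "norm (u' t) \<le> L * norm (u m) + \<delta>" if "t \<in> {a..b}" for t
      using B[OF that] m(2)[OF that] L(1) mult_left_mono by fastforce
  qed
  also have "\<dots> \<le> (L * norm (u m) + \<delta>) * (b - a)"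
    using L m st by (intro mult_left_mono) auto
  also have "\<dots> = ((b - a) * L) * norm (u m) + (b - a) * \<delta>" by (simp add: algebra_simps)
  also have "\<dots> \<le> (1/2) * norm (u m) + (b - a) * \<delta>" using L(3) by (intro add_right_mono mult_right_mono) auto
  finally have "norm (u m) \<le> 2 * norm (u s) + 2 * (b - a) * \<delta>"
    using norm_triangle_sub[of "u m" "u s"] by (simp add: algebra_simps)
  with m(2)[OF st(2)] show ?thesis by simp
qed

text \<open>The integral operator contracts by the factor \<open>1/2\<close> in the supremum norm.
  The initial time may be any point of the interval, so that flows run in both directions.\<close>

lemma picard_short:
  fixes f :: "real \<Rightarrow> 'a::euclidean_space \<Rightarrow> 'a"
  assumes f: "continuous_on ({a..b} \<times> UNIV) (\<lambda>(t,x). f t x)"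
    and L: "\<And>t x y. t \<in> {a..b} \<Longrightarrow> norm (f t x - f t y) \<le> L * norm (x - y)" "0 \<le> L" "(b - a) * L \<le> 1/2"
    and s: "s \<in> {a..b}"
  obtains \<phi> where "\<phi> s = z" "\<And>t. t \<in> {a..b} \<Longrightarrow> (\<phi> has_vector_derivative f t (\<phi> t)) (at t within {a..b})"
proof -
  have fg: "continuous_on {a..b} (\<lambda>r. f r (g r))" if "continuous_on {a..b} g" for g
  proof -
    have "continuous_on {a..b} (\<lambda>r. (r, g r))" using that by (intro continuous_intros)
    from continuous_on_compose2[OF f this] show ?thesis by auto
  qed
  have gc: "continuous_on {a..b} (apply_bcontfun g)" for g :: "real \<Rightarrow>\<^sub>C 'a" by simp
  \<comment> \<open>A difference of two integrals from \<open>a\<close> stands for the integral from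
    \<open>s\<close> to \<open>t\<close>, also when \<open>t < s\<close>.\<close>
  define I where "I g t = z + (integral {a..t} (\<lambda>r. f r (apply_bcontfun g r)) - integral {a..s} (\<lambda>r. f r (apply_bcontfun g r)))"
    for g :: "real \<Rightarrow>\<^sub>C 'a" and t
  have I: "(I g has_vector_derivative f t (g t)) (at t within {a..b})" if "t \<in> {a..b}" for g t
    unfolding I_def using integral_has_vector_derivative[OF fg[OF gc] that, of g]
    by (auto intro!: derivative_eq_intros)
  have Ic: "continuous_on (cbox a b) (I g)" for g
    using I has_vector_derivative_continuous continuous_on_eq_continuous_within by (metis cbox_interval)
  \<comment> \<open>The fixed point theorem is applied in the complete space of bounded continuous
    functions on the line; clamping the argument extends \<open>I g\<close> to such a
    function.\<close>
  have "\<exists>h::real \<Rightarrow>\<^sub>C 'a. (\<forall>x\<in>{a..b}. h x = I g x) \<and> (\<forall>x. h x = I g (clamp a b x))" for g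
    using continuous_on_cbox_bcontfunE[OF Ic, of g] by (metis cbox_interval)
  then obtain T where T: "\<And>g x. x \<in> {a..b} \<Longrightarrow> apply_bcontfun (T g) x = I g x" "\<And>g x. apply_bcontfun (T g) x = I g (clamp a b x)"
    by metis
  have "\<exists>!g. T g = g"
  proof (rule banach_fix_type[of "1/2"])
    show "\<forall>g h. dist (T g) (T h) \<le> 1 / 2 * dist g h"
    proof (intro allI dist_bound)
      fix g h x
      have cl: "clamp a b x \<in> {a..b}" using s by (metis cbox_interval clamp_in_interval box_real(2) atLeastAtMost_iff order_trans inner_real_def mult.right_neutral Basis_real_def singletonD)
      have "norm ((I g (clamp a b x) - I h (clamp a b x)) - (I g s - I h s)) \<le> (L * dist g h) * \<bar>clamp a b x - s\<bar>"
      proof (rule vector_derivative_bound[where u'="\<lambda>t. f t (g t) - f t (h t)" and u="\<lambda>t. I g t - I h t"])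
        show "((\<lambda>t. I g t - I h t) has_vector_derivative f t (g t) - f t (h t)) (at t within {a..b})"
          if "t \<in> {a..b}" for t using I[OF that] by (auto intro!: derivative_eq_intros)
        show "norm (f t (g t) - f t (h t)) \<le> L * dist g h" if "t \<in> {a..b}" for t
          using L(1)[OF that, of "g t" "h t"] dist_bounded[of g t h] L(2)
          by (metis dist_norm mult_left_mono order_trans)
      qed (use s cl in auto)
      also have "\<dots> \<le> (L * dist g h) * (b - a)" using cl s L by (intro mult_left_mono) auto
      also have "\<dots> \<le> 1/2 * dist g h" using L(3) mult_right_mono[OF L(3), of "dist g h"] by (simp add: algebra_simps)
      finally show "dist (apply_bcontfun (T g) x) (apply_bcontfun (T h) x) \<le> 1 / 2 * dist g h"
        by (simp add: T(2) dist_norm I_def)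
    qed
  qed auto
  then obtain g where g: "T g = g" by blast
  have gI: "apply_bcontfun g x = I g x" if "x \<in> {a..b}" for x using T(1)[OF that, of g] g by simp
  show ?thesis
  proof (rule that[of "apply_bcontfun g"])
    show "apply_bcontfun g s = z" using gI[OF s] by (simp add: I_def)
    show "(apply_bcontfun g has_vector_derivative f t (apply_bcontfun g t)) (at t within {a..b})" if t: "t \<in> {a..b}" for t
      by (rule has_vector_derivative_transform[OF t _ I[OF t]]) (use gI in auto)
  qed
qed

lemma ode_unique_short:
  assumes X: "C1D W X X'" and W: "open W" and z0: "z0 \<in> W"
  obtains r e where "r > 0" "e > 0" "ball z0 r \<subseteq> W"
    "\<And>a b z1 z2 s t. \<lbrakk>b - a \<le> e; s \<in> {a..b}; t \<in> {a..b};
       \<And>t. t \<in> {a..b} \<Longrightarrow> z1 t \<in> ball z0 r \<and> (z1 has_vector_derivative X (z1 t)) (at t within {a..b});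
       \<And>t. t \<in> {a..b} \<Longrightarrow> z2 t \<in> ball z0 r \<and> (z2 has_vector_derivative X (z2 t)) (at t within {a..b});
       z1 s = z2 s\<rbrakk> \<Longrightarrow> z1 t = z2 t"
proof -
  obtain r where r: "r > 0" "cball z0 r \<subseteq> W" using W z0 open_contains_cball by blast
  obtain L where L: "L \<ge> 0" "\<And>x v. x \<in> cball z0 r \<Longrightarrow> norm (X' x v) \<le> L * norm v"
    using C1D_bound_compact[OF X compact_cball r(2)] by blast
  note lip = C1D_lipschitz_convex[OF X convex_cball r(2) L(2)]
  show ?thesis
  \<comment> \<open>The denominator \<open>2 * L + 1\<close> gives
    \<open>(b - a) * L \<le> 1/2\<close> and stays positive when \<open>L = 0\<close>.\<close>
  proof (rule that[of r "1 / (2 * L + 1)"])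
    show "ball z0 r \<subseteq> W" using r ball_subset_cball by blast
    fix a b s t :: real and z1 z2
    assume ab: "b - a \<le> 1 / (2 * L + 1)" and st: "s \<in> {a..b}" "t \<in> {a..b}"
      and z1: "\<And>t. t \<in> {a..b} \<Longrightarrow> z1 t \<in> ball z0 r \<and> (z1 has_vector_derivative X (z1 t)) (at t within {a..b})"
      and z2: "\<And>t. t \<in> {a..b} \<Longrightarrow> z2 t \<in> ball z0 r \<and> (z2 has_vector_derivative X (z2 t)) (at t within {a..b})"
      and eq: "z1 s = z2 s"
    have "norm (z1 t - z2 t) \<le> 2 * norm (z1 s - z2 s) + 2 * (b - a) * 0"
    proof (rule short_time_bound[where u'="\<lambda>t. X (z1 t) - X (z2 t)"])
      show "((\<lambda>t. z1 t - z2 t) has_vector_derivative X (z1 t) - X (z2 t)) (at t within {a..b})" if "t \<in> {a..b}" for t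
        using z1[OF that] z2[OF that] by (auto intro!: derivative_eq_intros)
      show "norm (X (z1 t) - X (z2 t)) \<le> L * norm (z1 t - z2 t) + 0" if "t \<in> {a..b}" for t
        using lip[of "z1 t" "z2 t"] z1[OF that] z2[OF that] by auto
      have "(b - a) * L \<le> 1 / (2 * L + 1) * L" using ab L by (intro mult_right_mono) auto
      also have "\<dots> \<le> 1/2" using L by (simp add: field_simps)
      finally show "(b - a) * L \<le> 1/2" .
    qed (use L st in auto)
    then show "z1 t = z2 t" using eq by simp
  qed (use r L in auto)
qed

text \<open>The flow near \<open>z0\<close> is obtained by freezing the vector field outside of a ball, which makes it
  globally Lipschitz; \<open>\<psi>\<close> is the derivative of the flow in the initial value.\<close>

lemma local_flow:
  fixes X :: "'a::euclidean_space \<Rightarrow> 'a"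
  assumes X: "C1D W X X'" and W: "open W" and z0: "z0 \<in> W"
  obtains r e \<phi> \<psi> where "r > 0" "e > 0" "ball z0 r \<subseteq> W"
    "\<And>z. z \<in> ball z0 r \<Longrightarrow> \<phi> z 0 = z"
    "\<And>z t. z \<in> ball z0 r \<Longrightarrow> t \<in> {-e..e} \<Longrightarrow> \<phi> z t \<in> W \<and> (\<phi> z has_vector_derivative X (\<phi> z t)) (at t within {-e..e})"
    "\<And>t. t \<in> {-e..e} \<Longrightarrow> C1D (ball z0 r) (\<lambda>z. \<phi> z t) (\<lambda>z w. \<psi> z w t)"
    "\<And>z w t. z \<in> ball z0 r \<Longrightarrow> t \<in> {-e..e} \<Longrightarrow> (\<psi> z w has_vector_derivative X' (\<phi> z t) (\<psi> z w t)) (at t within {-e..e})"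
proof -
  obtain R where R: "R > 0" "cball z0 R \<subseteq> W" using W z0 open_contains_cball by blast
  define K where "K = cball z0 R"
  have K: "compact K" "convex K" "K \<subseteq> W" "closed K" "K \<noteq> {}" using R by (auto simp: K_def)
  obtain L0 where L0: "L0 \<ge> 0" "\<And>x v. x \<in> K \<Longrightarrow> norm (X' x v) \<le> L0 * norm v"
    using C1D_bound_compact[OF X K(1,3)] by blast
  define L where "L = L0 + 1"
  have L: "L \<ge> 1" "\<And>x v. x \<in> K \<Longrightarrow> norm (X' x v) \<le> L * norm v"
  proof -
    show "norm (X' x v) \<le> L * norm v" if "x \<in> K" for x v
      using L0(2)[OF that, of v] by (simp add: L_def algebra_simps add_increasing)
  qed (use L0 in \<open>simp add: L_def\<close>)
  have lip: "norm (X x - X y) \<le> L * norm (x - y)" if "x \<in> K" "y \<in> K" for x y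
    by (rule C1D_lipschitz_convex[OF X K(2,3) _ that]) (rule L(2))
  have Xc: "continuous_on K X" using C1D_continuous[OF X] K continuous_on_subset by blast
  then have "bounded (X ` K)" using K compact_continuous_image compact_imp_bounded by blast
  then obtain M0 where M0: "\<And>x. x \<in> K \<Longrightarrow> norm (X x) \<le> M0" by (auto simp: bounded_iff)
  define M where "M = \<bar>M0\<bar> + 1"
  have M: "M \<ge> 1" "\<And>x. x \<in> K \<Longrightarrow> norm (X x) \<le> M" using M0 unfolding M_def by force+
  \<comment> \<open>The first bound lets solutions move by at most \<open>R / 4\<close>, so those
    that start within \<open>R / 2\<close> of \<open>z0\<close> stay in \<open>K\<close>. The second
    one gives \<open>2 * e * L \<le> 1/2\<close>, the smallness required by
    \<open>picard_short\<close> and \<open>short_time_bound\<close>.\<close>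
  define e where "e = min (R / (4 * M)) (1 / (4 * L))"
  have e: "e > 0" using R M L by (auto simp: e_def)
  have eL: "(e - (-e)) * L \<le> 1/2"
  proof -
    have "e * L \<le> 1 / (4 * L) * L" using L by (intro mult_right_mono) (auto simp: e_def)
    also have "\<dots> = 1/4" using L by simp
    finally show ?thesis by simp
  qed
  have eM: "M * e \<le> R / 4"
  proof -
    have "M * e \<le> M * (R / (4 * M))" using M by (intro mult_left_mono) (auto simp: e_def)
    also have "\<dots> = R / 4" using M by simp
    finally show ?thesis .
  qed
  \<comment> \<open>The nearest point map of a closed convex set is 1-Lipschitz, so the extension
    \<open>X (cp x)\<close> of the vector field keeps the constant \<open>L\<close>.\<close>
  define cp where "cp = closest_point K"
  have cp: "\<And>x. cp x \<in> K" "\<And>x. x \<in> K \<Longrightarrow> cp x = x" "\<And>x y. norm (cp x - cp y) \<le> norm (x - y)"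
    using closest_point_in_set[OF K(4,5)] closest_point_self closest_point_lipschitz[OF K(2,4,5)]
    by (auto simp: cp_def dist_norm)
  have cpc: "continuous_on UNIV cp" unfolding cp_def by (rule continuous_on_closest_point[OF K(2,4,5)])
  have lip': "norm (X (cp x) - X (cp y)) \<le> L * norm (x - y)" for x y
    using lip[OF cp(1) cp(1), of x y] cp(3)[of x y] L by (meson mult_left_mono order_trans zero_le_one)
  have "\<exists>\<phi>. \<phi> 0 = z \<and> (\<forall>t\<in>{-e..e}. (\<phi> has_vector_derivative X (cp (\<phi> t))) (at t within {-e..e}))" for z
  proof -
    have c: "continuous_on ({-e..e} \<times> UNIV) (\<lambda>(t,x). X (cp x))"
      unfolding case_prod_unfold
      by (rule continuous_on_compose2[OF Xc], rule continuous_on_compose2[OF cpc]) (auto intro!: continuous_intros cp)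
    show ?thesis
      by (rule picard_short[OF c lip' _ eL, of 0 z]) (use L e in auto)
  qed
  then obtain \<phi> where \<phi>0: "\<And>z. \<phi> z 0 = z"
    and \<phi>': "\<And>z t. t \<in> {-e..e} \<Longrightarrow> (\<phi> z has_vector_derivative X (cp (\<phi> z t))) (at t within {-e..e})"
    by metis
  define r where "r = R / 2"
  have \<phi>K: "\<phi> z t \<in> K" if z: "z \<in> ball z0 r" and t: "t \<in> {-e..e}" for z t
  proof -
    have "norm (\<phi> z t - \<phi> z 0) \<le> M * \<bar>t - 0\<bar>"
      by (rule vector_derivative_bound[OF \<phi>']) (use M(2)[OF cp(1)] t e in auto)
    also have "\<dots> \<le> M * e" using t M by (intro mult_left_mono) auto
    finally have "norm (\<phi> z t - z) \<le> R / 4" using eM by (simp add: \<phi>0)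
    moreover have "norm (z - z0) \<le> R / 2" using z by (auto simp: r_def dist_norm norm_minus_commute)
    ultimately have "norm (\<phi> z t - z0) \<le> R" using R norm_triangle_ineq[of "\<phi> z t - z" "z - z0"] by simp
    then show ?thesis by (auto simp: K_def dist_norm norm_minus_commute)
  qed
  have \<phi>X: "(\<phi> z has_vector_derivative X (\<phi> z t)) (at t within {-e..e})" if "z \<in> ball z0 r" "t \<in> {-e..e}" for z t
    using \<phi>'[OF that(2), of z] cp(2)[OF \<phi>K[OF that]] by simp
  have \<phi>cont: "continuous_on {-e..e} (\<phi> z)" for z
    using \<phi>' has_vector_derivative_continuous continuous_on_eq_continuous_within by blast
  have \<phi>lip: "norm (\<phi> y t - \<phi> z t) \<le> 2 * norm (y - z)" if "t \<in> {-e..e}" for y z t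
  proof -
    have "norm (\<phi> y t - \<phi> z t) \<le> 2 * norm (\<phi> y 0 - \<phi> z 0) + 2 * (e - - e) * 0"
      by (rule short_time_bound[where u'="\<lambda>t. X (cp (\<phi> y t)) - X (cp (\<phi> z t))" and L=L])
         (use \<phi>' lip' L eL that e in \<open>auto intro!: derivative_eq_intros\<close>)
    then show ?thesis by (simp add: \<phi>0)
  qed
  \<comment> \<open>The variational equation along \<open>\<phi> z\<close>. It is linear in the
    unknown and again Lipschitz with constant \<open>L\<close>.\<close>
  have "\<exists>\<psi>. \<psi> 0 = w \<and> (\<forall>t\<in>{-e..e}. (\<psi> has_vector_derivative X' (\<phi> z t) (\<psi> t)) (at t within {-e..e}))"
    if z: "z \<in> ball z0 r" for z w
  proof -
    have c: "continuous_on ({-e..e} \<times> UNIV) (\<lambda>(t,x). X' (\<phi> z t) x)"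
      unfolding case_prod_unfold
    proof (rule continuous_on_linear_family[where A="\<lambda>p. X' (\<phi> z (fst p))" and w=snd])
      show "linear (X' (\<phi> z (fst p)))" if "p \<in> {-e..e} \<times> UNIV" for p :: "real \<times> 'a"
        using C1D_linear[OF X] \<phi>K[OF z, of "fst p"] K that by auto
      show "continuous_on ({-e..e} \<times> UNIV) (\<lambda>p::real \<times> 'a. X' (\<phi> z (fst p)) b)" for b
      proof (rule continuous_on_compose2[of W "\<lambda>y. X' y b"])
        show "continuous_on W (\<lambda>y. X' y b)" using X by (auto simp: C1D_def)
        show "continuous_on ({-e..e} \<times> UNIV) (\<lambda>p::real \<times> 'a. \<phi> z (fst p))"
          by (rule continuous_on_compose2[OF \<phi>cont]) (auto intro!: continuous_intros)
      qed (use subsetD[OF K(3) \<phi>K[OF z]] in auto)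
    qed (auto intro!: continuous_intros)
    have l: "norm (X' (\<phi> z t) x - X' (\<phi> z t) y) \<le> L * norm (x - y)" if t: "t \<in> {-e..e}" for t x y
    proof -
      have "X' (\<phi> z t) x - X' (\<phi> z t) y = X' (\<phi> z t) (x - y)"
        using linear_diff[OF C1D_linear[OF X]] \<phi>K[OF z t] K by (metis subsetD)
      then show ?thesis using L(2)[OF \<phi>K[OF z t]] by simp
    qed
    show ?thesis
      by (rule picard_short[OF c l _ eL, of 0 w]) (use L e in auto)
  qed
  then obtain \<psi> where \<psi>0: "\<And>z w. z \<in> ball z0 r \<Longrightarrow> \<psi> z w 0 = w"
    and \<psi>': "\<And>z w t. z \<in> ball z0 r \<Longrightarrow> t \<in> {-e..e} \<Longrightarrow> (\<psi> z w has_vector_derivative X' (\<phi> z t) (\<psi> z w t)) (at t within {-e..e})"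
    by metis
  have \<psi>b: "norm (\<psi> z w t) \<le> 2 * norm w" if z: "z \<in> ball z0 r" and t: "t \<in> {-e..e}" for z w t
  proof -
    have "norm (\<psi> z w t) \<le> 2 * norm (\<psi> z w 0) + 2 * (e - - e) * 0"
      by (rule short_time_bound[OF \<psi>'[OF z], where L=L]) (use \<phi>K[OF z] L eL t e in auto)
    then show ?thesis by (simp add: \<psi>0[OF z])
  qed
  have lin: "linear (\<lambda>w. \<psi> z w t)" if z: "z \<in> ball z0 r" and t: "t \<in> {-e..e}" for z t
  proof -
    have lX: "linear (X' (\<phi> z t))" if "t \<in> {-e..e}" for t using C1D_linear[OF X] \<phi>K[OF z that] K by auto
    have *: "\<psi> z (c *\<^sub>R w + d *\<^sub>R v) t = c *\<^sub>R \<psi> z w t + d *\<^sub>R \<psi> z v t" for c d w v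
    proof -
      let ?u = "\<lambda>t. \<psi> z (c *\<^sub>R w + d *\<^sub>R v) t - c *\<^sub>R \<psi> z w t - d *\<^sub>R \<psi> z v t"
      have "norm (?u t) \<le> 2 * norm (?u 0) + 2 * (e - - e) * 0"
      proof (rule short_time_bound[where u'="\<lambda>t. X' (\<phi> z t) (?u t)" and L=L])
        show "(?u has_vector_derivative X' (\<phi> z t) (?u t)) (at t within {-e..e})" if t: "t \<in> {-e..e}" for t
          using \<psi>'[OF z t] by (auto intro!: derivative_eq_intros simp: linear_diff[OF lX[OF t]] linear_scale[OF lX[OF t]])
      qed (use L(2)[OF \<phi>K[OF z]] L eL t e in auto)
      then show ?thesis by (simp add: \<psi>0[OF z] algebra_simps)
    qed
    show ?thesis using *[of 1 _ 1] *[of _ _ 0] by (intro linearI) (auto)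
  qed
  have der: "((\<lambda>z. \<phi> z t) has_derivative (\<lambda>w. \<psi> z w t)) (at z)" if z: "z \<in> ball z0 r" and t: "t \<in> {-e..e}" for z t
    unfolding has_derivative_at_alt
  proof (intro conjI allI impI)
    show "bounded_linear (\<lambda>w. \<psi> z w t)" using lin[OF z t] linear_conv_bounded_linear by blast
    fix \<epsilon> :: real assume \<epsilon>: "\<epsilon> > 0"
    \<comment> \<open>\<open>short_time_bound\<close> will multiply the error
      \<open>\<eta> * (2 * norm (y - z))\<close> of the linearization by \<open>2 * (2 * e)\<close>,
      which gives \<open>\<epsilon> * norm (y - z)\<close>.\<close>
    define \<eta> where "\<eta> = \<epsilon> / (8 * e)"
    have \<eta>: "\<eta> > 0" using \<epsilon> e by (simp add: \<eta>_def)
    obtain d where d: "d > 0" "\<And>x y v. x \<in> K \<Longrightarrow> y \<in> K \<Longrightarrow> dist x y < d \<Longrightarrow> norm (X' x v - X' y v) \<le> \<eta> * norm v"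
      using C1D_uniform_compact[OF X K(1,3) \<eta>] by blast
    obtain d1 where d1: "d1 > 0" "ball z d1 \<subseteq> ball z0 r" using z open_contains_ball open_ball by blast
    show "\<exists>\<delta>>0. \<forall>y. norm (y - z) < \<delta> \<longrightarrow> norm (\<phi> y t - \<phi> z t - \<psi> z (y - z) t) \<le> \<epsilon> * norm (y - z)"
    proof (intro exI[of _ "min (d/2) d1"] conjI allI impI)
      fix y assume y: "norm (y - z) < min (d/2) d1"
      then have yb: "y \<in> ball z0 r" using d1 by (auto simp: dist_norm norm_minus_commute subset_iff)
      let ?u = "\<lambda>t. \<phi> y t - \<phi> z t - \<psi> z (y - z) t"
      have "norm (?u t) \<le> 2 * norm (?u 0) + 2 * (e - - e) * (\<eta> * (2 * norm (y - z)))"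
      proof (rule short_time_bound[where u'="\<lambda>t. X (\<phi> y t) - X (\<phi> z t) - X' (\<phi> z t) (\<psi> z (y - z) t)" and L=L])
        show "(?u has_vector_derivative X (\<phi> y t) - X (\<phi> z t) - X' (\<phi> z t) (\<psi> z (y - z) t)) (at t within {-e..e})"
          if t: "t \<in> {-e..e}" for t
          using \<phi>X[OF yb t] \<phi>X[OF z t] \<psi>'[OF z t] by (auto intro!: derivative_eq_intros)
        fix t assume t: "t \<in> {-e..e}"
        have lX: "linear (X' (\<phi> z t))" using C1D_linear[OF X] \<phi>K[OF z t] K by auto
        define h where "h = \<phi> y t - \<phi> z t"
        have hb: "norm h \<le> 2 * norm (y - z)" using \<phi>lip[OF t] by (simp add: h_def)
        have "norm (X (\<phi> z t + h) - X (\<phi> z t) - X' (\<phi> z t) h) \<le> \<eta> * norm h"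
          by (rule C1D_linearization[OF X K(2,3) \<phi>K[OF z t], where d=d])
             (use \<phi>K[OF yb t] \<phi>K[OF z t] d(2) hb y in \<open>auto simp: h_def\<close>)
        also have "\<dots> \<le> \<eta> * (2 * norm (y - z))" using hb \<eta> by (intro mult_left_mono) auto
        finally have 1: "norm (X (\<phi> z t + h) - X (\<phi> z t) - X' (\<phi> z t) h) \<le> \<eta> * (2 * norm (y - z))" .
        have e1: "X (\<phi> y t) - X (\<phi> z t) - X' (\<phi> z t) (\<psi> z (y - z) t)
          = X' (\<phi> z t) (?u t) + (X (\<phi> z t + h) - X (\<phi> z t) - X' (\<phi> z t) h)"
          by (simp add: h_def linear_diff[OF lX])
        show "norm (X (\<phi> y t) - X (\<phi> z t) - X' (\<phi> z t) (\<psi> z (y - z) t)) \<le> L * norm (?u t) + \<eta> * (2 * norm (y - z))"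
          unfolding e1 by (rule order_trans[OF norm_triangle_ineq add_mono[OF L(2)[OF \<phi>K[OF z t]] 1]])
      qed (use L eL t e \<eta> in auto)
      also have "\<dots> = \<epsilon> * norm (y - z)" using e by (simp add: \<phi>0 \<psi>0[OF z] \<eta>_def)
      finally show "norm (?u t) \<le> \<epsilon> * norm (y - z)" .
    qed (use d d1 in auto)
  qed
  have cont: "continuous_on (ball z0 r) (\<lambda>z. \<psi> z w t)" if t: "t \<in> {-e..e}" for t w
    unfolding continuous_on_iff
  proof (intro ballI allI impI)
    fix \<epsilon> :: real and z assume z: "z \<in> ball z0 r" and \<epsilon>: "(\<epsilon>::real) > 0"
    define \<eta> where "\<eta> = \<epsilon> / (16 * e * (norm w + 1))"
    have nw: "norm w + 1 > 0" by (smt (verit) norm_ge_zero)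
    have \<eta>: "\<eta> > 0" using \<epsilon> e nw by (simp add: \<eta>_def)
    obtain d where d: "d > 0" "\<And>x y v. x \<in> K \<Longrightarrow> y \<in> K \<Longrightarrow> dist x y < d \<Longrightarrow> norm (X' x v - X' y v) \<le> \<eta> * norm v"
      using C1D_uniform_compact[OF X K(1,3) \<eta>] by blast
    show "\<exists>\<delta>>0. \<forall>y\<in>ball z0 r. dist y z < \<delta> \<longrightarrow> dist (\<psi> y w t) (\<psi> z w t) < \<epsilon>"
    proof (intro exI[of _ "d/2"] conjI ballI impI)
      fix y assume y: "y \<in> ball z0 r" "dist y z < d/2"
      let ?u = "\<lambda>t. \<psi> y w t - \<psi> z w t"
      have "norm (?u t) \<le> 2 * norm (?u 0) + 2 * (e - - e) * (\<eta> * (2 * norm w))"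
      proof (rule short_time_bound[where u'="\<lambda>t. X' (\<phi> y t) (\<psi> y w t) - X' (\<phi> z t) (\<psi> z w t)" and L=L])
        show "(?u has_vector_derivative X' (\<phi> y t) (\<psi> y w t) - X' (\<phi> z t) (\<psi> z w t)) (at t within {-e..e})"
          if t: "t \<in> {-e..e}" for t
          using \<psi>'[OF y(1) t] \<psi>'[OF z t] by (auto intro!: derivative_eq_intros)
        fix t assume t: "t \<in> {-e..e}"
        have lX: "linear (X' (\<phi> y t))" using C1D_linear[OF X] \<phi>K[OF y(1) t] K by auto
        have "dist (\<phi> y t) (\<phi> z t) < d" using \<phi>lip[OF t, of y z] y(2) by (simp add: dist_norm)
        then have "norm (X' (\<phi> y t) (\<psi> z w t) - X' (\<phi> z t) (\<psi> z w t)) \<le> \<eta> * norm (\<psi> z w t)"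
          using d(2) \<phi>K y(1) z t by blast
        also have "\<dots> \<le> \<eta> * (2 * norm w)" using \<psi>b[OF z t] \<eta> by (intro mult_left_mono) auto
        finally have 1: "norm (X' (\<phi> y t) (\<psi> z w t) - X' (\<phi> z t) (\<psi> z w t)) \<le> \<eta> * (2 * norm w)" .
        have e1: "X' (\<phi> y t) (\<psi> y w t) - X' (\<phi> z t) (\<psi> z w t) = X' (\<phi> y t) (?u t) + (X' (\<phi> y t) (\<psi> z w t) - X' (\<phi> z t) (\<psi> z w t))"
          by (simp add: linear_diff[OF lX])
        show "norm (X' (\<phi> y t) (\<psi> y w t) - X' (\<phi> z t) (\<psi> z w t)) \<le> L * norm (?u t) + \<eta> * (2 * norm w)"
          unfolding e1 by (rule order_trans[OF norm_triangle_ineq add_mono[OF L(2)[OF \<phi>K[OF y(1) t]] 1]])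
      qed (use L eL t e \<eta> in auto)
      also have "\<dots> = 8 * e * \<eta> * norm w" by (simp add: \<psi>0[OF z] \<psi>0[OF y(1)])
      also have "\<dots> = (\<epsilon> / 2) * (norm w / (norm w + 1))"
      proof -
        have "8 * e * (\<epsilon> / (16 * e * a)) * n = (\<epsilon> / 2) * (n / a)" if "a > 0" for a n
          using e that by (simp add: field_simps)
        from this[OF nw] show ?thesis by (simp add: \<eta>_def)
      qed
      also have "\<dots> \<le> (\<epsilon> / 2) * 1" using \<epsilon> nw by (intro mult_left_mono) (auto simp: divide_le_eq)
      also have "\<dots> < \<epsilon>" using \<epsilon> by simp
      finally show "dist (\<psi> y w t) (\<psi> z w t) < \<epsilon>" by (simp add: dist_norm)
    qed (use d in auto)
  qed
  show ?thesis
  proof (rule that[of r e \<phi> \<psi>])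
    show "ball z0 r \<subseteq> W" using R by (auto simp: r_def)
    show "C1D (ball z0 r) (\<lambda>z. \<phi> z t) (\<lambda>z w. \<psi> z w t)" if "t \<in> {-e..e}" for t
      using der cont that by (auto simp: C1D_def)
    show "\<phi> z t \<in> W \<and> (\<phi> z has_vector_derivative X (\<phi> z t)) (at t within {-e..e})"
      if "z \<in> ball z0 r" "t \<in> {-e..e}" for z t using \<phi>X[OF that] \<phi>K[OF that] K(3) by blast
  qed (use R e \<phi>0 \<psi>' in \<open>auto simp: r_def\<close>)
qed

section \<open>Riemannian metrics in coordinates\<close>

lemma bilinear_basis_expand:
  fixes B :: "'u::euclidean_space \<Rightarrow> 'v::euclidean_space \<Rightarrow> 'b::real_normed_vector"
  assumes "bilinear B"
  shows "B u v = (\<Sum>b\<in>Basis. \<Sum>c\<in>Basis. ((u \<bullet> b) * (v \<bullet> c)) *\<^sub>R B b c)"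
proof -
  have l: "linear (\<lambda>u. B u v)" "linear (B b)" for b using assms by (auto simp: bilinear_def)
  have "B u v = (\<Sum>b\<in>Basis. (u \<bullet> b) *\<^sub>R B b v)" using linear_basis_expand[OF l(1)] .
  also have "\<dots> = (\<Sum>b\<in>Basis. (u \<bullet> b) *\<^sub>R (\<Sum>c\<in>Basis. (v \<bullet> c) *\<^sub>R B b c))"
    by (simp flip: linear_basis_expand[OF l(2), where v=v])
  finally show ?thesis by (simp add: scaleR_sum_right)
qed

text \<open>The instances are the metric, the Christoffel symbols and the derivative of an isometry.
  The purpose is to differentiate \<open>B (x t) (u t) (v t)\<close> along curves.\<close>

locale bilinear_family =
  fixes U :: "'p::euclidean_space set" and B :: "'p \<Rightarrow> 'u::euclidean_space \<Rightarrow> 'v::euclidean_space \<Rightarrow> 'b::real_normed_vector"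
  assumes open_U: "open U" and bilinear: "p \<in> U \<Longrightarrow> bilinear (B p)" and C1: "C1_on U (\<lambda>p. B p u v)"
begin

definition dB :: "'p \<Rightarrow> 'p \<Rightarrow> 'u \<Rightarrow> 'v \<Rightarrow> 'b" where
  "dB p a u v = frechet_derivative (\<lambda>q. B q u v) (at p) a"

lemma dB: "C1D U (\<lambda>p. B p u v) (\<lambda>p a. dB p a u v)"
  using C1_on_frechet[OF C1] by (simp add: dB_def)

lemma dB_expand:
  assumes p: "p \<in> U"
  shows "dB p a u v = (\<Sum>b\<in>Basis. \<Sum>c\<in>Basis. ((u \<bullet> b) * (v \<bullet> c)) *\<^sub>R dB p a b c)"
proof -
  have "((\<lambda>q. \<Sum>b\<in>Basis. \<Sum>c\<in>Basis. ((u \<bullet> b) * (v \<bullet> c)) *\<^sub>R B q b c) has_derivative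
     (\<lambda>a. \<Sum>b\<in>Basis. \<Sum>c\<in>Basis. ((u \<bullet> b) * (v \<bullet> c)) *\<^sub>R dB p a b c)) (at p)"
    by (intro has_derivative_sum has_derivative_scaleR_right C1D_derivative[OF dB p])
  then have "((\<lambda>q. B q u v) has_derivative
     (\<lambda>a. \<Sum>b\<in>Basis. \<Sum>c\<in>Basis. ((u \<bullet> b) * (v \<bullet> c)) *\<^sub>R dB p a b c)) (at p)"
    by (rule has_derivative_transform_within_open[OF _ open_U p]) (simp flip: bilinear_basis_expand[OF bilinear])
  from has_derivative_unique[OF C1D_derivative[OF dB p] this] show ?thesis by (rule fun_cong)
qed

lemma bilinear_dB:
  assumes p: "p \<in> U" shows "bilinear (dB p a)"
  unfolding bilinear_def
proof (intro allI conjI)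
  show "linear (dB p a u)" for u
  proof (rule linearI)
    show "dB p a u (v + v') = dB p a u v + dB p a u v'" for v v'
      unfolding dB_expand[OF p, of a u "v + v'"] dB_expand[OF p, of a u v] dB_expand[OF p, of a u v']
      by (simp add: inner_add_left algebra_simps sum.distrib)
    show "dB p a u (c *\<^sub>R v) = c *\<^sub>R dB p a u v" for c v
      unfolding dB_expand[OF p, of a u "c *\<^sub>R v"] dB_expand[OF p, of a u v]
      by (simp add: algebra_simps scaleR_sum_right)
  qed
  show "linear (\<lambda>u. dB p a u v)" for v
  proof (rule linearI)
    show "dB p a (u + u') v = dB p a u v + dB p a u' v" for u u'
      unfolding dB_expand[OF p, of a "u + u'" v] dB_expand[OF p, of a u v] dB_expand[OF p, of a u' v]
      by (simp add: inner_add_left algebra_simps sum.distrib)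
    show "dB p a (c *\<^sub>R u) v = c *\<^sub>R dB p a u v" for c u
      unfolding dB_expand[OF p, of a "c *\<^sub>R u" v] dB_expand[OF p, of a u v]
      by (simp add: algebra_simps scaleR_sum_right)
  qed
qed

lemma linear_dB: "p \<in> U \<Longrightarrow> linear (\<lambda>a. dB p a u v)"
  using C1D_linear[OF dB] .

text \<open>In a basis, \<open>B p u v\<close> is a finite sum of products of coordinates of
  \<open>u\<close> and \<open>v\<close> with coefficients that depend on \<open>p\<close>
  alone.\<close>

lemma C1D_joint:
  "C1D (U \<times> UNIV \<times> UNIV) (\<lambda>(p,u,v). B p u v) (\<lambda>(p,u,v) (a,u',v'). dB p a u v + (B p u v' + B p u' v))"
proof -
  define D where "D b c z w = ((fst (snd z) \<bullet> b) * (snd (snd z) \<bullet> c)) *\<^sub>R dB (fst z) (fst w) b c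
     + ((fst (snd z) \<bullet> b) * (snd (snd w) \<bullet> c) + (fst (snd w) \<bullet> b) * (snd (snd z) \<bullet> c)) *\<^sub>R B (fst z) b c"
     for b :: 'u and c :: 'v and z w :: "'p \<times> 'u \<times> 'v"
  let ?U = "U \<times> (UNIV :: 'u set) \<times> (UNIV :: 'v set)"
  have 1: "C1D ?U (\<lambda>z. B (fst z) b c) (\<lambda>z w. dB (fst z) (fst w) b c)" for b c
    by (rule C1D_compose[OF C1D_linear_map[OF bounded_linear_fst] dB]) auto
  have "bounded_linear (\<lambda>z::'p \<times> 'u \<times> 'v. fst (snd z) \<bullet> b)" "bounded_linear (\<lambda>z::'p \<times> 'u \<times> 'v. snd (snd z) \<bullet> c)" for b c
    by (intro bounded_linear_compose[OF bounded_linear_inner_left] bounded_linear_compose[OF bounded_linear_fst]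
        bounded_linear_compose[OF bounded_linear_snd] bounded_linear_snd)+
  note 2 = C1D_linear_map[OF this(1)] C1D_linear_map[OF this(2)]
  have "C1D ?U (\<lambda>z. ((fst (snd z) \<bullet> b) * (snd (snd z) \<bullet> c)) *\<^sub>R B (fst z) b c) (D b c)" for b c
    using C1D_bilinear[OF bounded_bilinear_scaleR C1D_bilinear[OF bounded_bilinear_mult 2(1)[of _ b] 2(2)[of _ c]] 1[of b c]]
    unfolding D_def by blast
  then have "C1D ?U (\<lambda>z. \<Sum>b\<in>Basis. \<Sum>c\<in>Basis. ((fst (snd z) \<bullet> b) * (snd (snd z) \<bullet> c)) *\<^sub>R B (fst z) b c)
      (\<lambda>z w. \<Sum>b\<in>Basis. \<Sum>c\<in>Basis. D b c z w)"
    by (intro C1D_sum)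
  then have 3: "C1D ?U (\<lambda>(p,u,v). B p u v) (\<lambda>z w. \<Sum>b\<in>Basis. \<Sum>c\<in>Basis. D b c z w)"
    by (rule C1D_cong[rotated 2])
       (auto simp: open_Times open_U simp flip: bilinear_basis_expand[OF bilinear])
  have 4: "(\<Sum>b\<in>Basis. \<Sum>c\<in>Basis. D b c z w) = (\<lambda>(p,u,v) (a,u',v'). dB p a u v + (B p u v' + B p u' v)) z w"
    if "z \<in> ?U" for z w
  proof -
    obtain p u v a u' v' where zw: "z = (p,u,v)" "w = (a,u',v')" by (metis prod_cases3)
    have p: "p \<in> U" using that zw by simp
    show ?thesis unfolding zw D_def
      by (simp add: sum.distrib scaleR_add_left flip: dB_expand[OF p] bilinear_basis_expand[OF bilinear[OF p]])
  qed
  show ?thesis unfolding C1D_def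
  proof (intro conjI ballI allI)
    fix z assume z: "z \<in> ?U"
    have "(\<lambda>w. \<Sum>b\<in>Basis. \<Sum>c\<in>Basis. D b c z w) = (\<lambda>(p,u,v) (a,u',v'). dB p a u v + (B p u v' + B p u' v)) z"
      using 4[OF z] by blast
    then show "((\<lambda>(p,u,v). B p u v) has_derivative (\<lambda>(p,u,v) (a,u',v'). dB p a u v + (B p u v' + B p u' v)) z) (at z)"
      using C1D_derivative[OF 3 z] by simp
  next
    fix w
    show "continuous_on ?U (\<lambda>z. (\<lambda>(p,u,v) (a,u',v'). dB p a u v + (B p u v' + B p u' v)) z w)"
    proof (rule continuous_on_eq[OF _ 4])
      show "continuous_on ?U (\<lambda>z. \<Sum>b\<in>Basis. \<Sum>c\<in>Basis. D b c z w)" using 3 unfolding C1D_def by blast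
    qed
  qed
qed

lemma C1_on_family:
  fixes f :: "'x::euclidean_space \<Rightarrow> 'p"
  assumes "C1_on S f" "C1_on S u" "C1_on S v" "\<And>x. x \<in> S \<Longrightarrow> f x \<in> U"
  shows "C1_on S (\<lambda>x. B (f x) (u x) (v x))"
proof -
  have "C1_on S (\<lambda>x. (f x, u x, v x))" by (intro C1_on_Pair assms)
  from C1_on_compose[OF this C1D_C1[OF C1D_joint]] assms(4) show ?thesis by auto
qed

lemma vector_derivative_family:
  assumes x: "(x has_vector_derivative x') (at t within I)" and u: "(u has_vector_derivative u') (at t within I)"
    and v: "(v has_vector_derivative v') (at t within I)" and xU: "x t \<in> U"
  shows "((\<lambda>s. B (x s) (u s) (v s)) has_vector_derivative
     (dB (x t) x' (u t) (v t) + (B (x t) (u t) v' + B (x t) u' (v t)))) (at t within I)"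
proof -
  have "((\<lambda>s. (x s, u s, v s)) has_derivative (\<lambda>h. (h *\<^sub>R x', h *\<^sub>R u', h *\<^sub>R v'))) (at t within I)"
    using x u v unfolding has_vector_derivative_def by (intro has_derivative_Pair)
  from has_derivative_compose[OF this C1D_derivative[OF C1D_joint, of "(x t, u t, v t)"]] xU
  have "((\<lambda>s. B (x s) (u s) (v s)) has_derivative
     (\<lambda>h. dB (x t) (h *\<^sub>R x') (u t) (v t) + (B (x t) (u t) (h *\<^sub>R v') + B (x t) (h *\<^sub>R u') (v t)))) (at t within I)"
    by simp
  moreover have "dB (x t) (h *\<^sub>R x') (u t) (v t) + (B (x t) (u t) (h *\<^sub>R v') + B (x t) (h *\<^sub>R u') (v t))
     = h *\<^sub>R (dB (x t) x' (u t) (v t) + (B (x t) (u t) v' + B (x t) u' (v t)))" for h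
    using linear_scale[OF linear_dB[OF xU]] bilinear_rmul[OF bilinear[OF xU]] bilinear_lmul[OF bilinear[OF xU]]
    by (simp add: scaleR_add_right)
  ultimately show ?thesis by (simp add: has_vector_derivative_def)
qed

end

section \<open>The Levi-Civita connection in coordinates\<close>

definition chr :: "('e::euclidean_space \<Rightarrow> 'e \<Rightarrow> 'e \<Rightarrow> real) \<Rightarrow> 'e \<Rightarrow> 'e \<Rightarrow> 'e \<Rightarrow> 'e" where
  "chr g p u v = (THE z. \<forall>w. g p z w =
     (frechet_derivative (\<lambda>q. g q v w) (at p) u
      + frechet_derivative (\<lambda>q. g q u w) (at p) v
      - frechet_derivative (\<lambda>q. g q u v) (at p) w) / 2)"

text \<open>Detaches the local calculus from the manifold: from here on a single metric on an open
  set of the model space is studied.\<close>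

lemma christoffel_chr: "christoffel R c = chr (metric_at R c)"
  unfolding christoffel_def chr_def by (intro ext) simp

locale metric_patch =
  fixes U :: "'e::euclidean_space set" and g :: "'e \<Rightarrow> 'e \<Rightarrow> 'e \<Rightarrow> real"
  assumes open_U: "open U" and bilinear_g: "p \<in> U \<Longrightarrow> bilinear (g p)"
    and sym: "p \<in> U \<Longrightarrow> g p u v = g p v u" and pos: "p \<in> U \<Longrightarrow> u \<noteq> 0 \<Longrightarrow> g p u u > 0"
    and smooth: "smooth_on U (\<lambda>p. g p u v)"
begin

sublocale G: bilinear_family U g
  by unfold_locales (use open_U bilinear_g smooth_on_C1[OF open_U smooth] in auto)

abbreviation "dg \<equiv> G.dB"

lemma dg_C1: "C1_on U (\<lambda>p. dg p a u v)"
  using smooth_on_C1[OF open_U smooth_on_derivative[OF smooth]] by (simp add: G.dB_def)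

lemma dg_sym: "p \<in> U \<Longrightarrow> dg p a u v = dg p a v u"
proof -
  assume p: "p \<in> U"
  have "((\<lambda>q. g q v u) has_derivative (\<lambda>a. dg p a u v)) (at p)"
    by (rule has_derivative_transform_within_open[OF C1D_derivative[OF G.dB p, of u v] open_U p]) (simp add: sym)
  then show ?thesis using has_derivative_unique[OF C1D_derivative[OF G.dB p, of v u]] by metis
qed

lemma nonneg: "p \<in> U \<Longrightarrow> g p u u \<ge> 0"
  using pos[of p u] bilinear_lzero[OF bilinear_g, of p u] by (cases "u = 0") (auto simp: less_imp_le)

lemma zero_iff: "p \<in> U \<Longrightarrow> g p u u = 0 \<longleftrightarrow> u = 0"
  using pos[of p u] bilinear_lzero[OF bilinear_g, of p u] by (metis less_irrefl)

lemma nondegenerate: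
  assumes p: "p \<in> U" and "\<And>w. g p z w = g p z' w"
  shows "z = z'"
proof -
  have "g p (z - z') (z - z') = 0" using assms(2)[of "z - z'"] bilinear_lsub[OF bilinear_g[OF p]] by simp
  then show ?thesis using zero_iff[OF p] by simp
qed

lemma cauchy_schwarz:
  assumes p: "p \<in> U" shows "(g p u v)\<^sup>2 \<le> g p u u * g p v v"
proof (cases "v = 0")
  case True
  then show ?thesis using bilinear_rzero[OF bilinear_g[OF p]] by simp
next
  case False
  define b where "b = g p v v"
  have b: "b > 0" using pos[OF p False] by (simp add: b_def)
  have "0 \<le> g p (b *\<^sub>R u - g p u v *\<^sub>R v) (b *\<^sub>R u - g p u v *\<^sub>R v)" by (rule nonneg[OF p])
  also have "\<dots> = b * (b * g p u u - (g p u v)\<^sup>2)"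
    by (simp add: bilinear_lsub[OF bilinear_g[OF p]] bilinear_rsub[OF bilinear_g[OF p]] bilinear_lmul[OF bilinear_g[OF p]]
      bilinear_rmul[OF bilinear_g[OF p]] sym[OF p, of v u] b_def[symmetric] power2_eq_square algebra_simps)
  finally show ?thesis using b by (simp add: zero_le_mult_iff b_def mult.commute)
qed

text \<open>Gram--Schmidt orthogonalization, without normalization in order to avoid square roots.\<close>

lemma orthogonal_frame:
  assumes "finite B" "independent B"
  shows "\<exists>e::'e \<Rightarrow> 'e \<Rightarrow> 'e. (\<forall>b\<in>B. C1_on U (e b)) \<and> (\<forall>p\<in>U. (\<forall>b\<in>B. e b p \<noteq> 0) \<and>
     (\<forall>b\<in>B. \<forall>c\<in>B. b \<noteq> c \<longrightarrow> g p (e b p) (e c p) = 0) \<and> span ((\<lambda>b. e b p) ` B) = span B)"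
  using assms
proof (induction B rule: finite_induct)
  case empty
  then show ?case by auto
next
  case (insert a B)
  then have indB: "independent B" "a \<notin> span B" by (auto simp: independent_insert)
  then obtain e where e: "\<And>b. b \<in> B \<Longrightarrow> C1_on U (e b)" "\<And>p b. p \<in> U \<Longrightarrow> b \<in> B \<Longrightarrow> e b p \<noteq> 0"
    "\<And>p b c. p \<in> U \<Longrightarrow> b \<in> B \<Longrightarrow> c \<in> B \<Longrightarrow> b \<noteq> c \<Longrightarrow> g p (e b p) (e c p) = 0"
    "\<And>p. p \<in> U \<Longrightarrow> span ((\<lambda>b. e b p) ` B) = span B"
    using insert.IH[OF indB(1)] that by (elim exE conjE) blast
  define k where "k b p = g p a (e b p) * inverse (g p (e b p) (e b p))" for b p
  define ea where "ea p = a - (\<Sum>b\<in>B. k b p *\<^sub>R e b p)" for p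
  define e' where "e' b = (if b = a then ea else e b)" for b
  have eB: "e' b = e b" if "b \<in> B" for b using that insert by (auto simp: e'_def)
  have s: "(\<Sum>b\<in>B. k b p *\<^sub>R e b p) \<in> span B" if p: "p \<in> U" for p
    unfolding e(4)[OF p, symmetric] by (intro span_sum span_scale span_base) auto
  have C1: "C1_on U (e' b)" if "b \<in> insert a B" for b
  proof (cases "b = a")
    case True
    have "C1_on U (k b)" if b: "b \<in> B" for b
      unfolding k_def
      by (intro C1_on_mult C1_on_inverse G.C1_on_family C1_on_const e(1)[OF b] C1_on_linear_map[OF bounded_linear_ident])
         (use pos e(2) b in \<open>force\<close>)+
    then have "C1_on U ea" unfolding ea_def by (intro C1_on_diff C1_on_const C1_on_sum C1_on_scaleR e(1))
    then show ?thesis using True by (simp add: e'_def)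
  qed (use that e in \<open>auto simp: e'_def\<close>)
  have nz: "ea p \<noteq> 0" if p: "p \<in> U" for p
    using s[OF p] indB(2) by (auto simp: ea_def)
  have orth: "g p (ea p) (e c p) = 0" if p: "p \<in> U" and c: "c \<in> B" for p c
  proof -
    have "g p (\<Sum>b\<in>B. k b p *\<^sub>R e b p) (e c p) = (\<Sum>b\<in>B. k b p * g p (e b p) (e c p))"
    proof -
      have l: "linear (\<lambda>x. g p x (e c p))" using bilinear_g[OF p] by (simp add: bilinear_def)
      show ?thesis by (simp add: linear_sum[OF l] linear_scale[OF l])
    qed
    also have "\<dots> = (\<Sum>b\<in>B. if b = c then k c p * g p (e c p) (e c p) else 0)"
      by (rule sum.cong) (use e(3)[OF p _ c] in auto)
    also have "\<dots> = k c p * g p (e c p) (e c p)" using insert c by simp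
    also have "\<dots> = g p a (e c p)" using pos[OF p e(2)[OF p c]] by (simp add: k_def)
    finally show ?thesis by (simp add: ea_def bilinear_lsub[OF bilinear_g[OF p]])
  qed
  show ?case
  proof (intro exI[of _ e'] conjI ballI impI)
    fix p assume p: "p \<in> U"
    show "e' b p \<noteq> 0" if "b \<in> insert a B" for b using that nz[OF p] e(2)[OF p] by (auto simp: e'_def)
    show "g p (e' b p) (e' c p) = 0" if "b \<in> insert a B" "c \<in> insert a B" "b \<noteq> c" for b c
      using that orth[OF p] e(3)[OF p] sym[OF p, of "e b p" "ea p"] by (auto simp: e'_def)
    have im: "(\<lambda>b. e' b p) ` insert a B = insert (ea p) ((\<lambda>b. e b p) ` B)"
      using eB by (auto simp: e'_def)
    have "span ((\<lambda>b. e' b p) ` insert a B) = span (insert (ea p) (span ((\<lambda>b. e b p) ` B)))"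
      unfolding im by (simp add: span_insert span_span)
    also have "\<dots> = span (insert (ea p) (span B))" by (simp add: e(4)[OF p])
    also have "\<dots> = span (insert (ea p) B)" by (simp add: span_insert span_span)
    also have "\<dots> = span (insert a B)"
    proof (rule eq_span_insert_eq)
      have "ea p - a = - (\<Sum>b\<in>B. k b p *\<^sub>R e b p)" by (simp add: ea_def)
      then show "ea p - a \<in> span B" using s[OF p] span_neg by metis
    qed
    finally show "span ((\<lambda>b. e' b p) ` insert a B) = span (insert a B)" .
  qed (use C1 in auto)
qed

text \<open>The right hand side of the Koszul formula for vector fields with constant coordinates,
  whose brackets vanish.\<close>

definition koszul :: "'e \<Rightarrow> 'e \<Rightarrow> 'e \<Rightarrow> 'e \<Rightarrow> real" where
  "koszul p u v w = (dg p u v w + dg p v u w - dg p w u v) / 2"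

lemma linear_koszul: "p \<in> U \<Longrightarrow> linear (koszul p u v)"
  unfolding koszul_def
  by (rule linearI)
     (simp_all add: bilinear_radd[OF G.bilinear_dB] bilinear_rmul[OF G.bilinear_dB] linear_add[OF G.linear_dB] linear_scale[OF G.linear_dB] field_simps)

text \<open>An orthogonal frame solves the Koszul formula explicitly. This justifies the definite
  description in \<open>chr\<close>, and the explicit solution is visibly differentiable in
  \<open>p\<close>.\<close>

lemma chr_formula:
  obtains e :: "'e \<Rightarrow> 'e \<Rightarrow> 'e" where "\<And>b. b \<in> Basis \<Longrightarrow> C1_on U (e b)"
    "\<And>p b. p \<in> U \<Longrightarrow> b \<in> Basis \<Longrightarrow> g p (e b p) (e b p) > 0"
    "\<And>p u v. p \<in> U \<Longrightarrow> chr g p u v = (\<Sum>b\<in>Basis. (koszul p u v (e b p) * inverse (g p (e b p) (e b p))) *\<^sub>R e b p)"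
    "\<And>p u v w. p \<in> U \<Longrightarrow> g p (chr g p u v) w = koszul p u v w"
proof -
  obtain e :: "'e \<Rightarrow> 'e \<Rightarrow> 'e" where e0: "(\<forall>b\<in>Basis. C1_on U (e b)) \<and> (\<forall>p\<in>U. (\<forall>b\<in>Basis. e b p \<noteq> 0) \<and>
     (\<forall>b\<in>Basis. \<forall>c\<in>Basis. b \<noteq> c \<longrightarrow> g p (e b p) (e c p) = 0) \<and> span ((\<lambda>b. e b p) ` Basis) = UNIV)"
    using orthogonal_frame[OF finite_Basis independent_Basis] unfolding span_Basis by (rule exE)
  then have e: "\<And>b. b \<in> Basis \<Longrightarrow> C1_on U (e b)" "\<And>p b. p \<in> U \<Longrightarrow> b \<in> Basis \<Longrightarrow> e b p \<noteq> 0"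
    "\<And>p b c. p \<in> U \<Longrightarrow> b \<in> Basis \<Longrightarrow> c \<in> Basis \<Longrightarrow> b \<noteq> c \<Longrightarrow> g p (e b p) (e c p) = 0"
    "\<And>p. p \<in> U \<Longrightarrow> span ((\<lambda>b. e b p) ` Basis) = UNIV"
    by auto
  define z where "z p u v = (\<Sum>b\<in>Basis. (koszul p u v (e b p) * inverse (g p (e b p) (e b p))) *\<^sub>R e b p)" for p u v
  have pe: "g p (e b p) (e b p) > 0" if "p \<in> U" "b \<in> Basis" for p b using pos e(2) that by blast
  have zk: "g p (z p u v) w = koszul p u v w" if p: "p \<in> U" for p u v w
  proof -
    have "g p (z p u v) (e c p) = koszul p u v (e c p)" if c: "c \<in> Basis" for c
    proof -
      let ?k = "\<lambda>b. koszul p u v (e b p) * inverse (g p (e b p) (e b p))"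
      have "g p (z p u v) (e c p) = (\<Sum>b\<in>Basis. ?k b * g p (e b p) (e c p))"
      proof -
        have l: "linear (\<lambda>x. g p x (e c p))" using bilinear_g[OF p] by (simp add: bilinear_def)
        show ?thesis by (simp add: z_def linear_sum[OF l] linear_scale[OF l])
      qed
      also have "\<dots> = (\<Sum>b\<in>Basis. if b = c then ?k c * g p (e c p) (e c p) else 0)"
        by (rule sum.cong) (use e(3)[OF p _ c] in auto)
      also have "\<dots> = koszul p u v (e c p)" using c pe[OF p c] by simp
      finally show ?thesis .
    qed
    then have "g p (z p u v) w = koszul p u v w" if "w \<in> span ((\<lambda>b. e b p) ` Basis)" for w
      using linear_eq_on_span[OF _ linear_koszul[OF p, of u v] _ that, of "g p (z p u v)"] bilinear_g[OF p]
      by (auto simp: bilinear_def)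
    then show ?thesis using e(4)[OF p] by blast
  qed
  have "chr g p u v = z p u v" if p: "p \<in> U" for p u v
    unfolding chr_def
  proof (rule the_equality)
    show *: "\<forall>w. g p (z p u v) w = (frechet_derivative (\<lambda>q. g q v w) (at p) u + frechet_derivative (\<lambda>q. g q u w) (at p) v -
       frechet_derivative (\<lambda>q. g q u v) (at p) w) / 2"
      using zk[OF p] by (simp add: koszul_def G.dB_def)
    fix y assume y: "\<forall>w. g p y w = (frechet_derivative (\<lambda>q. g q v w) (at p) u + frechet_derivative (\<lambda>q. g q u w) (at p) v -
       frechet_derivative (\<lambda>q. g q u v) (at p) w) / 2"
    show "y = z p u v" by (rule nondegenerate[OF p]) (simp only: y[rule_format] *[rule_format])
  qed
  then show ?thesis using that[of e] e(1) pe zk z_def by metis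
qed

lemma chr_koszul: "p \<in> U \<Longrightarrow> g p (chr g p u v) w = koszul p u v w"
  using chr_formula by metis

lemma chr_C1: "C1_on U (\<lambda>p. chr g p u v)"
proof -
  obtain e :: "'e \<Rightarrow> 'e \<Rightarrow> 'e" where e: "\<And>b. b \<in> Basis \<Longrightarrow> C1_on U (e b)" "\<And>p b. p \<in> U \<Longrightarrow> b \<in> Basis \<Longrightarrow> g p (e b p) (e b p) > 0"
    "\<And>p u v. p \<in> U \<Longrightarrow> chr g p u v = (\<Sum>b\<in>Basis. (koszul p u v (e b p) * inverse (g p (e b p) (e b p))) *\<^sub>R e b p)"
    "\<And>p u v w. p \<in> U \<Longrightarrow> g p (chr g p u v) w = koszul p u v w"
    by (rule chr_formula) (rule that, assumption+)
  have k: "C1_on U (\<lambda>p. koszul p u v (e b p))" if b: "b \<in> Basis" for b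
  proof -
    have "C1_on U (\<lambda>p. koszul p u v c)" for c
    proof -
      have "C1_on U (\<lambda>p. (1/2) * (dg p u v c + dg p v u c - dg p c u v))"
        by (intro C1_on_mult C1_on_const C1_on_diff C1_on_add dg_C1)
      then show ?thesis by (simp add: koszul_def)
    qed
    then have "C1_on U (\<lambda>p. \<Sum>c\<in>Basis. (e b p \<bullet> c) *\<^sub>R koszul p u v c)"
      by (intro C1_on_sum C1_on_scaleR C1_on_inner e(1)[OF b] C1_on_const)
    then show ?thesis
      by (rule C1_on_cong[OF open_U, rotated]) (rule linear_basis_expand[OF linear_koszul, symmetric])
  qed
  have "C1_on U (\<lambda>p. \<Sum>b\<in>Basis. (koszul p u v (e b p) * inverse (g p (e b p) (e b p))) *\<^sub>R e b p)"
    by (intro C1_on_sum C1_on_scaleR C1_on_mult k C1_on_inverse G.C1_on_family C1_on_linear_map[OF bounded_linear_ident] e(1))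
       (use e(2) in force)+
  then show ?thesis by (rule C1_on_cong[OF open_U, rotated]) (simp add: e(3))
qed

lemma chr_sym: "p \<in> U \<Longrightarrow> chr g p u v = chr g p v u"
  by (rule nondegenerate, assumption) (simp add: chr_koszul koszul_def dg_sym)

lemma chr_bilinear: "p \<in> U \<Longrightarrow> bilinear (chr g p)"
proof -
  assume p: "p \<in> U"
  have "linear (chr g p u)" for u
  proof (rule linearI; rule nondegenerate[OF p])
    show "g p (chr g p u (v + v')) w = g p (chr g p u v + chr g p u v') w" for v v' w
      by (simp add: chr_koszul[OF p] bilinear_ladd[OF bilinear_g[OF p]] koszul_def bilinear_radd[OF G.bilinear_dB[OF p]]
         bilinear_ladd[OF G.bilinear_dB[OF p]] linear_add[OF G.linear_dB[OF p]] field_simps)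
    show "g p (chr g p u (c *\<^sub>R v)) w = g p (c *\<^sub>R chr g p u v) w" for c v w
      by (simp add: chr_koszul[OF p] bilinear_lmul[OF bilinear_g[OF p]] koszul_def bilinear_rmul[OF G.bilinear_dB[OF p]]
         bilinear_lmul[OF G.bilinear_dB[OF p]] linear_scale[OF G.linear_dB[OF p]] field_simps)
  qed
  then show ?thesis unfolding bilinear_def using chr_sym[OF p] by presburger
qed

sublocale C: bilinear_family U "chr g"
  by unfold_locales (use open_U chr_bilinear chr_C1 in auto)

abbreviation "dchr \<equiv> C.dB"

text \<open>When the two Koszul expressions are added, everything except \<open>dg p a u v\<close>
  cancels.\<close>

lemma metric_compatible:
  assumes p: "p \<in> U" shows "dg p a u v = g p (chr g p a u) v + g p u (chr g p a v)"
  unfolding sym[OF p, of u "chr g p a v"] chr_koszul[OF p] koszul_def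
  using dg_sym[OF p, of a u v] by (simp add: field_simps)

text \<open>The geodesic equation as a first order system for position and velocity.\<close>

definition spray :: "'e \<times> 'e \<Rightarrow> 'e \<times> 'e" where
  "spray z = (snd z, - chr g (fst z) (snd z) (snd z))"

text \<open>The linearization of \<open>spray\<close>; its solutions along a geodesic are the Jacobi
  fields paired with their coordinate derivatives.\<close>

definition dspray :: "'e \<times> 'e \<Rightarrow> 'e \<times> 'e \<Rightarrow> 'e \<times> 'e" where
  "dspray z w = (snd w, - (dchr (fst z) (fst w) (snd z) (snd z) + (chr g (fst z) (snd z) (snd w) + chr g (fst z) (snd w) (snd z))))"

lemma spray_C1D: "C1D (U \<times> UNIV) spray dspray"
proof -
  have l: "bounded_linear (\<lambda>z::'e \<times> 'e. (fst z, snd z, snd z))"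
    by (intro bounded_linear_Pair bounded_linear_fst bounded_linear_snd)
  have "C1D (U \<times> UNIV) (\<lambda>z. (\<lambda>(p,u,v). chr g p u v) (fst z, snd z, snd z))
    (\<lambda>z w. (\<lambda>(p,u,v) (a,u',v'). dchr p a u v + (chr g p u v' + chr g p u' v)) (fst z, snd z, snd z) (fst w, snd w, snd w))"
    by (rule C1D_compose[OF C1D_linear_map[OF l] C.C1D_joint]) auto
  from C1D_bilinear[OF bounded_bilinear_scaleR C1D_const[of _ "-1"] this]
  have "C1D (U \<times> UNIV) (\<lambda>z. - chr g (fst z) (snd z) (snd z))
    (\<lambda>z w. - (dchr (fst z) (fst w) (snd z) (snd z) + (chr g (fst z) (snd z) (snd w) + chr g (fst z) (snd w) (snd z))))"
    by simp
  from C1D_Pair[OF C1D_linear_map[OF bounded_linear_snd] this] show ?thesis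
    unfolding spray_def[abs_def] dspray_def[abs_def] by simp
qed

end

section \<open>Curvature and Jacobi fields in coordinates\<close>

definition curv :: "('e::euclidean_space \<Rightarrow> 'e \<Rightarrow> 'e \<Rightarrow> real) \<Rightarrow> 'e \<Rightarrow> 'e \<Rightarrow> 'e \<Rightarrow> 'e \<Rightarrow> 'e" where
  "curv g p u v w = frechet_derivative (\<lambda>q. chr g q v w) (at p) u - frechet_derivative (\<lambda>q. chr g q u w) (at p) v
     + chr g p u (chr g p v w) - chr g p v (chr g p u w)"

lemma curvature_curv: "curvature R c = curv (metric_at R c)"
  unfolding curvature_def curv_def christoffel_chr by (intro ext) simp

context metric_patch
begin

lemma curv_dchr: "curv g p u v w = dchr p u v w - dchr p v u w + chr g p u (chr g p v w) - chr g p v (chr g p u w)"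
  by (simp add: curv_def C.dB_def)

text \<open>The curvature assumption speaks of independent pairs. For the other pairs the numerator
  of the sectional curvature vanishes, so that \<open>npc_curv\<close> holds for all
  vectors.\<close>

lemma curv_dependent:
  assumes p: "p \<in> U" and "\<not> (u \<noteq> v \<and> independent {u, v})"
  shows "g p (curv g p u v v) u = 0"
proof -
  note rules = bilinear_rmul[OF chr_bilinear[OF p]] bilinear_lmul[OF chr_bilinear[OF p]] bilinear_rzero[OF chr_bilinear[OF p]]
     bilinear_lmul[OF C.bilinear_dB[OF p]] bilinear_rmul[OF C.bilinear_dB[OF p]] linear_scale[OF C.linear_dB[OF p]]
     bilinear_rzero[OF C.bilinear_dB[OF p]] bilinear_lzero[OF C.bilinear_dB[OF p]] linear_0[OF C.linear_dB[OF p]] bilinear_lzero[OF chr_bilinear[OF p]]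
     bilinear_lzero[OF bilinear_g[OF p]]
  have "v = 0 \<or> (\<exists>c. u = c *\<^sub>R v)"
  proof (rule ccontr)
    assume n: "\<not> ?thesis"
    then have "u \<noteq> v" by (metis scaleR_one)
    moreover have "u \<notin> span {v}" using n by (auto simp: span_singleton)
    ultimately show False using assms(2) n by (auto simp: independent_insert)
  qed
  then show ?thesis by (auto simp: curv_dchr rules)
qed

lemma speed_derivative:
  assumes x: "(x has_vector_derivative v t) (at t within I)" and v: "(v has_vector_derivative - chr g (x t) (v t) (v t)) (at t within I)"
    and xU: "x t \<in> U"
  shows "((\<lambda>s. g (x s) (v s) (v s)) has_vector_derivative 0) (at t within I)"
proof -
  have "dg (x t) (v t) (v t) (v t) + (g (x t) (v t) (- chr g (x t) (v t) (v t)) + g (x t) (- chr g (x t) (v t) (v t)) (v t)) = 0"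
    by (simp add: metric_compatible[OF xU] bilinear_rneg[OF bilinear_g[OF xU]] bilinear_lneg[OF bilinear_g[OF xU]])
  then show ?thesis using G.vector_derivative_family[OF x v v xU] by simp
qed

text \<open>\<open>k\<close> is the coordinate derivative of the Jacobi field \<open>y\<close> and \<open>z\<close> its covariant derivative.\<close>

lemma jacobi_derivatives:
  assumes x: "(x has_vector_derivative v t) (at t within I)" and v: "(v has_vector_derivative - chr g (x t) (v t) (v t)) (at t within I)"
    and y: "(y has_vector_derivative k t) (at t within I)"
    and k: "(k has_vector_derivative - (dchr (x t) (y t) (v t) (v t) + (chr g (x t) (v t) (k t) + chr g (x t) (k t) (v t)))) (at t within I)"
    and xU: "x t \<in> U"
    and K: "g (x t) (curv g (x t) (y t) (v t) (v t)) (y t) \<le> 0"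
  defines "z \<equiv> \<lambda>s. k s + chr g (x s) (v s) (y s)"
  shows "((\<lambda>s. g (x s) (y s) (y s)) has_vector_derivative 2 * g (x t) (z t) (y t)) (at t within I)"
    and "\<exists>h2. ((\<lambda>s. 2 * g (x s) (z s) (y s)) has_vector_derivative h2) (at t within I) \<and>
       (2 * g (x t) (z t) (y t))\<^sup>2 \<le> 2 * g (x t) (y t) (y t) * h2"
proof -
  note rules = bilinear_radd[OF chr_bilinear[OF xU]] bilinear_ladd[OF chr_bilinear[OF xU]] bilinear_rneg[OF chr_bilinear[OF xU]]
     bilinear_lneg[OF chr_bilinear[OF xU]] bilinear_ladd[OF bilinear_g[OF xU]] bilinear_radd[OF bilinear_g[OF xU]]
     bilinear_lneg[OF bilinear_g[OF xU]] bilinear_rneg[OF bilinear_g[OF xU]] bilinear_lsub[OF bilinear_g[OF xU]]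
  have "dg (x t) (v t) (y t) (y t) + (g (x t) (y t) (k t) + g (x t) (k t) (y t)) = 2 * g (x t) (z t) (y t)"
    unfolding metric_compatible[OF xU] z_def rules
    by (simp add: sym[OF xU, of "y t"])
  then show "((\<lambda>s. g (x s) (y s) (y s)) has_vector_derivative 2 * g (x t) (z t) (y t)) (at t within I)"
    using G.vector_derivative_family[OF x y y xU] by simp
  let ?k' = "- (dchr (x t) (y t) (v t) (v t) + (chr g (x t) (v t) (k t) + chr g (x t) (k t) (v t)))"
  let ?z' = "?k' + (dchr (x t) (v t) (v t) (y t) + (chr g (x t) (v t) (k t) + chr g (x t) (- chr g (x t) (v t) (v t)) (y t)))"
  have z': "(z has_vector_derivative ?z') (at t within I)"
    unfolding z_def by (intro has_vector_derivative_add k C.vector_derivative_family x v y xU)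
  have dsym: "dchr (x t) a u w = dchr (x t) a w u" for a u w
  proof -
    have "((\<lambda>q. chr g q w u) has_derivative (\<lambda>a. dchr (x t) a u w)) (at (x t))"
      by (rule has_derivative_transform_within_open[OF C1D_derivative[OF C.dB xU, of u w] open_U xU]) (rule chr_sym)
    from has_derivative_unique[OF this C1D_derivative[OF C.dB xU]] show ?thesis by (rule fun_cong)
  qed
  \<comment> \<open>The Jacobi equation: the second covariant derivative of \<open>y\<close> equals
    \<open>- R(y,v)v\<close>.\<close>
  have cz: "?z' + chr g (x t) (v t) (z t) = - curv g (x t) (y t) (v t) (v t)"
    unfolding z_def curv_dchr rules dsym[of "v t" "v t" "y t"]
    by (simp add: chr_sym[OF xU, of "k t" "v t"] chr_sym[OF xU, of "y t" "v t"] chr_sym[OF xU, of "chr g (x t) (v t) (v t)" "y t"])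
  define h2 where "h2 = 2 * (dg (x t) (v t) (z t) (y t) + (g (x t) (z t) (k t) + g (x t) ?z' (y t)))"
  have "h2 = 2 * (g (x t) (z t) (z t) + g (x t) (?z' + chr g (x t) (v t) (z t)) (y t))"
    unfolding h2_def metric_compatible[OF xU] unfolding bilinear_ladd[OF bilinear_g[OF xU], of ?z']
    unfolding z_def by (simp add: bilinear_radd[OF bilinear_g[OF xU]])
  then have h2: "h2 \<ge> 2 * g (x t) (z t) (z t)"
    using K unfolding cz by (simp add: rules)
  have "((\<lambda>s. 2 * g (x s) (z s) (y s)) has_vector_derivative h2) (at t within I)"
    unfolding h2_def by (intro has_vector_derivative_mult_right G.vector_derivative_family[OF x z' y xU])
  \<comment> \<open>For \<open>h = g y y\<close> this reads
    \<open>h'\<^sup>2 \<le> 2 * h * h''\<close>, which is the condition for \<open>sqrt h\<close> to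
    be convex where it is positive. It follows from Cauchy--Schwarz, since \<open>h''\<close> is at
    least twice the squared norm of \<open>z\<close>.\<close>
  moreover have "(2 * g (x t) (z t) (y t))\<^sup>2 \<le> 2 * g (x t) (y t) (y t) * h2"
  proof -
    have "(2 * g (x t) (z t) (y t))\<^sup>2 = 4 * (g (x t) (z t) (y t))\<^sup>2" by (simp add: power_mult_distrib)
    also have "\<dots> \<le> 4 * (g (x t) (z t) (z t) * g (x t) (y t) (y t))" using cauchy_schwarz[OF xU] by simp
    also have "\<dots> = 2 * g (x t) (y t) (y t) * (2 * g (x t) (z t) (z t))" by simp
    also have "\<dots> \<le> 2 * g (x t) (y t) (y t) * h2" using h2 nonneg[OF xU] by (intro mult_left_mono) auto
    finally show ?thesis .
  qed
  ultimately show "\<exists>h2. ((\<lambda>s. 2 * g (x s) (z s) (y s)) has_vector_derivative h2) (at t within I) \<and>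
       (2 * g (x t) (z t) (y t))\<^sup>2 \<le> 2 * g (x t) (y t) (y t) * h2" by blast
qed

lemma norm_lower_bound:
  assumes K: "compact K" "K \<subseteq> U"
  obtains m where "m > 0" "\<And>p u. p \<in> K \<Longrightarrow> m * norm u \<le> sqrt (g p u u)"
proof (cases "K = {}")
  case False
  let ?S = "K \<times> sphere (0::'e) 1"
  have cont: "continuous_on ?S (\<lambda>(p,u). g p u u)"
  proof -
    have "continuous_on (U \<times> UNIV \<times> UNIV) (\<lambda>(p,u,v). g p u v)" by (rule C1D_continuous[OF G.C1D_joint])
    then have "continuous_on ?S (\<lambda>z. (\<lambda>(p,u,v). g p u v) (fst z, snd z, snd z))"
      by (rule continuous_on_compose2) (use K in \<open>auto intro!: continuous_intros\<close>)
    then show ?thesis by (simp add: case_prod_unfold)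
  qed
  have "compact ?S" "?S \<noteq> {}" using K False by (auto intro: compact_Times)
  then obtain p0 u0 where m: "p0 \<in> K" "norm u0 = 1" "\<And>p u. p \<in> K \<Longrightarrow> norm u = 1 \<Longrightarrow> g p0 u0 u0 \<le> g p u u"
    using continuous_attains_inf[OF _ _ cont] by fastforce
  have "u0 \<noteq> 0" using m(2) by auto
  then have m0: "g p0 u0 u0 > 0" using pos[of p0 u0] m(1) K(2) by blast
  show ?thesis
  proof (rule that[of "sqrt (g p0 u0 u0)"])
    fix p u assume p: "p \<in> K"
    show "sqrt (g p0 u0 u0) * norm u \<le> sqrt (g p u u)"
    proof (cases "u = 0")
      case False
      let ?w = "(1 / norm u) *\<^sub>R u"
      have pU: "p \<in> U" using p K by auto
      have "g p u u = (norm u)\<^sup>2 * g p ?w ?w"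
        using False by (simp add: bilinear_lmul[OF bilinear_g[OF pU]] bilinear_rmul[OF bilinear_g[OF pU]] power2_eq_square)
      moreover have "g p0 u0 u0 \<le> g p ?w ?w" by (rule m(3)) (use p False in auto)
      ultimately have "(norm u)\<^sup>2 * g p0 u0 u0 \<le> g p u u" by (metis mult_left_mono zero_le_power2)
      then have "sqrt ((norm u)\<^sup>2 * g p0 u0 u0) \<le> sqrt (g p u u)" by simp
      then show ?thesis by (simp add: real_sqrt_mult mult.commute)
    qed (use nonneg p K in auto)
  qed (use m0 in simp)
qed (use that[of 1] in auto)

lemma norm_upper_bound:
  assumes K: "compact K" "K \<subseteq> U"
  obtains m where "m > 0" "\<And>p u. p \<in> K \<Longrightarrow> sqrt (g p u u) \<le> m * norm u"
proof (cases "K = {}")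
  case False
  let ?S = "K \<times> sphere (0::'e) 1"
  have cont: "continuous_on ?S (\<lambda>(p,u). g p u u)"
  proof -
    have "continuous_on (U \<times> UNIV \<times> UNIV) (\<lambda>(p,u,v). g p u v)" by (rule C1D_continuous[OF G.C1D_joint])
    then have "continuous_on ?S (\<lambda>z. (\<lambda>(p,u,v). g p u v) (fst z, snd z, snd z))"
      by (rule continuous_on_compose2) (use K in \<open>auto intro!: continuous_intros\<close>)
    then show ?thesis by (simp add: case_prod_unfold)
  qed
  have "compact ?S" "?S \<noteq> {}" using K False by (auto intro: compact_Times)
  then obtain p0 u0 where m: "p0 \<in> K" "norm u0 = 1" "\<And>p u. p \<in> K \<Longrightarrow> norm u = 1 \<Longrightarrow> g p u u \<le> g p0 u0 u0"
    using continuous_attains_sup[OF _ _ cont] by fastforce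
  have "u0 \<noteq> 0" using m(2) by auto
  then have m0: "g p0 u0 u0 > 0" using pos[of p0 u0] m(1) K(2) by blast
  show ?thesis
  proof (rule that[of "sqrt (g p0 u0 u0)"])
    fix p u assume p: "p \<in> K"
    show "sqrt (g p u u) \<le> sqrt (g p0 u0 u0) * norm u"
    proof (cases "u = 0")
      case True
      then show ?thesis using bilinear_lzero[OF bilinear_g, of p] p K by auto
    next
      case False
      let ?w = "(1 / norm u) *\<^sub>R u"
      have pU: "p \<in> U" using p K by auto
      have "g p u u = (norm u)\<^sup>2 * g p ?w ?w"
        using False by (simp add: bilinear_lmul[OF bilinear_g[OF pU]] bilinear_rmul[OF bilinear_g[OF pU]] power2_eq_square)
      moreover have "g p ?w ?w \<le> g p0 u0 u0" by (rule m(3)) (use p False in auto)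
      ultimately have "g p u u \<le> (norm u)\<^sup>2 * g p0 u0 u0" by (metis mult_left_mono zero_le_power2)
      then have "sqrt (g p u u) \<le> sqrt ((norm u)\<^sup>2 * g p0 u0 u0)" by simp
      then show ?thesis by (simp add: real_sqrt_mult mult.commute)
    qed
  qed (use m0 in simp)
qed (use that[of 1] in auto)

end

section \<open>Isometries between coordinate patches\<close>

locale isometry_patch = P: metric_patch U g + P': metric_patch U' g'
  for U U' :: "'e::euclidean_space set" and g g' :: "'e \<Rightarrow> 'e \<Rightarrow> 'e \<Rightarrow> real" +
  fixes A :: "'e set" and \<psi> :: "'e \<Rightarrow> 'e"
  assumes open_A: "open A" and A: "A \<subseteq> U" and im: "p \<in> A \<Longrightarrow> \<psi> p \<in> U'" and smooth_\<psi>: "smooth_on A \<psi>"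
    and iso: "p \<in> A \<Longrightarrow> g' (\<psi> p) (frechet_derivative \<psi> (at p) u) (frechet_derivative \<psi> (at p) v) = g p u v"
begin

definition D :: "'e \<Rightarrow> 'e \<Rightarrow> 'e" where "D p = frechet_derivative \<psi> (at p)"

lemma \<psi>_C1D: "C1D A \<psi> D"
  using C1_on_frechet[OF smooth_on_C1[OF open_A smooth_\<psi>]] by (simp add: D_def[abs_def])

lemma D_C1: "C1_on A (\<lambda>p. D p u)"
  using smooth_on_C1[OF open_A smooth_on_derivative[OF smooth_\<psi>]] by (simp add: D_def)

lemma linear_D: "p \<in> A \<Longrightarrow> linear (D p)"
  by (rule C1D_linear[OF \<psi>_C1D])

text \<open>The dummy scalar argument makes the results on bilinear families applicable to the derivative.\<close>

sublocale DF: bilinear_family A "\<lambda>p u (r::real). r *\<^sub>R D p u"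
proof
  show "bilinear (\<lambda>u (r::real). r *\<^sub>R D p u)" if "p \<in> A" for p
    unfolding bilinear_def using linear_D[OF that]
    by (auto intro!: linearI simp: linear_add linear_scale algebra_simps)
  show "C1_on A (\<lambda>p. r *\<^sub>R D p u)" for u and r :: real
    by (intro C1_on_scaleR C1_on_const D_C1)
qed (rule open_A)

definition D2 :: "'e \<Rightarrow> 'e \<Rightarrow> 'e \<Rightarrow> 'e" where "D2 p a u = DF.dB p a u 1"

lemma D2: "p \<in> A \<Longrightarrow> ((\<lambda>q. D q u) has_derivative (\<lambda>a. D2 p a u)) (at p)"
  using C1D_derivative[OF DF.dB[where u=u and v=1], of p] by (simp add: D2_def)

lemma D2_sym: "p \<in> A \<Longrightarrow> D2 p a u = D2 p u a"
  using second_derivative_symmetric[OF open_A _ C1D_derivative[OF \<psi>_C1D] D2 D2, of p u a] by simp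

lemma iso': "p \<in> A \<Longrightarrow> g' (\<psi> p) (D p u) (D p v) = g p u v"
  using iso by (simp add: D_def)

lemma D_injective: "p \<in> A \<Longrightarrow> D p u = 0 \<Longrightarrow> u = 0"
proof -
  assume p: "p \<in> A" and "D p u = 0"
  then have "g p u u = 0" using iso'[OF p, of u u] bilinear_lzero[OF P'.bilinear_g[OF im[OF p]]] by simp
  then show ?thesis using P.zero_iff A p by auto
qed

lemma D_surj: "p \<in> A \<Longrightarrow> surj (D p)"
  using linear_D D_injective linear_injective_0 linear_injective_imp_surjective by metis

lemma D_bij: "p \<in> A \<Longrightarrow> bij (D p)"
  using linear_D D_injective linear_injective_0 D_surj bij_def by metis

lemma iso_differentiated:
  assumes p: "p \<in> A"
  shows "P'.dg (\<psi> p) (D p a) (D p u) (D p v) + (g' (\<psi> p) (D p u) (D2 p a v) + g' (\<psi> p) (D2 p a u) (D p v)) = P.dg p a u v"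
proof -
  have pU: "p \<in> U" using p A by auto
  have "((\<lambda>q. (\<psi> q, D q u, D q v)) has_derivative (\<lambda>a. (D p a, D2 p a u, D2 p a v))) (at p)"
    by (intro has_derivative_Pair C1D_derivative[OF \<psi>_C1D p] D2 p)
  from has_derivative_compose[OF this C1D_derivative[OF P'.G.C1D_joint, of "(\<psi> p, D p u, D p v)"]] im[OF p]
  have "((\<lambda>q. g' (\<psi> q) (D q u) (D q v)) has_derivative
     (\<lambda>a. P'.dg (\<psi> p) (D p a) (D p u) (D p v) + (g' (\<psi> p) (D p u) (D2 p a v) + g' (\<psi> p) (D2 p a u) (D p v)))) (at p)"
    by simp
  then have "((\<lambda>q. g q u v) has_derivative
     (\<lambda>a. P'.dg (\<psi> p) (D p a) (D p u) (D p v) + (g' (\<psi> p) (D p u) (D2 p a v) + g' (\<psi> p) (D2 p a u) (D p v)))) (at p)"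
    by (rule has_derivative_transform_within_open[OF _ open_A p]) (rule iso')
  from has_derivative_unique[OF this C1D_derivative[OF P.G.dB pU]] show ?thesis by (rule fun_cong)
qed

text \<open>The transformation law of Christoffel symbols with its inhomogeneous term
  \<open>D2\<close>. Three copies of the differentiated isometry relation are combined as in the
  Koszul formula, and the symmetry of \<open>D2\<close> removes the other second
  derivatives.\<close>

lemma chr_transform:
  assumes p: "p \<in> A"
  shows "chr g' (\<psi> p) (D p u) (D p v) + D2 p u v = D p (chr g p u v)"
proof (rule P'.nondegenerate[OF im[OF p]])
  fix w'
  obtain w where w: "w' = D p w" using D_surj[OF p] by (metis surjD)
  have pU: "p \<in> U" using p A by auto
  have "g' (\<psi> p) (D p (chr g p u v)) w' = P.koszul p u v w"
    unfolding w iso'[OF p] by (rule P.chr_koszul[OF pU])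
  also have "\<dots> = P'.koszul (\<psi> p) (D p u) (D p v) (D p w) + g' (\<psi> p) (D2 p u v) (D p w)"
    unfolding P.koszul_def P'.koszul_def iso_differentiated[OF p, symmetric]
    by (simp add: D2_sym[OF p, of v u] D2_sym[OF p, of w u] D2_sym[OF p, of w v] P'.sym[OF im[OF p], of "D p v"]
        P'.sym[OF im[OF p], of "D p u"] field_simps)
  also have "\<dots> = g' (\<psi> p) (chr g' (\<psi> p) (D p u) (D p v) + D2 p u v) w'"
    unfolding w bilinear_ladd[OF P'.bilinear_g[OF im[OF p]]] P'.chr_koszul[OF im[OF p]] ..
  finally show "g' (\<psi> p) (chr g' (\<psi> p) (D p u) (D p v) + D2 p u v) w' = g' (\<psi> p) (D p (chr g p u v)) w'" ..
qed

lemma curve_derivative: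
  assumes x: "(x has_vector_derivative v) (at t within I)" and xA: "x t \<in> A"
  shows "((\<lambda>s. \<psi> (x s)) has_vector_derivative D (x t) v) (at t within I)"
  using has_derivative_compose[OF x[unfolded has_vector_derivative_def] C1D_derivative[OF \<psi>_C1D xA]]
  by (simp add: has_vector_derivative_def linear_scale[OF linear_D[OF xA]])

text \<open>Differentiating \<open>D (x s) (v s)\<close> along the curve produces exactly the second
  derivative term of \<open>chr_transform\<close>, so the image satisfies the geodesic equation of
  \<open>g'\<close>.\<close>

lemma geodesic_transform:
  assumes x: "(x has_vector_derivative v t) (at t within I)" and v: "(v has_vector_derivative - chr g (x t) (v t) (v t)) (at t within I)"
    and xA: "x t \<in> A"
  shows "((\<lambda>s. \<psi> (x s)) has_vector_derivative D (x t) (v t)) (at t within I)"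
    "((\<lambda>s. D (x s) (v s)) has_vector_derivative - chr g' (\<psi> (x t)) (D (x t) (v t)) (D (x t) (v t))) (at t within I)"
proof -
  show "((\<lambda>s. \<psi> (x s)) has_vector_derivative D (x t) (v t)) (at t within I)" by (rule curve_derivative[OF x xA])
  have "((\<lambda>s. 1 *\<^sub>R D (x s) (v s)) has_vector_derivative
     DF.dB (x t) (v t) (v t) 1 + (0 *\<^sub>R D (x t) (v t) + 1 *\<^sub>R D (x t) (- chr g (x t) (v t) (v t)))) (at t within I)"
    using DF.vector_derivative_family[OF x v has_vector_derivative_const[where c="1::real"] xA] by simp
  moreover have "DF.dB (x t) (v t) (v t) 1 + (0 *\<^sub>R D (x t) (v t) + 1 *\<^sub>R D (x t) (- chr g (x t) (v t) (v t)))
    = - chr g' (\<psi> (x t)) (D (x t) (v t)) (D (x t) (v t))"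
    using chr_transform[OF xA, of "v t" "v t"] by (simp add: linear_neg[OF linear_D[OF xA]] D2_def algebra_simps add_eq_0_iff)
  ultimately show "((\<lambda>s. D (x s) (v s)) has_vector_derivative - chr g' (\<psi> (x t)) (D (x t) (v t)) (D (x t) (v t))) (at t within I)"
    by simp
qed

text \<open>The induced map on positions with velocities. It transports smooth dependence on initial
  velocities from one chart to another.\<close>

lemma state_map_C1: "C1_on (A \<times> UNIV) (\<lambda>z. (\<psi> (fst z), D (fst z) (snd z)))"
proof -
  have "C1_on (A \<times> UNIV) (\<lambda>z. 1 *\<^sub>R D (fst z) (snd z))"
    by (rule DF.C1_on_family) (auto intro!: C1_on_linear_map C1_on_const bounded_linear_fst bounded_linear_snd)
  moreover have "C1_on (A \<times> UNIV) (\<lambda>z. \<psi> (fst z))"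
    by (rule C1_on_compose[OF C1_on_linear_map[OF bounded_linear_fst] C1D_C1[OF \<psi>_C1D]]) auto
  ultimately show ?thesis by (intro C1_on_Pair) auto
qed

end

section \<open>Charts and local isometries\<close>

lemma continuous_within_nbhd:
  assumes "continuous (at t within I) \<gamma>" "open W" "\<gamma> t \<in> W"
  obtains d where "d > (0::real)" "\<And>s. s \<in> I \<Longrightarrow> dist s (t::'a::metric_space) < d \<Longrightarrow> \<gamma> s \<in> W"
  using tendsto_imp_ev_within[OF assms] assms(3) unfolding eventually_at by metis

abbreviation chart_im :: "('m, 'e) chart \<Rightarrow> 'e set" where "chart_im c \<equiv> coord c ` chart_dom c"

text \<open>The part of \<open>local_isometry_at\<close> that concerns the map itself. It also
  applies to the identity, so that a change of charts is the case \<open>h = id\<close>.\<close>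

definition local_iso_on ::
    "('m::topological_space, 'e::euclidean_space) riemannian \<Rightarrow>
     ('n::topological_space, 'e) riemannian \<Rightarrow> ('m \<Rightarrow> 'n) \<Rightarrow> 'm set \<Rightarrow> bool" where
  "local_iso_on R R' h V \<longleftrightarrow> open V \<and> smooth_map_on R R' V h \<and>
     (\<forall>y\<in>V. \<forall>c\<in>charts R. \<forall>c'\<in>charts R'. y \<in> chart_dom c \<and> h y \<in> chart_dom c' \<longrightarrow>
        (\<forall>u v. let D = frechet_derivative (coord_rep c c' h) (at (coord c y))
               in metric_at R' c' (coord c' (h y)) (D u) (D v) = metric_at R c (coord c y) u v))"

lemma local_isometry_at_imp_on: "local_isometry_at R R' h x \<Longrightarrow> \<exists>V. x \<in> V \<and> inj_on h V \<and> local_iso_on R R' h V"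
  unfolding local_isometry_at_def local_iso_on_def by blast

locale riem =
  fixes R :: "('m::{t2_space, second_countable_topology}, 'e::euclidean_space) riemannian"
  assumes riemannian: "riemannian_manifold R"
begin

lemma is_chart: "c \<in> charts R \<Longrightarrow> is_chart c"
  using riemannian by (auto simp: riemannian_manifold_def smooth_atlas_def)

lemma chart_open: "c \<in> charts R \<Longrightarrow> open (chart_dom c)" "c \<in> charts R \<Longrightarrow> open (chart_im c)"
  and chart_homeo: "c \<in> charts R \<Longrightarrow> homeomorphism (chart_dom c) (chart_im c) (coord c) (chart_inv c)"
  using is_chart unfolding is_chart_def by auto

lemma chart_inv_coord [simp]: "c \<in> charts R \<Longrightarrow> x \<in> chart_dom c \<Longrightarrow> chart_inv c (coord c x) = x"
  using chart_homeo homeomorphism_apply1 by metis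

lemma coord_chart_inv [simp]: "c \<in> charts R \<Longrightarrow> p \<in> chart_im c \<Longrightarrow> coord c (chart_inv c p) = p"
  using chart_homeo homeomorphism_apply2 by metis

lemma chart_inv_dom: "c \<in> charts R \<Longrightarrow> p \<in> chart_im c \<Longrightarrow> chart_inv c p \<in> chart_dom c"
  by (auto simp del: split_paired_All)

lemma coord_continuous: "c \<in> charts R \<Longrightarrow> continuous_on (chart_dom c) (coord c)"
  and chart_inv_continuous: "c \<in> charts R \<Longrightarrow> continuous_on (chart_im c) (chart_inv c)"
  using chart_homeo homeomorphism_cont1 homeomorphism_cont2 by blast+

lemma chart_exists: "\<exists>c\<in>charts R. x \<in> chart_dom c"
  using riemannian unfolding riemannian_manifold_def smooth_atlas_def by blast

lemma some_chart: "(SOME c. c \<in> charts R \<and> x \<in> chart_dom c) \<in> charts R"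
    "x \<in> chart_dom (SOME c. c \<in> charts R \<and> x \<in> chart_dom c)"
proof -
  obtain c where "c \<in> charts R \<and> x \<in> chart_dom c" using chart_exists by blast
  then have "(SOME c. c \<in> charts R \<and> x \<in> chart_dom c) \<in> charts R \<and> x \<in> chart_dom (SOME c. c \<in> charts R \<and> x \<in> chart_dom c)"
    by (rule someI)
  then show "(SOME c. c \<in> charts R \<and> x \<in> chart_dom c) \<in> charts R"
    "x \<in> chart_dom (SOME c. c \<in> charts R \<and> x \<in> chart_dom c)" by blast+
qed

lemma patch: "c \<in> charts R \<Longrightarrow> metric_patch (chart_im c) (metric_at R c)"
  using riemannian chart_open unfolding riemannian_manifold_def metric_patch_def by blast

lemma local_iso_id: "local_iso_on R R id UNIV"
  using riemannian unfolding local_iso_on_def smooth_map_on_def riemannian_manifold_def smooth_atlas_def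
  by (simp add: continuous_on_id)

end

lemma coord_rep_coord:
  "riem R \<Longrightarrow> c \<in> charts R \<Longrightarrow> y \<in> chart_dom c \<Longrightarrow> coord_rep c c' h (coord c y) = coord c' (h y)"
  by (simp add: coord_rep_def riem.chart_inv_coord)

lemma isometry_patch_charts:
  assumes R: "riem R" and R': "riem R'" and h: "local_iso_on R R' h V" and c: "c \<in> charts R" "c' \<in> charts R'"
  shows "isometry_patch (chart_im c) (chart_im c') (metric_at R c) (metric_at R' c')
    (coord c ` (chart_dom c \<inter> V \<inter> h -` chart_dom c')) (coord_rep c c' h)"
proof -
  interpret R: riem R by (rule R)
  interpret R': riem R' by (rule R')
  let ?A = "coord c ` (chart_dom c \<inter> V \<inter> h -` chart_dom c')"
  have V: "open V" "continuous_on V h" using h by (auto simp: local_iso_on_def smooth_map_on_def)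
  have o: "open (V \<inter> h -` chart_dom c')" using V R'.chart_open[OF c(2)] continuous_open_preimage by blast
  have "?A = chart_im c \<inter> chart_inv c -` (V \<inter> h -` chart_dom c')" using c by auto
  moreover have "open \<dots>" using continuous_open_preimage[OF R.chart_inv_continuous R.chart_open(2) o] c by blast
  ultimately have oA: "open ?A" by simp
  show ?thesis
  proof (intro isometry_patch.intro isometry_patch_axioms.intro)
    show "smooth_on ?A (coord_rep c c' h)" using h c by (auto simp: local_iso_on_def smooth_map_on_def)
    show "coord_rep c c' h p \<in> chart_im c'" if "p \<in> ?A" for p using that coord_rep_coord[OF R c(1), where c'=c' and h=h] by auto
    fix p u v assume "p \<in> ?A"
    then obtain y where y: "y \<in> chart_dom c" "y \<in> V" "h y \<in> chart_dom c'" "p = coord c y" by auto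
    show "metric_at R' c' (coord_rep c c' h p) (frechet_derivative (coord_rep c c' h) (at p) u) (frechet_derivative (coord_rep c c' h) (at p) v) = metric_at R c p u v"
      using h y c unfolding local_iso_on_def Let_def by (simp add: coord_rep_coord[OF R c(1)])
  qed (use R.patch R'.patch c oA in auto)
qed

abbreviation chart_D :: "('m, 'e::euclidean_space) chart \<Rightarrow> ('n, 'e) chart \<Rightarrow> ('m \<Rightarrow> 'n) \<Rightarrow> 'm \<Rightarrow> 'e \<Rightarrow> 'e" where
  "chart_D c c' h y \<equiv> frechet_derivative (coord_rep c c' h) (at (coord c y))"

lemma curve_push:
  fixes R :: "('m::{t2_space, second_countable_topology}, 'e::euclidean_space) riemannian"
    and R' :: "('n::{t2_space, second_countable_topology}, 'e) riemannian"
  assumes R: "riem R" and R': "riem R'" and h: "local_iso_on R R' h V" and c: "c \<in> charts R" "c' \<in> charts R'"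
    and t: "t \<in> I" "\<gamma> t \<in> chart_dom c" "\<gamma> t \<in> V" "h (\<gamma> t) \<in> chart_dom c'"
    and \<gamma>: "continuous (at t within I) \<gamma>" and v: "((coord c \<circ> \<gamma>) has_vector_derivative v) (at t within I)"
  shows "((coord c' \<circ> (h \<circ> \<gamma>)) has_vector_derivative chart_D c c' h (\<gamma> t) v) (at t within I)"
    "metric_at R' c' (coord c' (h (\<gamma> t))) (chart_D c c' h (\<gamma> t) v) (chart_D c c' h (\<gamma> t) v) = metric_at R c (coord c (\<gamma> t)) v v"
proof -
  interpret R: riem R by (rule R)
  interpret R': riem R' by (rule R')
  interpret isometry_patch "chart_im c" "chart_im c'" "metric_at R c" "metric_at R' c'"
    "coord c ` (chart_dom c \<inter> V \<inter> h -` chart_dom c')" "coord_rep c c' h"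
    by (rule isometry_patch_charts[OF R R' h c])
  have tA: "coord c (\<gamma> t) \<in> coord c ` (chart_dom c \<inter> V \<inter> h -` chart_dom c')" using t by auto
  have 1: "((\<lambda>s. coord_rep c c' h ((coord c \<circ> \<gamma>) s)) has_vector_derivative chart_D c c' h (\<gamma> t) v) (at t within I)"
    using curve_derivative[OF v] tA by (simp add: D_def)
  obtain d where d: "d > 0" "\<And>s. s \<in> I \<Longrightarrow> dist s t < d \<Longrightarrow> \<gamma> s \<in> chart_dom c"
    using continuous_within_nbhd[OF \<gamma> R.chart_open(1)[OF c(1)] t(2)] by blast
  show "((coord c' \<circ> (h \<circ> \<gamma>)) has_vector_derivative chart_D c c' h (\<gamma> t) v) (at t within I)"
    by (rule has_vector_derivative_transform_within[OF 1 d(1) t(1)]) (use d(2) coord_rep_coord[OF R c(1), where c'=c' and h=h] in auto)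
  show "metric_at R' c' (coord c' (h (\<gamma> t))) (chart_D c c' h (\<gamma> t) v) (chart_D c c' h (\<gamma> t) v) = metric_at R c (coord c (\<gamma> t)) v v"
    using iso'[OF tA] coord_rep_coord[OF R c(1) t(2), where c'=c' and h=h] by (simp add: D_def)
qed

context riem
begin

lemma curve_change:
  fixes \<gamma> :: "real \<Rightarrow> 'm"
  assumes c: "c \<in> charts R" "c' \<in> charts R"
    and t: "t \<in> I" "\<gamma> t \<in> chart_dom c" "\<gamma> t \<in> chart_dom c'"
    and \<gamma>: "continuous (at t within I) \<gamma>" and v: "((coord c \<circ> \<gamma>) has_vector_derivative v) (at t within I)"
  shows "((coord c' \<circ> \<gamma>) has_vector_derivative chart_D c c' id (\<gamma> t) v) (at t within I)"
    "metric_at R c' (coord c' (\<gamma> t)) (chart_D c c' id (\<gamma> t) v) (chart_D c c' id (\<gamma> t) v) = metric_at R c (coord c (\<gamma> t)) v v"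
  using curve_push[OF riem_axioms riem_axioms local_iso_id c t(1,2) _ _ \<gamma> v] t by auto

end

subsection \<open>Speed and length\<close>

lemma speed_push:
  fixes R :: "('m::{t2_space, second_countable_topology}, 'e::euclidean_space) riemannian"
    and R' :: "('n::{t2_space, second_countable_topology}, 'e) riemannian"
  assumes R: "riem R" and R': "riem R'" and h: "local_iso_on R R' h V" and c: "c \<in> charts R"
    and t: "\<gamma> t \<in> chart_dom c" "\<gamma> t \<in> V"
    and \<gamma>: "isCont \<gamma> t" and v: "((coord c \<circ> \<gamma>) has_vector_derivative v) (at t)"
  shows "speed R' (h \<circ> \<gamma>) t = sqrt (metric_at R c (coord c (\<gamma> t)) v v)"
proof -
  define c' where "c' = (SOME c. c \<in> charts R' \<and> (h \<circ> \<gamma>) t \<in> chart_dom c)"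
  have c': "c' \<in> charts R'" "h (\<gamma> t) \<in> chart_dom c'"
    unfolding c'_def comp_apply by (rule riem.some_chart[OF R'])+
  note p = curve_push[OF R R' h c c'(1) _ t c'(2) \<gamma> v]
  show ?thesis
    unfolding speed_def comp_apply[of h \<gamma> t] c'_def[unfolded comp_apply, symmetric] Let_def
    using vector_derivative_at[OF p(1)] p(2) by simp
qed

context riem
begin

lemma speed_chart:
  assumes c: "c \<in> charts R" and t: "\<gamma> t \<in> chart_dom c"
    and \<gamma>: "isCont \<gamma> t" and v: "((coord c \<circ> \<gamma>) has_vector_derivative v) (at t)"
  shows "speed R \<gamma> t = sqrt (metric_at R c (coord c (\<gamma> t)) v v)"
  using speed_push[OF riem_axioms riem_axioms local_iso_id c t _ \<gamma> v] by simp

lemma metric_nonneg: "c \<in> charts R \<Longrightarrow> x \<in> chart_dom c \<Longrightarrow> metric_at R c (coord c x) v v \<ge> 0"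
  using metric_patch.nonneg[OF patch] by auto

lemma speed_nonneg: "speed R \<gamma> t \<ge> 0"
  unfolding speed_def Let_def using metric_nonneg some_chart by simp

text \<open>\<open>speed\<close> chooses a chart for each time separately. Its values do not depend
  on this choice, and within one chart they vary continuously. The interval is open because
  \<open>speed\<close> takes two-sided derivatives, which may fail to exist at the end
  points.\<close>

lemma C1_curve_speed:
  assumes \<gamma>: "C1_curve_on R a b \<gamma>" and ab: "a < b"
  obtains s where "continuous_on {a..b} s" "\<And>t. t \<in> {a<..<b} \<Longrightarrow> speed R \<gamma> t = s t"
proof -
  have cont: "continuous_on {a..b} \<gamma>" using \<gamma> by (simp add: C1_curve_on_def)
  obtain w where w: "\<And>c. c \<in> charts R \<Longrightarrow> continuous_on ({a..b} \<inter> \<gamma> -` chart_dom c) (w c)"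
    "\<And>c t. c \<in> charts R \<Longrightarrow> t \<in> {a..b} \<Longrightarrow> \<gamma> t \<in> chart_dom c \<Longrightarrow> ((coord c \<circ> \<gamma>) has_vector_derivative w c t) (at t within {a..b})"
    using \<gamma> unfolding C1_curve_on_def by (metis IntI vimageI)
  define C where "C t = (SOME c. c \<in> charts R \<and> \<gamma> t \<in> chart_dom c)" for t
  have C: "C t \<in> charts R" "\<gamma> t \<in> chart_dom (C t)" for t
    unfolding C_def by (rule some_chart)+
  define s where "s t = sqrt (metric_at R (C t) (coord (C t) (\<gamma> t)) (w (C t) t) (w (C t) t))" for t
  have s: "s t = sqrt (metric_at R c (coord c (\<gamma> t)) (w c t) (w c t))"
    if "c \<in> charts R" "t \<in> {a..b}" "\<gamma> t \<in> chart_dom c" for c t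
  proof -
    have cw: "continuous (at t within {a..b}) \<gamma>" using cont that continuous_on_eq_continuous_within by blast
    note k = curve_change[OF that(1) C(1) that(2,3) C(2) cw w(2)[OF that]]
    have "chart_D c (C t) id (\<gamma> t) (w c t) = w (C t) t"
      using vector_derivative_unique_within[OF _ k(1) w(2)[OF C(1) that(2) C(2)]] that(2) ab
      by (simp add: trivial_limit_within islimpt_Icc)
    with k(2) show ?thesis by (simp add: s_def)
  qed
  show ?thesis
  proof (rule that[of s])
    show "continuous_on {a..b} s" unfolding continuous_on_eq_continuous_within
    proof
      fix t assume t: "t \<in> {a..b}"
      let ?J = "{a..b} \<inter> \<gamma> -` chart_dom (C t)"
      interpret P: metric_patch "chart_im (C t)" "metric_at R (C t)" by (rule patch[OF C(1)])
      have op: "openin (top_of_set {a..b}) ?J"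
        using continuous_openin_preimage_gen[OF cont chart_open(1)[OF C(1)]] .
      have "continuous_on ?J (\<lambda>r. (coord (C t) (\<gamma> r), w (C t) r, w (C t) r))"
        by (intro continuous_on_Pair w(1) C continuous_on_compose2[OF coord_continuous[OF C(1), of t]] continuous_on_subset[OF cont]) auto
      from continuous_on_compose2[OF C1D_continuous[OF P.G.C1D_joint] this]
      have "continuous_on ?J (\<lambda>r. metric_at R (C t) (coord (C t) (\<gamma> r)) (w (C t) r) (w (C t) r))" by auto
      then have "continuous_on ?J s"
        by (rule continuous_on_eq[OF continuous_on_real_sqrt]) (use s[OF C(1)[of t]] in auto)
      then have "continuous (at t within ?J) s" using t C by (simp add: continuous_on_eq_continuous_within)
      then show "continuous (at t within {a..b}) s"
      proof -
        obtain S where S: "open S" "?J = {a..b} \<inter> S" using op by (auto simp: openin_open)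
        have "t \<in> S" using S(2) t C(2)[of t] by blast
        then have "at t within ?J = at t within {a..b}" by (rule at_within_nhd[OF _ S(1)]) (use S(2) in blast)
        then show ?thesis using \<open>continuous (at t within ?J) s\<close> by simp
      qed
    qed
    fix t assume t: "t \<in> {a<..<b}"
    then have a: "at t within {a..b} = at t" by (intro at_within_interior) (auto simp: interior_atLeastAtMost_real)
    have tab: "t \<in> {a..b}" using t by auto
    have "isCont \<gamma> t" using cont tab a unfolding continuous_on_eq_continuous_within by metis
    then show "speed R \<gamma> t = s t"
      unfolding s_def using w(2)[OF C(1)[of t] tab C(2)[of t]] unfolding a
      by (rule speed_chart[where c="C t" and \<gamma>=\<gamma> and t=t, OF C(1) C(2)])
  qed
qed

lemma C1_curve_speed_integrable:
  assumes "C1_curve_on R a b \<gamma>" "a < b"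
  shows "speed R \<gamma> integrable_on {a..b}"
proof -
  obtain s where s: "continuous_on {a..b} s" "\<And>t. t \<in> {a<..<b} \<Longrightarrow> speed R \<gamma> t = s t"
    using C1_curve_speed[OF assms] by blast
  show ?thesis
    by (rule integrable_spike_finite[of "{a,b}", OF _ _ integrable_continuous_real[OF s(1)]]) (use s(2) in auto)
qed

end

lemma piecewise_induct:
  fixes a b :: real
  assumes P: "finite P" and base: "\<And>a b. a \<in> P \<Longrightarrow> b \<in> P \<Longrightarrow> a < b \<Longrightarrow> P \<inter> {a<..<b} = {} \<Longrightarrow> Q a b"
    and step: "\<And>a m b. a < m \<Longrightarrow> m < b \<Longrightarrow> Q a m \<Longrightarrow> Q m b \<Longrightarrow> Q a b"
    and ab: "a \<in> P" "b \<in> P" "a < b"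
  shows "Q a b"
  using ab
proof (induction "card (P \<inter> {a<..<b})" arbitrary: a b rule: less_induct)
  case less
  show ?case
  proof (cases "P \<inter> {a<..<b} = {}")
    case False
    then obtain m where m: "m \<in> P" "a < m" "m < b" by auto
    have "P \<inter> {a<..<m} \<subset> P \<inter> {a<..<b}" "P \<inter> {m<..<b} \<subset> P \<inter> {a<..<b}" using m by auto
    then have "card (P \<inter> {a<..<m}) < card (P \<inter> {a<..<b})" "card (P \<inter> {m<..<b}) < card (P \<inter> {a<..<b})"
      using P by (meson finite_Int psubset_card_mono)+
    then show ?thesis using step[OF m(2,3)] less m by auto
  qed (use base less in auto)
qed

section \<open>Piecewise continuously differentiable curves and their lengths\<close>

definition pw :: "('m::topological_space, 'e::euclidean_space) riemannian \<Rightarrow> real \<Rightarrow> real \<Rightarrow> (real \<Rightarrow> 'm) \<Rightarrow> bool" where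
  "pw R a b \<gamma> \<longleftrightarrow> (\<exists>P. finite P \<and> {a, b} \<subseteq> P \<and> P \<subseteq> {a..b} \<and>
     (\<forall>a\<in>P. \<forall>b\<in>P. a < b \<and> P \<inter> {a<..<b} = {} \<longrightarrow> C1_curve_on R a b \<gamma>))"

lemma pw_01: "pw R 0 1 = piecewise_C1_curve R"
  unfolding pw_def piecewise_C1_curve_def by simp

lemma C1_curve_restrict:
  assumes "C1_curve_on R a b \<gamma>" "a \<le> a'" "b' \<le> b"
  shows "C1_curve_on R a' b' \<gamma>"
  unfolding C1_curve_on_def
proof (intro conjI ballI)
  have sub: "{a'..b'} \<subseteq> {a..b}" using assms by auto
  show "continuous_on {a'..b'} \<gamma>" using assms(1) sub continuous_on_subset unfolding C1_curve_on_def by blast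
  fix c assume "c \<in> charts R"
  then obtain v where v: "continuous_on ({a..b} \<inter> \<gamma> -` chart_dom c) v"
        "\<forall>t\<in>{a..b} \<inter> \<gamma> -` chart_dom c. ((coord c \<circ> \<gamma>) has_vector_derivative v t) (at t within {a..b})"
    using assms(1) unfolding C1_curve_on_def by blast
  show "\<exists>v. continuous_on ({a'..b'} \<inter> \<gamma> -` chart_dom c) v \<and>
        (\<forall>t\<in>{a'..b'} \<inter> \<gamma> -` chart_dom c. ((coord c \<circ> \<gamma>) has_vector_derivative v t) (at t within {a'..b'}))"
  proof (intro exI[of _ v] conjI ballI)
    show "continuous_on ({a'..b'} \<inter> \<gamma> -` chart_dom c) v"
      by (rule continuous_on_subset[OF v(1)]) (use sub in auto)
    show "((coord c \<circ> \<gamma>) has_vector_derivative v t) (at t within {a'..b'})" if "t \<in> {a'..b'} \<inter> \<gamma> -` chart_dom c" for t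
      using has_vector_derivative_within_subset[OF _ sub] v(2) that sub by blast
  qed
qed

text \<open>With \<open>m = 1\<close> and \<open>k = 0\<close> this allows to change the curve outside of the interval.\<close>

lemma C1_curve_affine:
  assumes \<gamma>: "C1_curve_on R a b \<gamma>" and m: "\<And>t. t \<in> {a'..b'} \<Longrightarrow> m * t + k \<in> {a..b}"
    and eq: "\<And>t. t \<in> {a'..b'} \<Longrightarrow> \<delta> t = \<gamma> (m * t + k)"
  shows "C1_curve_on R a' b' \<delta>"
  unfolding C1_curve_on_def
proof (intro conjI ballI)
  have "continuous_on {a'..b'} (\<lambda>t. \<gamma> (m * t + k))"
    by (rule continuous_on_compose2[of "{a..b}" \<gamma>]) (use \<gamma> m in \<open>auto simp: C1_curve_on_def intro!: continuous_intros\<close>)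
  then show "continuous_on {a'..b'} \<delta>" by (rule continuous_on_eq) (use eq in auto)
  fix c assume "c \<in> charts R"
  then obtain v where v: "continuous_on ({a..b} \<inter> \<gamma> -` chart_dom c) v"
        "\<forall>t\<in>{a..b} \<inter> \<gamma> -` chart_dom c. ((coord c \<circ> \<gamma>) has_vector_derivative v t) (at t within {a..b})"
    using \<gamma> unfolding C1_curve_on_def by blast
  show "\<exists>v. continuous_on ({a'..b'} \<inter> \<delta> -` chart_dom c) v \<and>
        (\<forall>t\<in>{a'..b'} \<inter> \<delta> -` chart_dom c. ((coord c \<circ> \<delta>) has_vector_derivative v t) (at t within {a'..b'}))"
  proof (intro exI[of _ "\<lambda>t. m *\<^sub>R v (m * t + k)"] conjI ballI)
    show "continuous_on ({a'..b'} \<inter> \<delta> -` chart_dom c) (\<lambda>t. m *\<^sub>R v (m * t + k))"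
      by (intro continuous_on_scaleR continuous_on_const continuous_on_compose2[OF v(1)])
         (use m eq in \<open>auto intro!: continuous_intros\<close>)
    fix t assume t: "t \<in> {a'..b'} \<inter> \<delta> -` chart_dom c"
    have "((\<lambda>t. m * t + k) has_vector_derivative m) (at t within {a'..b'})"
      by (auto intro!: derivative_eq_intros)
    moreover have "((coord c \<circ> \<gamma>) has_vector_derivative v (m * t + k)) (at (m * t + k) within (\<lambda>t. m * t + k) ` {a'..b'})"
      by (rule has_vector_derivative_within_subset[OF v(2)[rule_format]]) (use t m eq in auto)
    ultimately have "(((coord c \<circ> \<gamma>) \<circ> (\<lambda>t. m * t + k)) has_vector_derivative m *\<^sub>R v (m * t + k)) (at t within {a'..b'})"
      by (rule vector_diff_chain_within)
    then show "((coord c \<circ> \<delta>) has_vector_derivative m *\<^sub>R v (m * t + k)) (at t within {a'..b'})"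
      by (rule has_vector_derivative_transform[rotated 2]) (use t eq in auto)
  qed
qed

lemma pw_le: "pw R a b \<gamma> \<Longrightarrow> a \<le> b"
  unfolding pw_def by auto

definition partition :: "('m::topological_space, 'e::euclidean_space) riemannian \<Rightarrow> real \<Rightarrow> real \<Rightarrow> (real \<Rightarrow> 'm) \<Rightarrow> real set \<Rightarrow> bool" where
  "partition R a b \<gamma> P \<longleftrightarrow> finite P \<and> {a, b} \<subseteq> P \<and> P \<subseteq> {a..b} \<and>
     (\<forall>a\<in>P. \<forall>b\<in>P. a < b \<and> P \<inter> {a<..<b} = {} \<longrightarrow> C1_curve_on R a b \<gamma>)"

lemma pw_iff_partition: "pw R a b \<gamma> \<longleftrightarrow> (\<exists>P. partition R a b \<gamma> P)"
  by (simp add: pw_def partition_def)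

lemma partitionD:
  assumes "partition R a b \<gamma> P"
  shows "finite P" "{a,b} \<subseteq> P" "P \<subseteq> {a..b}"
    "\<And>s t. s \<in> P \<Longrightarrow> t \<in> P \<Longrightarrow> s < t \<Longrightarrow> P \<inter> {s<..<t} = {} \<Longrightarrow> C1_curve_on R s t \<gamma>"
  using assms unfolding partition_def by blast+

lemma pw_with:
  assumes "pw R a b \<gamma>" "finite T" "T \<subseteq> {a..b}"
  obtains P where "partition R a b \<gamma> P" "T \<subseteq> P"
proof -
  obtain P where pP: "partition R a b \<gamma> P" using assms(1) unfolding pw_iff_partition by blast
  note P = partitionD[OF pP]
  show ?thesis
  proof (rule that[of "P \<union> T"], unfold partition_def, intro conjI ballI impI)
    fix s t assume "s \<in> P \<union> T" "t \<in> P \<union> T" "s < t \<and> (P \<union> T) \<inter> {s<..<t} = {}"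
    then have st: "s \<in> P \<union> T" "t \<in> P \<union> T" "s < t" "(P \<union> T) \<inter> {s<..<t} = {}" by auto
    have ab: "a \<le> s" "t \<le> b" using st P assms(3) by auto
    \<comment> \<open>\<open>s'\<close> and \<open>t'\<close> delimit the cell of the old partition
      that contains the given cell of the refined one.\<close>
    define s' where "s' = Max {p\<in>P. p \<le> s}"
    define t' where "t' = Min {p\<in>P. p \<ge> t}"
    have fs: "finite {p\<in>P. p \<le> s}" "{p\<in>P. p \<le> s} \<noteq> {}" "finite {p\<in>P. p \<ge> t}" "{p\<in>P. p \<ge> t} \<noteq> {}"
      using P ab by auto
    have s': "s' \<in> P" "s' \<le> s" "\<And>p. p \<in> P \<Longrightarrow> p \<le> s \<Longrightarrow> p \<le> s'"
      using Max_in[OF fs(1,2)] Max_ge[OF fs(1)] by (auto simp: s'_def)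
    have t': "t' \<in> P" "t \<le> t'" "\<And>p. p \<in> P \<Longrightarrow> t \<le> p \<Longrightarrow> t' \<le> p"
      using Min_in[OF fs(3,4)] Min_le[OF fs(3)] by (auto simp: t'_def)
    have "P \<inter> {s'<..<t'} = {}"
    proof (rule ccontr)
      assume "P \<inter> {s'<..<t'} \<noteq> {}"
      then obtain p where p: "p \<in> P" "s' < p" "p < t'" by auto
      then have "s < p" "p < t" using s'(3)[of p] t'(3)[of p] by (meson not_le)+
      then show False using st(4) p by auto
    qed
    then have "C1_curve_on R s' t' \<gamma>" using P(4)[OF s'(1) t'(1)] s' t' st by auto
    then show "C1_curve_on R s t \<gamma>" by (rule C1_curve_restrict) (use s' t' in auto)
  qed (use P assms in auto)
qed

lemma pw_induct:
  assumes \<gamma>: "pw R a b \<gamma>" and st: "a \<le> s" "s < t" "t \<le> b"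
    and base: "\<And>s t. a \<le> s \<Longrightarrow> s < t \<Longrightarrow> t \<le> b \<Longrightarrow> C1_curve_on R s t \<gamma> \<Longrightarrow> Q s t"
    and step: "\<And>s m t. s < m \<Longrightarrow> m < t \<Longrightarrow> Q s m \<Longrightarrow> Q m t \<Longrightarrow> Q s t"
  shows "Q s t"
proof -
  obtain P where pP: "partition R a b \<gamma> P" "{s,t} \<subseteq> P"
    using pw_with[OF \<gamma>, of "{s,t}"] st by auto
  note P = partitionD[OF pP(1)]
  show ?thesis
    by (rule piecewise_induct[OF P(1), of Q]) (use P pP(2) st base step in \<open>auto simp: subset_iff\<close>)
qed

lemma pw_restrict:
  assumes \<gamma>: "pw R a b \<gamma>" and st: "a \<le> s" "s \<le> t" "t \<le> b"
  shows "pw R s t \<gamma>"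
proof -
  obtain P where pP: "partition R a b \<gamma> P" "{s,t} \<subseteq> P"
    using pw_with[OF \<gamma>, of "{s,t}"] st by auto
  note P = partitionD[OF pP(1)]
  show ?thesis unfolding pw_def
  proof (intro exI[of _ "P \<inter> {s..t}"] conjI ballI impI)
    fix u v assume uv: "u \<in> P \<inter> {s..t}" "v \<in> P \<inter> {s..t}" "u < v \<and> P \<inter> {s..t} \<inter> {u<..<v} = {}"
    then have "P \<inter> {u<..<v} = {}" by fastforce
    then show "C1_curve_on R u v \<gamma>" using P(4) uv by auto
  qed (use P pP(2) st in auto)
qed

lemma C1_imp_pw: "C1_curve_on R a b \<gamma> \<Longrightarrow> a \<le> b \<Longrightarrow> pw R a b \<gamma>"
  unfolding pw_def by (intro exI[of _ "{a,b}"]) auto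

lemma pw_continuous:
  assumes "pw R a b \<gamma>" shows "continuous_on {a..b} \<gamma>"
proof (cases "a < b")
  case True
  show ?thesis
  proof (rule pw_induct[OF assms order_refl True order_refl, of "\<lambda>s t. continuous_on {s..t} \<gamma>"])
    show "continuous_on {s..t} \<gamma>" if "s < m" "m < t" "continuous_on {s..m} \<gamma>" "continuous_on {m..t} \<gamma>" for s m t
    proof -
      have "{s..t} = {s..m} \<union> {m..t}" using that by auto
      then show ?thesis using continuous_on_closed_Un[OF _ _ that(3,4)] by simp
    qed
  qed (auto simp: C1_curve_on_def)
qed (use pw_le[OF assms] in auto)

definition diff_at :: "('m::{t2_space, second_countable_topology}, 'e::euclidean_space) riemannian \<Rightarrow> (real \<Rightarrow> 'm) \<Rightarrow> real \<Rightarrow> bool" where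
  "diff_at R \<gamma> t \<longleftrightarrow> isCont \<gamma> t \<and> (\<forall>c\<in>charts R. \<gamma> t \<in> chart_dom c \<longrightarrow> (\<exists>v. ((coord c \<circ> \<gamma>) has_vector_derivative v) (at t)))"

lemma C1_curve_diff_at:
  assumes \<gamma>: "C1_curve_on R a b \<gamma>" and t: "t \<in> {a<..<b}"
  shows "diff_at R \<gamma> t"
proof -
  have a: "at t within {a..b} = at t" using t by (intro at_within_interior) (auto simp: interior_atLeastAtMost_real)
  have tab: "t \<in> {a..b}" using t by auto
  have "continuous (at t within {a..b}) \<gamma>"
    using \<gamma> tab unfolding C1_curve_on_def continuous_on_eq_continuous_within by blast
  moreover have "\<exists>v. ((coord c \<circ> \<gamma>) has_vector_derivative v) (at t within {a..b})" if "c \<in> charts R" "\<gamma> t \<in> chart_dom c" for c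
    using \<gamma> tab that unfolding C1_curve_on_def by blast
  ultimately show ?thesis unfolding diff_at_def a by blast
qed

lemma pw_diff_at:
  assumes \<gamma>: "pw R a b \<gamma>"
  obtains P where "finite P" "\<And>t. t \<in> {a..b} - P \<Longrightarrow> diff_at R \<gamma> t"
proof -
  have "\<exists>P. finite P \<and> (\<forall>t\<in>{a..b} - P. diff_at R \<gamma> t)"
  proof (cases "a < b")
    case True
    show ?thesis
    proof (rule pw_induct[OF \<gamma> order_refl True order_refl, of "\<lambda>s t. \<exists>P. finite P \<and> (\<forall>t\<in>{s..t} - P. diff_at R \<gamma> t)"])
      fix s t assume c: "C1_curve_on R s t \<gamma>"
      have "diff_at R \<gamma> u" if "u \<in> {s..t} - {s,t}" for u
        by (rule C1_curve_diff_at[OF c]) (use that in auto)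
      then show "\<exists>P. finite P \<and> (\<forall>t\<in>{s..t} - P. diff_at R \<gamma> t)"
        by (intro exI[of _ "{s,t}"]) auto
    next
      fix s m t :: real assume "s < m" "m < t" "\<exists>P. finite P \<and> (\<forall>t\<in>{s..m} - P. diff_at R \<gamma> t)" "\<exists>P. finite P \<and> (\<forall>t\<in>{m..t} - P. diff_at R \<gamma> t)"
      then obtain P Q where PQ: "finite P" "\<And>u. u \<in> {s..m} - P \<Longrightarrow> diff_at R \<gamma> u" "finite Q" "\<And>u. u \<in> {m..t} - Q \<Longrightarrow> diff_at R \<gamma> u" by blast
      have "diff_at R \<gamma> u" if "u \<in> {s..t} - (P \<union> Q)" for u
        using PQ(2)[of u] PQ(4)[of u] that by (cases "u \<le> m") auto
      then show "\<exists>P. finite P \<and> (\<forall>t\<in>{s..t} - P. diff_at R \<gamma> t)" using PQ(1,3) by (intro exI[of _ "P \<union> Q"]) auto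
    qed
  next
    case False
    then show ?thesis by (intro exI[of _ "{a..b}"]) (cases "a = b"; auto)
  qed
  then show ?thesis using that by blast
qed

context riem
begin

lemma diff_at_speed:
  assumes "diff_at R \<gamma> t"
  obtains c v where "c \<in> charts R" "\<gamma> t \<in> chart_dom c" "((coord c \<circ> \<gamma>) has_vector_derivative v) (at t)"
    "speed R \<gamma> t = sqrt (metric_at R c (coord c (\<gamma> t)) v v)"
  using assms chart_exists[of "\<gamma> t"] speed_chart unfolding diff_at_def by meson

lemma pw_integrable:
  assumes \<gamma>: "pw R a b \<gamma>" shows "speed R \<gamma> integrable_on {a..b}"
proof (cases "a < b")
  case True
  show ?thesis
  proof (rule pw_induct[OF \<gamma> order_refl True order_refl, of "\<lambda>s t. speed R \<gamma> integrable_on {s..t}"])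
    show "speed R \<gamma> integrable_on {s..t}" if "s < m" "m < t" "speed R \<gamma> integrable_on {s..m}" "speed R \<gamma> integrable_on {m..t}" for s m t
      using Henstock_Kurzweil_Integration.integrable_combine[OF _ _ that(3,4)] that by auto
  qed (use C1_curve_speed_integrable in auto)
next
  case False
  then show ?thesis using pw_le[OF \<gamma>] integrable_on_refl[of "speed R \<gamma>" b] by auto
qed

text \<open>The fundamental theorem of calculus on each piece. It bounds lengths from below by the
  growth of a function along the curve: a coordinate in \<open>exit_length\<close>, a linear
  function of the preimage under \<open>E\<close> in \<open>E_expands\<close>.\<close>

lemma pw_bound:
  assumes \<gamma>: "pw R a b \<gamma>" and C: "C \<ge> 0" and \<phi>: "continuous_on {a..b} \<phi>"
    and d: "\<And>t. t \<in> {a<..<b} \<Longrightarrow> diff_at R \<gamma> t \<Longrightarrow> \<exists>\<phi>'. (\<phi> has_real_derivative \<phi>') (at t) \<and> \<phi>' \<le> C * speed R \<gamma> t"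
  shows "\<phi> b - \<phi> a \<le> C * integral {a..b} (speed R \<gamma>)"
proof (cases "a < b")
  case True
  show ?thesis
  proof (rule pw_induct[OF \<gamma> order_refl True order_refl, of "\<lambda>s t. speed R \<gamma> integrable_on {s..t} \<and> \<phi> t - \<phi> s \<le> C * integral {s..t} (speed R \<gamma>)", THEN conjunct2])
    fix s t assume st: "a \<le> s" "s < t" "t \<le> b" and c: "C1_curve_on R s t \<gamma>"
    obtain \<phi>' where \<phi>': "\<And>u. u \<in> {s<..<t} \<Longrightarrow> (\<phi> has_real_derivative \<phi>' u) (at u) \<and> \<phi>' u \<le> C * speed R \<gamma> u"
      using d C1_curve_diff_at[OF c] st by (metis greaterThanLessThan_iff le_less_trans less_le_trans)
    define f where "f u = (if u \<in> {s<..<t} then \<phi>' u else 0)" for u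
    have "(f has_integral \<phi> t - \<phi> s) {s..t}"
    proof (rule fundamental_theorem_of_calculus_interior)
      show "continuous_on {s..t} \<phi>" using \<phi> st continuous_on_subset by (metis atLeastatMost_subset_iff)
      show "(\<phi> has_vector_derivative f u) (at u)" if "u \<in> {s<..<t}" for u
        using \<phi>'[OF that] that by (simp add: f_def has_real_derivative_iff_has_vector_derivative)
    qed (use st in auto)
    moreover have i: "speed R \<gamma> integrable_on {s..t}" using C1_curve_speed_integrable[OF c st(2)] .
    moreover have "((\<lambda>u. C * speed R \<gamma> u) has_integral C * integral {s..t} (speed R \<gamma>)) {s..t}"
      using i by (intro has_integral_mult_right) (simp add: integrable_integral)
    moreover have "f u \<le> C * speed R \<gamma> u" for u using \<phi>' C speed_nonneg by (auto simp: f_def)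
    ultimately show "speed R \<gamma> integrable_on {s..t} \<and> \<phi> t - \<phi> s \<le> C * integral {s..t} (speed R \<gamma>)"
      using has_integral_le by blast
  next
    fix s m t assume st: "s < m" "m < t" and 1: "speed R \<gamma> integrable_on {s..m} \<and> \<phi> m - \<phi> s \<le> C * integral {s..m} (speed R \<gamma>)"
      and 2: "speed R \<gamma> integrable_on {m..t} \<and> \<phi> t - \<phi> m \<le> C * integral {m..t} (speed R \<gamma>)"
    have i: "speed R \<gamma> integrable_on {s..t}" using Henstock_Kurzweil_Integration.integrable_combine[where a=s and c=m and b=t] st 1 2 by auto
    have "integral {s..t} (speed R \<gamma>) = integral {s..m} (speed R \<gamma>) + integral {m..t} (speed R \<gamma>)"
      by (rule Henstock_Kurzweil_Integration.integral_combine[symmetric]) (use st i in auto)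
    then show "speed R \<gamma> integrable_on {s..t} \<and> \<phi> t - \<phi> s \<le> C * integral {s..t} (speed R \<gamma>)"
      using 1 2 i by (auto simp: distrib_left)
  qed
next
  case False
  then show ?thesis using pw_le[OF \<gamma>] C by auto
qed

lemma integral_speed_le:
  assumes \<gamma>: "pw R a b \<gamma>" and B: "B \<ge> 0" and sp: "\<And>t. t \<in> {a<..<b} \<Longrightarrow> diff_at R \<gamma> t \<Longrightarrow> speed R \<gamma> t \<le> B"
  shows "integral {a..b} (speed R \<gamma>) \<le> B * (b - a)"
proof -
  obtain P where P: "finite P" "\<And>t. t \<in> {a..b} - P \<Longrightarrow> diff_at R \<gamma> t" using pw_diff_at[OF \<gamma>] by blast
  define f where "f t = (if t \<in> P \<union> {a,b} then 0 else speed R \<gamma> t)" for t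
  have "(f has_integral integral {a..b} (speed R \<gamma>)) {a..b}"
    by (rule has_integral_spike_finite[of "P \<union> {a,b}" _ _ "speed R \<gamma>"])
       (use P pw_integrable[OF \<gamma>] in \<open>auto simp: f_def integrable_integral\<close>)
  moreover have "((\<lambda>t. B) has_integral B * (b - a)) {a..b}"
    using has_integral_const_real[of B a b] pw_le[OF \<gamma>] by (simp add: mult.commute)
  moreover have "f t \<le> B" if "t \<in> {a..b}" for t
    using that P(2)[of t] sp[of t] B by (auto simp: f_def)
  ultimately show ?thesis using has_integral_le by blast
qed

lemma diff_at_speed_affine:
  assumes "diff_at R \<gamma> (m * t + k)" and eq: "open W" "t \<in> W" "\<And>s. s \<in> W \<Longrightarrow> \<delta> s = \<gamma> (m * s + k)"
  shows "speed R \<delta> t = \<bar>m\<bar> * speed R \<gamma> (m * t + k)"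
proof -
  obtain c v where c: "c \<in> charts R" "\<gamma> (m * t + k) \<in> chart_dom c" "((coord c \<circ> \<gamma>) has_vector_derivative v) (at (m * t + k))"
    "speed R \<gamma> (m * t + k) = sqrt (metric_at R c (coord c (\<gamma> (m * t + k))) v v)"
    using diff_at_speed[OF assms(1)] .
  interpret P: metric_patch "chart_im c" "metric_at R c" by (rule patch[OF c(1)])
  have 1: "((\<lambda>t. m * t + k) has_vector_derivative m) (at t)"
    by (auto intro!: derivative_eq_intros)
  have "(((coord c \<circ> \<gamma>) \<circ> (\<lambda>t. m * t + k)) has_vector_derivative m *\<^sub>R v) (at t)"
    using vector_diff_chain_at[OF 1 c(3)] .
  then have d: "((coord c \<circ> \<delta>) has_vector_derivative m *\<^sub>R v) (at t)"
    by (rule has_vector_derivative_transform_within_open[OF _ eq(1,2)]) (use eq(3) in auto)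
  have "isCont \<gamma> (m * t + k)" using assms(1) by (simp add: diff_at_def)
  moreover have "isCont (\<lambda>s. m * s + k) t" by (intro continuous_intros)
  ultimately have "isCont (\<lambda>s. \<gamma> (m * s + k)) t" by (rule isCont_o2[rotated])
  moreover have ev: "\<forall>\<^sub>F s in nhds t. \<gamma> (m * s + k) = \<delta> s"
    unfolding eventually_nhds using eq by (intro exI[of _ W]) auto
  ultimately have ct: "isCont \<delta> t" using isCont_cong[OF ev] by simp
  have im: "coord c (\<delta> t) \<in> chart_im c" using c(2) eq by auto
  have "speed R \<delta> t = sqrt (metric_at R c (coord c (\<delta> t)) (m *\<^sub>R v) (m *\<^sub>R v))"
    by (rule speed_chart[OF c(1) _ ct d]) (use c eq in auto)
  also have "\<dots> = sqrt (m\<^sup>2 * metric_at R c (coord c (\<delta> t)) v v)"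
    by (simp add: bilinear_lmul[OF P.bilinear_g[OF im]] bilinear_rmul[OF P.bilinear_g[OF im]] power2_eq_square)
  finally show ?thesis using c(4) eq by (simp add: real_sqrt_mult)
qed

text \<open>The factor \<open>m\<close> may be negative, which includes the reversal of curves; the
  end points are then exchanged.\<close>

lemma pw_affine:
  assumes \<gamma>: "pw R a b \<gamma>" and m: "m \<noteq> 0" and ab': "a' \<le> b'" and im: "(\<lambda>t. m * t + k) ` {a'..b'} = {a..b}"
    and eq: "\<And>t. t \<in> {a'..b'} \<Longrightarrow> \<delta> t = \<gamma> (m * t + k)"
  shows "pw R a' b' \<delta>" "integral {a'..b'} (speed R \<delta>) = integral {a..b} (speed R \<gamma>)"
proof -
  obtain P where pP: "partition R a b \<gamma> P" using \<gamma> unfolding pw_iff_partition by blast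
  note P = partitionD[OF pP]
  define g where "g = (\<lambda>t. m * t + k)"
  have inj: "inj g" using m by (auto simp: inj_def g_def)
  have ends: "{g a', g b'} = {a, b}"
  proof (cases "m > 0")
    case True
    then have "{a..b} = {g a'..g b'}" using image_affinity_atLeastAtMost[of m k a' b'] im ab' by (auto simp: g_def)
    moreover have "g a' \<le> g b'" using True ab' by (simp add: g_def)
    ultimately show ?thesis using pw_le[OF \<gamma>] by (auto simp: Icc_eq_Icc)
  next
    case False
    then have "{a..b} = {g b'..g a'}" using image_affinity_atLeastAtMost[of m k a' b'] im ab' m by (auto simp: g_def)
    moreover have "g b' \<le> g a'" using False ab' by (simp add: g_def mult_left_mono_neg)
    ultimately show ?thesis using pw_le[OF \<gamma>] by (auto simp: Icc_eq_Icc)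
  qed
  define P' where "P' = {a'..b'} \<inter> g -` P"
  have fP': "finite P'" unfolding P'_def by (intro finite_Int disjI2 finite_vimageI P(1) inj)
  show pw: "pw R a' b' \<delta>" unfolding pw_def
  proof (intro exI[of _ P'] conjI ballI impI)
    show "{a',b'} \<subseteq> P'" using ends P(2) ab' by (auto simp: P'_def)
    fix s t assume st: "s \<in> P'" "t \<in> P'" "s < t \<and> P' \<inter> {s<..<t} = {}"
    define s1 where "s1 = min (g s) (g t)"
    define t1 where "t1 = max (g s) (g t)"
    have "g s \<noteq> g t" using st inj by (metis injD less_irrefl)
    then have 1: "s1 \<in> P" "t1 \<in> P" "s1 < t1" using st by (auto simp: s1_def t1_def P'_def min_def max_def)
    have img: "g r \<in> {s1..t1}" if "r \<in> {s..t}" for r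
      using that m by (cases "m > 0") (auto simp: s1_def t1_def g_def min_le_iff_disj le_max_iff_disj mult_left_mono mult_left_mono_neg)
    have "P \<inter> {s1<..<t1} = {}"
    proof (rule ccontr)
      assume "P \<inter> {s1<..<t1} \<noteq> {}"
      then obtain p where p: "p \<in> P" "s1 < p" "p < t1" by auto
      define r where "r = (p - k) / m"
      have gr: "g r = p" using m by (simp add: r_def g_def)
      have "s < r \<and> r < t"
      proof (cases "m > 0")
        case True
        then have "s1 = g s" "t1 = g t" using st by (auto simp: s1_def t1_def g_def)
        then show ?thesis using p True unfolding gr[symmetric] g_def by auto
      next
        case False
        then have mn: "m < 0" using m by auto
        then have "s1 = g t" "t1 = g s" using st by (auto simp: s1_def t1_def g_def min_def max_def)
        then show ?thesis using p mn unfolding gr[symmetric] g_def by auto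
      qed
      moreover have "r \<in> P'" using calculation st p(1) gr by (auto simp: P'_def)
      ultimately show False using st by auto
    qed
    then have "C1_curve_on R s1 t1 \<gamma>" using P(4) 1 by auto
    then show "C1_curve_on R s t \<delta>"
      by (rule C1_curve_affine[where m=m and k=k]) (use img eq st in \<open>auto simp: g_def P'_def\<close>)
  qed (use fP' in \<open>auto simp: P'_def\<close>)
  obtain Q where Q: "finite Q" "\<And>t. t \<in> {a..b} - Q \<Longrightarrow> diff_at R \<gamma> t" using pw_diff_at[OF \<gamma>] by blast
  have "(speed R \<gamma> has_integral integral {a..b} (speed R \<gamma>)) (cbox a b)"
    using pw_integrable[OF \<gamma>] by (simp add: integrable_integral)
  from has_integral_affinity[OF this m, of k]
  have "((\<lambda>x. speed R \<gamma> (m * x + k)) has_integral (1 / \<bar>m\<bar>) * integral {a..b} (speed R \<gamma>)) ((\<lambda>x. (1 / m) * x + - ((1 / m) * k)) ` {a..b})"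
    by simp
  moreover have "(\<lambda>x. (1 / m) * x + - ((1 / m) * k)) ` {a..b} = {a'..b'}"
    unfolding im[symmetric] image_image using m by (simp add: field_simps)
  ultimately have "((\<lambda>x. speed R \<gamma> (m * x + k)) has_integral (1 / \<bar>m\<bar>) * integral {a..b} (speed R \<gamma>)) {a'..b'}" by simp
  from has_integral_mult_right[OF this, of "\<bar>m\<bar>"]
  have "((\<lambda>x. \<bar>m\<bar> * speed R \<gamma> (m * x + k)) has_integral integral {a..b} (speed R \<gamma>)) {a'..b'}" using m by simp
  then have "(speed R \<delta> has_integral integral {a..b} (speed R \<gamma>)) {a'..b'}"
  proof (rule has_integral_spike_finite[of "{a',b'} \<union> g -` Q", rotated 2])
    show "finite ({a', b'} \<union> g -` Q)" using Q(1) inj by (simp add: finite_vimageI)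
    fix t assume t: "t \<in> {a'..b'} - ({a', b'} \<union> g -` Q)"
    show "speed R \<delta> t = \<bar>m\<bar> * speed R \<gamma> (m * t + k)"
    proof (rule diff_at_speed_affine[of _ _ _ _ "{a'<..<b'}"])
      show "diff_at R \<gamma> (m * t + k)" by (rule Q(2)) (use t im imageI[of t "{a'..b'}" "\<lambda>t. m * t + k"] in \<open>auto simp: g_def\<close>)
    qed (use t eq in auto)
  qed
  then show "integral {a'..b'} (speed R \<delta>) = integral {a..b} (speed R \<gamma>)" by (rule integral_unique)
qed

lemma pw_concat:
  assumes \<gamma>: "pw R a b \<gamma>" and \<delta>: "pw R b c \<delta>" and eq: "\<gamma> b = \<delta> b"
  defines "\<eta> \<equiv> \<lambda>t. if t \<le> b then \<gamma> t else \<delta> t"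
  shows "pw R a c \<eta>" "integral {a..c} (speed R \<eta>) = integral {a..b} (speed R \<gamma>) + integral {b..c} (speed R \<delta>)"
proof -
  have abc: "a \<le> b" "b \<le> c" using pw_le \<gamma> \<delta> by auto
  have e1: "\<eta> t = \<gamma> (1 * t + 0)" if "t \<in> {a..b}" for t using that by (simp add: \<eta>_def)
  have e2: "\<eta> t = \<delta> (1 * t + 0)" if "t \<in> {b..c}" for t using that eq by (auto simp: \<eta>_def)
  have 1: "pw R a b \<eta>" "integral {a..b} (speed R \<eta>) = integral {a..b} (speed R \<gamma>)"
    by (rule pw_affine[OF \<gamma>, of 1 a b 0]; use abc e1 in simp)+
  have 2: "pw R b c \<eta>" "integral {b..c} (speed R \<eta>) = integral {b..c} (speed R \<delta>)"
    by (rule pw_affine[OF \<delta>, of 1 b c 0]; use abc e2 in simp)+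
  obtain P where pP: "partition R a b \<eta> P" using 1(1) unfolding pw_iff_partition by blast
  note P = partitionD[OF pP]
  obtain Q where pQ: "partition R b c \<eta> Q" using 2(1) unfolding pw_iff_partition by blast
  note Q = partitionD[OF pQ]
  show pw: "pw R a c \<eta>" unfolding pw_def
  proof (intro exI[of _ "P \<union> Q"] conjI ballI impI)
    fix s t assume st: "s \<in> P \<union> Q" "t \<in> P \<union> Q" "s < t \<and> (P \<union> Q) \<inter> {s<..<t} = {}"
    have "b \<in> P" using P by auto
    then have nb: "\<not> (s < b \<and> b < t)" using st by auto
    have "(s \<in> P \<and> t \<in> P) \<or> (s \<in> Q \<and> t \<in> Q)"
    proof (cases "t \<le> b")
      case True
      then have "s < b" using st by auto
      then have "s \<in> P" using st Q(3) by force
      moreover have "t \<in> P" using True st Q(3) \<open>b \<in> P\<close> by (metis Un_iff antisym atLeastAtMost_iff subsetD)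
      ultimately show ?thesis by auto
    next
      case False
      then have "s \<ge> b" using nb by auto
      then have "s \<in> Q" using st P(3) Q(2) by (metis Un_iff antisym atLeastAtMost_iff insert_subset subsetD)
      moreover have "t \<in> Q" using False st P(3) by force
      ultimately show ?thesis by auto
    qed
    then show "C1_curve_on R s t \<eta>" using P(4) Q(4) st by blast
  qed (use P Q abc in auto)
  show "integral {a..c} (speed R \<eta>) = integral {a..b} (speed R \<gamma>) + integral {b..c} (speed R \<delta>)"
    using Henstock_Kurzweil_Integration.integral_combine[OF abc pw_integrable[OF pw]] 1 2 by simp
qed

subsection \<open>The Riemannian distance\<close>

lemma length_nonneg: "integral S (speed R \<gamma>) \<ge> 0"
  by (cases "speed R \<gamma> integrable_on S") (auto intro: integral_nonneg speed_nonneg simp: not_integrable_integral)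

lemma dist_le_01:
  assumes "pw R 0 1 \<gamma>" shows "riem_dist R (\<gamma> 0) (\<gamma> 1) \<le> integral {0..1} (speed R \<gamma>)"
  unfolding riem_dist_def
proof (rule cInf_lower)
  show "integral {0..1} (speed R \<gamma>) \<in> {curve_length R \<gamma>' |\<gamma>'. piecewise_C1_curve R \<gamma>' \<and> \<gamma>' 0 = \<gamma> 0 \<and> \<gamma>' 1 = \<gamma> 1}"
    using assms by (auto simp: curve_length_def pw_01)
  show "bdd_below {curve_length R \<gamma>' |\<gamma>'. piecewise_C1_curve R \<gamma>' \<and> \<gamma>' 0 = \<gamma> 0 \<and> \<gamma>' 1 = \<gamma> 1}"
    by (rule bdd_belowI[of _ 0]) (auto simp: curve_length_def length_nonneg)
qed

lemma pw_to_01: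
  assumes \<gamma>: "pw R a b \<gamma>" and ab: "a < b"
  obtains \<delta> where "pw R 0 1 \<delta>" "\<delta> 0 = \<gamma> a" "\<delta> 1 = \<gamma> b" "integral {0..1} (speed R \<delta>) = integral {a..b} (speed R \<gamma>)"
proof -
  let ?d = "\<lambda>t. \<gamma> ((b - a) * t + a)"
  have im: "(\<lambda>t. (b - a) * t + a) ` {0..1} = {a..b}"
    using image_affinity_atLeastAtMost[of "b - a" a 0 1] ab by auto
  have ab0: "b - a \<noteq> 0" using ab by auto
  show ?thesis
    using that[of ?d] pw_affine[OF \<gamma> ab0 _ im, of ?d] by simp
qed

lemma dist_le:
  assumes \<gamma>: "pw R a b \<gamma>" and ab: "a < b"
  shows "riem_dist R (\<gamma> a) (\<gamma> b) \<le> integral {a..b} (speed R \<gamma>)"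
  using pw_to_01[OF assms] dist_le_01 by metis

lemma C1_curve_from_chart:
  assumes c: "c \<in> charts R" and x: "\<And>t. t \<in> {a..b} \<Longrightarrow> (x has_vector_derivative x' t) (at t within {a..b})"
    and x': "continuous_on {a..b} x'" and im: "\<And>t. t \<in> {a..b} \<Longrightarrow> x t \<in> chart_im c"
  shows "C1_curve_on R a b (chart_inv c \<circ> x)"
  unfolding C1_curve_on_def
proof (intro conjI ballI)
  have xc: "continuous_on {a..b} x" using x has_vector_derivative_continuous continuous_on_eq_continuous_within by blast
  then show cont: "continuous_on {a..b} (chart_inv c \<circ> x)"
    unfolding comp_def by (rule continuous_on_compose2[OF chart_inv_continuous[OF c]]) (use im in auto)
  fix c' assume c': "c' \<in> charts R"
  interpret I: isometry_patch "chart_im c" "chart_im c'" "metric_at R c" "metric_at R c'"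
    "coord c ` (chart_dom c \<inter> UNIV \<inter> id -` chart_dom c')" "coord_rep c c' id"
    by (rule isometry_patch_charts[OF riem_axioms riem_axioms local_iso_id c c'])
  let ?J = "{a..b} \<inter> (chart_inv c \<circ> x) -` chart_dom c'"
  have xA: "x t \<in> coord c ` (chart_dom c \<inter> UNIV \<inter> id -` chart_dom c')" if "t \<in> ?J" for t
    using that im[of t] chart_inv_dom[OF c, of "x t"] coord_chart_inv[OF c, of "x t"] by (auto intro!: image_eqI[of _ _ "chart_inv c (x t)"])
  show "\<exists>v. continuous_on ?J v \<and> (\<forall>t\<in>?J. ((coord c' \<circ> (chart_inv c \<circ> x)) has_vector_derivative v t) (at t within {a..b}))"
  proof (intro exI[of _ "\<lambda>t. I.D (x t) (x' t)"] conjI ballI)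
    show "continuous_on ?J (\<lambda>t. I.D (x t) (x' t))"
    proof (rule continuous_on_linear_family[where A="\<lambda>t. I.D (x t)" and w=x'])
      show "linear (I.D (x t))" if "t \<in> ?J" for t using I.linear_D[OF xA[OF that]] .
      show "continuous_on ?J (\<lambda>t. I.D (x t) v)" for v
        by (rule continuous_on_compose2[OF C1_on_continuous[OF I.D_C1]])
           (use xA xc in \<open>auto intro: continuous_on_subset\<close>)
      show "continuous_on ?J x'" by (rule continuous_on_subset[OF x']) auto
    qed
    fix t assume t: "t \<in> ?J"
    then have tab: "t \<in> {a..b}" by auto
    have 1: "((coord c \<circ> (chart_inv c \<circ> x)) has_vector_derivative x' t) (at t within {a..b})"
      by (rule has_vector_derivative_transform[OF tab _ x[OF tab]]) (use im c in auto)
    have 2: "continuous (at t within {a..b}) (chart_inv c \<circ> x)"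
      using cont tab continuous_on_eq_continuous_within by blast
    have "(chart_inv c \<circ> x) t \<in> chart_dom c" "(chart_inv c \<circ> x) t \<in> chart_dom c'"
      using t im chart_inv_dom[OF c] by auto
    from curve_change(1)[OF c c' tab this 2 1]
    show "((coord c' \<circ> (chart_inv c \<circ> x)) has_vector_derivative I.D (x t) (x' t)) (at t within {a..b})"
      using im[OF tab] c by (simp add: I.D_def)
  qed
qed

lemma chart_segment:
  assumes c: "c \<in> charts R" and seg: "closed_segment p q \<subseteq> chart_im c"
    and M: "\<And>r u. r \<in> closed_segment p q \<Longrightarrow> sqrt (metric_at R c r u u) \<le> M * norm u"
  obtains \<gamma> where "pw R 0 1 \<gamma>" "\<gamma> 0 = chart_inv c p" "\<gamma> 1 = chart_inv c q" "integral {0..1} (speed R \<gamma>) \<le> M * norm (q - p)"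
proof -
  define x where "x t = p + t *\<^sub>R (q - p)" for t
  have xs: "x t \<in> closed_segment p q" if "t \<in> {0..1}" for t
    using that unfolding closed_segment_def x_def by (auto intro!: exI[of _ t] simp: algebra_simps)
  have xd: "(x has_vector_derivative (q - p)) (at t within S)" for t S
    unfolding x_def by (auto intro!: derivative_eq_intros)
  define \<gamma> where "\<gamma> = chart_inv c \<circ> x"
  have C1: "C1_curve_on R 0 1 \<gamma>" unfolding \<gamma>_def
    by (rule C1_curve_from_chart[OF c xd]) (use xs seg in auto)
  have sp: "speed R \<gamma> t \<le> M * norm (q - p)" if t: "t \<in> {0<..<1}" for t
  proof -
    have t01: "t \<in> {0..1}" using t by auto
    have ic: "isCont \<gamma> t" using C1_curve_diff_at[OF C1 t] by (simp add: diff_at_def)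
    have "(coord c \<circ> \<gamma> has_vector_derivative (q - p)) (at t)"
      by (rule has_vector_derivative_transform_within_open[OF xd open_greaterThanLessThan t])
         (use subsetD[OF seg xs] c in \<open>auto simp: \<gamma>_def\<close>)
    from speed_chart[OF c _ ic this] have "speed R \<gamma> t = sqrt (metric_at R c (x t) (q - p) (q - p))"
      using xs[OF t01] seg chart_inv_dom[OF c] c by (auto simp: \<gamma>_def)
    then show ?thesis using M[OF xs[OF t01]] by simp
  qed
  have "norm (q - p) * M \<ge> 0"
    using order_trans[OF real_sqrt_ge_zero M[of p "q - p"]] metric_patch.nonneg[OF patch[OF c], of p] seg
    by (auto simp: mult.commute)
  then have "integral {0..1} (speed R \<gamma>) \<le> (M * norm (q - p)) * (1 - 0)"
    by (intro integral_speed_le C1_imp_pw C1) (use sp in \<open>auto simp: mult.commute\<close>)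
  then show ?thesis using that[of \<gamma>] C1_imp_pw[OF C1] xs by (simp add: \<gamma>_def x_def)
qed

end

section \<open>Local comparison of lengths with coordinates\<close>

context riem
begin

text \<open>On a compact coordinate ball the metric is uniformly equivalent to the Euclidean one.
  Through \<open>M\<close>, coordinate segments bound distances from above; through
  \<open>m\<close>, \<open>exit_length\<close> bounds them from below.\<close>

lemma local_comparison:
  obtains c r m M where "c \<in> charts R" "x0 \<in> chart_dom c" "r > 0" "cball (coord c x0) r \<subseteq> chart_im c" "m > 0" "M > 0"
    "\<And>p q. p \<in> cball (coord c x0) r \<Longrightarrow> q \<in> cball (coord c x0) r \<Longrightarrow>
       \<exists>\<gamma>. pw R 0 1 \<gamma> \<and> \<gamma> 0 = chart_inv c p \<and> \<gamma> 1 = chart_inv c q \<and> integral {0..1} (speed R \<gamma>) \<le> M * norm (q - p)"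
    "\<And>p u. p \<in> cball (coord c x0) r \<Longrightarrow> m * norm u \<le> sqrt (metric_at R c p u u)"
    "\<And>p u. p \<in> cball (coord c x0) r \<Longrightarrow> sqrt (metric_at R c p u u) \<le> M * norm u"
proof -
  obtain c where c: "c \<in> charts R" "x0 \<in> chart_dom c" using chart_exists by blast
  interpret P: metric_patch "chart_im c" "metric_at R c" by (rule patch[OF c(1)])
  obtain r where r: "r > 0" "cball (coord c x0) r \<subseteq> chart_im c"
    using chart_open(2)[OF c(1)] c open_contains_cball by blast
  obtain m where m: "m > 0" "\<And>p u. p \<in> cball (coord c x0) r \<Longrightarrow> m * norm u \<le> sqrt (metric_at R c p u u)"
    using P.norm_lower_bound[OF compact_cball r(2)] by blast
  obtain M where M: "M > 0" "\<And>p u. p \<in> cball (coord c x0) r \<Longrightarrow> sqrt (metric_at R c p u u) \<le> M * norm u"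
    using P.norm_upper_bound[OF compact_cball r(2)] by blast
  show ?thesis
  proof (rule that[OF c r m(1) M(1) _ m(2) M(2)])
    fix p q assume pq: "p \<in> cball (coord c x0) r" "q \<in> cball (coord c x0) r"
    then have seg: "closed_segment p q \<subseteq> cball (coord c x0) r" by (intro closed_segment_subset) auto
    show "\<exists>\<gamma>. pw R 0 1 \<gamma> \<and> \<gamma> 0 = chart_inv c p \<and> \<gamma> 1 = chart_inv c q \<and> integral {0..1} (speed R \<gamma>) \<le> M * norm (q - p)"
      by (rule chart_segment[OF c(1), of p q M]) (use seg r M(2) in auto)
  qed
qed

text \<open>Until its first exit time \<open>\<tau>\<close> the curve stays in the chart. There the
  coordinate component in the direction of the exit point grows from \<open>0\<close> to
  \<open>\<rho>\<close>, at a rate of at most the speed divided by \<open>m\<close>.\<close>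

lemma exit_length:
  assumes c: "c \<in> charts R" "x0 \<in> chart_dom c" and r: "cball (coord c x0) r \<subseteq> chart_im c" and m: "m > 0"
    "\<And>p u. p \<in> cball (coord c x0) r \<Longrightarrow> m * norm u \<le> sqrt (metric_at R c p u u)"
    and rho: "0 < \<rho>" "\<rho> \<le> r" and \<gamma>: "pw R 0 1 \<gamma>" "\<gamma> 0 = x0" "\<gamma> 1 \<notin> chart_inv c ` ball (coord c x0) \<rho>"
  shows "m * \<rho> \<le> integral {0..1} (speed R \<gamma>)"
proof -
  let ?p0 = "coord c x0"
  let ?B = "chart_inv c ` ball ?p0 \<rho>"
  have br: "ball ?p0 \<rho> \<subseteq> cball ?p0 r" "cball ?p0 \<rho> \<subseteq> cball ?p0 r" using rho by auto
  have Beq: "?B = chart_dom c \<inter> coord c -` ball ?p0 \<rho>"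
    using br r c(1) chart_inv_dom[OF c(1)] by (auto intro!: image_eqI[of _ "chart_inv c" "coord c _"])
  have oB: "open ?B" unfolding Beq
    using continuous_open_preimage[OF coord_continuous[OF c(1)] chart_open(1)[OF c(1)] open_ball] .
  have cont: "continuous_on {0..1} \<gamma>" using pw_continuous[OF \<gamma>(1)] .
  define S where "S = {0..1} \<inter> \<gamma> -` (- ?B)"
  have cS: "closed S" unfolding S_def
    by (rule continuous_closed_preimage[OF cont]) (use oB in \<open>auto simp: closed_Compl\<close>)
  have "1 \<in> S" using \<gamma>(3) by (simp add: S_def)
  then have neS: "S \<noteq> {}" by blast
  have bS: "bdd_below S" by (rule bdd_belowI[of _ 0]) (simp add: S_def)
  define \<tau> where "\<tau> = Inf S"
  have \<tau>S: "\<tau> \<in> S" unfolding \<tau>_def by (rule closed_contains_Inf[OF neS bS cS])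
  have before: "\<gamma> t \<in> ?B" if "0 \<le> t" "t < \<tau>" for t
  proof (rule ccontr)
    assume "\<gamma> t \<notin> ?B"
    then have "t \<in> S" using that \<tau>S by (auto simp: S_def)
    then have "\<tau> \<le> t" unfolding \<tau>_def using bS cInf_lower by metis
    then show False using that by simp
  qed
  have "x0 \<in> ?B" using c rho by (auto simp: Beq)
  then have \<tau>0: "0 < \<tau>" "\<tau> \<le> 1" using \<tau>S \<gamma>(2) by (auto simp: S_def less_le)
  let ?K = "chart_inv c ` cball ?p0 \<rho>"
  have cK: "closed ?K"
    using compact_continuous_image[OF continuous_on_subset[OF chart_inv_continuous[OF c(1)]] compact_cball, of ?p0 \<rho>] br r
    by (simp add: compact_imp_closed subset_iff)
  have "\<gamma> ` closure {0..<\<tau>} \<subseteq> ?K"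
  proof (rule image_closure_subset[OF _ cK])
    show "continuous_on (closure {0..<\<tau>}) \<gamma>" using \<tau>0 by (intro continuous_on_subset[OF cont]) (auto simp: closure_atLeastLessThan)
    show "\<gamma> ` {0..<\<tau>} \<subseteq> ?K" using before ball_subset_cball by fastforce
  qed
  then have inK: "\<gamma> t \<in> ?K" if "t \<in> {0..\<tau>}" for t using that \<tau>0 by (auto simp: closure_atLeastLessThan)
  have cb: "coord c (\<gamma> t) \<in> cball ?p0 \<rho>" "\<gamma> t \<in> chart_dom c" if t: "t \<in> {0..\<tau>}" for t
  proof -
    obtain q where q: "q \<in> cball ?p0 \<rho>" "\<gamma> t = chart_inv c q" using inK[OF t] by auto
    then have "q \<in> chart_im c" using br(2) r by blast
    with q show "coord c (\<gamma> t) \<in> cball ?p0 \<rho>" "\<gamma> t \<in> chart_dom c" using coord_chart_inv[OF c(1), of q] chart_inv_dom[OF c(1), of q] by auto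
  qed
  have n\<tau>: "norm (coord c (\<gamma> \<tau>) - ?p0) = \<rho>"
  proof -
    have "\<gamma> \<tau> \<notin> ?B" using \<tau>S by (auto simp: S_def)
    then have "coord c (\<gamma> \<tau>) \<notin> ball ?p0 \<rho>" using cb(2)[of \<tau>] \<tau>0 by (auto simp: Beq)
    moreover have "coord c (\<gamma> \<tau>) \<in> cball ?p0 \<rho>" using cb(1)[of \<tau>] \<tau>0 by auto
    ultimately show ?thesis by (auto simp: dist_norm norm_minus_commute)
  qed
  define w where "w = (1 / \<rho>) *\<^sub>R (coord c (\<gamma> \<tau>) - ?p0)"
  have nw: "norm w = 1" using n\<tau> rho by (simp add: w_def)
  define \<phi> where "\<phi> t = (coord c (\<gamma> t) - ?p0) \<bullet> w" for t
  have pw\<tau>: "pw R 0 \<tau> \<gamma>" using pw_restrict[OF \<gamma>(1), of 0 \<tau>] \<tau>0 by auto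
  have "\<phi> \<tau> - \<phi> 0 \<le> (1 / m) * integral {0..\<tau>} (speed R \<gamma>)"
  proof (rule pw_bound[OF pw\<tau>])
    show "continuous_on {0..\<tau>} \<phi>" unfolding \<phi>_def
      by (intro continuous_intros continuous_on_compose2[OF coord_continuous[OF c(1)]] continuous_on_subset[OF cont])
         (use cb \<tau>0 in auto)
    fix t assume t: "t \<in> {0<..<\<tau>}" and d: "diff_at R \<gamma> t"
    have t': "t \<in> {0..\<tau>}" using t by auto
    obtain v where v: "((coord c \<circ> \<gamma>) has_vector_derivative v) (at t)" using d c(1) cb(2)[OF t'] by (auto simp: diff_at_def)
    have sp: "speed R \<gamma> t = sqrt (metric_at R c (coord c (\<gamma> t)) v v)"
      using speed_chart[OF c(1) cb(2)[OF t'] _ v] d by (auto simp: diff_at_def)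
    have "((\<lambda>s. ((coord c \<circ> \<gamma>) s - ?p0) \<bullet> w) has_vector_derivative (v - 0) \<bullet> w) (at t)"
      by (intro bounded_linear.has_vector_derivative[OF bounded_linear_inner_left] has_vector_derivative_diff v has_vector_derivative_const)
    then have "(\<phi> has_real_derivative v \<bullet> w) (at t)"
      by (simp add: \<phi>_def[abs_def] has_real_derivative_iff_has_vector_derivative comp_def)
    moreover have "v \<bullet> w \<le> (1 / m) * speed R \<gamma> t"
    proof -
      have "v \<bullet> w \<le> norm v" using norm_cauchy_schwarz[of v w] nw by simp
      also have "\<dots> \<le> (1 / m) * sqrt (metric_at R c (coord c (\<gamma> t)) v v)"
        using m(2)[of "coord c (\<gamma> t)" v] cb(1)[OF t'] br(2) m(1) by (auto simp: field_simps)
      finally show ?thesis using sp by simp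
    qed
    ultimately show "\<exists>\<phi>'. (\<phi> has_real_derivative \<phi>') (at t) \<and> \<phi>' \<le> 1 / m * speed R \<gamma> t" by blast
  qed (use m in auto)
  moreover have "\<phi> \<tau> - \<phi> 0 = \<rho>"
    using n\<tau> rho \<gamma>(2) by (simp add: \<phi>_def w_def power2_norm_eq_inner[symmetric] power2_eq_square)
  moreover have "integral {0..\<tau>} (speed R \<gamma>) \<le> integral {0..1} (speed R \<gamma>)"
    by (rule integral_subset_le) (use \<tau>0 pw_integrable[OF pw\<tau>] pw_integrable[OF \<gamma>(1)] speed_nonneg in auto)
  ultimately show ?thesis using m(1) by (simp add: field_simps)
qed

definition joined :: "'m \<Rightarrow> 'm \<Rightarrow> bool" where
  "joined x y \<longleftrightarrow> (\<exists>\<gamma>. pw R 0 1 \<gamma> \<and> \<gamma> 0 = x \<and> \<gamma> 1 = y)"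

lemma reverse_curve:
  assumes "pw R 0 1 \<gamma>"
  obtains \<delta> where "pw R 0 1 \<delta>" "\<delta> 0 = \<gamma> 1" "\<delta> 1 = \<gamma> 0" "integral {0..1} (speed R \<delta>) = integral {0..1} (speed R \<gamma>)"
proof -
  have im: "(\<lambda>t::real. -1 * t + 1) ` {0..1} = {0..1}"
    by (subst image_affinity_atLeastAtMost) auto
  let ?d = "\<lambda>t. \<gamma> (-1 * t + 1)"
  show ?thesis
    by (rule that[of ?d]; (rule pw_affine[OF assms _ _ im, of ?d] | simp); simp?)
qed

lemma concat_curves:
  assumes "pw R 0 1 \<gamma>" "pw R 0 1 \<delta>" "\<gamma> 1 = \<delta> 0"
  obtains \<eta> where "pw R 0 1 \<eta>" "\<eta> 0 = \<gamma> 0" "\<eta> 1 = \<delta> 1"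
    "integral {0..1} (speed R \<eta>) = integral {0..1} (speed R \<gamma>) + integral {0..1} (speed R \<delta>)"
proof -
  let ?d = "\<lambda>t. \<delta> (1 * t + -1)"
  have im: "(\<lambda>t::real. 1 * t + -1) ` {1..2} = {0..1}"
    by (subst image_affinity_atLeastAtMost) auto
  have d: "pw R 1 2 ?d" "integral {1..2} (speed R ?d) = integral {0..1} (speed R \<delta>)"
    by (rule pw_affine[OF assms(2) _ _ im]; simp)+
  have e: "\<gamma> 1 = ?d 1" using assms(3) by simp
  from pw_to_01[OF pw_concat(1)[OF assms(1) d(1) e]] pw_concat(2)[OF assms(1) d(1) e] d(2)
  show ?thesis using that by (smt (verit))
qed

end

section \<open>The Riemannian distance as a metric for the topology of the manifold\<close>

locale conn_riem = riem R for R :: "('m::{t2_space, second_countable_topology}, 'e::euclidean_space) riemannian" +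
  assumes conn: "connected (UNIV :: 'm set)"
begin

text \<open>Makes the set of lengths in \<open>riem_dist\<close> nonempty, so that a lower bound for
  all lengths is one for the distance.\<close>

lemma all_joined: "joined x y"
proof (rule connected_equivalence_relation[OF conn])
  show "joined y x" if "joined x y" for x y using that reverse_curve unfolding joined_def by metis
  show "joined x z" if "joined x y" "joined y z" for x y z
    using that concat_curves unfolding joined_def by metis
  fix x
  obtain c r m M where c: "c \<in> charts R" "x \<in> chart_dom c" "r > 0" "cball (coord c x) r \<subseteq> chart_im c"
    and j: "\<And>p q. p \<in> cball (coord c x) r \<Longrightarrow> q \<in> cball (coord c x) r \<Longrightarrow>
       \<exists>\<gamma>. pw R 0 1 \<gamma> \<and> \<gamma> 0 = chart_inv c p \<and> \<gamma> 1 = chart_inv c q \<and> integral {0..1} (speed R \<gamma>) \<le> M * norm (q - p)"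
    using local_comparison[of x] by metis
  let ?T = "chart_dom c \<inter> coord c -` ball (coord c x) r"
  have "open ?T" using continuous_open_preimage[OF coord_continuous[OF c(1)] chart_open(1)[OF c(1)] open_ball] .
  moreover have "x \<in> ?T" using c by auto
  moreover have "joined x y" if "y \<in> ?T" for y
    using j[of "coord c x" "coord c y"] that c unfolding joined_def by auto
  ultimately show "\<exists>T. openin (top_of_set UNIV) T \<and> x \<in> T \<and> (\<forall>y\<in>T. joined x y)" by auto
qed auto

lemma dist_greatest:
  assumes "\<And>\<gamma>. pw R 0 1 \<gamma> \<Longrightarrow> \<gamma> 0 = x \<Longrightarrow> \<gamma> 1 = y \<Longrightarrow> B \<le> integral {0..1} (speed R \<gamma>)"
  shows "B \<le> riem_dist R x y"
  unfolding riem_dist_def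
  by (rule cInf_greatest) (use all_joined[of x y] assms in \<open>auto simp: joined_def pw_01 curve_length_def\<close>)

lemma dist_approx:
  assumes "e > 0"
  obtains \<gamma> where "pw R 0 1 \<gamma>" "\<gamma> 0 = x" "\<gamma> 1 = y" "integral {0..1} (speed R \<gamma>) < riem_dist R x y + e"
  using dist_greatest[of x y "riem_dist R x y + e"] assms by (metis add_le_same_cancel1 not_le)

lemma dist_nonneg: "riem_dist R x y \<ge> 0"
  by (rule dist_greatest) (rule length_nonneg)

lemma dist_self: "riem_dist R x x = 0"
proof -
  obtain c where c: "c \<in> charts R" "x \<in> chart_dom c" using chart_exists by blast
  have "C1_curve_on R 0 1 (chart_inv c \<circ> (\<lambda>t. coord c x))"
    by (rule C1_curve_from_chart[OF c(1), where x'="\<lambda>_. 0"]) (use c in auto)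
  then have p: "pw R 0 1 (\<lambda>t. x)" using C1_imp_pw[of R 0 1 "\<lambda>t. x"] c by (auto simp: comp_def)
  have "speed R (\<lambda>t. x) t = 0" for t
  proof -
    have "((coord c \<circ> (\<lambda>t. x)) has_vector_derivative 0) (at t)" by (simp add: comp_def)
    from speed_chart[OF c(1), of "\<lambda>t. x", OF c(2) _ this] show ?thesis
      using bilinear_lzero[OF metric_patch.bilinear_g[OF patch[OF c(1)]], of "coord c x" 0] c by auto
  qed
  then have "speed R (\<lambda>t. x) = (\<lambda>t. 0)" by (intro ext)
  then have "integral {0..1} (speed R (\<lambda>t. x)) = 0" by simp
  then show ?thesis using dist_le_01[OF p] dist_nonneg[of x x] by simp
qed

lemma dist_sym: "riem_dist R x y = riem_dist R y x"
proof -
  have "riem_dist R x y \<le> riem_dist R y x" for x y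
  proof (rule dist_greatest)
    fix \<gamma> assume g: "pw R 0 1 \<gamma>" "\<gamma> 0 = y" "\<gamma> 1 = x"
    show "riem_dist R x y \<le> integral {0..1} (speed R \<gamma>)"
      by (rule reverse_curve[OF g(1)]) (use g dist_le_01 in metis)
  qed
  then show ?thesis by (simp add: antisym)
qed

lemma dist_triangle: "riem_dist R x z \<le> riem_dist R x y + riem_dist R y z"
proof (rule field_le_epsilon)
  fix e :: real assume e: "e > 0"
  obtain \<gamma> where g: "pw R 0 1 \<gamma>" "\<gamma> 0 = x" "\<gamma> 1 = y" "integral {0..1} (speed R \<gamma>) < riem_dist R x y + e/2"
    using dist_approx[of "e/2" x y] e by auto
  obtain \<delta> where d: "pw R 0 1 \<delta>" "\<delta> 0 = y" "\<delta> 1 = z" "integral {0..1} (speed R \<delta>) < riem_dist R y z + e/2"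
    using dist_approx[of "e/2" y z] e by auto
  have "\<gamma> 1 = \<delta> 0" using g d by simp
  then obtain \<eta> where h: "pw R 0 1 \<eta>" "\<eta> 0 = \<gamma> 0" "\<eta> 1 = \<delta> 1"
    "integral {0..1} (speed R \<eta>) = integral {0..1} (speed R \<gamma>) + integral {0..1} (speed R \<delta>)"
    using concat_curves[OF g(1) d(1)] by blast
  then show "riem_dist R x z \<le> riem_dist R x y + riem_dist R y z + e"
    using dist_le_01[OF h(1)] g d by simp
qed

text \<open>Together with \<open>dist_upper\<close> it says that the distance induces the given
  topology.\<close>

lemma dist_lower:
  assumes "open V" "x \<in> V"
  obtains e where "e > 0" "\<And>y. riem_dist R x y < e \<Longrightarrow> y \<in> V"
proof -
  obtain c r m M where c: "c \<in> charts R" "x \<in> chart_dom c" "r > 0" "cball (coord c x) r \<subseteq> chart_im c" "m > 0"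
    "\<And>p u. p \<in> cball (coord c x) r \<Longrightarrow> m * norm u \<le> sqrt (metric_at R c p u u)"
    using local_comparison[of x] by metis
  have "open (chart_im c \<inter> chart_inv c -` V)"
    using continuous_open_preimage[OF chart_inv_continuous[OF c(1)] chart_open(2)[OF c(1)] assms(1)] .
  moreover have "coord c x \<in> chart_im c \<inter> chart_inv c -` V" using c assms by auto
  ultimately obtain r' where r': "r' > 0" "ball (coord c x) r' \<subseteq> chart_im c \<inter> chart_inv c -` V"
    using open_contains_ball by blast
  define \<rho> where "\<rho> = min r r'"
  have rho: "\<rho> > 0" "\<rho> \<le> r" "ball (coord c x) \<rho> \<subseteq> ball (coord c x) r'" using r' c by (auto simp: \<rho>_def)
  show ?thesis
  proof (rule that[of "m * \<rho>"])
    show "y \<in> V" if "riem_dist R x y < m * \<rho>" for y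
    proof (rule ccontr)
      assume "y \<notin> V"
      then have n: "y \<notin> chart_inv c ` ball (coord c x) \<rho>" using r'(2) rho(3) by blast
      have "m * \<rho> \<le> riem_dist R x y"
        by (rule dist_greatest, rule exit_length[OF c(1,2,4,5,6) rho(1,2)]) (use n in auto)
      then show False using that by simp
    qed
  qed (use c rho in auto)
qed

lemma dist_upper:
  assumes "e > 0"
  obtains V where "open V" "x \<in> V" "\<And>y. y \<in> V \<Longrightarrow> riem_dist R x y < e"
proof -
  obtain c r m M where c: "c \<in> charts R" "x \<in> chart_dom c" "r > 0" "cball (coord c x) r \<subseteq> chart_im c" "M > 0"
    and j: "\<And>p q. p \<in> cball (coord c x) r \<Longrightarrow> q \<in> cball (coord c x) r \<Longrightarrow>
       \<exists>\<gamma>. pw R 0 1 \<gamma> \<and> \<gamma> 0 = chart_inv c p \<and> \<gamma> 1 = chart_inv c q \<and> integral {0..1} (speed R \<gamma>) \<le> M * norm (q - p)"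
    using local_comparison[of x] by metis
  define \<rho> where "\<rho> = min r (e / M)"
  have rho: "\<rho> > 0" "\<rho> \<le> r" "\<rho> \<le> e / M" using assms c by (auto simp: \<rho>_def)
  let ?V = "chart_dom c \<inter> coord c -` ball (coord c x) \<rho>"
  show ?thesis
  proof (rule that[of ?V])
    show "open ?V" using continuous_open_preimage[OF coord_continuous[OF c(1)] chart_open(1)[OF c(1)] open_ball] .
    show "x \<in> ?V" using c rho by auto
    fix y assume y: "y \<in> ?V"
    then obtain \<gamma> where "pw R 0 1 \<gamma>" "\<gamma> 0 = x" "\<gamma> 1 = y" "integral {0..1} (speed R \<gamma>) \<le> M * norm (coord c y - coord c x)"
      using j[of "coord c x" "coord c y"] c rho by auto
    then have "riem_dist R x y \<le> M * norm (coord c y - coord c x)" using dist_le_01 by force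
    also have "\<dots> < M * \<rho>" using y c(5) by (auto simp: dist_norm norm_minus_commute)
    also have "\<dots> \<le> e" using rho(3) c(5) by (simp add: field_simps)
    finally show "riem_dist R x y < e" .
  qed
qed

lemma dist_zero: "riem_dist R x y = 0 \<Longrightarrow> x = y"
proof (rule ccontr)
  assume d: "riem_dist R x y = 0" and "x \<noteq> y"
  then have "open (- {y})" "x \<in> - {y}" by auto
  from dist_lower[OF this] show False using d by (metis ComplD insertI1)
qed

lemma metric_space: "Metric_space UNIV (riem_dist R)"
proof
  show "riem_dist R x y = 0 \<longleftrightarrow> x = y" for x y using dist_zero dist_self by blast
qed (rule dist_nonneg dist_sym dist_triangle)+

lemma dist_diff: "\<bar>riem_dist R x y - riem_dist R x' y'\<bar> \<le> riem_dist R x x' + riem_dist R y y'"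
  using dist_triangle[of x y x'] dist_triangle[of x' y y'] dist_triangle[of x' y' x] dist_triangle[of x y' y]
    dist_sym[of x x'] dist_sym[of y y'] by linarith

lemma tendsto_dist_iff: "(f \<longlongrightarrow> l) F \<longleftrightarrow> ((\<lambda>x. riem_dist R (f x) l) \<longlongrightarrow> 0) F"
proof
  assume f: "(f \<longlongrightarrow> l) F"
  show "((\<lambda>x. riem_dist R (f x) l) \<longlongrightarrow> 0) F"
  proof (rule tendstoI)
    fix e :: real assume "e > 0"
    then obtain V where V: "open V" "l \<in> V" "\<And>y. y \<in> V \<Longrightarrow> riem_dist R l y < e" using dist_upper by blast
    show "\<forall>\<^sub>F x in F. dist (riem_dist R (f x) l) 0 < e"
      using topological_tendstoD[OF f V(1,2)] by eventually_elim (use V(3) dist_nonneg dist_sym[of _ l] in simp)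
  qed
next
  assume f: "((\<lambda>x. riem_dist R (f x) l) \<longlongrightarrow> 0) F"
  show "(f \<longlongrightarrow> l) F"
  proof (rule topological_tendstoI)
    fix V assume "open V" "l \<in> V"
    then obtain e where e: "e > 0" "\<And>y. riem_dist R l y < e \<Longrightarrow> y \<in> V" using dist_lower by blast
    have "\<forall>\<^sub>F x in F. dist (riem_dist R (f x) l) 0 < e" using f e(1) tendstoD by blast
    then show "\<forall>\<^sub>F x in F. f x \<in> V" by eventually_elim (use e(2) dist_sym[of _ l] dist_nonneg in simp)
  qed
qed

lemma tendsto_dist:
  assumes "(f \<longlongrightarrow> a) F" "(g \<longlongrightarrow> b) F"
  shows "((\<lambda>x. riem_dist R (f x) (g x)) \<longlongrightarrow> riem_dist R a b) F"
proof -
  have "((\<lambda>x. riem_dist R (f x) a + riem_dist R (g x) b) \<longlongrightarrow> 0 + 0) F"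
    using assms unfolding tendsto_dist_iff by (rule tendsto_add)
  then have "((\<lambda>x. riem_dist R (f x) (g x) - riem_dist R a b) \<longlongrightarrow> 0) F"
    unfolding add_0_right by (rule Lim_null_comparison[rotated]) (use dist_diff in auto)
  then show ?thesis by (simp add: LIM_zero_iff)
qed

lemma complete_limit:
  assumes "Metric_space.mcomplete UNIV (riem_dist R)"
    and cauchy: "\<And>e. e > 0 \<Longrightarrow> \<exists>N. \<forall>m\<ge>N. \<forall>n\<ge>N. riem_dist R (\<sigma> m) (\<sigma> n) < e"
  obtains l where "\<sigma> \<longlonglongrightarrow> l"
proof -
  interpret S: Metric_space UNIV "riem_dist R" by (rule metric_space)
  have "S.MCauchy \<sigma>" unfolding S.MCauchy_def using cauchy by auto
  then obtain l where "limitin S.mtopology \<sigma> l sequentially" using assms(1) S.mcomplete_def by blast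
  then have l: "\<And>e. e > 0 \<Longrightarrow> \<forall>\<^sub>F n in sequentially. riem_dist R (\<sigma> n) l < e"
    by (auto simp: S.limit_metric_sequentially eventually_sequentially)
  have "((\<lambda>n. riem_dist R (\<sigma> n) l) \<longlongrightarrow> 0) sequentially"
  proof (rule tendstoI)
    show "\<forall>\<^sub>F n in sequentially. dist (riem_dist R (\<sigma> n) l) 0 < e" if "e > 0" for e
      using l[OF that] by eventually_elim (use dist_nonneg in auto)
  qed
  then show ?thesis using that tendsto_dist_iff by blast
qed

end

section \<open>Geodesics\<close>

context riem
begin

text \<open>\<open>geodesic_on\<close> with its velocities made explicit as a family over times and
  charts, which uniqueness and changes of charts have to refer to. At charts that do not contain the
  point the values are arbitrary.\<close>

definition geo :: "real set \<Rightarrow> (real \<Rightarrow> 'm) \<Rightarrow> (real \<Rightarrow> ('m, 'e) chart \<Rightarrow> 'e) \<Rightarrow> bool" where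
  "geo I \<gamma> V \<longleftrightarrow> continuous_on I \<gamma> \<and> (\<forall>c\<in>charts R. \<forall>t\<in>I. \<gamma> t \<in> chart_dom c \<longrightarrow>
     ((coord c \<circ> \<gamma>) has_vector_derivative V t c) (at t within I) \<and>
     ((\<lambda>s. V s c) has_vector_derivative - chr (metric_at R c) (coord c (\<gamma> t)) (V t c) (V t c)) (at t within I))"

lemma geodesic_on_iff: "geodesic_on R I \<gamma> \<longleftrightarrow> (\<exists>V. geo I \<gamma> V)"
proof
  assume g: "geodesic_on R I \<gamma>"
  then have "\<forall>c\<in>charts R. \<exists>v. \<forall>t\<in>I \<inter> \<gamma> -` chart_dom c. ((coord c \<circ> \<gamma>) has_vector_derivative v t) (at t within I) \<and>
        (v has_vector_derivative - chr (metric_at R c) (coord c (\<gamma> t)) (v t) (v t)) (at t within I)"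
    unfolding geodesic_on_def christoffel_chr by blast
  from bchoice[OF this] obtain v where v: "\<forall>c\<in>charts R. \<forall>t\<in>I \<inter> \<gamma> -` chart_dom c. ((coord c \<circ> \<gamma>) has_vector_derivative v c t) (at t within I) \<and>
        (v c has_vector_derivative - chr (metric_at R c) (coord c (\<gamma> t)) (v c t) (v c t)) (at t within I)" by blast
  have "geo I \<gamma> (\<lambda>t c. v c t)" using g v unfolding geo_def geodesic_on_def by auto
  then show "\<exists>V. geo I \<gamma> V" by blast
next
  assume "\<exists>V. geo I \<gamma> V"
  then obtain V where "geo I \<gamma> V" by blast
  then show "geodesic_on R I \<gamma>" unfolding geo_def geodesic_on_def christoffel_chr
    by (intro conjI ballI exI[of _ "\<lambda>t. V t _"]) auto
qed

lemma geoD: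
  assumes "geo I \<gamma> V" "c \<in> charts R" "t \<in> I" "\<gamma> t \<in> chart_dom c"
  shows "((coord c \<circ> \<gamma>) has_vector_derivative V t c) (at t within I)"
    "((\<lambda>s. V s c) has_vector_derivative - chr (metric_at R c) (coord c (\<gamma> t)) (V t c) (V t c)) (at t within I)"
    "continuous (at t within I) \<gamma>" "continuous (at t within I) (\<lambda>s. V s c)" "continuous (at t within I) (coord c \<circ> \<gamma>)"
  using assms unfolding geo_def
  by (auto simp: continuous_on_eq_continuous_within intro: has_vector_derivative_continuous)

lemma geo_continuous: "geo I \<gamma> V \<Longrightarrow> continuous_on I \<gamma>"
  by (simp add: geo_def)

lemma geo_subset: "geo I \<gamma> V \<Longrightarrow> J \<subseteq> I \<Longrightarrow> geo J \<gamma> V"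
  unfolding geo_def by (meson continuous_on_subset has_vector_derivative_within_subset subsetD)

lemma geo_change:
  assumes g: "geo I \<gamma> V" and c: "c \<in> charts R" "c' \<in> charts R" and t: "t \<in> I" "\<gamma> t \<in> chart_dom c" "\<gamma> t \<in> chart_dom c'"
    and nt: "at t within I \<noteq> bot"
  shows "V t c' = chart_D c c' id (\<gamma> t) (V t c)"
  using vector_derivative_unique_within[OF nt geoD(1)[OF g c(2) t(1,3)] curve_change(1)[OF c t geoD(3)[OF g c(1) t(1,2)] geoD(1)[OF g c(1) t(1,2)]]] .

lemma interval_nontrivial: "a < b \<Longrightarrow> t \<in> {a..b} \<Longrightarrow> at t within {a..b::real} \<noteq> bot"
  by (simp add: trivial_limit_within islimpt_Icc)

lemma geo_energy_change:
  assumes g: "geo I \<gamma> V" and c: "c \<in> charts R" "c' \<in> charts R" and t: "t \<in> I" "\<gamma> t \<in> chart_dom c" "\<gamma> t \<in> chart_dom c'"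
    and nt: "at t within I \<noteq> bot"
  shows "metric_at R c' (coord c' (\<gamma> t)) (V t c') (V t c') = metric_at R c (coord c (\<gamma> t)) (V t c) (V t c)"
  using curve_change(2)[OF c t geoD(3)[OF g c(1) t(1,2)] geoD(1)[OF g c(1) t(1,2)]]
  unfolding geo_change[OF g c t nt] .

lemma geo_stays:
  assumes g: "geo I \<gamma> V" and t: "t \<in> I" and W: "open W" "\<gamma> t \<in> W"
  obtains d where "d > 0" "\<And>s. s \<in> I \<Longrightarrow> \<bar>s - t\<bar> < d \<Longrightarrow> \<gamma> s \<in> W"
proof -
  have "continuous (at t within I) \<gamma>" using geo_continuous[OF g] t continuous_on_eq_continuous_within by blast
  then show ?thesis
    using continuous_within_nbhd[where \<gamma>=\<gamma> and t=t and I=I and W=W, OF _ W] that unfolding dist_real_def by metis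
qed

lemma geo_constant_speed:
  assumes g: "geo {a..b} \<gamma> V" and ab: "a < b" and c: "c \<in> charts R" "c' \<in> charts R"
    and st: "s \<in> {a..b}" "\<gamma> s \<in> chart_dom c" "t \<in> {a..b}" "\<gamma> t \<in> chart_dom c'"
  shows "metric_at R c' (coord c' (\<gamma> t)) (V t c') (V t c') = metric_at R c (coord c (\<gamma> s)) (V s c) (V s c)"
proof -
  define C where "C t = (SOME c. c \<in> charts R \<and> \<gamma> t \<in> chart_dom c)" for t
  have C: "C t \<in> charts R" "\<gamma> t \<in> chart_dom (C t)" for t
    unfolding C_def by (rule some_chart)+
  define E where "E t = metric_at R (C t) (coord (C t) (\<gamma> t)) (V t (C t)) (V t (C t))" for t
  have E: "metric_at R c (coord c (\<gamma> t)) (V t c) (V t c) = E t" if "c \<in> charts R" "t \<in> {a..b}" "\<gamma> t \<in> chart_dom c" for c t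
    unfolding E_def by (rule geo_energy_change[OF g C(1) that(1,2) C(2) that(3) interval_nontrivial[OF ab that(2)]])
  have "(E has_vector_derivative 0) (at t within {a..b})" if t: "t \<in> {a..b}" for t
  proof -
    interpret P: metric_patch "chart_im (C t)" "metric_at R (C t)" by (rule patch[OF C(1)])
    obtain d where d: "d > 0" "\<And>s. s \<in> {a..b} \<Longrightarrow> \<bar>s - t\<bar> < d \<Longrightarrow> \<gamma> s \<in> chart_dom (C t)"
      using geo_stays[OF g t chart_open(1)[OF C(1)] C(2)] by metis
    have "((\<lambda>s. metric_at R (C t) ((coord (C t) \<circ> \<gamma>) s) (V s (C t)) (V s (C t))) has_vector_derivative 0) (at t within {a..b})"
      by (rule P.speed_derivative) (use geoD[OF g C(1) t C(2)] C in \<open>auto simp: comp_def\<close>)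
    then show ?thesis
      by (rule has_vector_derivative_transform_within[OF _ d(1) t]) (use E[OF C(1)[of t]] d(2) in \<open>auto simp: dist_real_def\<close>)
  qed
  then obtain k where k: "\<And>t. t \<in> {a..b} \<Longrightarrow> E t = k"
    using has_vector_derivative_zero_constant[of "{a..b}" E] by (metis convex_real_interval(5))
  show ?thesis using E[OF c(1) st(1,2)] E[OF c(2) st(3,4)] k[OF st(1)] k[OF st(3)] by simp
qed

lemma geo_C1_curve:
  assumes g: "geo {a..b} \<gamma> V"
  shows "C1_curve_on R a b \<gamma>"
  unfolding C1_curve_on_def
proof (intro conjI ballI)
  show "continuous_on {a..b} \<gamma>" using geo_continuous[OF g] .
  fix c assume c: "c \<in> charts R"
  show "\<exists>v. continuous_on ({a..b} \<inter> \<gamma> -` chart_dom c) v \<and>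
        (\<forall>t\<in>{a..b} \<inter> \<gamma> -` chart_dom c. ((coord c \<circ> \<gamma>) has_vector_derivative v t) (at t within {a..b}))"
  proof (intro exI[of _ "\<lambda>t. V t c"] conjI ballI)
    show "continuous_on ({a..b} \<inter> \<gamma> -` chart_dom c) (\<lambda>t. V t c)"
      unfolding continuous_on_eq_continuous_within
    proof
      fix t assume "t \<in> {a..b} \<inter> \<gamma> -` chart_dom c"
      then have "continuous (at t within {a..b}) (\<lambda>t. V t c)" using geoD(4)[OF g c] by auto
      then show "continuous (at t within {a..b} \<inter> \<gamma> -` chart_dom c) (\<lambda>t. V t c)"
        by (rule continuous_within_subset) auto
    qed
  qed (use geoD(1)[OF g c] in auto)
qed

lemma geo_length:
  assumes g: "geo {a..b} \<gamma> V" and ab: "a < b" and c: "c \<in> charts R" and s: "s \<in> {a..b}" "\<gamma> s \<in> chart_dom c"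
  shows "riem_dist R (\<gamma> a) (\<gamma> b) \<le> sqrt (metric_at R c (coord c (\<gamma> s)) (V s c) (V s c)) * (b - a)"
proof -
  let ?N = "sqrt (metric_at R c (coord c (\<gamma> s)) (V s c) (V s c))"
  have pw: "pw R a b \<gamma>" by (rule C1_imp_pw[OF geo_C1_curve[OF g]]) (use ab in simp)
  have "integral {a..b} (speed R \<gamma>) \<le> ?N * (b - a)"
  proof (rule integral_speed_le[OF pw])
    show "0 \<le> ?N" using metric_nonneg c s by simp
    fix t assume t: "t \<in> {a<..<b}" and d: "diff_at R \<gamma> t"
    obtain c' where c': "c' \<in> charts R" "\<gamma> t \<in> chart_dom c'" using chart_exists by blast
    have a: "at t within {a..b} = at t" using t by (intro at_within_interior) (auto simp: interior_atLeastAtMost_real)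
    have t': "t \<in> {a..b}" using t by auto
    have "speed R \<gamma> t = sqrt (metric_at R c' (coord c' (\<gamma> t)) (V t c') (V t c'))"
      using speed_chart[OF c' _ geoD(1)[OF g c'(1) t' c'(2), unfolded a]] d by (simp add: diff_at_def)
    also have "\<dots> = ?N" using geo_constant_speed[OF g ab c c'(1) s t' c'(2)] by simp
    finally show "speed R \<gamma> t \<le> ?N" by simp
  qed
  then show ?thesis using dist_le[OF pw ab] by linarith
qed

text \<open>In the other charts the velocity is the image under the derivative of the chart change,
  and \<open>geodesic_transform\<close> provides the equation.\<close>

lemma geo_from_chart:
  assumes c: "c \<in> charts R" and im: "\<And>t. t \<in> I \<Longrightarrow> x t \<in> chart_im c"
    and x: "\<And>t. t \<in> I \<Longrightarrow> (x has_vector_derivative v t) (at t within I)"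
    and v: "\<And>t. t \<in> I \<Longrightarrow> (v has_vector_derivative - chr (metric_at R c) (x t) (v t) (v t)) (at t within I)"
  obtains V where "geo I (\<lambda>t. chart_inv c (x t)) V" "\<And>t. V t c = v t"
proof -
  define V where "V t c' = (if c' = c then v t else chart_D c c' id (chart_inv c (x t)) (v t))" for t c'
  let ?\<gamma> = "\<lambda>t. chart_inv c (x t)"
  have xc: "continuous_on I x" using x has_vector_derivative_continuous continuous_on_eq_continuous_within by blast
  have cont: "continuous_on I ?\<gamma>"
    by (rule continuous_on_compose2[OF chart_inv_continuous[OF c] xc]) (use im in auto)
  have "geo I ?\<gamma> V" unfolding geo_def
  proof (intro conjI ballI impI)
    show "continuous_on I ?\<gamma>" by (rule cont)
    fix c' t assume c': "c' \<in> charts R" and t: "t \<in> I" and d: "?\<gamma> t \<in> chart_dom c'"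
    have b: "((coord c' \<circ> ?\<gamma>) has_vector_derivative V t c') (at t within I) \<and>
      ((\<lambda>s. V s c') has_vector_derivative - chr (metric_at R c') (coord c' (?\<gamma> t)) (V t c') (V t c')) (at t within I)"
    proof (cases "c' = c")
      case True
      have "((coord c \<circ> ?\<gamma>) has_vector_derivative v t) (at t within I)"
        by (rule has_vector_derivative_transform[OF t _ x[OF t]]) (use im c in auto)
      then show ?thesis using True v[OF t] im[OF t] c by (simp add: V_def)
    next
      case False
      let ?A = "coord c ` (chart_dom c \<inter> UNIV \<inter> id -` chart_dom c')"
      interpret I: isometry_patch "chart_im c" "chart_im c'" "metric_at R c" "metric_at R c'" ?A "coord_rep c c' id"
        by (rule isometry_patch_charts[OF riem_axioms riem_axioms local_iso_id c c'])
      have xA: "x t \<in> ?A" using d im[OF t] chart_inv_dom[OF c, of "x t"] c by (auto intro!: image_eqI[of _ _ "?\<gamma> t"])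
      note tr = I.geodesic_transform[OF x[OF t] v[OF t] xA]
      have r: "coord_rep c c' id (x s) = coord c' (?\<gamma> s)" if "s \<in> I" for s
        by (simp add: coord_rep_def)
      have D: "I.D (x s) (v s) = V s c'" if "s \<in> I" for s
        using im[OF that] c False by (simp add: V_def I.D_def)
      have "((coord c' \<circ> ?\<gamma>) has_vector_derivative I.D (x t) (v t)) (at t within I)"
        by (rule has_vector_derivative_transform[OF t _ tr(1)]) (use r in auto)
      moreover have "((\<lambda>s. V s c') has_vector_derivative - chr (metric_at R c') (coord_rep c c' id (x t)) (I.D (x t) (v t)) (I.D (x t) (v t))) (at t within I)"
        by (rule has_vector_derivative_transform[OF t _ tr(2)]) (use D in auto)
      ultimately show ?thesis using D[OF t] r[OF t] by simp
    qed
    then show "((coord c' \<circ> ?\<gamma>) has_vector_derivative V t c') (at t within I)" by blast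
    show "((\<lambda>s. V s c') has_vector_derivative - chr (metric_at R c') (coord c' (?\<gamma> t)) (V t c') (V t c')) (at t within I)"
      using b by blast
  qed
  then show ?thesis by (rule that) (simp add: V_def)
qed

lemma geo_affine:
  assumes g: "geo I \<gamma> V" and m: "\<And>t. t \<in> J \<Longrightarrow> m * t + k \<in> I"
  shows "geo J (\<lambda>t. \<gamma> (m * t + k)) (\<lambda>t c. m *\<^sub>R V (m * t + k) c)"
  unfolding geo_def
proof (intro conjI ballI impI)
  show "continuous_on J (\<lambda>t. \<gamma> (m * t + k))"
    by (rule continuous_on_compose2[OF geo_continuous[OF g]]) (use m in \<open>auto intro!: continuous_intros\<close>)
  fix c t assume c: "c \<in> charts R" and t: "t \<in> J" and d: "\<gamma> (m * t + k) \<in> chart_dom c"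
  interpret P: metric_patch "chart_im c" "metric_at R c" by (rule patch[OF c])
  have im: "coord c (\<gamma> (m * t + k)) \<in> chart_im c" using d by auto
  have a: "((\<lambda>t. m * t + k) has_vector_derivative m) (at t within J)"
    by (auto intro!: derivative_eq_intros)
  have sub: "(\<lambda>t. m * t + k) ` J \<subseteq> I" using m by auto
  note gd = geoD[OF g c m[OF t] d]
  have "(((coord c \<circ> \<gamma>) \<circ> (\<lambda>t. m * t + k)) has_vector_derivative m *\<^sub>R V (m * t + k) c) (at t within J)"
    by (rule vector_diff_chain_within[OF a has_vector_derivative_within_subset[OF gd(1) sub]])
  then show "((coord c \<circ> (\<lambda>t. \<gamma> (m * t + k))) has_vector_derivative m *\<^sub>R V (m * t + k) c) (at t within J)"
    by (simp add: comp_def)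
  have "(((\<lambda>s. V s c) \<circ> (\<lambda>t. m * t + k)) has_vector_derivative
     m *\<^sub>R (- chr (metric_at R c) (coord c (\<gamma> (m * t + k))) (V (m * t + k) c) (V (m * t + k) c))) (at t within J)"
    by (rule vector_diff_chain_within[OF a has_vector_derivative_within_subset[OF gd(2) sub]])
  then have "((\<lambda>t. m *\<^sub>R V (m * t + k) c) has_vector_derivative
     m *\<^sub>R (m *\<^sub>R (- chr (metric_at R c) (coord c (\<gamma> (m * t + k))) (V (m * t + k) c) (V (m * t + k) c)))) (at t within J)"
    unfolding comp_def by (intro bounded_linear.has_vector_derivative[OF bounded_linear_scaleR_right])
  then show "((\<lambda>t. m *\<^sub>R V (m * t + k) c) has_vector_derivative
     - chr (metric_at R c) (coord c (\<gamma> (m * t + k))) (m *\<^sub>R V (m * t + k) c) (m *\<^sub>R V (m * t + k) c)) (at t within J)"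
    by (simp add: bilinear_lmul[OF P.chr_bilinear[OF im]] bilinear_rmul[OF P.chr_bilinear[OF im]])
qed

text \<open>Being a geodesic at time \<open>t\<close> depends on the curve and the time set near
  \<open>t\<close> only. This serves to glue geodesics and to exhaust \<open>{0..}\<close> by
  bounded intervals.\<close>

lemma geo_cong_local:
  assumes t: "t \<in> I" "t \<in> J" and W: "open W" "t \<in> W" "I \<inter> W = J \<inter> W"
    and g: "geo J \<gamma> V" and eq: "\<And>s. s \<in> I \<inter> W \<Longrightarrow> \<delta> s = \<gamma> s"
    and Veq: "\<And>s c. s \<in> I \<inter> W \<Longrightarrow> c \<in> charts R \<Longrightarrow> \<gamma> s \<in> chart_dom c \<Longrightarrow> U s c = V s c"
  shows "continuous (at t within I) \<delta>"
    and "c \<in> charts R \<Longrightarrow> \<delta> t \<in> chart_dom c \<Longrightarrow> ((coord c \<circ> \<delta>) has_vector_derivative U t c) (at t within I) \<and>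
     ((\<lambda>s. U s c) has_vector_derivative - chr (metric_at R c) (coord c (\<delta> t)) (U t c) (U t c)) (at t within I)"
proof -
  have at: "at t within I = at t within J"
    by (rule at_within_nhd[OF W(2,1)]) (use W(3) in blast)
  obtain d0 where d0: "d0 > 0" "\<And>s. dist s t < d0 \<Longrightarrow> s \<in> W"
    using W open_dist by (metis)
  show "continuous (at t within I) \<delta>"
    by (rule continuous_transform_within[OF _ d0(1) t(1), of \<gamma>])
       (use geo_continuous[OF g] t eq d0 in \<open>auto simp: at continuous_on_eq_continuous_within\<close>)
  assume c: "c \<in> charts R" and "\<delta> t \<in> chart_dom c"
  then have d: "\<gamma> t \<in> chart_dom c" using eq t W by auto
  note gd = geoD[OF g c t(2) d]
  obtain d1 where d1: "d1 > 0" "\<And>s. s \<in> J \<Longrightarrow> \<bar>s - t\<bar> < d1 \<Longrightarrow> \<gamma> s \<in> chart_dom c"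
    using geo_stays[OF g t(2) chart_open(1)[OF c] d] by metis
  have dpos: "min d0 d1 > 0" using d0 d1 by simp
  have 1: "((coord c \<circ> \<delta>) has_vector_derivative V t c) (at t within I)"
    by (rule has_vector_derivative_transform_within[OF gd(1)[folded at] dpos t(1)]) (use eq d0 in auto)
  have 2: "((\<lambda>s. U s c) has_vector_derivative - chr (metric_at R c) (coord c (\<gamma> t)) (V t c) (V t c)) (at t within I)"
  proof (rule has_vector_derivative_transform_within[OF gd(2)[folded at] dpos t(1)])
    fix s assume s: "s \<in> I" "dist s t < min d0 d1"
    then have "s \<in> I \<inter> W" using d0 by auto
    moreover have "s \<in> J" using calculation W(3) by blast
    ultimately show "V s c = U s c" using Veq[OF _ c] d1(2)[of s] s by (auto simp: dist_real_def)
  qed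
  have "U t c = V t c" "\<delta> t = \<gamma> t" using Veq[OF _ c d] eq t W by auto
  with 1 2 show "((coord c \<circ> \<delta>) has_vector_derivative U t c) (at t within I) \<and>
     ((\<lambda>s. U s c) has_vector_derivative - chr (metric_at R c) (coord c (\<delta> t)) (U t c) (U t c)) (at t within I)" by simp
qed

text \<open>The pieces overlap in an interval of positive length, so near every time the glued curve
  coincides with one of them and no one-sided derivatives have to be matched.\<close>

lemma geo_glue:
  assumes g1: "geo {a..b} \<gamma>1 V1" and g2: "geo {c..d} \<gamma>2 V2" and ord: "a \<le> c" "c < b" "b \<le> d"
    and eq: "\<And>t. t \<in> {c..b} \<Longrightarrow> \<gamma>1 t = \<gamma>2 t"
    and Veq: "\<And>t k. t \<in> {c..b} \<Longrightarrow> k \<in> charts R \<Longrightarrow> \<gamma>1 t \<in> chart_dom k \<Longrightarrow> V1 t k = V2 t k"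
  shows "geo {a..d} (\<lambda>t. if t \<le> b then \<gamma>1 t else \<gamma>2 t) (\<lambda>t. if t \<le> b then V1 t else V2 t)"
proof -
  let ?g = "\<lambda>t. if t \<le> b then \<gamma>1 t else \<gamma>2 t"
  let ?V = "\<lambda>t. if t \<le> b then V1 t else V2 t"
  have *: "continuous (at t within {a..d}) ?g \<and> (\<forall>k. k \<in> charts R \<longrightarrow> ?g t \<in> chart_dom k \<longrightarrow>
     ((coord k \<circ> ?g) has_vector_derivative ?V t k) (at t within {a..d}) \<and>
     ((\<lambda>s. ?V s k) has_vector_derivative - chr (metric_at R k) (coord k (?g t)) (?V t k) (?V t k)) (at t within {a..d}))"
    if t: "t \<in> {a..d}" for t
  proof (cases "t < b")
    case True
    have I: "{a..d} \<inter> {..<b} = {a..b} \<inter> {..<b}" using ord by auto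
    have e: "?g s = \<gamma>1 s" if "s \<in> {a..d} \<inter> {..<b}" for s using that by auto
    have Ve: "?V s k = V1 s k" if "s \<in> {a..d} \<inter> {..<b}" "k \<in> charts R" "\<gamma>1 s \<in> chart_dom k" for s k
      using that by auto
    show ?thesis
      using geo_cong_local[where I="{a..d}" and J="{a..b}" and W="{..<b}" and t=t and \<delta>="?g" and U="?V", OF _ _ _ _ I g1 e Ve] t True ord by auto
  next
    case False
    have e: "?g s = \<gamma>2 s" if "s \<in> {a..d} \<inter> {c<..}" for s using that eq[of s] by auto
    have Ve: "?V s k = V2 s k" if "s \<in> {a..d} \<inter> {c<..}" "k \<in> charts R" "\<gamma>2 s \<in> chart_dom k" for s k
      using that eq[of s] Veq[of s k] by auto
    have I: "{a..d} \<inter> {c<..} = {c..d} \<inter> {c<..}" using ord by auto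
    show ?thesis
      using geo_cong_local[where I="{a..d}" and J="{c..d}" and W="{c<..}" and t=t and \<delta>="?g" and U="?V", OF _ _ _ _ I g2 e Ve] t False ord by auto
  qed
  show ?thesis unfolding geo_def continuous_on_eq_continuous_within using * by blast
qed

text \<open>The agreement of positions and velocities is an open and closed condition on the time.
  Distinct positions stay distinct by the Hausdorff property, distinct velocities by continuity, and
  agreement spreads by uniqueness for the first order system \<open>spray\<close>.\<close>

lemma geo_unique:
  assumes g1: "geo {a..b} \<gamma>1 V1" and g2: "geo {a..b} \<gamma>2 V2" and ab: "a < b"
    and s0: "s0 \<in> {a..b}" "\<gamma>1 s0 = \<gamma>2 s0" "c0 \<in> charts R" "\<gamma>1 s0 \<in> chart_dom c0" "V1 s0 c0 = V2 s0 c0"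
    and t: "t \<in> {a..b}"
  shows "\<gamma>1 t = \<gamma>2 t \<and> (\<forall>c\<in>charts R. \<gamma>1 t \<in> chart_dom c \<longrightarrow> V1 t c = V2 t c)"
proof -
  define P where "P t \<longleftrightarrow> \<gamma>1 t = \<gamma>2 t \<and> (\<forall>c\<in>charts R. \<gamma>1 t \<in> chart_dom c \<longrightarrow> V1 t c = V2 t c)" for t
  have one: "P t" if "t \<in> {a..b}" "\<gamma>1 t = \<gamma>2 t" "c \<in> charts R" "\<gamma>1 t \<in> chart_dom c" "V1 t c = V2 t c" for t c
    unfolding P_def
  proof (intro conjI ballI impI)
    fix c' assume c': "c' \<in> charts R" "\<gamma>1 t \<in> chart_dom c'"
    note nt = interval_nontrivial[OF ab that(1)]
    show "V1 t c' = V2 t c'"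
      using geo_change[OF g1 that(3) c'(1) that(1) that(4) c'(2) nt] geo_change[OF g2 that(3) c'(1) that(1) _ _ nt] that c' by simp
  qed (rule that)
  have "P t"
  proof (rule connected_induction_simple[of "{a..b}" s0 t P])
    show "P s0" using one[OF s0] .
    fix t0 assume t0: "t0 \<in> {a..b}"
    have "\<exists>e>0. \<forall>s\<in>{a..b}. \<forall>s'\<in>{a..b}. \<bar>s - t0\<bar> < e \<longrightarrow> \<bar>s' - t0\<bar> < e \<longrightarrow> P s \<longrightarrow> P s'"
    proof (cases "\<gamma>1 t0 = \<gamma>2 t0")
      case False
      then obtain U W where UW: "open U" "open W" "\<gamma>1 t0 \<in> U" "\<gamma>2 t0 \<in> W" "U \<inter> W = {}" using hausdorff[OF False] by blast
      obtain d1 where d1: "d1 > 0" "\<And>s. s \<in> {a..b} \<Longrightarrow> \<bar>s - t0\<bar> < d1 \<Longrightarrow> \<gamma>1 s \<in> U" using geo_stays[OF g1 t0 UW(1,3)] by metis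
      obtain d2 where d2: "d2 > 0" "\<And>s. s \<in> {a..b} \<Longrightarrow> \<bar>s - t0\<bar> < d2 \<Longrightarrow> \<gamma>2 s \<in> W" using geo_stays[OF g2 t0 UW(2,4)] by metis
      have "\<not> P s" if "s \<in> {a..b}" "\<bar>s - t0\<bar> < min d1 d2" for s
        using d1(2)[of s] d2(2)[of s] that UW(5) by (auto simp: P_def)
      then show ?thesis using d1(1) d2(1) by (intro exI[of _ "min d1 d2"]) auto
    next
      case True
      obtain c where c: "c \<in> charts R" "\<gamma>1 t0 \<in> chart_dom c" using chart_exists by blast
      have c2: "\<gamma>2 t0 \<in> chart_dom c" using c True by simp
      interpret P: metric_patch "chart_im c" "metric_at R c" by (rule patch[OF c(1)])
      obtain d1 where d1: "d1 > 0" "\<And>s. s \<in> {a..b} \<Longrightarrow> \<bar>s - t0\<bar> < d1 \<Longrightarrow> \<gamma>1 s \<in> chart_dom c"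
        using geo_stays[OF g1 t0 chart_open(1)[OF c(1)] c(2)] by metis
      obtain d2 where d2: "d2 > 0" "\<And>s. s \<in> {a..b} \<Longrightarrow> \<bar>s - t0\<bar> < d2 \<Longrightarrow> \<gamma>2 s \<in> chart_dom c"
        using geo_stays[OF g2 t0 chart_open(1)[OF c(1)] c2] by metis
      note G1 = geoD[OF g1 c(1) t0 c(2)] and G2 = geoD[OF g2 c(1) t0 c2]
      show ?thesis
      proof (cases "V1 t0 c = V2 t0 c")
        case False
        have "continuous (at t0 within {a..b}) (\<lambda>s. V1 s c - V2 s c)"
          using G1(4) G2(4) by (intro continuous_intros)
        then obtain d3 where d3: "d3 > 0" "\<And>s. s \<in> {a..b} \<Longrightarrow> dist s t0 < d3 \<Longrightarrow> V1 s c - V2 s c \<in> - {0}"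
          using continuous_within_nbhd[of t0 "{a..b}" "\<lambda>s. V1 s c - V2 s c" "- {0}"] False by auto
        have "\<not> P s" if "s \<in> {a..b}" "\<bar>s - t0\<bar> < min d1 d3" for s
          using d1(2)[of s] d3(2)[of s] that c by (auto simp: P_def dist_real_def)
        then show ?thesis using d1(1) d3(1) by (intro exI[of _ "min d1 d3"]) auto
      next
        case VV: True
        define z1 where "z1 s = (coord c (\<gamma>1 s), V1 s c)" for s
        define z2 where "z2 s = (coord c (\<gamma>2 s), V2 s c)" for s
        have W: "open (chart_im c \<times> (UNIV::'e set))" "z1 t0 \<in> chart_im c \<times> UNIV"
          using chart_open(2)[OF c(1)] c by (auto simp: z1_def open_Times)
        obtain r e where re: "r > 0" "e > 0" "\<And>a b z1' z2' s t. \<lbrakk>b - a \<le> e; s \<in> {a..b}; t \<in> {a..b};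
       \<And>t. t \<in> {a..b} \<Longrightarrow> z1' t \<in> ball (z1 t0) r \<and> (z1' has_vector_derivative P.spray (z1' t)) (at t within {a..b});
       \<And>t. t \<in> {a..b} \<Longrightarrow> z2' t \<in> ball (z1 t0) r \<and> (z2' has_vector_derivative P.spray (z2' t)) (at t within {a..b});
       z1' s = z2' s\<rbrakk> \<Longrightarrow> z1' t = z2' t"
          using ode_unique_short[OF P.spray_C1D W] by metis
        have cz: "continuous (at t0 within {a..b}) z1" "continuous (at t0 within {a..b}) z2"
          using G1(4,5) G2(4,5) unfolding z1_def z2_def comp_def by (auto intro!: continuous_intros)
        have "z2 t0 = z1 t0" using True VV by (simp add: z1_def z2_def)
        then have inb: "z1 t0 \<in> ball (z1 t0) r" "z2 t0 \<in> ball (z1 t0) r" using re(1) by auto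
        obtain d3 where d3: "d3 > 0" "\<And>s. s \<in> {a..b} \<Longrightarrow> dist s t0 < d3 \<Longrightarrow> z1 s \<in> ball (z1 t0) r"
          using continuous_within_nbhd[OF cz(1) open_ball inb(1)] by metis
        obtain d4 where d4: "d4 > 0" "\<And>s. s \<in> {a..b} \<Longrightarrow> dist s t0 < d4 \<Longrightarrow> z2 s \<in> ball (z1 t0) r"
          using continuous_within_nbhd[OF cz(2) open_ball inb(2)] by metis
        define \<epsilon> where "\<epsilon> = Min {d1, d2, d3, d4, e/2}"
        have eps: "\<epsilon> > 0" "\<epsilon> \<le> d1" "\<epsilon> \<le> d2" "\<epsilon> \<le> d3" "\<epsilon> \<le> d4" "\<epsilon> \<le> e/2"
          using d1 d2 d3 d4 re by (auto simp: \<epsilon>_def)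
        show ?thesis
        proof (intro exI[of _ \<epsilon>] conjI ballI impI)
          fix s s' assume s: "s \<in> {a..b}" "s' \<in> {a..b}" "\<bar>s - t0\<bar> < \<epsilon>" "\<bar>s' - t0\<bar> < \<epsilon>" "P s"
          let ?J = "{min s s'..max s s'}"
          have J: "r \<in> {a..b}" "\<bar>r - t0\<bar> < \<epsilon>" if "r \<in> ?J" for r using that s by auto
          have sub: "?J \<subseteq> {a..b}" using J by blast
          have eq: "z1 s' = z2 s'"
          proof (rule re(3)[of "max s s'" "min s s'" s s'])
            show "max s s' - min s s' \<le> e" using s eps by (auto simp: max_def min_def)
            show "z1 t \<in> ball (z1 t0) r \<and> (z1 has_vector_derivative P.spray (z1 t)) (at t within ?J)" if "t \<in> ?J" for t
            proof
              show "z1 t \<in> ball (z1 t0) r" using d3(2)[of t] J[OF that] eps by (auto simp: dist_real_def)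
              note k = geoD[OF g1 c(1) J(1)[OF that] d1(2)]
              have "((\<lambda>s. ((coord c \<circ> \<gamma>1) s, V1 s c)) has_vector_derivative P.spray (z1 t)) (at t within {a..b})"
                unfolding P.spray_def z1_def fst_conv snd_conv
                by (intro has_vector_derivative_Pair k) (use J[OF that] eps in auto)
              then show "(z1 has_vector_derivative P.spray (z1 t)) (at t within ?J)"
                unfolding z1_def[abs_def] comp_def using has_vector_derivative_within_subset[OF _ sub] by blast
            qed
            show "z2 t \<in> ball (z1 t0) r \<and> (z2 has_vector_derivative P.spray (z2 t)) (at t within ?J)" if "t \<in> ?J" for t
            proof
              show "z2 t \<in> ball (z1 t0) r" using d4(2)[of t] J[OF that] eps by (auto simp: dist_real_def)
              note k = geoD[OF g2 c(1) J(1)[OF that] d2(2)]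
              have "((\<lambda>s. ((coord c \<circ> \<gamma>2) s, V2 s c)) has_vector_derivative P.spray (z2 t)) (at t within {a..b})"
                unfolding P.spray_def z2_def fst_conv snd_conv
                by (intro has_vector_derivative_Pair k) (use J[OF that] eps in auto)
              then show "(z2 has_vector_derivative P.spray (z2 t)) (at t within ?J)"
                unfolding z2_def[abs_def] comp_def using has_vector_derivative_within_subset[OF _ sub] by blast
            qed
            show "z1 s = z2 s" using \<open>P s\<close> d1(2)[of s] s eps c by (auto simp: P_def z1_def z2_def)
          qed auto
          have dd: "\<gamma>1 s' \<in> chart_dom c" "\<gamma>2 s' \<in> chart_dom c" using d1(2)[of s'] d2(2)[of s'] s eps by auto
          have "\<gamma>1 s' = \<gamma>2 s'" using eq dd c(1) unfolding z1_def z2_def by (metis chart_inv_coord prod.inject)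
          then show "P s'" using one[OF s(2) _ c(1) dd(1)] eq by (simp add: z1_def z2_def)
        qed (use eps in auto)
      qed
    qed
    then obtain e where "e > 0" "\<forall>s\<in>{a..b}. \<forall>s'\<in>{a..b}. \<bar>s - t0\<bar> < e \<longrightarrow> \<bar>s' - t0\<bar> < e \<longrightarrow> P s \<longrightarrow> P s'" by blast
    then show "\<exists>T. openin (top_of_set {a..b}) T \<and> t0 \<in> T \<and> (\<forall>x\<in>T. \<forall>y\<in>T. P x \<longrightarrow> P y)"
      using t0 by (intro exI[of _ "{a..b} \<inter> ball t0 e"]) (auto intro: openin_open_Int simp: dist_real_def abs_minus_commute)
  qed (use s0 t in auto)
  then show ?thesis by (simp add: P_def)
qed

text \<open>The existence time \<open>e\<close> is common to all initial states near
  \<open>(p0, u0)\<close>. This uniformity lets \<open>geodesic_extends\<close> pass beyond a limit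
  time.\<close>

lemma local_geodesics:
  assumes c: "c \<in> charts R" and p0: "p0 \<in> chart_im c"
  obtains r e where "r > 0" "e > 0" "\<And>p u. (p, u) \<in> ball (p0, u0) r \<Longrightarrow>
     p \<in> chart_im c \<and> (\<exists>\<gamma> V. geo {-e..e} \<gamma> V \<and> \<gamma> 0 = chart_inv c p \<and> V 0 c = u)"
proof -
  interpret P: metric_patch "chart_im c" "metric_at R c" by (rule patch[OF c])
  have W: "open (chart_im c \<times> (UNIV::'e set))" "(p0, u0) \<in> chart_im c \<times> UNIV"
    using chart_open(2)[OF c] p0 by (auto simp: open_Times)
  obtain r e \<phi> \<psi> where f: "r > 0" "e > 0" "ball (p0, u0) r \<subseteq> chart_im c \<times> UNIV"
    "\<And>z. z \<in> ball (p0, u0) r \<Longrightarrow> \<phi> z 0 = z"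
    "\<And>z t. z \<in> ball (p0, u0) r \<Longrightarrow> t \<in> {-e..e} \<Longrightarrow> \<phi> z t \<in> chart_im c \<times> UNIV \<and> (\<phi> z has_vector_derivative P.spray (\<phi> z t)) (at t within {-e..e})"
    "\<And>t. t \<in> {-e..e} \<Longrightarrow> C1D (ball (p0, u0) r) (\<lambda>z. \<phi> z t) (\<lambda>z w. \<psi> z w t)"
    "\<And>z w t. z \<in> ball (p0, u0) r \<Longrightarrow> t \<in> {-e..e} \<Longrightarrow> (\<psi> z w has_vector_derivative P.dspray (\<phi> z t) (\<psi> z w t)) (at t within {-e..e})"
    by (rule local_flow[OF P.spray_C1D W]) blast
  show ?thesis
  proof (rule that[OF f(1,2)])
    fix p u assume z: "(p, u) \<in> ball (p0, u0) r"
    have d: "((\<lambda>s. fst (\<phi> (p,u) s)) has_vector_derivative snd (\<phi> (p,u) t)) (at t within {-e..e})"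
       "((\<lambda>s. snd (\<phi> (p,u) s)) has_vector_derivative - chr (metric_at R c) (fst (\<phi> (p,u) t)) (snd (\<phi> (p,u) t)) (snd (\<phi> (p,u) t))) (at t within {-e..e})"
      if "t \<in> {-e..e}" for t
      using bounded_linear.has_vector_derivative[OF bounded_linear_fst] bounded_linear.has_vector_derivative[OF bounded_linear_snd]
         f(5)[OF z that] unfolding P.spray_def by fastforce+
    obtain V where V: "geo {-e..e} (\<lambda>t. chart_inv c (fst (\<phi> (p,u) t))) V" "\<And>t. V t c = snd (\<phi> (p,u) t)"
      by (rule geo_from_chart[OF c _ d]) (use f(5)[OF z] in \<open>auto simp: mem_Times_iff\<close>)
    then show "p \<in> chart_im c \<and> (\<exists>\<gamma> V. geo {-e..e} \<gamma> V \<and> \<gamma> 0 = chart_inv c p \<and> V 0 c = u)"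
      using f(3) z f(4)[OF z] by (intro conjI exI[of _ "\<lambda>t. chart_inv c (fst (\<phi> (p,u) t))"] exI[of _ V]) auto
  qed
qed

end

text \<open>\<open>sqrt h\<close> is convex where \<open>h\<close> is positive, but \<open>h\<close>
  may vanish inside the interval. So a maximum principle is used: if \<open>sqrt h\<close> exceeded
  its chord, then \<open>h\<close> would be positive at the maximum of the difference, and local
  convexity there is contradictory.\<close>

lemma sqrt_convex_chord:
  fixes h :: "real \<Rightarrow> real"
  assumes cont: "continuous_on {0..1} h" and nn: "\<And>t. t \<in> {0..1} \<Longrightarrow> h t \<ge> 0" and h0: "h 0 = 0"
    and loc: "\<And>t. t \<in> {0<..<1} \<Longrightarrow> \<exists>\<epsilon>>0. \<exists>h1. \<forall>s. \<bar>s - t\<bar> < \<epsilon> \<longrightarrow> (h has_real_derivative h1 s) (at s) \<and>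
       (\<exists>h2. (h1 has_real_derivative h2) (at s) \<and> (h1 s)\<^sup>2 \<le> 2 * h s * h2)"
    and t: "t \<in> {0..1}"
  shows "sqrt (h t) \<le> t * sqrt (h 1)"
proof (rule ccontr)
  define f where "f t = sqrt (h t)" for t
  define k where "k t = f t - t * f 1" for t
  assume "\<not> sqrt (h t) \<le> t * sqrt (h 1)"
  then have kt: "k t > 0" by (simp add: k_def f_def)
  have "continuous_on {0..1} f" unfolding f_def by (intro continuous_intros cont)
  then have kc: "continuous_on {0..1} k" unfolding k_def by (intro continuous_intros)
  have "\<exists>m\<in>{0..1}. \<forall>s\<in>{0..1}. k s \<le> k m" by (rule continuous_attains_sup[OF _ _ kc]) auto
  then obtain m where m: "m \<in> {0..1}" "\<And>s. s \<in> {0..1} \<Longrightarrow> k s \<le> k m" by blast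
  define S where "S = {0..1} \<inter> k -` {k m}"
  have cS: "closed S" unfolding S_def by (rule continuous_closed_preimage[OF kc]) auto
  have neS: "S \<noteq> {}" using m(1) by (auto simp: S_def)
  have bS: "bdd_above S" by (rule bdd_aboveI[of _ 1]) (simp add: S_def)
  \<comment> \<open>The last maximum point: to its right \<open>k\<close> is strictly smaller, which
    makes the inequality from convexity strict.\<close>
  define \<tau> where "\<tau> = Sup S"
  have "\<tau> \<in> S" unfolding \<tau>_def by (rule closed_contains_Sup[OF neS bS cS])
  then have k\<tau>: "k \<tau> = k m" "\<tau> \<in> {0..1}" by (auto simp: S_def)
  have km: "k m > 0" using m(2)[OF t] kt by simp
  have "k 0 = 0" "k 1 = 0" by (simp_all add: k_def f_def h0)
  then have "\<tau> \<noteq> 0" "\<tau> \<noteq> 1" using k\<tau> km by auto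
  then have \<tau>: "\<tau> \<in> {0<..<1}" using k\<tau> by auto
  obtain \<epsilon> h1 where e: "\<epsilon> > 0" "\<And>s. \<bar>s - \<tau>\<bar> < \<epsilon> \<Longrightarrow> (h has_real_derivative h1 s) (at s) \<and>
       (\<exists>h2. (h1 has_real_derivative h2) (at s) \<and> (h1 s)\<^sup>2 \<le> 2 * h s * h2)" using loc[OF \<tau>] by blast
  have "\<tau> * f 1 \<ge> 0" using nn[of 1] \<tau> by (simp add: f_def)
  then have "f \<tau> > 0" using km k\<tau>(1) by (simp add: k_def)
  then have h\<tau>: "h \<tau> > 0" by (simp add: f_def)
  have "isCont h \<tau>" using e(2)[of \<tau>] e(1) DERIV_isCont by fastforce
  then have "\<forall>\<^sub>F s in at \<tau>. h s > 0" using h\<tau> by (simp add: isCont_def order_tendstoD(1))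
  then obtain d where d: "d > 0" "\<And>s. \<bar>s - \<tau>\<bar> < d \<Longrightarrow> h s > 0"
    unfolding eventually_at dist_real_def using h\<tau> by (metis UNIV_I)
  define \<delta> where "\<delta> = Min {\<epsilon>, d, \<tau>, 1 - \<tau>}"
  have del: "\<delta> > 0" "\<delta> \<le> \<epsilon>" "\<delta> \<le> d" "\<delta> \<le> \<tau>" "\<delta> \<le> 1 - \<tau>" using e d \<tau> by (auto simp: \<delta>_def)
  let ?C = "{\<tau> - \<delta><..<\<tau> + \<delta>}"
  obtain h2 where h2: "\<And>s. s \<in> ?C \<Longrightarrow> (h1 has_real_derivative h2 s) (at s) \<and> (h1 s)\<^sup>2 \<le> 2 * h s * h2 s"
    using e(2) del by (metis (no_types, opaque_lifting) abs_diff_less_iff diff_add_eq greaterThanLessThan_iff less_le_trans diff_less_eq less_diff_eq add.commute)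
  have h1: "(h has_real_derivative h1 s) (at s)" "h s > 0" if "s \<in> ?C" for s
    using e(2)[of s] d(2)[of s] that del by auto
  have "convex_on ?C f"
  proof (rule f''_ge0_imp_convex)
    fix s assume s: "s \<in> ?C"
    show "(f has_real_derivative h1 s / (2 * sqrt (h s))) (at s)"
      unfolding f_def using h1[OF s] by (auto intro!: derivative_eq_intros simp: field_simps)
    have sq: "sqrt (h s) * sqrt (h s) = h s" using h1(2)[OF s] by simp
    show "((\<lambda>s. h1 s / (2 * sqrt (h s))) has_real_derivative
        (h2 s * (2 * sqrt (h s)) - h1 s * (2 * (h1 s / (2 * sqrt (h s))))) / (2 * sqrt (h s) * (2 * sqrt (h s)))) (at s)"
    proof (rule DERIV_divide)
      show "((\<lambda>x. 2 * sqrt (h x)) has_real_derivative 2 * (h1 s / (2 * sqrt (h s)))) (at s)"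
        using h1[OF s] by (auto intro!: derivative_eq_intros simp: field_simps)
    qed (use h2[OF s] h1[OF s] in auto)
    have "h2 s * (2 * sqrt (h s)) - h1 s * (2 * (h1 s / (2 * sqrt (h s)))) = (2 * h s * h2 s - (h1 s)\<^sup>2) / sqrt (h s)"
      using h1(2)[OF s] sq by (simp add: field_simps power2_eq_square)
    also have "\<dots> \<ge> 0" using h2[OF s] h1(2)[OF s] by simp
    finally show "0 \<le> (h2 s * (2 * sqrt (h s)) - h1 s * (2 * (h1 s / (2 * sqrt (h s))))) / (2 * sqrt (h s) * (2 * sqrt (h s)))"
      using h1(2)[OF s] by simp
  qed simp
  define a where "a = \<tau> - \<delta>/2"
  define b where "b = \<tau> + \<delta>/2"
  have ab: "a \<in> ?C" "b \<in> ?C" "a \<in> {0..1}" "b \<in> {0..1}" "\<tau> = (1/2) *\<^sub>R a + (1/2) *\<^sub>R b" "\<tau> < b"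
    using del \<tau> by (auto simp: a_def b_def field_simps)
  have "f ((1 - 1/2) *\<^sub>R a + (1/2) *\<^sub>R b) \<le> (1 - 1/2) * f a + (1/2) * f b"
    by (rule convex_onD[OF \<open>convex_on ?C f\<close>]) (use ab in auto)
  then have "f \<tau> \<le> (1/2) * f a + (1/2) * f b" using ab(5) by simp
  then have "k \<tau> \<le> (1/2) * k a + (1/2) * k b" unfolding k_def by (subst ab(5)) (simp add: field_simps)
  moreover have "k a \<le> k m" using m(2) ab by blast
  moreover have "k b < k m"
  proof -
    have "b \<notin> S" using cSup_upper[OF _ bS, of b] ab(6) by (auto simp: \<tau>_def)
    then have "k b \<noteq> k m" using ab by (auto simp: S_def)
    then show ?thesis using m(2)[OF ab(4)] by simp
  qed
  ultimately show False using k\<tau>(1) by simp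
qed

section \<open>Geodesics that are defined for all times\<close>

locale complete_riem = conn_riem R for R :: "('m::{t2_space, second_countable_topology}, 'e::euclidean_space) riemannian" +
  assumes complete: "Metric_space.mcomplete UNIV (riem_dist R)"
begin

text \<open>Because the speed is constant, the points at times tending to \<open>b\<close> form a
  Cauchy sequence, and in a chart at its limit their velocities are bounded. States near an
  accumulation point have a common existence time \<open>e\<close>; one that is reached later than
  \<open>b - e\<close> can be continued past \<open>b\<close>.\<close>

lemma geodesic_extends:
  assumes c: "c \<in> charts R" "x \<in> chart_dom c" and b: "b > 0"
    and G: "\<And>T. 0 < T \<Longrightarrow> T < b \<Longrightarrow> geo {0..T} (G T) (W T) \<and> G T 0 = x \<and> W T 0 c = u"
  shows "\<exists>T>b. \<exists>\<gamma> V. geo {0..T} \<gamma> V \<and> \<gamma> 0 = x \<and> V 0 c = u"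
proof -
  define N where "N = sqrt (metric_at R c (coord c x) u u)"
  \<comment> \<open>Times increasing to \<open>b\<close>; the shift by \<open>2\<close> keeps all of
    them positive.\<close>
  define \<tau> where "\<tau> n = b * (1 - 1 / real (n + 2))" for n
  have \<tau>: "0 < \<tau> n" "\<tau> n < b" for n
  proof -
    show "0 < \<tau> n" unfolding \<tau>_def using b by (intro mult_pos_pos) auto
    have "b * (1 / real (n + 2)) > 0" using b by simp
    then show "\<tau> n < b" unfolding \<tau>_def right_diff_distrib by simp
  qed
  have \<tau>mono: "\<tau> m < \<tau> n" if "m < n" for m n
    unfolding \<tau>_def using b that by (intro mult_strict_left_mono diff_strict_left_mono divide_strict_left_mono) auto
  have "(\<lambda>n. b * (1 - 1 / real (n + 2))) \<longlonglongrightarrow> b * (1 - 0)"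
    by (intro tendsto_intros LIMSEQ_ignore_initial_segment[OF lim_1_over_n, of 2])
  then have \<tau>lim: "\<tau> \<longlonglongrightarrow> b" by (simp add: \<tau>_def[abs_def])
  have agree: "G T t = G T' t \<and> (\<forall>k\<in>charts R. G T t \<in> chart_dom k \<longrightarrow> W T t k = W T' t k)"
    if "0 < T" "T \<le> T'" "T' < b" "t \<in> {0..T}" for T T' t
  proof (rule geo_unique[of 0 T _ _ _ _ 0 c])
    show "geo {0..T} (G T) (W T)" using G that by auto
    show "geo {0..T} (G T') (W T')" by (rule geo_subset[of "{0..T'}"]) (use G[of T'] that in auto)
  qed (use G[of T] G[of T'] that c in auto)
  define \<sigma> where "\<sigma> n = G (\<tau> n) (\<tau> n)" for n
  have \<sigma>: "\<sigma> m = G (\<tau> n) (\<tau> m)" if "m \<le> n" for m n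
  proof -
    have "\<tau> m \<le> \<tau> n" using \<tau>mono[of m n] that by (cases "m = n") auto
    then show ?thesis using agree[of "\<tau> m" "\<tau> n" "\<tau> m"] \<tau>[of m] \<tau>[of n] by (auto simp: \<sigma>_def)
  qed
  have Wn: "metric_at R k (coord k (G T t)) (W T t k) (W T t k) = N\<^sup>2"
    if "0 < T" "T < b" "t \<in> {0..T}" "k \<in> charts R" "G T t \<in> chart_dom k" for T t k
  proof -
    have "metric_at R k (coord k (G T t)) (W T t k) (W T t k) = metric_at R c (coord c (G T 0)) (W T 0 c) (W T 0 c)"
      by (rule geo_constant_speed[of 0 T]) (use G[of T] that c in auto)
    then show ?thesis using G[of T] that metric_nonneg[OF c] by (simp add: N_def)
  qed
  have N0: "N \<ge> 0" using metric_nonneg[OF c] by (simp add: N_def)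
  have dist: "riem_dist R (\<sigma> m) (\<sigma> n) \<le> N * \<bar>\<tau> n - \<tau> m\<bar>" if "m < n" for m n
  proof -
    obtain k where k: "k \<in> charts R" "G (\<tau> n) (\<tau> n) \<in> chart_dom k" using chart_exists by blast
    have "riem_dist R (G (\<tau> n) (\<tau> m)) (G (\<tau> n) (\<tau> n)) \<le> sqrt (metric_at R k (coord k (G (\<tau> n) (\<tau> n))) (W (\<tau> n) (\<tau> n) k) (W (\<tau> n) (\<tau> n) k)) * (\<tau> n - \<tau> m)"
      by (rule geo_length[of _ _ _ "W (\<tau> n)"], rule geo_subset[of "{0..\<tau> n}"]) (use G[of "\<tau> n"] \<tau>[of n] \<tau>[of m] \<tau>mono[OF that] k in auto)
    then show ?thesis using \<sigma>[of m n] \<sigma>[of n n] Wn[of "\<tau> n" "\<tau> n" k] \<tau>[of n] k N0 \<tau>mono[OF that] that by simp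
  qed
  have dist': "riem_dist R (\<sigma> m) (\<sigma> n) \<le> N * \<bar>\<tau> n - \<tau> m\<bar>" for m n
    using dist[of m n] dist[of n m] dist_self[of "\<sigma> m"] dist_sym[of "\<sigma> m" "\<sigma> n"] by (cases m n rule: linorder_cases) (auto simp: abs_minus_commute)
  obtain q where q: "\<sigma> \<longlonglongrightarrow> q"
  proof (rule complete_limit[OF complete, of \<sigma>])
    fix e :: real assume e: "e > 0"
    have "Cauchy \<tau>" using \<tau>lim LIMSEQ_imp_Cauchy by blast
    then obtain M where M: "\<And>m n. m \<ge> M \<Longrightarrow> n \<ge> M \<Longrightarrow> dist (\<tau> m) (\<tau> n) < e / (N + 1)"
      using e N0 unfolding Cauchy_def by (metis divide_pos_pos add_nonneg_pos zero_less_one)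
    show "\<exists>M. \<forall>m\<ge>M. \<forall>n\<ge>M. riem_dist R (\<sigma> m) (\<sigma> n) < e"
    proof (intro exI[of _ M] allI impI)
      fix m n assume mn: "m \<ge> M" "n \<ge> M"
      have "N * \<bar>\<tau> n - \<tau> m\<bar> \<le> N * (e / (N + 1))"
        using M[OF mn] N0 by (intro mult_left_mono) (auto simp: dist_real_def abs_minus_commute)
      also have "\<dots> < e" using e N0 by (simp add: field_simps)
      finally show "riem_dist R (\<sigma> m) (\<sigma> n) < e" using dist'[of m n] by simp
    qed
  qed blast
  obtain k r0 m0 M0 where k: "k \<in> charts R" "q \<in> chart_dom k" "r0 > 0" "cball (coord k q) r0 \<subseteq> chart_im k" "m0 > 0"
    "\<And>p u. p \<in> cball (coord k q) r0 \<Longrightarrow> m0 * norm u \<le> sqrt (metric_at R k p u u)"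
    using local_comparison[of q] by metis
  have ev1: "\<forall>\<^sub>F n in sequentially. \<sigma> n \<in> chart_dom k" using topological_tendstoD[OF q chart_open(1)[OF k(1)] k(2)] .
  have ck: "(\<lambda>n. coord k (\<sigma> n)) \<longlonglongrightarrow> coord k q"
    using continuous_on_tendsto_compose[OF coord_continuous[OF k(1)] q k(2) ev1] .
  then have ev2: "\<forall>\<^sub>F n in sequentially. coord k (\<sigma> n) \<in> ball (coord k q) r0"
    using topological_tendstoD[OF ck open_ball] k(3) by auto
  define w where "w n = W (\<tau> n) (\<tau> n) k" for n
  obtain n0 where n0: "\<And>n. n \<ge> n0 \<Longrightarrow> \<sigma> n \<in> chart_dom k \<and> coord k (\<sigma> n) \<in> ball (coord k q) r0"
    using eventually_conj[OF ev1 ev2] unfolding eventually_sequentially by blast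
  have wb: "norm (w n) \<le> N / m0" if "n \<ge> n0" for n
  proof -
    have "m0 * norm (w n) \<le> sqrt (metric_at R k (coord k (\<sigma> n)) (w n) (w n))"
      using k(6) n0[OF that] by auto
    also have "\<dots> = N" using Wn[of "\<tau> n" "\<tau> n" k] n0[OF that] k(1) \<tau>[of n] N0 by (simp add: \<sigma>_def w_def)
    finally show ?thesis using k(5) by (simp add: field_simps)
  qed
  have "bounded (range (\<lambda>n. w (n + n0)))" by (rule boundedI[of _ "N / m0"]) (use wb in auto)
  then obtain w0 \<rho> where \<rho>: "strict_mono \<rho>" "((\<lambda>n. w (n + n0)) \<circ> \<rho>) \<longlonglongrightarrow> w0"
    using bounded_imp_convergent_subsequence by blast
  define \<nu> where "\<nu> n = \<rho> n + n0" for n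
  have \<nu>: "filterlim \<nu> sequentially sequentially" unfolding \<nu>_def
    using filterlim_subseq[OF \<rho>(1)] by (rule filterlim_at_top_mono) simp
  have l1: "(\<lambda>n. coord k (\<sigma> (\<nu> n))) \<longlonglongrightarrow> coord k q" using ck \<nu> by (rule filterlim_compose)
  have l2: "(\<lambda>n. w (\<nu> n)) \<longlonglongrightarrow> w0" using \<rho>(2) by (simp add: comp_def \<nu>_def)
  have l3: "(\<lambda>n. \<tau> (\<nu> n)) \<longlonglongrightarrow> b" using \<tau>lim \<nu> by (rule filterlim_compose)
  have qi: "coord k q \<in> chart_im k" using k by auto
  obtain r e where re: "r > 0" "e > 0" "\<And>p u. (p, u) \<in> ball (coord k q, w0) r \<Longrightarrow>
     p \<in> chart_im k \<and> (\<exists>\<gamma> V. geo {-e..e} \<gamma> V \<and> \<gamma> 0 = chart_inv k p \<and> V 0 k = u)"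
    using local_geodesics[OF k(1) qi, of w0] by metis
  have "\<forall>\<^sub>F n in sequentially. (coord k (\<sigma> (\<nu> n)), w (\<nu> n)) \<in> ball (coord k q, w0) r"
    using topological_tendstoD[OF tendsto_Pair[OF l1 l2] open_ball] re(1) by auto
  moreover have "\<forall>\<^sub>F n in sequentially. \<tau> (\<nu> n) > b - e"
    using order_tendstoD(1)[OF l3, of "b - e"] re(2) by auto
  ultimately obtain j where j: "(coord k (\<sigma> (\<nu> j)), w (\<nu> j)) \<in> ball (coord k q, w0) r" "\<tau> (\<nu> j) > b - e"
    using eventually_happens'[OF sequentially_bot] eventually_conj by (metis (no_types, lifting))
  define n where "n = \<nu> j"
  have nn: "n \<ge> n0" by (simp add: n_def \<nu>_def)
  note sd = n0[OF nn, THEN conjunct1]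
  obtain \<gamma>' V' where g': "geo {-e..e} \<gamma>' V'" "\<gamma>' 0 = \<sigma> n" "V' 0 k = w n"
    using re(3)[OF j(1)] sd k(1) by (auto simp: n_def)
  let ?T = "\<tau> n"
  \<comment> \<open>The start of an overlap of positive length, as \<open>geo_glue\<close>
    demands.\<close>
  define lo where "lo = max 0 (?T - e)"
  have lo: "0 \<le> lo" "lo < ?T" using re(2) \<tau>[of n] by (auto simp: lo_def)
  have "geo {lo..?T + e} (\<lambda>t. \<gamma>' (1 * t + (-?T))) (\<lambda>t c. 1 *\<^sub>R V' (1 * t + (-?T)) c)"
    by (rule geo_affine[OF g'(1)]) (auto simp: lo_def)
  then have g2: "geo {lo..?T + e} (\<lambda>t. \<gamma>' (t - ?T)) (\<lambda>t. V' (t - ?T))" by simp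
  have g1: "geo {0..?T} (G ?T) (W ?T)" "G ?T 0 = x" "W ?T 0 c = u" using G[of ?T] \<tau>[of n] by auto
  have un: "G ?T t = \<gamma>' (t - ?T) \<and> (\<forall>k\<in>charts R. G ?T t \<in> chart_dom k \<longrightarrow> W ?T t k = V' (t - ?T) k)" if "t \<in> {lo..?T}" for t
  proof (rule geo_unique[of lo ?T "G ?T" "W ?T" "\<lambda>t. \<gamma>' (t - ?T)" "\<lambda>t. V' (t - ?T)" ?T k])
    show "geo {lo..?T} (G ?T) (W ?T)" by (rule geo_subset[OF g1(1)]) (use lo in auto)
    show "geo {lo..?T} (\<lambda>t. \<gamma>' (t - ?T)) (\<lambda>t. V' (t - ?T))" by (rule geo_subset[OF g2]) (use re in auto)
  qed (use lo g' sd k that in \<open>auto simp: \<sigma>_def w_def\<close>)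
  have "geo {0..?T + e} (\<lambda>t. if t \<le> ?T then G ?T t else \<gamma>' (t - ?T)) (\<lambda>t. if t \<le> ?T then W ?T t else V' (t - ?T))"
    by (rule geo_glue[OF g1(1) g2]) (use lo re un in auto)
  then show ?thesis using j(2) g1 \<tau>[of n] unfolding n_def[symmetric]
    by (intro exI[of _ "?T + e"] conjI exI[of _ "\<lambda>t. if t \<le> ?T then G ?T t else \<gamma>' (t - ?T)"]
        exI[of _ "\<lambda>t. if t \<le> ?T then W ?T t else V' (t - ?T)"]) auto
qed

lemma global_geodesic:
  assumes c: "c \<in> charts R" "x \<in> chart_dom c"
  shows "\<exists>\<gamma> V. geo {0..} \<gamma> V \<and> \<gamma> 0 = x \<and> V 0 c = u"
proof -
  define Q where "Q T \<longleftrightarrow> (\<exists>\<gamma> V. geo {0..T} \<gamma> V \<and> \<gamma> 0 = x \<and> V 0 c = u)" for T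
  have mono: "Q T'" if "Q T" "T' \<le> T" for T T'
  proof -
    have "{0..T'} \<subseteq> {0..T}" using that by auto
    then show ?thesis using \<open>Q T\<close> geo_subset unfolding Q_def by blast
  qed
  have pi: "coord c x \<in> chart_im c" using c by auto
  have "\<exists>e>0. Q e"
  proof -
    obtain r e where re: "r > 0" "e > 0" "\<And>p v. (p, v) \<in> ball (coord c x, u) r \<Longrightarrow>
     p \<in> chart_im c \<and> (\<exists>\<gamma> V. geo {-e..e} \<gamma> V \<and> \<gamma> 0 = chart_inv c p \<and> V 0 c = v)"
      using local_geodesics[OF c(1) pi, of u] by metis
    then obtain \<gamma> V where "geo {-e..e} \<gamma> V" "\<gamma> 0 = x" "V 0 c = u" using re(3)[of "coord c x" u] c by auto
    moreover have "{0..e} \<subseteq> {-e..e}" using re by auto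
    ultimately show ?thesis unfolding Q_def using re(2) geo_subset by blast
  qed
  then obtain e where e: "e > 0" "Q e" by blast
  have "Q T" for T
  proof (rule ccontr)
    assume nT: "\<not> Q T"
    define b where "b = Sup (Collect Q)"
    have bdd: "bdd_above (Collect Q)" by (rule bdd_aboveI[of _ T]) (metis mem_Collect_eq nT mono linear)
    have b: "e \<le> b" unfolding b_def using e(2) bdd by (intro cSup_upper) auto
    have "Q T" if "T < b" for T
    proof -
      obtain T' where "Q T'" "T < T'" using \<open>T < b\<close> less_cSup_iff[OF _ bdd] e(2) unfolding b_def by blast
      then show ?thesis using mono by simp
    qed
    then have "\<forall>T. \<exists>\<gamma> V. T < b \<longrightarrow> geo {0..T} \<gamma> V \<and> \<gamma> 0 = x \<and> V 0 c = u" unfolding Q_def by blast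
    then obtain G W where "\<And>T. T < b \<Longrightarrow> geo {0..T} (G T) (W T) \<and> G T 0 = x \<and> W T 0 c = u" by metis
    then obtain T where "T > b" "Q T" using geodesic_extends[OF c, of b G W u] b e(1) unfolding Q_def by auto
    then show False using cSup_upper[of T "Collect Q"] bdd by (auto simp: b_def)
  qed
  then obtain G W where G: "\<And>T. geo {0..T} (G T) (W T)" "\<And>T. G T 0 = x" "\<And>T. W T 0 c = u" unfolding Q_def by metis
  have agree: "G T t = G T' t \<and> (\<forall>k\<in>charts R. G T t \<in> chart_dom k \<longrightarrow> W T t k = W T' t k)"
    if "0 < T" "T \<le> T'" "t \<in> {0..T}" for T T' t
  proof (rule geo_unique[of 0 T _ _ _ _ 0 c])
    show "geo {0..T} (G T) (W T)" using G that by auto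
    show "geo {0..T} (G T') (W T')" by (rule geo_subset[OF G(1)[of T']]) (use that in auto)
  qed (use G that c in auto)
  \<comment> \<open>Taking \<open>G (t + 1)\<close> at time \<open>t\<close> leaves room to the
    right of \<open>t\<close> and avoids a degenerate interval for \<open>t = 0\<close>.\<close>
  let ?g = "\<lambda>t. G (t + 1) t"
  let ?V = "\<lambda>t. W (t + 1) t"
  have eq: "?g s = G (T + 2) s" "\<And>k. k \<in> charts R \<Longrightarrow> G (T + 2) s \<in> chart_dom k \<Longrightarrow> ?V s k = W (T + 2) s k"
    if "s \<in> {0..} \<inter> {..<T + 1}" for s T
    using agree[of "s + 1" "T + 2" s] that by auto
  have "continuous (at t within {0..}) ?g \<and> (\<forall>k. k \<in> charts R \<longrightarrow> ?g t \<in> chart_dom k \<longrightarrow>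
     ((coord k \<circ> ?g) has_vector_derivative ?V t k) (at t within {0..}) \<and>
     ((\<lambda>s. ?V s k) has_vector_derivative - chr (metric_at R k) (coord k (?g t)) (?V t k) (?V t k)) (at t within {0..}))"
    if t: "t \<in> {0..}" for t
  proof -
    have I: "{0..} \<inter> {..<t + 1} = {0..t + 2} \<inter> {..<t + 1}" by auto
    show ?thesis
      using geo_cong_local[where I="{0..}" and J="{0..t + 2}" and W="{..<t + 1}" and t=t and \<delta>="?g" and U="?V", OF _ _ _ _ I G(1) eq] t by auto
  qed
  then have "geo {0..} ?g ?V" unfolding geo_def continuous_on_eq_continuous_within by blast
  then show ?thesis using G by (intro exI[of _ ?g] exI[of _ ?V]) auto
qed

end

section \<open>The exponential map\<close>

text \<open>The chart \<open>c0\<close> identifies the tangent space at \<open>x0\<close> with the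
  model space, so that the exponential map becomes a map on the model space.\<close>

locale exp_map = complete_riem R for R :: "('m::{t2_space, second_countable_topology}, 'e::euclidean_space) riemannian" +
  fixes c0 :: "('m, 'e) chart" and x0 :: 'm
  assumes c0: "c0 \<in> charts R" "x0 \<in> chart_dom c0"
begin

definition gV :: "'e \<Rightarrow> (real \<Rightarrow> 'm) \<times> (real \<Rightarrow> ('m, 'e) chart \<Rightarrow> 'e)" where
  "gV u = (SOME gV. geo {0..} (fst gV) (snd gV) \<and> fst gV 0 = x0 \<and> snd gV 0 c0 = u)"

definition geod :: "'e \<Rightarrow> real \<Rightarrow> 'm" where "geod u = fst (gV u)"
definition vel :: "'e \<Rightarrow> real \<Rightarrow> ('m, 'e) chart \<Rightarrow> 'e" where "vel u = snd (gV u)"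

lemma geod: "geo {0..} (geod u) (vel u)" "geod u 0 = x0" "vel u 0 c0 = u"
proof -
  obtain \<gamma> V where "geo {0..} \<gamma> V \<and> \<gamma> 0 = x0 \<and> V 0 c0 = u" using global_geodesic[OF c0] by blast
  then have "\<exists>gV. geo {0..} (fst gV) (snd gV) \<and> fst gV 0 = x0 \<and> snd gV 0 c0 = u" by (intro exI[of _ "(\<gamma>, V)"]) simp
  from someI_ex[OF this] show "geo {0..} (geod u) (vel u)" "geod u 0 = x0" "vel u 0 c0 = u"
    unfolding geod_def vel_def gV_def by blast+
qed

lemma geod_sub: "J \<subseteq> {0..} \<Longrightarrow> geo J (geod u) (vel u)"
  using geo_subset[OF geod(1)] .

lemma geod_unique:
  assumes g: "geo {0..T} \<gamma> V" and T: "T > 0" and i: "\<gamma> 0 = x0" "V 0 c0 = u" and t: "t \<in> {0..T}"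
  shows "\<gamma> t = geod u t \<and> (\<forall>c\<in>charts R. \<gamma> t \<in> chart_dom c \<longrightarrow> V t c = vel u t c)"
  by (rule geo_unique[of 0 T \<gamma> V "geod u" "vel u" 0 c0 t]) (use T i t c0 geod g geod_sub[of "{0..T}"] in auto)

lemma geod_scale:
  assumes l: "l \<ge> 0" and t: "t \<ge> 0"
  shows "geod (l *\<^sub>R u) t = geod u (l * t)" "c \<in> charts R \<Longrightarrow> geod u (l * t) \<in> chart_dom c \<Longrightarrow> vel (l *\<^sub>R u) t c = l *\<^sub>R vel u (l * t) c"
proof -
  have "geo {0..t+1} (\<lambda>t. geod u (l * t + 0)) (\<lambda>t c. l *\<^sub>R vel u (l * t + 0) c)"
    by (rule geo_affine[OF geod(1)]) (use l in auto)
  then have "geo {0..t+1} (\<lambda>t. geod u (l * t)) (\<lambda>t c. l *\<^sub>R vel u (l * t) c)" by simp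
  from geod_unique[OF this, of "l *\<^sub>R u" t] t geod[of u]
  show "geod (l *\<^sub>R u) t = geod u (l * t)" "c \<in> charts R \<Longrightarrow> geod u (l * t) \<in> chart_dom c \<Longrightarrow> vel (l *\<^sub>R u) t c = l *\<^sub>R vel u (l * t) c"
    by auto
qed

definition E :: "'e \<Rightarrow> 'm" where "E u = geod u 1"

lemma geod_E: "t \<ge> 0 \<Longrightarrow> geod u t = E (t *\<^sub>R u)"
  unfolding E_def using geod_scale(1)[of t 1 u] by simp

definition st :: "('m, 'e) chart \<Rightarrow> real \<Rightarrow> 'e \<Rightarrow> 'e \<times> 'e" where
  "st c t u = (coord c (geod u t), vel u t c)"

text \<open>Position and velocity are taken together because the flow that carries this property
  along a geodesic acts on both.\<close>

definition smooth_at :: "('m, 'e) chart \<Rightarrow> real \<Rightarrow> 'e \<Rightarrow> bool" where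
  "smooth_at c t u0 \<longleftrightarrow> (\<exists>d>0. (\<forall>u\<in>ball u0 d. geod u t \<in> chart_dom c) \<and> C1_on (ball u0 d) (st c t))"

lemma smooth_at_change:
  assumes c: "c \<in> charts R" "c' \<in> charts R" and t: "t \<ge> 0" and s: "smooth_at c t u0" and d: "geod u0 t \<in> chart_dom c'"
  shows "smooth_at c' t u0"
proof -
  let ?A = "coord c ` (chart_dom c \<inter> UNIV \<inter> id -` chart_dom c')"
  interpret I: isometry_patch "chart_im c" "chart_im c'" "metric_at R c" "metric_at R c'" ?A "coord_rep c c' id"
    by (rule isometry_patch_charts[OF riem_axioms riem_axioms local_iso_id c])
  obtain d where d1: "d > 0" "\<And>u. u \<in> ball u0 d \<Longrightarrow> geod u t \<in> chart_dom c" "C1_on (ball u0 d) (st c t)"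
    using s unfolding smooth_at_def by blast
  have "continuous_on (ball u0 d) (\<lambda>u. fst (st c t u))" by (intro continuous_intros C1_on_continuous d1(3))
  then have "open (ball u0 d \<inter> (\<lambda>u. fst (st c t u)) -` ?A)" using I.open_A continuous_open_preimage open_ball by blast
  moreover have "u0 \<in> ball u0 d \<inter> (\<lambda>u. fst (st c t u)) -` ?A" using d1 d by (auto simp: st_def)
  ultimately obtain d2 where d2: "d2 > 0" "ball u0 d2 \<subseteq> ball u0 d \<inter> (\<lambda>u. fst (st c t u)) -` ?A"
    using open_contains_ball by blast
  have A: "fst (st c t u) \<in> ?A" "u \<in> ball u0 d" if "u \<in> ball u0 d2" for u using d2(2) that by auto
  have dc': "geod u t \<in> chart_dom c'" if u: "u \<in> ball u0 d2" for u
  proof -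
    obtain y where "y \<in> chart_dom c" "y \<in> chart_dom c'" "coord c (geod u t) = coord c y" using A(1)[OF u] by (auto simp: st_def)
    then show ?thesis using d1(2)[OF A(2)[OF u]] chart_inv_coord[OF c(1)] by metis
  qed
  have "t islimpt {t..t + 1}" by (simp add: islimpt_Icc)
  then have "t islimpt {0..}" by (rule islimpt_subset) (use t in auto)
  then have nt: "at t within {0..} \<noteq> bot" by (simp add: trivial_limit_within)
  have eq: "(coord_rep c c' id (fst (st c t u)), I.D (fst (st c t u)) (snd (st c t u))) = st c' t u" if "u \<in> ball u0 d2" for u
    using geo_change[OF geod(1) c _ d1(2)[OF A(2)[OF that]] dc'[OF that] nt] t
      coord_rep_coord[OF riem_axioms c(1) d1(2)[OF A(2)[OF that]], where c'=c' and h=id]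
    by (simp add: st_def I.D_def)
  have "C1_on (ball u0 d2) (\<lambda>u. (\<lambda>z. (coord_rep c c' id (fst z), I.D (fst z) (snd z))) (st c t u))"
    by (rule C1_on_compose[OF C1_on_subset[OF d1(3)] I.state_map_C1]) (use d2 A in \<open>auto simp: mem_Times_iff\<close>)
  then have "C1_on (ball u0 d2) (st c' t)"
    by (rule C1_on_cong[rotated 2]) (use eq in auto)
  then show ?thesis unfolding smooth_at_def using d2(1) dc' by blast
qed

text \<open>Propagation of smooth dependence on the initial velocity along a chart; the derivative
  solves the linearized geodesic equation.\<close>

lemma smooth_at_window:
  assumes c: "c \<in> charts R" and t0: "t0 \<ge> 0" and d: "geod u0 t0 \<in> chart_dom c"
  shows "\<exists>\<epsilon>>0. (\<forall>s\<ge>0. \<bar>s - t0\<bar> < \<epsilon> \<longrightarrow> geod u0 s \<in> chart_dom c) \<and>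
    (\<forall>s\<ge>0. \<bar>s - t0\<bar> < \<epsilon> \<longrightarrow> smooth_at c s u0 \<longrightarrow>
      (\<exists>D. \<forall>s'\<ge>0. \<bar>s' - t0\<bar> < \<epsilon> \<longrightarrow> smooth_at c s' u0 \<and> (st c s' has_derivative D s') (at u0) \<and>
       (\<forall>w. ((\<lambda>s. D s w) has_vector_derivative metric_patch.dspray (metric_at R c) (st c s' u0) (D s' w)) (at s' within {0..}))))"
proof -
  interpret P: metric_patch "chart_im c" "metric_at R c" by (rule patch[OF c])
  let ?z0 = "st c t0 u0"
  have W: "open (chart_im c \<times> (UNIV::'e set))" "?z0 \<in> chart_im c \<times> UNIV"
    using chart_open(2)[OF c] d by (auto simp: open_Times st_def)
  obtain r e \<phi> \<psi> where f: "r > 0" "e > 0" "ball ?z0 r \<subseteq> chart_im c \<times> UNIV"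
    "\<And>z. z \<in> ball ?z0 r \<Longrightarrow> \<phi> z 0 = z"
    "\<And>z t. z \<in> ball ?z0 r \<Longrightarrow> t \<in> {-e..e} \<Longrightarrow> \<phi> z t \<in> chart_im c \<times> UNIV \<and> (\<phi> z has_vector_derivative P.spray (\<phi> z t)) (at t within {-e..e})"
    "\<And>t. t \<in> {-e..e} \<Longrightarrow> C1D (ball ?z0 r) (\<lambda>z. \<phi> z t) (\<lambda>z w. \<psi> z w t)"
    "\<And>z w t. z \<in> ball ?z0 r \<Longrightarrow> t \<in> {-e..e} \<Longrightarrow> (\<psi> z w has_vector_derivative P.dspray (\<phi> z t) (\<psi> z w t)) (at t within {-e..e})"
    by (rule local_flow[OF P.spray_C1D W]) blast
  have t0': "t0 \<in> {0..}" using t0 by simp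
  note G = geoD[OF geod(1) c t0' d]
  have cz: "continuous (at t0 within {0..}) (\<lambda>s. st c s u0)"
    unfolding st_def using G(4,5) by (auto intro!: continuous_intros simp: comp_def)
  obtain e1 where e1: "e1 > 0" "\<And>s. s \<in> {0..} \<Longrightarrow> \<bar>s - t0\<bar> < e1 \<Longrightarrow> geod u0 s \<in> chart_dom c"
    using geo_stays[OF geod(1) t0' chart_open(1)[OF c] d] by metis
  have "st c t0 u0 \<in> ball ?z0 r" using f(1) by simp
  then obtain e2 where e2: "e2 > 0" "\<And>s. s \<in> {0..} \<Longrightarrow> dist s t0 < e2 \<Longrightarrow> st c s u0 \<in> ball ?z0 r"
    using continuous_within_nbhd[OF cz open_ball] by metis
  define \<epsilon> where "\<epsilon> = Min {e1, e2, e/2}"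
  have eps: "\<epsilon> > 0" "\<epsilon> \<le> e1" "\<epsilon> \<le> e2" "\<epsilon> \<le> e/2" using e1 e2 f by (auto simp: \<epsilon>_def)
  have main: "\<exists>D. \<forall>s'\<ge>0. \<bar>s' - t0\<bar> < \<epsilon> \<longrightarrow> smooth_at c s' u0 \<and> (st c s' has_derivative D s') (at u0) \<and>
       (\<forall>w. ((\<lambda>s. D s w) has_vector_derivative P.dspray (st c s' u0) (D s' w)) (at s' within {0..}))"
    if s: "s \<ge> 0" "\<bar>s - t0\<bar> < \<epsilon>" "smooth_at c s u0" for s
  proof -
    obtain d0 where d0: "d0 > 0" "\<And>u. u \<in> ball u0 d0 \<Longrightarrow> geod u s \<in> chart_dom c" "C1_on (ball u0 d0) (st c s)"
      using s(3) unfolding smooth_at_def by blast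
    have sb: "st c s u0 \<in> ball ?z0 r" using e2(2)[of s] s eps by (auto simp: dist_real_def)
    have "open (ball u0 d0 \<inter> st c s -` ball ?z0 r)"
      using C1_on_continuous[OF d0(3)] continuous_open_preimage open_ball by blast
    moreover have "u0 \<in> ball u0 d0 \<inter> st c s -` ball ?z0 r" using d0 sb by auto
    ultimately obtain d1 where d1: "d1 > 0" "ball u0 d1 \<subseteq> ball u0 d0 \<inter> st c s -` ball ?z0 r"
      using open_contains_ball by blast
    have in0: "u \<in> ball u0 d0" "st c s u \<in> ball ?z0 r" if "u \<in> ball u0 d1" for u using d1(2) that by auto
    \<comment> \<open>By uniqueness of geodesics, the state at time \<open>t\<close> is the local
      flow applied to the state at time \<open>s\<close>, simultaneously for all initial velocities
      near \<open>u0\<close>. Differentiability in \<open>u\<close> then comes from the flow by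
      composition.\<close>
    have flow: "geod u t \<in> chart_dom c \<and> st c t u = \<phi> (st c s u) (t - s)" if u: "u \<in> ball u0 d1" and t: "t \<ge> 0" "\<bar>t - s\<bar> \<le> e" for u t
    proof -
      let ?z = "st c s u"
      have dd: "((\<lambda>s. fst (\<phi> ?z s)) has_vector_derivative snd (\<phi> ?z t)) (at t within {-e..e})"
         "((\<lambda>s. snd (\<phi> ?z s)) has_vector_derivative - chr (metric_at R c) (fst (\<phi> ?z t)) (snd (\<phi> ?z t)) (snd (\<phi> ?z t))) (at t within {-e..e})"
        if "t \<in> {-e..e}" for t
        using bounded_linear.has_vector_derivative[OF bounded_linear_fst] bounded_linear.has_vector_derivative[OF bounded_linear_snd]
         f(5)[OF in0(2)[OF u] that] unfolding P.spray_def by fastforce+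
      obtain V where V: "geo {-e..e} (\<lambda>t. chart_inv c (fst (\<phi> ?z t))) V" "\<And>t. V t c = snd (\<phi> ?z t)"
        by (rule geo_from_chart[OF c _ dd]) (use f(5)[OF in0(2)[OF u]] in \<open>auto simp: mem_Times_iff\<close>)
      let ?J = "{max 0 (s - e)..s + e}"
      have g: "geo ?J (\<lambda>t. chart_inv c (fst (\<phi> ?z (t - s)))) (\<lambda>t. V (t - s))"
        using geo_affine[OF V(1), of ?J 1 "-s"] by simp
      have "chart_inv c (fst (\<phi> ?z (t - s))) = geod u t \<and>
         (\<forall>k\<in>charts R. chart_inv c (fst (\<phi> ?z (t - s))) \<in> chart_dom k \<longrightarrow> V (t - s) k = vel u t k)"
      proof (rule geo_unique[of "max 0 (s - e)" "s + e" "\<lambda>t. chart_inv c (fst (\<phi> ?z (t - s)))" "\<lambda>t. V (t - s)" "geod u" "vel u" s c t])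
        show "geo ?J (\<lambda>t. chart_inv c (fst (\<phi> ?z (t - s)))) (\<lambda>t. V (t - s))" by (rule g)
        show "geo ?J (geod u) (vel u)" by (rule geod_sub) auto
        show "chart_inv c (fst (\<phi> ?z (s - s))) = geod u s" "V (s - s) c = vel u s c"
          using f(4)[OF in0(2)[OF u]] d0(2)[OF in0(1)[OF u]] c by (auto simp: V st_def)
        then show "chart_inv c (fst (\<phi> ?z (s - s))) \<in> chart_dom c" using d0(2)[OF in0(1)[OF u]] by simp
      qed (use s t f(2) c in auto)
      moreover have "fst (\<phi> ?z (t - s)) \<in> chart_im c" using f(5)[OF in0(2)[OF u], of "t - s"] t by (auto simp: mem_Times_iff abs_le_iff)
      ultimately show ?thesis
        using chart_inv_dom[OF c, of "fst (\<phi> ?z (t - s))"] c coord_chart_inv[OF c, of "fst (\<phi> ?z (t - s))"] V(2)[of "t - s"]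
        by (auto simp: st_def prod_eq_iff)
    qed
    obtain Ds where Ds: "C1D (ball u0 d1) (st c s) Ds" using C1_on_subset[OF d0(3), of "ball u0 d1"] d1(2) unfolding C1_on_def by blast
    define D where "D t w = \<psi> (st c s u0) (Ds u0 w) (t - s)" for t w
    have u0: "u0 \<in> ball u0 d1" using d1 by simp
    show ?thesis
    proof (intro exI[of _ D] allI impI conjI)
      fix s' assume s': "s' \<ge> 0" "\<bar>s' - t0\<bar> < \<epsilon>"
      have ss: "\<bar>s' - s\<bar> < e" using s s' eps by auto
      then have se: "s' - s \<in> {-e..e}" by auto
      have "C1D (ball u0 d1) (\<lambda>u. \<phi> (st c s u) (s' - s)) (\<lambda>u w. \<psi> (st c s u) (Ds u w) (s' - s))"
        by (rule C1D_compose[OF Ds f(6)[OF se] in0(2)])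
      then have C1: "C1D (ball u0 d1) (st c s') (\<lambda>u w. \<psi> (st c s u) (Ds u w) (s' - s))"
        by (rule C1D_cong[rotated 2]) (use flow s' ss in auto)
      show "smooth_at c s' u0" unfolding smooth_at_def
        using d1(1) C1D_C1[OF C1] flow s' ss by (intro exI[of _ d1]) auto
      show "(st c s' has_derivative D s') (at u0)" using C1D_derivative[OF C1 u0] by (simp add: D_def[abs_def])
      fix w
      have sub: "(\<lambda>t. t - s) ` ({0..} \<inter> ball s' (e - \<bar>s' - s\<bar>)) \<subseteq> {-e..e}" by (auto simp: dist_real_def)
      have sh: "((\<lambda>t. t - s) has_vector_derivative 1) (at s' within {0..} \<inter> ball s' (e - \<bar>s' - s\<bar>))"
        by (auto intro!: derivative_eq_intros)
      have "((\<psi> (st c s u0) (Ds u0 w) \<circ> (\<lambda>t. t - s)) has_vector_derivative 1 *\<^sub>R P.dspray (\<phi> (st c s u0) (s' - s)) (D s' w))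
        (at s' within {0..} \<inter> ball s' (e - \<bar>s' - s\<bar>))"
        unfolding D_def by (rule vector_diff_chain_within[OF sh has_vector_derivative_within_subset[OF f(7)[OF in0(2)[OF u0] se] sub]])
      moreover have "at s' within {0..} \<inter> ball s' (e - \<bar>s' - s\<bar>) = at s' within {0..}"
        by (rule at_within_nhd[of _ "ball s' (e - \<bar>s' - s\<bar>)"]) (use ss in auto)
      moreover have "\<phi> (st c s u0) (s' - s) = st c s' u0" using flow[OF u0 s'(1)] ss by simp
      ultimately show "((\<lambda>s. D s w) has_vector_derivative P.dspray (st c s' u0) (D s' w)) (at s' within {0..})"
        by (simp add: D_def[abs_def] comp_def)
    qed
  qed
  show ?thesis using eps(1,2) e1(2) main by (intro exI[of _ \<epsilon>]) auto
qed

lemma smooth_at_zero: "smooth_at c0 0 u0"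
  unfolding smooth_at_def
proof (intro exI[of _ 1] conjI)
  have "C1_on (ball u0 1) (\<lambda>u. (coord c0 x0, u))"
    by (intro C1_on_Pair C1_on_const C1_on_linear_map bounded_linear_ident)
  then show "C1_on (ball u0 1) (st c0 0)" by (rule C1_on_cong[rotated 2]) (auto simp: st_def geod)
qed (use c0 geod in auto)

text \<open>The property is carried along the geodesic from time \<open>0\<close>. The predicate
  \<open>P\<close> leaves the chart open, since it may have to change on the way.\<close>

lemma smooth_all: "t \<ge> 0 \<Longrightarrow> c \<in> charts R \<Longrightarrow> geod u0 t \<in> chart_dom c \<Longrightarrow> smooth_at c t u0"
proof -
  assume t: "t \<ge> 0" and c: "c \<in> charts R" "geod u0 t \<in> chart_dom c"
  define P where "P t \<longleftrightarrow> (\<exists>c\<in>charts R. geod u0 t \<in> chart_dom c \<and> smooth_at c t u0)" for t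
  have "P t"
  proof (rule real_interval_chain[of P t t])
    show "P 0" unfolding P_def using c0 geod smooth_at_zero by (intro bexI[of _ c0]) auto
    fix t0 assume t0: "t0 \<in> {0..t}"
    obtain k where k: "k \<in> charts R" "geod u0 t0 \<in> chart_dom k" using chart_exists by blast
    obtain \<epsilon> where eps: "\<epsilon> > 0" "\<And>s. s \<ge> 0 \<Longrightarrow> \<bar>s - t0\<bar> < \<epsilon> \<Longrightarrow> geod u0 s \<in> chart_dom k"
      "\<And>s s'. s \<ge> 0 \<Longrightarrow> \<bar>s - t0\<bar> < \<epsilon> \<Longrightarrow> smooth_at k s u0 \<Longrightarrow> s' \<ge> 0 \<Longrightarrow> \<bar>s' - t0\<bar> < \<epsilon> \<Longrightarrow> smooth_at k s' u0"
      using smooth_at_window[OF k(1) _ k(2)] t0 by (smt (verit) atLeastAtMost_iff)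
    show "\<exists>e>0. \<forall>s\<in>{0..t}. \<forall>s'\<in>{0..t}. \<bar>s - t0\<bar> < e \<longrightarrow> \<bar>s' - t0\<bar> < e \<longrightarrow> P s \<longrightarrow> P s'"
    proof (intro exI[of _ \<epsilon>] conjI ballI impI)
      fix s s' assume s: "s \<in> {0..t}" "s' \<in> {0..t}" "\<bar>s - t0\<bar> < \<epsilon>" "\<bar>s' - t0\<bar> < \<epsilon>" "P s"
      then obtain k' where "k' \<in> charts R" "geod u0 s \<in> chart_dom k'" "smooth_at k' s u0" unfolding P_def by blast
      then have "smooth_at k s u0" using smooth_at_change[OF _ k(1)] eps(2)[of s] s by auto
      then have "smooth_at k s' u0" using eps(3)[of s s'] s by auto
      then show "P s'" unfolding P_def using k(1) eps(2)[of s'] s by auto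
    qed (use eps in auto)
  qed (use t in auto)
  then show "smooth_at c t u0" unfolding P_def using smooth_at_change c t by blast
qed

end

context metric_patch
begin

text \<open>Positivity of the denominator of the sectional curvature.\<close>

lemma cauchy_schwarz_strict:
  assumes p: "p \<in> U" and uv: "u \<noteq> v" "independent {u, v}"
  shows "(g p u v)\<^sup>2 < g p u u * g p v v"
proof -
  have v0: "v \<noteq> 0" using uv dependent_zero by blast
  define b where "b = g p v v"
  have b: "b > 0" using pos[OF p v0] by (simp add: b_def)
  have "b *\<^sub>R u - g p u v *\<^sub>R v \<noteq> 0"
  proof
    assume "b *\<^sub>R u - g p u v *\<^sub>R v = 0"
    then have "u = (g p u v / b) *\<^sub>R v" using b
      by (metis (no_types, lifting) divideR_right divide_inverse_commute eq_iff_diff_eq_0 less_irrefl scaleR_scaleR)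
    then have "u \<in> span {v}" by (auto simp: span_singleton)
    then show False using uv by (auto simp: independent_insert)
  qed
  then have "0 < g p (b *\<^sub>R u - g p u v *\<^sub>R v) (b *\<^sub>R u - g p u v *\<^sub>R v)" by (rule pos[OF p])
  also have "\<dots> = b * (b * g p u u - (g p u v)\<^sup>2)"
    by (simp add: bilinear_lsub[OF bilinear_g[OF p]] bilinear_rsub[OF bilinear_g[OF p]] bilinear_lmul[OF bilinear_g[OF p]]
      bilinear_rmul[OF bilinear_g[OF p]] sym[OF p, of v u] b_def[symmetric] power2_eq_square algebra_simps)
  finally show ?thesis using b by (simp add: zero_less_mult_iff b_def mult.commute)
qed

end

lemma (in riem) npc_curv:
  assumes "nonpositively_curved R" and c: "c \<in> charts R" and p: "p \<in> chart_im c"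
  shows "metric_at R c p (curv (metric_at R c) p u v v) u \<le> 0"
proof -
  interpret P: metric_patch "chart_im c" "metric_at R c" by (rule patch[OF c])
  show ?thesis
  proof (cases "u \<noteq> v \<and> independent {u, v}")
    case True
    then have "sectional_curvature R c p u v \<le> 0" using assms unfolding nonpositively_curved_def by blast
    moreover have "metric_at R c p u u * metric_at R c p v v - (metric_at R c p u v)\<^sup>2 > 0"
      using P.cauchy_schwarz_strict[OF p] True by simp
    ultimately show ?thesis unfolding sectional_curvature_def curvature_curv by (simp add: divide_le_0_iff)
  qed (use P.curv_dependent[OF p] in auto)
qed

section \<open>Jacobi fields and the derivative of the exponential map\<close>

locale exp_npc = exp_map + assumes npc: "nonpositively_curved R"
begin

text \<open>As a function of \<open>t\<close>, its first component in the direction \<open>w\<close>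
  is the Jacobi field along \<open>geod u0\<close> that vanishes at time \<open>0\<close> with
  derivative \<open>w\<close>.\<close>

definition Dst :: "('a, 'b) chart \<Rightarrow> real \<Rightarrow> 'b \<Rightarrow> 'b \<Rightarrow> 'b \<times> 'b" where
  "Dst c t u0 = frechet_derivative (st c t) (at u0)"

lemma st_derivative:
  assumes "t \<ge> 0" "c \<in> charts R" "geod u0 t \<in> chart_dom c"
  shows "(st c t has_derivative Dst c t u0) (at u0)"
proof -
  obtain d where "d > 0" "C1_on (ball u0 d) (st c t)" using smooth_all[OF assms] unfolding smooth_at_def by blast
  then show ?thesis using C1D_derivative[OF C1_on_frechet, of "ball u0 d" "st c t" u0] by (simp add: Dst_def)
qed

lemma coord_derivative:
  assumes "t \<ge> 0" "c \<in> charts R" "geod u0 t \<in> chart_dom c"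
  shows "((\<lambda>u. coord c (geod u t)) has_derivative (\<lambda>w. fst (Dst c t u0 w))) (at u0)"
  using has_derivative_fst[OF st_derivative[OF assms]] by (simp add: st_def)

lemma Dst_window:
  assumes c: "c \<in> charts R" and t0: "t0 \<ge> 0" and d: "geod u0 t0 \<in> chart_dom c"
  obtains \<epsilon> where "\<epsilon> > 0" "\<And>s. s \<ge> 0 \<Longrightarrow> \<bar>s - t0\<bar> < \<epsilon> \<Longrightarrow> geod u0 s \<in> chart_dom c"
    "\<And>s w. s \<ge> 0 \<Longrightarrow> \<bar>s - t0\<bar> < \<epsilon> \<Longrightarrow>
       ((\<lambda>s. Dst c s u0 w) has_vector_derivative metric_patch.dspray (metric_at R c) (st c s u0) (Dst c s u0 w)) (at s within {0..})"
proof -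
  obtain \<epsilon> where eps: "\<epsilon> > 0" "\<And>s. s \<ge> 0 \<Longrightarrow> \<bar>s - t0\<bar> < \<epsilon> \<Longrightarrow> geod u0 s \<in> chart_dom c"
    "\<And>s. s \<ge> 0 \<Longrightarrow> \<bar>s - t0\<bar> < \<epsilon> \<Longrightarrow> smooth_at c s u0 \<Longrightarrow>
      (\<exists>D. \<forall>s'\<ge>0. \<bar>s' - t0\<bar> < \<epsilon> \<longrightarrow> smooth_at c s' u0 \<and> (st c s' has_derivative D s') (at u0) \<and>
       (\<forall>w. ((\<lambda>s. D s w) has_vector_derivative metric_patch.dspray (metric_at R c) (st c s' u0) (D s' w)) (at s' within {0..})))"
    using smooth_at_window[OF c t0 d] by metis
  obtain D where D: "\<And>s'. s' \<ge> 0 \<Longrightarrow> \<bar>s' - t0\<bar> < \<epsilon> \<Longrightarrow> (st c s' has_derivative D s') (at u0)"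
     "\<And>s' w. s' \<ge> 0 \<Longrightarrow> \<bar>s' - t0\<bar> < \<epsilon> \<Longrightarrow> ((\<lambda>s. D s w) has_vector_derivative metric_patch.dspray (metric_at R c) (st c s' u0) (D s' w)) (at s' within {0..})"
    using eps(3)[OF t0 _ smooth_all[OF t0 c d]] eps(1) by auto
  have eq: "Dst c s u0 = D s" if "s \<ge> 0" "\<bar>s - t0\<bar> < \<epsilon>" for s
    using has_derivative_unique[OF st_derivative[OF that(1) c eps(2)[OF that]] D(1)[OF that]] .
  show ?thesis
  proof (rule that[OF eps(1,2)])
    fix s w assume s: "s \<ge> 0" "\<bar>s - t0\<bar> < \<epsilon>"
    define d where "d = \<epsilon> - \<bar>s - t0\<bar>"
    have d: "d > 0" using s by (simp add: d_def)
    have "((\<lambda>s. Dst c s u0 w) has_vector_derivative metric_patch.dspray (metric_at R c) (st c s u0) (D s w)) (at s within {0..})"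
      by (rule has_vector_derivative_transform_within[OF D(2)[OF s] d]) (use s eq in \<open>auto simp: d_def dist_real_def\<close>)
    then show "((\<lambda>s. Dst c s u0 w) has_vector_derivative metric_patch.dspray (metric_at R c) (st c s u0) (Dst c s u0 w)) (at s within {0..})"
      using eq[OF s] by simp
  qed
qed

text \<open>The squared norm of the Jacobi field along \<open>geod u0\<close> with initial derivative \<open>w\<close>.\<close>

definition H :: "'b \<Rightarrow> 'b \<Rightarrow> real \<Rightarrow> real" where
  "H u0 w t = (let c = SOME c. c \<in> charts R \<and> geod u0 t \<in> chart_dom c
     in metric_at R c (coord c (geod u0 t)) (fst (Dst c t u0 w)) (fst (Dst c t u0 w)))"

lemma H_chart:
  assumes t: "t \<ge> 0" and c: "c \<in> charts R" "geod u0 t \<in> chart_dom c"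
  shows "H u0 w t = metric_at R c (coord c (geod u0 t)) (fst (Dst c t u0 w)) (fst (Dst c t u0 w))"
proof -
  define c' where "c' = (SOME c. c \<in> charts R \<and> geod u0 t \<in> chart_dom c)"
  have c': "c' \<in> charts R" "geod u0 t \<in> chart_dom c'" unfolding c'_def by (rule some_chart)+
  let ?A = "coord c ` (chart_dom c \<inter> UNIV \<inter> id -` chart_dom c')"
  interpret I: isometry_patch "chart_im c" "chart_im c'" "metric_at R c" "metric_at R c'" ?A "coord_rep c c' id"
    by (rule isometry_patch_charts[OF riem_axioms riem_axioms local_iso_id c(1) c'(1)])
  have A: "coord c (geod u0 t) \<in> ?A" using c c' by auto
  obtain d where d: "d > 0" "\<And>u. u \<in> ball u0 d \<Longrightarrow> geod u t \<in> chart_dom c" using smooth_all[OF t c] unfolding smooth_at_def by blast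
  have r: "coord_rep c c' id (coord c (geod u t)) = coord c' (geod u t)" if "u \<in> ball u0 d" for u
    using coord_rep_coord[OF riem_axioms c(1) d(2)[OF that], where c'=c' and h=id] by simp
  have "((\<lambda>u. coord_rep c c' id (coord c (geod u t))) has_derivative (\<lambda>w. I.D (coord c (geod u0 t)) (fst (Dst c t u0 w)))) (at u0)"
    by (rule has_derivative_compose[OF coord_derivative[OF t c] C1D_derivative[OF I.\<psi>_C1D A]])
  then have "((\<lambda>u. coord c' (geod u t)) has_derivative (\<lambda>w. I.D (coord c (geod u0 t)) (fst (Dst c t u0 w)))) (at u0)"
    by (rule has_derivative_transform_within_open[OF _ open_ball]) (use d r in auto)
  from fun_cong[OF has_derivative_unique[OF this coord_derivative[OF t c']]]
  have "fst (Dst c' t u0 w) = I.D (coord c (geod u0 t)) (fst (Dst c t u0 w))" by simp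
  then show ?thesis
    using I.iso'[OF A] r[of u0] d(1) by (simp add: H_def c'_def[symmetric] Let_def)
qed

lemma H_nonneg: "t \<ge> 0 \<Longrightarrow> H u0 w t \<ge> 0"
  using chart_exists[of "geod u0 t"] H_chart metric_nonneg by fastforce

lemma H_zero: "H u0 w 0 = 0"
proof -
  interpret P: metric_patch "chart_im c0" "metric_at R c0" by (rule patch[OF c0(1)])
  have "(st c0 0 has_derivative (\<lambda>w. (0, w))) (at u0)"
    unfolding st_def[abs_def] geod by (auto intro!: derivative_eq_intros)
  then have "Dst c0 0 u0 w = (0, w)" using has_derivative_unique[OF st_derivative[of 0 c0 u0]] c0 geod by (metis order_refl)
  then show ?thesis using H_chart[of 0 c0 u0 w] c0 geod P.zero_iff[of "coord c0 x0" 0] by simp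
qed

text \<open>\<open>jacobi_derivatives\<close> in the form that \<open>sqrt_convex_chord\<close> asks
  for; the derivatives are taken within \<open>{0..}\<close> because geodesics start at time
  \<open>0\<close>.\<close>

lemma H_local:
  assumes t: "t \<ge> 0"
  shows "\<exists>\<epsilon>>0. \<exists>h1. \<forall>s\<ge>0. \<bar>s - t\<bar> < \<epsilon> \<longrightarrow> (H u0 w has_real_derivative h1 s) (at s within {0..}) \<and>
       (\<exists>h2. (h1 has_real_derivative h2) (at s within {0..}) \<and> (h1 s)\<^sup>2 \<le> 2 * H u0 w s * h2)"
proof -
  obtain c where c: "c \<in> charts R" "geod u0 t \<in> chart_dom c" using chart_exists by blast
  interpret P: metric_patch "chart_im c" "metric_at R c" by (rule patch[OF c(1)])
  obtain \<epsilon> where eps: "\<epsilon> > 0" "\<And>s. s \<ge> 0 \<Longrightarrow> \<bar>s - t\<bar> < \<epsilon> \<Longrightarrow> geod u0 s \<in> chart_dom c"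
    "\<And>s w. s \<ge> 0 \<Longrightarrow> \<bar>s - t\<bar> < \<epsilon> \<Longrightarrow>
       ((\<lambda>s. Dst c s u0 w) has_vector_derivative P.dspray (st c s u0) (Dst c s u0 w)) (at s within {0..})"
    by (rule Dst_window[OF c(1) t c(2)]) blast
  define x where "x s = coord c (geod u0 s)" for s
  define v where "v s = vel u0 s c" for s
  define y where "y s = fst (Dst c s u0 w)" for s
  define k where "k s = snd (Dst c s u0 w)" for s
  define z where "z s = k s + chr (metric_at R c) (x s) (v s) (y s)" for s
  define h1 where "h1 s = 2 * metric_at R c (x s) (z s) (y s)" for s
  show ?thesis
  proof (rule exI[of _ \<epsilon>], rule conjI, rule eps(1), rule exI[of _ h1], intro allI impI conjI)
    fix s assume s: "s \<ge> 0" "\<bar>s - t\<bar> < \<epsilon>"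
    have xU: "x s \<in> chart_im c" using eps(2)[OF s] by (simp add: x_def)
    have s': "s \<in> {0..}" using s by simp
    note g = geoD[OF geod(1) c(1) s' eps(2)[OF s]]
    have x': "(x has_vector_derivative v s) (at s within {0..})" using g(1) by (simp add: x_def[abs_def] v_def comp_def)
    have v': "(v has_vector_derivative - chr (metric_at R c) (x s) (v s) (v s)) (at s within {0..})"
      using g(2) by (simp add: x_def v_def[abs_def])
    have dD: "P.dspray (st c s u0) (Dst c s u0 w) = (k s, - (P.dchr (x s) (y s) (v s) (v s) +
      (chr (metric_at R c) (x s) (v s) (k s) + chr (metric_at R c) (x s) (k s) (v s))))"
      by (simp add: P.dspray_def st_def x_def v_def y_def k_def)
    have y': "(y has_vector_derivative k s) (at s within {0..})"
      using bounded_linear.has_vector_derivative[OF bounded_linear_fst eps(3)[OF s, of w]] unfolding dD by (simp add: y_def[abs_def])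
    have k': "(k has_vector_derivative - (P.dchr (x s) (y s) (v s) (v s) +
      (chr (metric_at R c) (x s) (v s) (k s) + chr (metric_at R c) (x s) (k s) (v s)))) (at s within {0..})"
      using bounded_linear.has_vector_derivative[OF bounded_linear_snd eps(3)[OF s, of w]] unfolding dD by (simp add: k_def[abs_def])
    note J = P.jacobi_derivatives[OF x' v' y' k' xU npc_curv[OF npc c(1) xU], folded z_def]
    have "((\<lambda>s. metric_at R c (x s) (y s) (y s)) has_vector_derivative h1 s) (at s within {0..})"
      using J(1) by (simp add: h1_def)
    then have "(H u0 w has_vector_derivative h1 s) (at s within {0..})"
      by (rule has_vector_derivative_transform_within[where d="\<epsilon> - \<bar>s - t\<bar>"])
         (use s eps(2) in \<open>auto simp: dist_real_def x_def y_def intro!: H_chart[symmetric] c\<close>)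
    then show "(H u0 w has_real_derivative h1 s) (at s within {0..})" by (simp add: has_real_derivative_iff_has_vector_derivative)
    have Hs: "H u0 w s = metric_at R c (x s) (y s) (y s)" using H_chart[OF s(1) c(1) eps(2)[OF s]] by (simp add: x_def y_def)
    show "\<exists>h2. (h1 has_real_derivative h2) (at s within {0..}) \<and> (h1 s)\<^sup>2 \<le> 2 * H u0 w s * h2"
      using J(2) by (simp add: Hs h1_def[abs_def] has_real_derivative_iff_has_vector_derivative)
  qed
qed

lemma H_chord: "t \<in> {0..1} \<Longrightarrow> sqrt (H u0 w t) \<le> t * sqrt (H u0 w 1)"
proof (rule sqrt_convex_chord)
  show "continuous_on {0..1} (H u0 w)"
    unfolding continuous_on_eq_continuous_within
  proof
    fix t :: real assume t: "t \<in> {0..1}"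
    then obtain D where "(H u0 w has_real_derivative D) (at t within {0..})" using H_local[of t u0 w] by force
    then have "continuous (at t within {0..}) (H u0 w)" by (rule DERIV_continuous)
    then show "continuous (at t within {0..1}) (H u0 w)" by (rule continuous_within_subset) auto
  qed
  fix t :: real assume t: "t \<in> {0<..<1}"
  obtain \<epsilon> h1 where e: "\<epsilon> > 0" "\<forall>s\<ge>0. \<bar>s - t\<bar> < \<epsilon> \<longrightarrow> (H u0 w has_real_derivative h1 s) (at s within {0..}) \<and>
       (\<exists>h2. (h1 has_real_derivative h2) (at s within {0..}) \<and> (h1 s)\<^sup>2 \<le> 2 * H u0 w s * h2)"
    using H_local[of t u0 w] t by auto
  show "\<exists>\<epsilon>>0. \<exists>h1. \<forall>s. \<bar>s - t\<bar> < \<epsilon> \<longrightarrow> (H u0 w has_real_derivative h1 s) (at s) \<and>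
       (\<exists>h2. (h1 has_real_derivative h2) (at s) \<and> (h1 s)\<^sup>2 \<le> 2 * H u0 w s * h2)"
  proof (rule exI[of _ "min \<epsilon> t"], rule conjI, use e t in simp, rule exI[of _ h1], intro allI impI conjI)
    fix s assume s: "\<bar>s - t\<bar> < min \<epsilon> t"
    then have s0: "s > 0" "s \<ge> 0" "\<bar>s - t\<bar> < \<epsilon>" by auto
    have a: "at s within {0..} = at s" by (rule at_within_interior) (use s0 in \<open>simp add: interior_real_atLeast\<close>)
    show "(H u0 w has_real_derivative h1 s) (at s)"
       "\<exists>h2. (h1 has_real_derivative h2) (at s) \<and> (h1 s)\<^sup>2 \<le> 2 * H u0 w s * h2"
      using e(2)[rule_format, OF s0(2,3)] unfolding a by auto
  qed
qed (use H_nonneg H_zero in auto)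

text \<open>By \<open>H_chord\<close>, \<open>sqrt (H u0 w t) / t\<close> is at most
  \<open>sqrt (H u0 w 1)\<close> for small positive \<open>t\<close>. As \<open>t\<close> tends to
  \<open>0\<close> it converges to the length of \<open>w\<close> at \<open>x0\<close>, since the
  Jacobi field has initial derivative \<open>w\<close>.\<close>

lemma H_expands: "metric_at R c0 (coord c0 x0) w w \<le> H u0 w 1"
proof -
  interpret P: metric_patch "chart_im c0" "metric_at R c0" by (rule patch[OF c0(1)])
  let ?c = "c0"
  have d0: "geod u0 0 \<in> chart_dom c0" using c0 geod by simp
  obtain \<epsilon> where eps: "\<epsilon> > 0" "\<And>s. s \<ge> 0 \<Longrightarrow> \<bar>s - 0\<bar> < \<epsilon> \<Longrightarrow> geod u0 s \<in> chart_dom c0"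
    "\<And>s w. s \<ge> 0 \<Longrightarrow> \<bar>s - 0\<bar> < \<epsilon> \<Longrightarrow>
       ((\<lambda>s. Dst c0 s u0 w) has_vector_derivative P.dspray (st c0 s u0) (Dst c0 s u0 w)) (at s within {0..})"
    by (rule Dst_window[OF c0(1) order_refl d0]) blast
  define x where "x s = coord c0 (geod u0 s)" for s
  define y where "y s = fst (Dst c0 s u0 w)" for s
  have "(st c0 0 has_derivative (\<lambda>w. (0, w))) (at u0)"
    unfolding st_def[abs_def] geod by (auto intro!: derivative_eq_intros)
  then have D0: "Dst c0 0 u0 w = (0, w)" using has_derivative_unique[OF st_derivative[of 0 c0 u0]] c0 geod by (metis order_refl)
  have "((\<lambda>s. Dst c0 s u0 w) has_vector_derivative P.dspray (st c0 0 u0) (0, w)) (at 0 within {0..})"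
    using eps(3)[of 0 w] eps(1) D0 by simp
  from bounded_linear.has_vector_derivative[OF bounded_linear_fst this]
  have "(y has_vector_derivative w) (at 0 within {0..})" by (simp add: y_def[abs_def] P.dspray_def)
  then have "((\<lambda>t. (1 / norm (t - 0)) *\<^sub>R (y t - (y 0 + (t - 0) *\<^sub>R w))) \<longlongrightarrow> 0) (at 0 within {0..})"
    unfolding has_vector_derivative_def has_derivative_within by blast
  then have "((\<lambda>t. (1 / norm (t - 0)) *\<^sub>R (y t - (y 0 + (t - 0) *\<^sub>R w))) \<longlongrightarrow> 0) (at_right 0)"
    by (rule tendsto_within_subset) auto
  from tendsto_add[OF this tendsto_const[of w]]
  have "((\<lambda>t. (1 / norm (t - 0)) *\<^sub>R (y t - (y 0 + (t - 0) *\<^sub>R w)) + w) \<longlongrightarrow> w) (at_right 0)" by simp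
  then have yl: "((\<lambda>t. (1 / t) *\<^sub>R y t) \<longlongrightarrow> w) (at_right 0)"
    by (rule Lim_transform_eventually) (auto simp: eventually_at_filter y_def D0 algebra_simps)
  have "((\<lambda>t. x t) \<longlongrightarrow> coord c0 x0) (at_right 0)"
  proof -
    have "continuous (at 0 within {0..}) (coord c0 \<circ> geod u0)" by (rule geoD(5)[OF geod(1) c0(1) _ d0]) simp
    then have "(x \<longlongrightarrow> coord c0 x0) (at 0 within {0..})" by (simp add: continuous_within x_def[abs_def] comp_def geod)
    then show ?thesis by (rule tendsto_within_subset) auto
  qed
  then have l: "((\<lambda>t. (x t, (1 / t) *\<^sub>R y t, (1 / t) *\<^sub>R y t)) \<longlongrightarrow> (coord c0 x0, w, w)) (at_right 0)"
    by (intro tendsto_Pair yl)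
  have "isCont (\<lambda>(p,u,v). metric_at R c0 p u v) (coord c0 x0, w, w)"
    using C1D_continuous[OF P.G.C1D_joint] chart_open(2)[OF c0(1)] c0
    by (auto simp: continuous_on_eq_continuous_at open_Times)
  from isCont_tendsto_compose[OF this l]
  have lim: "((\<lambda>t. metric_at R c0 (x t) ((1 / t) *\<^sub>R y t) ((1 / t) *\<^sub>R y t)) \<longlongrightarrow> metric_at R c0 (coord c0 x0) w w) (at_right 0)" by simp
  have "\<forall>\<^sub>F t in at_right 0. metric_at R c0 (x t) ((1 / t) *\<^sub>R y t) ((1 / t) *\<^sub>R y t) \<le> H u0 w 1"
    unfolding eventually_at_right_field
  proof (intro exI[of _ "min \<epsilon> 1"] conjI allI impI)
    fix t :: real assume t: "0 < t" "t < min \<epsilon> 1"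
    have xU: "x t \<in> chart_im c0" using eps(2)[of t] t by (simp add: x_def)
    have Ht: "H u0 w t = metric_at R c0 (x t) (y t) (y t)" using H_chart[of t c0 u0 w] eps(2)[of t] t c0 by (simp add: x_def y_def)
    have "sqrt (H u0 w t) \<le> t * sqrt (H u0 w 1)" by (rule H_chord) (use t in auto)
    then have "(sqrt (H u0 w t))\<^sup>2 \<le> (t * sqrt (H u0 w 1))\<^sup>2" by (intro power_mono) (use H_nonneg t in auto)
    then have "H u0 w t \<le> t\<^sup>2 * H u0 w 1" using H_nonneg t by (simp add: power_mult_distrib)
    then show "metric_at R c0 (x t) ((1 / t) *\<^sub>R y t) ((1 / t) *\<^sub>R y t) \<le> H u0 w 1"
      using t unfolding Ht
      by (simp add: bilinear_lmul[OF P.bilinear_g[OF xU]] bilinear_rmul[OF P.bilinear_g[OF xU]] power2_eq_square field_simps)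
  qed (use eps in auto)
  then show ?thesis using tendsto_upperbound[OF lim] by simp
qed

lemma E_C1:
  assumes c: "c \<in> charts R" "E u0 \<in> chart_dom c"
  obtains d D where "d > 0" "\<And>u. u \<in> ball u0 d \<Longrightarrow> E u \<in> chart_dom c" "C1D (ball u0 d) (\<lambda>u. coord c (E u)) D"
    "\<And>u w. u \<in> ball u0 d \<Longrightarrow> metric_at R c0 (coord c0 x0) w w \<le> metric_at R c (coord c (E u)) (D u w) (D u w)"
proof -
  obtain d where d: "d > 0" "\<And>u. u \<in> ball u0 d \<Longrightarrow> geod u 1 \<in> chart_dom c" "C1_on (ball u0 d) (st c 1)"
    using smooth_all[of 1 c u0] c unfolding smooth_at_def E_def by auto
  have "C1D (ball u0 d) (st c 1) (\<lambda>u. Dst c 1 u)" using C1_on_frechet[OF d(3)] by (simp add: Dst_def[abs_def])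
  then have "C1D (ball u0 d) (\<lambda>u. fst (st c 1 u)) (\<lambda>u w. fst (Dst c 1 u w))"
    by (rule C1D_compose[OF _ C1D_linear_map[OF bounded_linear_fst, of UNIV]]) auto
  then have C1: "C1D (ball u0 d) (\<lambda>u. coord c (E u)) (\<lambda>u w. fst (Dst c 1 u w))" by (simp add: st_def E_def)
  show ?thesis
  proof (rule that[OF d(1) _ C1])
    show "E u \<in> chart_dom c" if "u \<in> ball u0 d" for u using d(2)[OF that] by (simp add: E_def)
    show "metric_at R c0 (coord c0 x0) w w \<le> metric_at R c (coord c (E u)) (fst (Dst c 1 u w)) (fst (Dst c 1 u w))"
      if "u \<in> ball u0 d" for u w
      using H_expands[of w u] H_chart[of 1 c u w] d(2)[OF that] c(1) by (simp add: E_def)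
  qed
qed

end

section \<open>The Cartan--Hadamard theorem\<close>

context exp_npc
begin

text \<open>\<open>G0\<close> and \<open>N\<close> are the inner product and the norm of the tangent
  space at the base point.\<close>

definition G0 :: "'b \<Rightarrow> 'b \<Rightarrow> real" where "G0 = metric_at R c0 (coord c0 x0)"
definition N :: "'b \<Rightarrow> real" where "N w = sqrt (G0 w w)"

lemma p0: "coord c0 x0 \<in> chart_im c0" using c0 by auto

lemma G0_bilinear: "bilinear G0"
  unfolding G0_def by (rule metric_patch.bilinear_g[OF patch[OF c0(1)] p0])

lemma G0_sym: "G0 u v = G0 v u"
  unfolding G0_def by (rule metric_patch.sym[OF patch[OF c0(1)] p0])

lemma G0_nonneg: "G0 u u \<ge> 0"
  unfolding G0_def by (rule metric_patch.nonneg[OF patch[OF c0(1)] p0])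

lemma N_sq: "(N w)\<^sup>2 = G0 w w"
  by (simp add: N_def G0_nonneg)

lemma N_nonneg: "N w \<ge> 0"
  by (simp add: N_def G0_nonneg)

lemma G0_le: "G0 u v \<le> N u * N v"
proof -
  have "(G0 u v)\<^sup>2 \<le> (N u * N v)\<^sup>2"
    using metric_patch.cauchy_schwarz[OF patch[OF c0(1)] p0, of u v]
    by (simp add: power_mult_distrib N_sq) (simp add: G0_def)
  then show ?thesis using N_nonneg by (simp add: abs_le_square_iff[symmetric] abs_le_iff)
qed

lemma N_scale: "N (l *\<^sub>R w) = \<bar>l\<bar> * N w"
  by (simp add: N_def bilinear_lmul[OF G0_bilinear] bilinear_rmul[OF G0_bilinear] real_sqrt_mult flip: mult.assoc)

lemma N_zero_iff: "N w = 0 \<longleftrightarrow> w = 0"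
  using metric_patch.zero_iff[OF patch[OF c0(1)] p0, of w] by (simp add: N_def G0_def)

lemma N_lower: obtains m where "m > 0" "\<And>w. m * norm w \<le> N w"
proof -
  have "compact {coord c0 x0}" "{coord c0 x0} \<subseteq> chart_im c0" using p0 by auto
  from metric_patch.norm_lower_bound[OF patch[OF c0(1)] this] show ?thesis
    using that unfolding N_def G0_def by (metis singletonI)
qed

lemma N_minus: "N (- w) = N w"
  using N_scale[of "-1" w] by simp

text \<open>The derivative of \<open>E\<close> does not decrease norms, hence it is invertible, and
  the local inverse from the inverse function theorem has a derivative that does not increase
  them.\<close>

lemma short_inverse:
  assumes c: "c \<in> charts R" "E u0 \<in> chart_dom c"
  obtains V W \<rho> \<rho>' where "open V" "u0 \<in> V" "open W" "W \<subseteq> chart_im c" "\<And>u. u \<in> V \<Longrightarrow> E u \<in> chart_dom c"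
    "homeomorphism V W (\<lambda>u. coord c (E u)) \<rho>"
    "\<And>q. q \<in> W \<Longrightarrow> (\<rho> has_derivative \<rho>' q) (at q)"
    "\<And>q w. q \<in> W \<Longrightarrow> N (\<rho>' q w) \<le> sqrt (metric_at R c q w w)"
proof -
  obtain d D where d: "d > 0" "\<And>u. u \<in> ball u0 d \<Longrightarrow> E u \<in> chart_dom c" and C1: "C1D (ball u0 d) (\<lambda>u. coord c (E u)) D"
    and ex: "\<And>u w. u \<in> ball u0 d \<Longrightarrow> metric_at R c0 (coord c0 x0) w w \<le> metric_at R c (coord c (E u)) (D u w) (D u w)"
    using E_C1[OF c] by blast
  have Nle: "N w \<le> sqrt (metric_at R c (coord c (E u)) (D u w) (D u w))" if "u \<in> ball u0 d" for u w
    using ex[OF that, of w] by (simp add: N_def G0_def)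
  have lin: "linear (D u)" if "u \<in> ball u0 d" for u using C1D_linear[OF C1 that] .
  have inj: "inj (D u)" if u: "u \<in> ball u0 d" for u
  proof (rule linear_injective_0[THEN iffD2, OF lin[OF u]], intro allI impI)
    fix w assume "D u w = 0"
    moreover have "coord c (E u) \<in> chart_im c" using d(2)[OF u] by auto
    ultimately have "N w \<le> 0" using Nle[OF u, of w] metric_patch.zero_iff[OF patch[OF c(1)], of "coord c (E u)" 0] by simp
    then show "w = 0" using N_zero_iff N_nonneg[of w] by simp
  qed
  have bl: "bounded_linear (D u)" if "u \<in> ball u0 d" for u using lin[OF that] linear_conv_bounded_linear by blast
  \<comment> \<open>The inverse function theorem takes the derivative as a bounded operator that
    depends continuously on the point; this continuity is checked on the basis vectors.\<close>
  define F where "F u = Blinfun (D u)" for u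
  have F: "blinfun_apply (F u) = D u" if "u \<in> ball u0 d" for u using bounded_linear_Blinfun_apply[OF bl[OF that]] by (simp add: F_def)
  have u0: "u0 \<in> ball u0 d" using d(1) by simp
  have "linear (inv (D u0))"
    by (rule inj_linear_imp_inv_linear[OF lin[OF u0] inj[OF u0]])
  then have "bounded_linear (inv (D u0))" using linear_conv_bounded_linear by blast
  then have "Blinfun (inv (D u0)) o\<^sub>L F u0 = id_blinfun"
    by (intro blinfun_eqI) (simp add: bounded_linear_Blinfun_apply F[OF u0] inj[OF u0])
  moreover have "continuous_on (ball u0 d) F"
  proof (rule continuous_on_blinfun_componentwise)
    fix i :: 'b assume "i \<in> Basis"
    show "continuous_on (ball u0 d) (\<lambda>u. blinfun_apply (F u) i)"
      by (rule continuous_on_eq[of _ "\<lambda>u. D u i"]) (use C1 F in \<open>auto simp: C1D_def\<close>)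
  qed
  moreover have "((\<lambda>u. coord c (E u)) has_derivative blinfun_apply (F u)) (at u)" if "u \<in> ball u0 d" for u
    using C1D_derivative[OF C1 that] F[OF that] by simp
  ultimately obtain V W \<rho> \<rho>' where I: "open V" "V \<subseteq> ball u0 d" "u0 \<in> V" "open W"
     "homeomorphism V W (\<lambda>u. coord c (E u)) \<rho>"
     "\<And>q. q \<in> W \<Longrightarrow> (\<rho> has_derivative \<rho>' q) (at q)" "\<And>q. q \<in> W \<Longrightarrow> \<rho>' q = inv (blinfun_apply (F (\<rho> q)))"
     "\<And>q. q \<in> W \<Longrightarrow> bij (blinfun_apply (F (\<rho> q)))"
    using inverse_function_theorem[OF open_ball _ _ u0, of "\<lambda>u. coord c (E u)" F "Blinfun (inv (D u0))"] by metis
  have \<rho>V: "\<rho> q \<in> V" "coord c (E (\<rho> q)) = q" if "q \<in> W" for q using I(5) that unfolding homeomorphism_def by auto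
  show ?thesis
  proof (rule that[OF I(1,3,4) _ _ I(5,6)])
    show "W \<subseteq> chart_im c"
    proof
      fix q assume "q \<in> W"
      then show "q \<in> chart_im c" using \<rho>V[of q] d(2)[of "\<rho> q"] I(2) by (metis imageI subsetD)
    qed
    show "E u \<in> chart_dom c" if "u \<in> V" for u using d(2) I(2) that by blast
    fix q w assume q: "q \<in> W"
    have b: "\<rho> q \<in> ball u0 d" using \<rho>V[OF q] I(2) by blast
    have "D (\<rho> q) (\<rho>' q w) = w"
      using I(7,8)[OF q] F[OF b] by (simp add: bij_is_surj surj_f_inv_f)
    then show "N (\<rho>' q w) \<le> sqrt (metric_at R c q w w)" using Nle[OF b, of "\<rho>' q w"] \<rho>V(2)[OF q] by simp
  qed
qed

lemma E_continuous: "continuous_on UNIV E"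
  unfolding continuous_on_eq_continuous_at[OF open_UNIV]
proof
  fix u0
  obtain c where c: "c \<in> charts R" "E u0 \<in> chart_dom c" using chart_exists by blast
  obtain V W \<rho> \<rho>' where I: "open V" "u0 \<in> V" "W \<subseteq> chart_im c" "\<And>u. u \<in> V \<Longrightarrow> E u \<in> chart_dom c"
    "homeomorphism V W (\<lambda>u. coord c (E u)) \<rho>" using short_inverse[OF c] by metis
  have "continuous_on V (\<lambda>u. chart_inv c (coord c (E u)))"
    by (rule continuous_on_compose2[OF chart_inv_continuous[OF c(1)] homeomorphism_cont1[OF I(5)]]) (use I in auto)
  then have "continuous_on V E" by (rule continuous_on_eq) (use I c in auto)
  then show "isCont E u0" using I continuous_on_eq_continuous_at by blast
qed

lemma E_locally_inj: "locally_inj E"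
  unfolding locally_inj_def
proof
  fix u0
  obtain c where c: "c \<in> charts R" "E u0 \<in> chart_dom c" using chart_exists by blast
  obtain V W \<rho> \<rho>' where I: "open V" "u0 \<in> V" "homeomorphism V W (\<lambda>u. coord c (E u)) \<rho>" using short_inverse[OF c] by metis
  have "inj_on E V" by (rule inj_onI) (metis I(3) homeomorphism_apply1)
  then show "\<exists>V. open V \<and> u0 \<in> V \<and> inj_on E V" using I by blast
qed

lemma E_local_section: "\<exists>B \<sigma>. local_section E u0 B \<sigma>"
proof -
  obtain c where c: "c \<in> charts R" "E u0 \<in> chart_dom c" using chart_exists by blast
  obtain V W \<rho> \<rho>' where I: "open V" "u0 \<in> V" "open W" "W \<subseteq> chart_im c" "\<And>u. u \<in> V \<Longrightarrow> E u \<in> chart_dom c"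
    "homeomorphism V W (\<lambda>u. coord c (E u)) \<rho>" using short_inverse[OF c] by metis
  let ?B = "chart_dom c \<inter> coord c -` W"
  have \<rho>V: "\<rho> q \<in> V" "coord c (E (\<rho> q)) = q" if "q \<in> W" for q using I(6) that unfolding homeomorphism_def by auto
  have "local_section E u0 ?B (\<lambda>x. \<rho> (coord c x))"
    unfolding local_section_def
  proof (intro conjI ballI)
    show "open ?B" using continuous_open_preimage[OF coord_continuous[OF c(1)] chart_open(1)[OF c(1)] I(3)] .
    show "E u0 \<in> ?B" using c I(2,6) by (auto simp: homeomorphism_def)
    show "continuous_on ?B (\<lambda>x. \<rho> (coord c x))"
      by (rule continuous_on_compose2[OF homeomorphism_cont2[OF I(6)] continuous_on_subset[OF coord_continuous[OF c(1)]]]) auto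
    show "\<rho> (coord c (E u0)) = u0" using I(2,6) by (simp add: homeomorphism_def)
    fix x assume x: "x \<in> ?B"
    then have "E (\<rho> (coord c x)) \<in> chart_dom c" "coord c (E (\<rho> (coord c x))) = coord c x" using \<rho>V I(5) by auto
    then show "E (\<rho> (coord c x)) = x" using x c(1) chart_inv_coord by (metis IntD1)
  qed
  then show ?thesis by blast
qed

text \<open>By \<open>short_inverse\<close> every partial lift is Lipschitz with constant
  \<open>M / m\<close>. At the supremum \<open>b\<close> of the times that can be reached, the
  partial lifts therefore converge, and the local inverse of \<open>E\<close> at the limit continues
  them.\<close>

lemma segment_lift:
  assumes c: "c \<in> charts R" and im: "\<And>s. s \<in> {0..1} \<Longrightarrow> p + s *\<^sub>R w \<in> chart_im c"
    and a: "E a = chart_inv c p" and M: "\<And>s. s \<in> {0..1} \<Longrightarrow> sqrt (metric_at R c (p + s *\<^sub>R w) w w) \<le> M"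
  shows "\<exists>l. continuous_on {0..1::real} l \<and> l 0 = a \<and> (\<forall>s\<in>{0..1}. E (l s) = chart_inv c (p + s *\<^sub>R w))"
proof -
  define \<beta> where "\<beta> s = p + s *\<^sub>R w" for s
  have \<beta>': "(\<beta> has_vector_derivative w) (at s within S)" for s S
    unfolding \<beta>_def by (auto intro!: derivative_eq_intros)
  have \<beta>c: "continuous_on S \<beta>" for S unfolding \<beta>_def by (intro continuous_intros)
  define P where "P t l \<longleftrightarrow> continuous_on {0..t} l \<and> l 0 = a \<and> (\<forall>s\<in>{0..t}. E (l s) = chart_inv c (\<beta> s))" for t :: real and l
  obtain m where m: "m > 0" "\<And>w. m * norm w \<le> N w" using N_lower by blast
  have lip: "norm (l t - l s) \<le> (M / m) * \<bar>t - s\<bar>" if P: "P b l" and b: "b \<le> 1" and st: "s \<in> {0..b}" "t \<in> {0..b}" for b l s t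
  proof -
    have "\<exists>l'. (l has_vector_derivative l') (at r within {0..b}) \<and> norm l' \<le> M / m" if r: "r \<in> {0..b}" for r
    proof -
      have r1: "r \<in> {0..1}" using r b by auto
      have bi: "\<beta> r \<in> chart_im c" using im[OF r1] by (simp add: \<beta>_def)
      have Er: "E (l r) = chart_inv c (\<beta> r)" using P r by (simp add: P_def)
      then have Ed: "E (l r) \<in> chart_dom c" using chart_inv_dom[OF c bi] by simp
      obtain V W \<rho> \<rho>' where I: "open V" "l r \<in> V" "open W" "W \<subseteq> chart_im c" "\<And>u. u \<in> V \<Longrightarrow> E u \<in> chart_dom c"
        "homeomorphism V W (\<lambda>u. coord c (E u)) \<rho>"
        "\<And>q. q \<in> W \<Longrightarrow> (\<rho> has_derivative \<rho>' q) (at q)"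
        "\<And>q w. q \<in> W \<Longrightarrow> N (\<rho>' q w) \<le> sqrt (metric_at R c q w w)"
        by (rule short_inverse[OF c Ed]) blast
      have cE: "coord c (E (l s)) = \<beta> s" if "s \<in> {0..b}" for s
        using P that im[of s] b c by (auto simp: P_def \<beta>_def)
      have lr: "l s = \<rho> (\<beta> s)" if "s \<in> {0..b}" "l s \<in> V" for s
        using I(6) that cE[OF that(1)] unfolding homeomorphism_def by metis
      have \<beta>W: "\<beta> r \<in> W" using I(2,6) cE[OF r] unfolding homeomorphism_def by (metis imageI)
      have "continuous (at r within {0..b}) l" using P r by (simp add: P_def continuous_on_eq_continuous_within)
      then obtain d where d: "d > 0" "\<And>s. s \<in> {0..b} \<Longrightarrow> dist s r < d \<Longrightarrow> l s \<in> V"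
        using continuous_within_nbhd[of r "{0..b}" l V] I(1,2) by metis
      have "((\<lambda>s. \<rho> (\<beta> s)) has_derivative (\<lambda>h. \<rho>' (\<beta> r) (h *\<^sub>R w))) (at r within {0..b})"
        using has_derivative_compose[OF \<beta>'[unfolded has_vector_derivative_def] I(7)[OF \<beta>W]] .
      then have "((\<lambda>s. \<rho> (\<beta> s)) has_vector_derivative \<rho>' (\<beta> r) w) (at r within {0..b})"
        using linear_scale[OF has_derivative_linear[OF I(7)[OF \<beta>W]]] by (simp add: has_vector_derivative_def)
      then have 1: "(l has_vector_derivative \<rho>' (\<beta> r) w) (at r within {0..b})"
        by (rule has_vector_derivative_transform_within[OF _ d(1) r]) (use lr d(2) in auto)
      have "m * norm (\<rho>' (\<beta> r) w) \<le> N (\<rho>' (\<beta> r) w)" by (rule m(2))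
      also have "\<dots> \<le> M" using I(8)[OF \<beta>W, of w] M[OF r1] by (simp add: \<beta>_def)
      finally have "norm (\<rho>' (\<beta> r) w) \<le> M / m" using m(1) by (simp add: field_simps)
      with 1 show ?thesis by blast
    qed
    then obtain l' where "\<And>r. r \<in> {0..b} \<Longrightarrow> (l has_vector_derivative l' r) (at r within {0..b}) \<and> norm (l' r) \<le> M / m" by metis
    then show ?thesis using vector_derivative_bound[of 0 b l l' "M / m" s t] st by blast
  qed
  have restrict: "P t l" if "P b l" "t \<le> b" for t b l
    using that unfolding P_def by (auto intro: continuous_on_subset)
  have P0: "P 0 (\<lambda>_. a)" using a by (simp add: P_def \<beta>_def)
  have "\<exists>l. P 1 l"
  proof (rule ccontr)
    assume no: "\<not> ?thesis"
    define S where "S = {t. t \<le> 1 \<and> (\<exists>l. P t l)}"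
    have bS: "bdd_above S" by (rule bdd_aboveI[of _ 1]) (simp add: S_def)
    have 0: "0 \<in> S" unfolding S_def by (rule CollectI, rule conjI[OF _ exI[of _ "\<lambda>_. a"]]) (use P0 in simp_all)
    define b where "b = Sup S"
    have b0: "0 \<le> b" unfolding b_def by (rule cSup_upper[OF 0 bS])
    have b1: "b \<le> 1" unfolding b_def
    proof (rule cSup_least)
      show "S \<noteq> {}" using 0 by blast
    qed (simp add: S_def)
    have "\<exists>l. P t l" if "t < b" for t
    proof -
      obtain t' where "t' \<in> S" "t < t'" using \<open>t < b\<close> less_cSup_iff[OF _ bS] 0 unfolding b_def by blast
      then show ?thesis using restrict[of t' _ t] by (auto simp: S_def)
    qed
    then obtain l where l: "\<And>t. t < b \<Longrightarrow> P t (l t)" by metis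
    define \<tau> where "\<tau> n = b - 1 / real (n + 1)" for n
    have \<tau>b: "\<tau> n < b" for n by (simp add: \<tau>_def)
    have "(\<lambda>n. b - 1 / real (n + 1)) \<longlonglongrightarrow> b - 0"
      by (intro tendsto_intros LIMSEQ_ignore_initial_segment[OF lim_1_over_n])
    then have \<tau>lim: "\<tau> \<longlonglongrightarrow> b" by (simp add: \<tau>_def[abs_def])
    have agree: "l t s = l t' s" if "0 \<le> s" "s \<le> t" "t \<le> t'" "t' < b" for s t t'
    proof (rule lift_unique[OF E_locally_inj, of "{0..t}" 0])
      show "E (l t r) = E (l t' r)" if "r \<in> {0..t}" for r
        using l[of t] l[of t'] that \<open>t \<le> t'\<close> \<open>t' < b\<close> by (auto simp: P_def)
      show "continuous_on {0..t} (l t)" "continuous_on {0..t} (l t')" "l t 0 = l t' 0"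
        using restrict[OF l[of t'], of t] l[of t] that by (auto simp: P_def)
    qed (use that in auto)
    \<comment> \<open>The times \<open>\<tau> n\<close> may be negative for small \<open>n\<close>;
      \<open>a\<close> is a placeholder for these.\<close>
    define x where "x n = (if \<tau> n < 0 then a else l (\<tau> n) (\<tau> n))" for n
    show False
    proof (cases "b = 0")
      case True
      \<comment> \<open>The limit argument uses positive times \<open>\<tau> n\<close>, so a first
        piece of the lift has to be built separately, with the local inverse at
        \<open>a\<close>.\<close>
      have "\<exists>e>0. \<exists>l. e \<le> 1 \<and> P e l"
      proof -
        have bi: "p \<in> chart_im c" using im[of 0] by simp
        have Ed: "E a \<in> chart_dom c" using chart_inv_dom[OF c bi] a by simp
        obtain V W \<rho> \<rho>' where I: "a \<in> V" "open W" "\<And>u. u \<in> V \<Longrightarrow> E u \<in> chart_dom c"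
          "homeomorphism V W (\<lambda>u. coord c (E u)) \<rho>"
          using short_inverse[OF c Ed] by metis
        have pW: "p \<in> W" using I(1,4) a bi c unfolding homeomorphism_def by (metis coord_chart_inv imageI)
        have "isCont \<beta> 0" using \<beta>c[of UNIV] by (simp add: continuous_on_eq_continuous_at)
        then obtain d where d: "d > 0" "\<And>s. s \<in> UNIV \<Longrightarrow> dist s 0 < d \<Longrightarrow> \<beta> s \<in> W"
          using continuous_within_nbhd[of 0 UNIV \<beta> W] I(2) pW by (auto simp: \<beta>_def)
        define e where "e = min 1 (d/2)"
        have e: "e > 0" "e \<le> 1" "e < d" using d by (auto simp: e_def)
        have bW: "\<beta> s \<in> W" if "s \<in> {0..e}" for s using d(2)[of s] that e by auto
        have "P e (\<lambda>s. \<rho> (\<beta> s))" unfolding P_def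
        proof (intro conjI ballI)
          show "continuous_on {0..e} (\<lambda>s. \<rho> (\<beta> s))"
            by (rule continuous_on_compose2[OF homeomorphism_cont2[OF I(4)] \<beta>c]) (use bW in auto)
          show "\<rho> (\<beta> 0) = a" using I(1,4) a bi c unfolding homeomorphism_def \<beta>_def by (metis add.right_neutral coord_chart_inv scaleR_zero_left)
          fix s assume s: "s \<in> {0..e}"
          then have "\<rho> (\<beta> s) \<in> V" "coord c (E (\<rho> (\<beta> s))) = \<beta> s" using I(4) bW[OF s] unfolding homeomorphism_def by auto
          then show "E (\<rho> (\<beta> s)) = chart_inv c (\<beta> s)" using I(3) c by (metis chart_inv_coord)
        qed
        then show ?thesis using e by blast
      qed
      then obtain e l where "e > 0" "e \<le> 1" "P e l" by blast
      then have "e \<le> b" unfolding b_def using bS by (intro cSup_upper) (auto simp: S_def)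
      then show False using True \<open>e > 0\<close> by simp
    next
      case False
      then have bpos: "b > 0" using b0 by simp
      obtain n0 where n0: "\<And>n. n \<ge> n0 \<Longrightarrow> \<tau> n > 0"
        using order_tendstoD(1)[OF \<tau>lim bpos] unfolding eventually_sequentially by blast
      have xl: "x n = l (\<tau> k) (\<tau> n)" if "n \<ge> n0" "k \<ge> n" for n k
      proof -
        have "1 / real (k + 1) \<le> 1 / real (n + 1)" using that by (simp add: frac_le)
        then have "\<tau> n \<le> \<tau> k" by (simp add: \<tau>_def)
        then show ?thesis using agree[of "\<tau> n" "\<tau> n" "\<tau> k"] n0[OF that(1)] \<tau>b by (simp add: x_def)
      qed
      have M0: "M \<ge> 0" using order_trans[OF real_sqrt_ge_zero M[of 0]] im[of 0] metric_patch.nonneg[OF patch[OF c]] by simp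
      have xlip: "norm (x n - x k) \<le> (M / m) * \<bar>\<tau> n - \<tau> k\<bar>" if "n \<ge> n0" "k \<ge> n0" for n k
      proof -
        have ord: "1 / real (max n k + 1) \<le> 1 / real (n + 1)" "1 / real (max n k + 1) \<le> 1 / real (k + 1)"
          by (simp_all add: frac_le)
        have "norm (l (\<tau> (max n k)) (\<tau> n) - l (\<tau> (max n k)) (\<tau> k)) \<le> (M / m) * \<bar>\<tau> n - \<tau> k\<bar>"
          by (rule lip[OF l[OF \<tau>b]]) (use less_imp_le[OF less_le_trans[OF \<tau>b b1], of "max n k"] n0[OF that(1)] n0[OF that(2)] ord in \<open>auto simp: \<tau>_def\<close>)
        then show ?thesis using xl[of n "max n k"] xl[of k "max n k"] that by simp
      qed
      have "Cauchy (\<lambda>n. x (n + n0))"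
      proof (rule CauchyI)
        fix e :: real assume e: "e > 0"
        have "Cauchy \<tau>" using \<tau>lim LIMSEQ_imp_Cauchy by blast
        moreover have "e / (M / m + 1) > 0" using e M0 m(1) by (simp add: add_nonneg_pos)
        ultimately obtain K where K: "\<And>i j. i \<ge> K \<Longrightarrow> j \<ge> K \<Longrightarrow> norm (\<tau> i - \<tau> j) < e / (M / m + 1)"
          unfolding Cauchy_iff by blast
        show "\<exists>K. \<forall>i\<ge>K. \<forall>j\<ge>K. norm (x (i + n0) - x (j + n0)) < e"
        proof (intro exI[of _ K] allI impI)
          fix i j assume ij: "i \<ge> K" "j \<ge> K"
          have "norm (x (i + n0) - x (j + n0)) \<le> (M / m) * \<bar>\<tau> (i + n0) - \<tau> (j + n0)\<bar>" by (rule xlip) auto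
          also have "\<dots> \<le> (M / m) * (e / (M / m + 1))"
            using K[of "i + n0" "j + n0"] ij M0 m(1) by (intro mult_left_mono) auto
          also have "\<dots> < e"
          proof -
            have q: "M / m \<ge> 0" using M0 m(1) by simp
            have "A * (e / (A + 1)) < e" if "A \<ge> 0" for A using that e by (simp add: field_simps)
            from this[OF q] show ?thesis .
          qed
          finally show "norm (x (i + n0) - x (j + n0)) < e" .
        qed
      qed
      then obtain y where y: "(\<lambda>n. x (n + n0)) \<longlonglongrightarrow> y" using Cauchy_convergent convergent_def by metis
      then have xy: "x \<longlonglongrightarrow> y" using LIMSEQ_offset by blast
      have bb: "b \<in> {0..1}" using b0 b1 by simp
      have bi: "\<beta> b \<in> chart_im c" using im[OF bb] by (simp add: \<beta>_def)
      have Ex: "E (x n) = chart_inv c (\<beta> (\<tau> n))" if "n \<ge> n0" for n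
        using l[OF \<tau>b[of n]] xl[of n n] n0[OF that] that by (auto simp: P_def)
      have "isCont E y" using E_continuous by (simp add: continuous_on_eq_continuous_at)
      then have L1: "(\<lambda>n. E (x n)) \<longlonglongrightarrow> E y" by (rule isCont_tendsto_compose[OF _ xy])
      have L: "(\<lambda>n. chart_inv c (\<beta> (\<tau> n))) \<longlonglongrightarrow> chart_inv c (\<beta> b)"
      proof (rule continuous_on_tendsto_compose[OF chart_inv_continuous[OF c] _ bi])
        have "isCont \<beta> b" using \<beta>c[of UNIV] by (simp add: continuous_on_eq_continuous_at)
        then show "(\<lambda>n. \<beta> (\<tau> n)) \<longlonglongrightarrow> \<beta> b" by (rule isCont_tendsto_compose[OF _ \<tau>lim])
        then show "\<forall>\<^sub>F n in sequentially. \<beta> (\<tau> n) \<in> chart_im c" using topological_tendstoD chart_open(2)[OF c] bi by blast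
      qed
      have ev: "\<forall>\<^sub>F n in sequentially. chart_inv c (\<beta> (\<tau> n)) = E (x n)"
        using eventually_ge_at_top[of n0] by eventually_elim (simp add: Ex)
      have Ey: "E y = chart_inv c (\<beta> b)"
        by (rule LIMSEQ_unique[OF L1 Lim_transform_eventually[OF L ev]])
      then have Ed: "E y \<in> chart_dom c" using chart_inv_dom[OF c bi] by simp
      obtain V W \<rho> \<rho>' where I: "open V" "y \<in> V" "open W" "\<And>u. u \<in> V \<Longrightarrow> E u \<in> chart_dom c"
        "homeomorphism V W (\<lambda>u. coord c (E u)) \<rho>"
        using short_inverse[OF c Ed] by metis
      have pW: "\<beta> b \<in> W" using I(2,5) Ey bi c unfolding homeomorphism_def by (metis coord_chart_inv imageI)
      have "isCont \<beta> b" using \<beta>c[of UNIV] by (simp add: continuous_on_eq_continuous_at)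
      then obtain d where d: "d > 0" "\<And>s. s \<in> UNIV \<Longrightarrow> dist s b < d \<Longrightarrow> \<beta> s \<in> W"
        using continuous_within_nbhd[of b UNIV \<beta> W] I(3) pW by auto
      have "\<forall>\<^sub>F n in sequentially. x n \<in> V \<and> \<tau> n > b - d \<and> n \<ge> n0"
        using topological_tendstoD[OF xy I(1,2)] order_tendstoD(1)[OF \<tau>lim, of "b - d"] d(1) eventually_ge_at_top[of n0]
        by (intro eventually_conj) auto
      then obtain n where n: "x n \<in> V" "\<tau> n > b - d" "n \<ge> n0" using eventually_happens'[OF sequentially_bot] by blast
      \<comment> \<open>If \<open>e = 1\<close>, the lift reaches the end of the segment, contrary
        to \<open>no\<close>; otherwise \<open>e > b\<close>, contrary to the choice of
        \<open>b\<close>.\<close>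
      define e where "e = min 1 (b + d/2)"
      have e: "e \<le> 1" "e < b + d" "b \<le> e" using d b1 by (auto simp: e_def)
      have tn: "0 < \<tau> n" "\<tau> n < b" using n0[OF n(3)] \<tau>b by auto
      have bW: "\<beta> s \<in> W" if "s \<in> {\<tau> n..e}" for s using d(2)[of s] that e n by (auto simp: dist_real_def)
      have ci: "coord c (E (x n)) = \<beta> (\<tau> n)" using Ex[OF n(3)] im[of "\<tau> n"] tn b1 c by (simp add: \<beta>_def)
      have \<rho>x: "\<rho> (\<beta> (\<tau> n)) = x n" using I(5) n(1) ci unfolding homeomorphism_def by metis
      let ?l = "\<lambda>s. if s \<le> \<tau> n then l (\<tau> n) s else \<rho> (\<beta> s)"
      have "P e ?l" unfolding P_def
      proof (intro conjI ballI)
        have "continuous_on ({0..\<tau> n} \<union> {\<tau> n..e}) ?l"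
        proof (rule continuous_on_If)
          show "continuous_on {\<tau> n..e} (\<lambda>s. \<rho> (\<beta> s))"
            by (rule continuous_on_compose2[OF homeomorphism_cont2[OF I(5)] \<beta>c]) (use bW in auto)
          show "continuous_on {0..\<tau> n} (l (\<tau> n))" using l[OF tn(2)] by (simp add: P_def)
        qed (use \<rho>x xl[OF n(3) order_refl] in auto)
        moreover have "{0..\<tau> n} \<union> {\<tau> n..e} = {0..e}" using tn e by auto
        ultimately show "continuous_on {0..e} ?l" by simp
        show "?l 0 = a" using l[OF tn(2)] tn by (simp add: P_def)
        fix s assume s: "s \<in> {0..e}"
        show "E (?l s) = chart_inv c (\<beta> s)"
        proof (cases "s \<le> \<tau> n")
          case True
          then show ?thesis using l[OF tn(2)] s by (simp add: P_def)
        next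
          case False
          then have "\<beta> s \<in> W" using bW[of s] s by auto
          then have "\<rho> (\<beta> s) \<in> V" "coord c (E (\<rho> (\<beta> s))) = \<beta> s" using I(5) unfolding homeomorphism_def by auto
          then show ?thesis using I(4) c False by (metis chart_inv_coord)
        qed
      qed
      then have "e \<in> S" using e by (auto simp: S_def)
      then have "e \<le> b" unfolding b_def using bS by (rule cSup_upper)
      then have "e = 1" using d(1) b1 by (auto simp: e_def min_def split: if_splits)
      then show False using no \<open>P e ?l\<close> by blast
    qed
  qed
  then show ?thesis unfolding P_def \<beta>_def by blast
qed

text \<open>In a coordinate ball all segments from a given point lift by
  \<open>segment_lift\<close>, and \<open>convex_lift\<close> assembles the lifts to a section. The
  ball is the same for all points over it, which is the gain over
  \<open>E_local_section\<close>.\<close>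

lemma E_section_nbhd: "\<exists>B. q \<in> B \<and> section_nbhd E B"
proof -
  obtain c r m M where c: "c \<in> charts R" "q \<in> chart_dom c" "r > 0" "cball (coord c q) r \<subseteq> chart_im c" "M > 0"
    "\<And>p u. p \<in> cball (coord c q) r \<Longrightarrow> sqrt (metric_at R c p u u) \<le> M * norm u"
    using local_comparison[of q] by metis
  let ?S = "ball (coord c q) r"
  let ?B = "chart_dom c \<inter> coord c -` ?S"
  have SI: "?S \<subseteq> chart_im c" using c(4) ball_subset_cball by blast
  have oB: "open ?B" using continuous_open_preimage[OF coord_continuous[OF c(1)] chart_open(1)[OF c(1)] open_ball] .
  have "\<exists>\<sigma>. local_section E a ?B \<sigma>" if a: "E a \<in> ?B" for a
  proof -
    let ?a0 = "coord c (E a)"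
    have a0: "?a0 \<in> ?S" using a by simp
    have hc: "continuous_on ?S (chart_inv c)" by (rule continuous_on_subset[OF chart_inv_continuous[OF c(1)] SI])
    have Ea: "E a = chart_inv c ?a0" using a c by simp
    have lft: "\<exists>l. continuous_on {0..1::real} l \<and> l 0 = a \<and> (\<forall>s\<in>{0..1}. E (l s) = chart_inv c (?a0 + s *\<^sub>R (u - ?a0)))"
      if u: "u \<in> ?S" for u
    proof (rule segment_lift[OF c(1) _ Ea])
      have seg: "?a0 + s *\<^sub>R (u - ?a0) \<in> ?S" if "s \<in> {0..1}" for s
      proof -
        have "?a0 + s *\<^sub>R (u - ?a0) = (1 - s) *\<^sub>R ?a0 + s *\<^sub>R u" by (simp add: algebra_simps)
        then show ?thesis using convexD_alt[OF convex_ball a0 u] that by auto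
      qed
      show "?a0 + s *\<^sub>R (u - ?a0) \<in> chart_im c" if "s \<in> {0..1}" for s using seg[OF that] SI by blast
      show "sqrt (metric_at R c (?a0 + s *\<^sub>R (u - ?a0)) (u - ?a0) (u - ?a0)) \<le> M * norm (u - ?a0)" if "s \<in> {0..1}" for s
        using c(6) seg[OF that] ball_subset_cball by blast
    qed
    obtain g where g: "continuous_on ?S g" "g ?a0 = a" "\<And>u. u \<in> ?S \<Longrightarrow> E (g u) = chart_inv c u"
      using convex_lift[OF E_locally_inj E_local_section convex_ball a0 hc Ea lft] by metis
    have "local_section E a ?B (\<lambda>x. g (coord c x))"
      unfolding local_section_def
    proof (intro conjI ballI)
      show "continuous_on ?B (\<lambda>x. g (coord c x))"
        by (rule continuous_on_compose2[OF g(1) continuous_on_subset[OF coord_continuous[OF c(1)]]]) auto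
      show "E (g (coord c x)) = x" if "x \<in> ?B" for x using g(3)[of "coord c x"] that c(1) by simp
    qed (use oB a g in auto)
    then show ?thesis by blast
  qed
  then have "section_nbhd E ?B" using oB unfolding section_nbhd_def by blast
  moreover have "q \<in> ?B" using c by simp
  ultimately show ?thesis by (intro exI[of _ ?B] conjI)
qed

text \<open>The range is open because of local sections. It is closed because a section
  neighbourhood that meets the range is contained in it.\<close>

lemma E_surj: "surj E"
proof -
  have "open (range E)"
    unfolding open_subopen[of "range E"]
  proof
    fix x assume "x \<in> range E"
    then obtain u where u: "x = E u" by blast
    obtain B \<sigma> where "local_section E u B \<sigma>" using E_local_section by blast
    then have "open B" "x \<in> B" "B \<subseteq> range E" unfolding local_section_def u by (auto, metis rangeI)
    then show "\<exists>T. open T \<and> x \<in> T \<and> T \<subseteq> range E" by blast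
  qed
  moreover have "open (- range E)"
    unfolding open_subopen[of "- range E"]
  proof
    fix x assume x: "x \<in> - range E"
    obtain B where B: "x \<in> B" "section_nbhd E B" using E_section_nbhd by blast
    have "B \<inter> range E = {}"
    proof (rule ccontr)
      assume "B \<inter> range E \<noteq> {}"
      then obtain a where "E a \<in> B" by blast
      then obtain \<sigma> where "local_section E a B \<sigma>" using B(2) unfolding section_nbhd_def by blast
      then have "E (\<sigma> x) = x" using B(1) unfolding local_section_def by blast
      then show False using x by (metis ComplD rangeI)
    qed
    then show "\<exists>T. open T \<and> x \<in> T \<and> T \<subseteq> - range E" using B unfolding section_nbhd_def by blast
  qed
  ultimately have "range E = {} \<or> - range E = {}"
    using conn unfolding connected_def by (metis Compl_disjoint Compl_partition Int_UNIV_left inf_bot_right inf_commute sup.orderE sup_top_right top_greatest)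
  then show ?thesis by auto
qed

end

section \<open>Bijectivity of the exponential map and the growth of distances\<close>

locale hadamard = exp_npc +
  assumes sc: "simply_connected (UNIV :: 'a set)"
begin

lemma E_inj: "inj E"
  by (rule simply_connected_lift_injective[OF E_locally_inj E_continuous E_section_nbhd sc])

lemma inv_E [simp]: "inv E (E u) = u" "E (inv E x) = x"
  using E_inj E_surj by (auto simp: surj_f_inv_f)

lemma inv_E_continuous: "continuous_on UNIV (inv E)"
  unfolding continuous_on_eq_continuous_at[OF open_UNIV]
proof
  fix x
  obtain B \<sigma> where B: "local_section E (inv E x) B \<sigma>" using E_local_section by blast
  have "inv E y = \<sigma> y" if "y \<in> B" for y using B that unfolding local_section_def by (metis inv_E(1))
  then have "continuous_on B (inv E)" using B unfolding local_section_def by (metis (no_types, lifting) continuous_on_cong)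
  then show "isCont (inv E) x" using B unfolding local_section_def by (simp add: continuous_on_eq_continuous_at)
qed

text \<open>Along the preimage of a curve from \<open>E b\<close> to \<open>E a\<close>, the linear
  function \<open>G0 (a - b)\<close> grows by \<open>(N (a - b))\<^sup>2\<close>, at a rate of at
  most \<open>N (a - b)\<close> times the speed. Working with a linear function avoids
  differentiating a norm at zero.\<close>

lemma E_expands: "N (a - b) \<le> riem_dist R (E b) (E a)"
proof (rule dist_greatest)
  fix \<gamma> assume \<gamma>: "pw R 0 1 \<gamma>" "\<gamma> 0 = E b" "\<gamma> 1 = E a"
  define u where "u t = inv E (\<gamma> t)" for t
  have Eu: "E (u t) = \<gamma> t" for t by (simp add: u_def)
  define \<phi> where "\<phi> t = G0 (a - b) (u t)" for t
  have lG: "bounded_linear (G0 (a - b))" using G0_bilinear unfolding bilinear_def linear_conv_bounded_linear by blast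
  have uc: "continuous_on {0..1} u" unfolding u_def
    by (rule continuous_on_compose2[OF inv_E_continuous pw_continuous[OF \<gamma>(1)]]) auto
  have "\<phi> 1 - \<phi> 0 \<le> N (a - b) * integral {0..1} (speed R \<gamma>)"
  proof (rule pw_bound[OF \<gamma>(1) N_nonneg])
    show "continuous_on {0..1} \<phi>" unfolding \<phi>_def
      by (rule bounded_linear.continuous_on[OF lG uc])
    fix t :: real assume t: "t \<in> {0<..<1}" and d: "diff_at R \<gamma> t"
    obtain c where c: "c \<in> charts R" "\<gamma> t \<in> chart_dom c" using chart_exists by blast
    obtain v where v: "((coord c \<circ> \<gamma>) has_vector_derivative v) (at t)" using d c by (auto simp: diff_at_def)
    have sp: "speed R \<gamma> t = sqrt (metric_at R c (coord c (\<gamma> t)) v v)"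
      using speed_chart[OF c _ v] d by (auto simp: diff_at_def)
    have Ed: "E (u t) \<in> chart_dom c" using c Eu by simp
    obtain V W \<rho> \<rho>' where I: "open V" "u t \<in> V" "open W" "W \<subseteq> chart_im c" "\<And>u. u \<in> V \<Longrightarrow> E u \<in> chart_dom c"
        "homeomorphism V W (\<lambda>u. coord c (E u)) \<rho>"
        "\<And>q. q \<in> W \<Longrightarrow> (\<rho> has_derivative \<rho>' q) (at q)"
        "\<And>q w. q \<in> W \<Longrightarrow> N (\<rho>' q w) \<le> sqrt (metric_at R c q w w)"
      by (rule short_inverse[OF c(1) Ed]) blast
    have W: "coord c (\<gamma> t) \<in> W" using I(2,6) Eu unfolding homeomorphism_def by (metis imageI)
    have "open ({0<..<1} \<inter> u -` V)"
      by (rule continuous_open_preimage[OF continuous_on_subset[OF uc]]) (use I(1) in auto)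
    moreover have "t \<in> {0<..<1} \<inter> u -` V" using t I(2) by simp
    moreover have "\<rho> ((coord c \<circ> \<gamma>) s) = u s" if "s \<in> {0<..<1} \<inter> u -` V" for s
      using I(6) that Eu unfolding homeomorphism_def by (metis IntD2 comp_apply vimageD)
    moreover have "((\<lambda>s. \<rho> ((coord c \<circ> \<gamma>) s)) has_vector_derivative \<rho>' (coord c (\<gamma> t)) v) (at t)"
      using has_derivative_compose[OF v[unfolded has_vector_derivative_def], of \<rho> "\<rho>' (coord c (\<gamma> t))"] I(7)[OF W]
        linear_scale[OF has_derivative_linear[OF I(7)[OF W]]] by (simp add: has_vector_derivative_def)
    ultimately have "(u has_vector_derivative \<rho>' (coord c (\<gamma> t)) v) (at t)"
      by (metis (no_types, lifting) has_vector_derivative_transform_within_open)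
    from bounded_linear.has_vector_derivative[OF lG this]
    have "(\<phi> has_real_derivative G0 (a - b) (\<rho>' (coord c (\<gamma> t)) v)) (at t)"
      by (simp add: \<phi>_def[abs_def] has_real_derivative_iff_has_vector_derivative)
    moreover have "G0 (a - b) (\<rho>' (coord c (\<gamma> t)) v) \<le> N (a - b) * speed R \<gamma> t"
      using G0_le[of "a - b" "\<rho>' (coord c (\<gamma> t)) v"] mult_left_mono[OF I(8)[OF W, of v] N_nonneg[of "a - b"]] sp by simp
    ultimately show "\<exists>\<phi>'. (\<phi> has_real_derivative \<phi>') (at t) \<and> \<phi>' \<le> N (a - b) * speed R \<gamma> t" by blast
  qed
  moreover have "\<phi> 1 - \<phi> 0 = N (a - b) * N (a - b)"
    using N_sq[of "a - b"] \<gamma> by (simp add: \<phi>_def u_def bilinear_rsub[OF G0_bilinear] power2_eq_square)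
  ultimately have le: "N (a - b) * N (a - b) \<le> N (a - b) * integral {0..1} (speed R \<gamma>)" by simp
  show "N (a - b) \<le> integral {0..1} (speed R \<gamma>)"
  proof (cases "N (a - b) = 0")
    case True
    then show ?thesis using length_nonneg by simp
  next
    case False
    then show ?thesis using le N_nonneg[of "a - b"] by (simp add: mult_le_cancel_left_pos)
  qed
qed

lemma E_zero: "E 0 = x0"
  unfolding E_def using geod_scale(1)[of 0 1 0] geod(2)[of 0] by simp

lemma dist_E: "riem_dist R x0 (E a) = N a"
proof (rule antisym)
  have "riem_dist R (geod a 0) (geod a 1) \<le> sqrt (metric_at R c0 (coord c0 (geod a 0)) (vel a 0 c0) (vel a 0 c0)) * (1 - 0)"
    by (rule geo_length[OF geod_sub]) (use c0 geod in auto)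
  then show "riem_dist R x0 (E a) \<le> N a" by (simp add: geod E_def N_def G0_def)
  show "N a \<le> riem_dist R x0 (E a)" using E_expands[of a 0] by (simp add: E_zero)
qed

end

section \<open>Comparison with flat triangles\<close>

context hadamard
begin

text \<open>The law of cosines at \<open>E (s *\<^sub>R v)\<close>, whose exponential map does not decrease distances.\<close>

lemma stewart:
  assumes s: "s \<in> {0..1}"
  shows "(riem_dist R (E (s *\<^sub>R v)) p)\<^sup>2 \<le>
    (1 - s) * (riem_dist R p x0)\<^sup>2 + s * (riem_dist R p (E v))\<^sup>2 - s * (1 - s) * (N v)\<^sup>2"
proof -
  define z where "z = geod v s"
  obtain c1 where c1: "c1 \<in> charts R" "z \<in> chart_dom c1" using chart_exists by blast
  interpret Z: hadamard R c1 z by unfold_locales (use c1 npc sc in auto)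
  define w where "w = vel v s c1"
  have zE: "E (s *\<^sub>R v) = z" using s geod_E by (simp add: z_def)
  have "geo {0..2} (\<lambda>t. geod v (1 * t + s)) (\<lambda>t c. 1 *\<^sub>R vel v (1 * t + s) c)"
    by (rule geo_affine[OF geod(1)]) (use s in auto)
  from Z.geod_unique[OF this, of w "1 - s"] have "geod v 1 = Z.geod w (1 - s)"
    using s by (simp add: z_def w_def)
  then have Ev: "E v = Z.E ((1 - s) *\<^sub>R w)" using Z.geod_E[of "1 - s" w] s by (simp add: E_def)
  \<comment> \<open>The geodesic from \<open>x0\<close> traversed backwards from
    \<open>z\<close>.\<close>
  have x0: "x0 = Z.E (- (s *\<^sub>R w))"
  proof (cases "s = 0")
    case True
    then show ?thesis using Z.E_zero by (simp add: z_def geod)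
  next
    case False
    then have s0: "s > 0" using s by simp
    have "geo {0..s} (\<lambda>t. geod v (- 1 * t + s)) (\<lambda>t c. - 1 *\<^sub>R vel v (- 1 * t + s) c)"
      by (rule geo_affine[OF geod(1)]) auto
    from Z.geod_unique[OF this s0, of "- w" s] have "geod v 0 = Z.geod (- w) s"
      using s by (simp add: z_def w_def)
    then show ?thesis using Z.geod_E[of s "- w"] s by (simp add: geod)
  qed
  define q where "q = inv Z.E p"
  have pq: "p = Z.E q" by (simp add: q_def)
  have dz: "riem_dist R z p = Z.N q" using Z.dist_E by (simp add: pq)
  have dx: "Z.N (q + s *\<^sub>R w) \<le> riem_dist R p x0"
    using Z.E_expands[of q "- (s *\<^sub>R w)"] dist_sym[of p x0] by (simp add: x0[symmetric] pq)
  have dy: "Z.N (q - (1 - s) *\<^sub>R w) \<le> riem_dist R p (E v)"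
    using Z.E_expands[of q "(1 - s) *\<^sub>R w"] dist_sym by (simp add: Ev pq)
  \<comment> \<open>The square of \<open>Z.N w\<close> enters the identity below with a negative
    coefficient, so it has to be bounded from below; this is the triangle inequality.\<close>
  have "N v = riem_dist R x0 (E v)" by (simp add: dist_E)
  also have "\<dots> \<le> riem_dist R z x0 + riem_dist R z (E v)" using dist_triangle[of x0 "E v" z] dist_sym[of x0 z] by simp
  also have "\<dots> = s * Z.N w + (1 - s) * Z.N w"
    using Z.dist_E[of "- (s *\<^sub>R w)"] Z.dist_E[of "(1 - s) *\<^sub>R w"] Z.N_minus[of "s *\<^sub>R w"] Z.N_scale[of s w] Z.N_scale[of "1 - s" w] s
    by (simp add: x0[symmetric] Ev)
  finally have Nw: "N v \<le> Z.N w" by (simp add: algebra_simps)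
  note B = Z.G0_bilinear
  have G: "Z.G0 w q = Z.G0 q w" by (rule Z.G0_sym)
  \<comment> \<open>Stewart's theorem in the Euclidean tangent space at \<open>z\<close>.\<close>
  have "(Z.N q)\<^sup>2 = (1 - s) * (Z.N (q + s *\<^sub>R w))\<^sup>2 + s * (Z.N (q - (1 - s) *\<^sub>R w))\<^sup>2 - s * (1 - s) * (Z.N w)\<^sup>2"
    unfolding Z.N_sq bilinear_ladd[OF B] bilinear_radd[OF B] bilinear_lsub[OF B] bilinear_rsub[OF B] bilinear_lmul[OF B] bilinear_rmul[OF B] G
    by (simp add: algebra_simps)
  also have "\<dots> \<le> (1 - s) * (riem_dist R p x0)\<^sup>2 + s * (riem_dist R p (E v))\<^sup>2 - s * (1 - s) * (N v)\<^sup>2"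
    using s Nw dx dy Z.N_nonneg N_nonneg by (intro diff_mono add_mono mult_left_mono power_mono) auto
  finally show ?thesis by (simp add: zE dz)
qed

text \<open>\<open>stewart\<close> is applied to the side from \<open>x0\<close> to
  \<open>E v\<close> with the point \<open>E (s *\<^sub>R w)\<close>, and then to the side from
  \<open>x0\<close> to \<open>E w\<close> with the point \<open>E v\<close>. In flat space both are
  equalities, so the bounds combine to an exact square.\<close>

lemma dist_E_scale:
  assumes s: "s \<in> {0..1}"
  shows "riem_dist R (E (s *\<^sub>R v)) (E (s *\<^sub>R w)) \<le> s * riem_dist R (E v) (E w)"
proof -
  let ?d = "riem_dist R"
  have "(?d (E (s *\<^sub>R v)) (E (s *\<^sub>R w)))\<^sup>2 \<le>
      (1 - s) * (?d (E (s *\<^sub>R w)) x0)\<^sup>2 + s * (?d (E (s *\<^sub>R w)) (E v))\<^sup>2 - s * (1 - s) * (N v)\<^sup>2"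
    by (rule stewart[OF s])
  also have "\<dots> \<le> (1 - s) * (s * N w)\<^sup>2
      + s * ((1 - s) * (N v)\<^sup>2 + s * (?d (E v) (E w))\<^sup>2 - s * (1 - s) * (N w)\<^sup>2) - s * (1 - s) * (N v)\<^sup>2"
    using s stewart[OF s, of w "E v"] dist_E[of "s *\<^sub>R w"] dist_E[of v] N_scale[of s w] dist_sym
    by (intro diff_mono add_mono mult_left_mono) auto
  also have "\<dots> = (s * ?d (E v) (E w))\<^sup>2" by (simp add: algebra_simps power2_eq_square)
  finally show ?thesis by (rule power2_le_imp_le) (use s dist_nonneg in auto)
qed

end

section \<open>Sequences that are tracked by a geodesic\<close>

context hadamard
begin

lemma E_cont_at: "isCont E u"
  using E_continuous by (simp add: continuous_on_eq_continuous_at)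

text \<open>\<open>u\<close> is a limit of the directions from \<open>x0\<close> to \<open>y n\<close>.\<close>

lemma limit_direction:
  assumes \<beta>: "\<beta> > 0"
    and inf: "\<exists>\<^sub>\<infinity>n. \<forall>k\<le>n. \<beta> * real k - C \<le> riem_dist R x0 (y n) - riem_dist R (y k) (y n)"
  shows "\<exists>u. \<forall>k. (riem_dist R (E ((\<beta> * real k) *\<^sub>R u)) (y k))\<^sup>2 \<le> (riem_dist R x0 (y k))\<^sup>2 - (\<beta> * real k)\<^sup>2 + 2 * C * (\<beta> * real k)"
proof -
  let ?d = "riem_dist R"
  obtain r :: "nat \<Rightarrow> nat" where r: "strict_mono r" "\<forall>n. r n \<in> {n. \<forall>k\<le>n. \<beta> * real k - C \<le> ?d x0 (y n) - ?d (y k) (y n)}"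
    using infinite_enumerate[OF inf[unfolded INFM_iff_infinite]] by (rule exE) (rule that, auto)
  define w where "w n = inv E (y n)" for n
  define D where "D n = N (w n)" for n
  define u where "u n = (1 / D n) *\<^sub>R w n" for n
  have Ew: "E (w n) = y n" for n by (simp add: w_def)
  have D: "D n = ?d x0 (y n)" for n using dist_E[of "w n"] by (simp add: D_def Ew)
  have D0: "D n \<ge> 0" for n by (simp add: D_def N_nonneg)
  obtain m where m: "m > 0" "\<And>w. m * norm w \<le> N w" by (rule N_lower) blast
  have "norm (u n) \<le> 1 / m" for n
  proof -
    have "N (u n) \<le> 1" using D0[of n] by (simp add: u_def N_scale D_def[symmetric])
    then show ?thesis using m(1) m(2)[of "u n"] by (simp add: field_simps)
  qed
  then have "bounded (range (u \<circ> r))" by (intro boundedI) auto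
  then obtain l r' where l: "strict_mono r'" "((u \<circ> r) \<circ> r') \<longlonglongrightarrow> l"
    using bounded_imp_convergent_subsequence by blast
  define q where "q n = r (r' n)" for n
  have ul: "(\<lambda>n. u (q n)) \<longlonglongrightarrow> l" using l(2) by (simp add: comp_def q_def)
  have qn: "n \<le> q n" for n
    using strict_mono_imp_increasing[OF strict_mono_o[OF r(1) l(1)], of n] by (simp add: q_def)
  have key: "?d (y k) (y (q n)) \<le> D (q n) - \<beta> * real k + C" if "k \<le> n" for k n
  proof -
    have "k \<le> q n" using that qn[of n] by simp
    then have "\<beta> * real k - C \<le> ?d x0 (y (q n)) - ?d (y k) (y (q n))" using r(2) by (simp add: q_def)
    then show ?thesis by (simp add: D)
  qed
  have Dn: "\<beta> * real n - C \<le> D (q n)" for n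
    using key[of n n] dist_nonneg[of "y n" "y (q n)"] by linarith
  have "filterlim (\<lambda>n. - C + \<beta> * real n) at_top sequentially"
    by (intro filterlim_tendsto_add_at_top[OF tendsto_const] filterlim_tendsto_pos_mult_at_top[OF tendsto_const \<beta>] filterlim_real_sequentially)
  then have Dinf: "filterlim (\<lambda>n. D (q n)) at_top sequentially"
    by (rule filterlim_at_top_mono) (use Dn in \<open>simp add: add.commute\<close>)
  show ?thesis
  proof (intro exI[of _ l] allI)
    fix k
    define b where "b = \<beta> * real k"
    define P where "P = ?d x0 (y k)"
    have b0: "b \<ge> 0" using \<beta> by (simp add: b_def)
    have sD: "(\<lambda>n. b / D (q n)) \<longlonglongrightarrow> 0" by (rule tendsto_divide_0[OF tendsto_const filterlim_at_top_imp_at_infinity[OF Dinf]])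
    have CD: "(\<lambda>n. b * C\<^sup>2 / D (q n)) \<longlonglongrightarrow> 0" by (rule tendsto_divide_0[OF tendsto_const filterlim_at_top_imp_at_infinity[OF Dinf]])
    have "(\<lambda>n. (1 - b / D (q n)) * (P\<^sup>2 - b\<^sup>2 + 2 * C * b) + b * C\<^sup>2 / D (q n)) \<longlonglongrightarrow> (1 - 0) * (P\<^sup>2 - b\<^sup>2 + 2 * C * b) + 0"
      by (intro tendsto_intros sD CD)
    moreover have "(\<lambda>n. (?d (E (b *\<^sub>R u (q n))) (y k))\<^sup>2) \<longlonglongrightarrow> (?d (E (b *\<^sub>R l)) (y k))\<^sup>2"
      by (intro tendsto_power tendsto_dist tendsto_const isCont_tendsto_compose[OF E_cont_at] tendsto_scaleR ul)
    moreover have "\<forall>\<^sub>F n in sequentially. (?d (E (b *\<^sub>R u (q n))) (y k))\<^sup>2 \<le> (1 - b / D (q n)) * (P\<^sup>2 - b\<^sup>2 + 2 * C * b) + b * C\<^sup>2 / D (q n)"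
      using eventually_ge_at_top[of k] filterlim_at_top_dense[THEN iffD1, OF Dinf, rule_format, of b]
    proof eventually_elim
      fix n assume n: "k \<le> n" "b < D (q n)"
      let ?D = "D (q n)"
      have Dp: "?D > 0" using n b0 by simp
      \<comment> \<open>\<open>stewart\<close> for the triangle with vertices \<open>x0\<close>,
        \<open>y k\<close> and \<open>y (q n)\<close>, at the point at distance \<open>b\<close>
        from \<open>x0\<close>. The side from \<open>y k\<close> to \<open>y (q n)\<close> is at
        most \<open>?D - b + C\<close>; after cancellation of the terms that grow with
        \<open>?D\<close>, the error \<open>b * C\<^sup>2 / ?D\<close> tends to zero.\<close>
      have s: "b / ?D \<in> {0..1}" using n b0 Dp by simp
      have "b *\<^sub>R u (q n) = (b / ?D) *\<^sub>R w (q n)" by (simp add: u_def)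
      then have "(?d (E (b *\<^sub>R u (q n))) (y k))\<^sup>2 \<le> (1 - b / ?D) * (?d (y k) x0)\<^sup>2 + (b / ?D) * (?d (y k) (y (q n)))\<^sup>2 - (b / ?D) * (1 - b / ?D) * ?D\<^sup>2"
        using stewart[OF s, of "w (q n)" "y k"] by (simp add: Ew D_def)
      also have "\<dots> \<le> (1 - b / ?D) * P\<^sup>2 + (b / ?D) * (?D - b + C)\<^sup>2 - (b / ?D) * (1 - b / ?D) * ?D\<^sup>2"
        using key[OF n(1)] s dist_nonneg dist_sym[of "y k" x0] unfolding b_def[symmetric] P_def
        by (intro diff_right_mono add_mono mult_left_mono power_mono) auto
      also have "\<dots> = (1 - b / ?D) * (P\<^sup>2 - b\<^sup>2 + 2 * C * b) + b * C\<^sup>2 / ?D"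
        using Dp by (simp add: field_simps power2_eq_square)
      finally show "(?d (E (b *\<^sub>R u (q n))) (y k))\<^sup>2 \<le> (1 - b / ?D) * (P\<^sup>2 - b\<^sup>2 + 2 * C * b) + b * C\<^sup>2 / ?D" .
    qed
    ultimately have "(?d (E (b *\<^sub>R l)) (y k))\<^sup>2 \<le> (1 - 0) * (P\<^sup>2 - b\<^sup>2 + 2 * C * b) + 0"
      by (rule tendsto_le[OF sequentially_bot])
    then show "(?d (E ((\<beta> * real k) *\<^sub>R l)) (y k))\<^sup>2 \<le> (?d x0 (y k))\<^sup>2 - (\<beta> * real k)\<^sup>2 + 2 * C * (\<beta> * real k)"
      by (simp add: b_def P_def)
  qed
qed

lemma approximate_tracking:
  assumes A: "A \<ge> 0" and up: "\<And>e. e > 0 \<Longrightarrow> \<forall>\<^sub>F n in sequentially. riem_dist R x0 (y n) \<le> (A + e) * real n"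
    and rec: "\<And>\<beta>. 0 < \<beta> \<Longrightarrow> \<beta> < A \<Longrightarrow> \<exists>C. \<exists>\<^sub>\<infinity>n. \<forall>k\<le>n. \<beta> * real k - C \<le> riem_dist R x0 (y n) - riem_dist R (y k) (y n)"
    and \<delta>: "\<delta> > 0"
  shows "\<exists>v. \<forall>\<^sub>F k in sequentially. riem_dist R (E (real k *\<^sub>R v)) (y k) \<le> \<delta> * real k"
proof (cases "A = 0")
  case True
  then show ?thesis using up[OF \<delta>] by (intro exI[of _ 0]) (simp add: E_zero)
next
  case False
  then have A0: "A > 0" using A by simp
  let ?d = "riem_dist R"
  \<comment> \<open>Here \<open>(A + \<eta>)\<^sup>2 - (A - \<eta>)\<^sup>2 = 4 * A * \<eta>\<close>
    is at most half of \<open>\<delta>\<^sup>2\<close>. The other half absorbs the error that is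
    linear in \<open>k\<close>, and \<open>A / 2\<close> keeps \<open>\<beta>\<close>
    positive.\<close>
  define \<eta> where "\<eta> = min (A / 2) (\<delta>\<^sup>2 / (8 * A))"
  have \<eta>: "\<eta> > 0" "\<eta> < A" using A0 \<delta> by (auto simp: \<eta>_def)
  have "4 * A * \<eta> \<le> 4 * A * (\<delta>\<^sup>2 / (8 * A))" using A0 by (intro mult_left_mono) (auto simp: \<eta>_def)
  then have \<eta>2: "(A + \<eta>)\<^sup>2 - (A - \<eta>)\<^sup>2 \<le> \<delta>\<^sup>2 / 2" using A0 by (simp add: power2_eq_square algebra_simps)
  define \<beta> where "\<beta> = A - \<eta>"
  have \<beta>: "0 < \<beta>" "\<beta> < A" using \<eta> by (auto simp: \<beta>_def)
  obtain C where "\<exists>\<^sub>\<infinity>n. \<forall>k\<le>n. \<beta> * real k - C \<le> ?d x0 (y n) - ?d (y k) (y n)" using rec[OF \<beta>] by blast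
  from limit_direction[OF \<beta>(1) this] obtain u where
    u: "\<And>k. (?d (E ((\<beta> * real k) *\<^sub>R u)) (y k))\<^sup>2 \<le> (?d x0 (y k))\<^sup>2 - (\<beta> * real k)\<^sup>2 + 2 * C * (\<beta> * real k)" by blast
  have "\<forall>\<^sub>F k in sequentially. real k > 4 * C * \<beta> / \<delta>\<^sup>2"
    using filterlim_at_top_dense[THEN iffD1, OF filterlim_real_sequentially] by blast
  then have "\<forall>\<^sub>F k in sequentially. ?d (E (real k *\<^sub>R (\<beta> *\<^sub>R u))) (y k) \<le> \<delta> * real k"
    using up[OF \<eta>(1)]
  proof eventually_elim
    fix k assume k: "real k > 4 * C * \<beta> / \<delta>\<^sup>2" "?d x0 (y k) \<le> (A + \<eta>) * real k"
    have "4 * C * \<beta> \<le> \<delta>\<^sup>2 * real k" using k(1) \<delta> by (simp add: field_simps)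
    then have "(4 * C * \<beta>) * real k \<le> (\<delta>\<^sup>2 * real k) * real k" by (rule mult_right_mono) simp
    then have 1: "2 * C * (\<beta> * real k) \<le> \<delta>\<^sup>2 / 2 * (real k)\<^sup>2" by (simp add: power2_eq_square algebra_simps)
    have "(?d x0 (y k))\<^sup>2 \<le> ((A + \<eta>) * real k)\<^sup>2" using k(2) dist_nonneg by (rule power_mono)
    then have "(?d x0 (y k))\<^sup>2 - (\<beta> * real k)\<^sup>2 \<le> ((A + \<eta>)\<^sup>2 - (A - \<eta>)\<^sup>2) * (real k)\<^sup>2"
      unfolding \<beta>_def power_mult_distrib[symmetric] left_diff_distrib by (simp add: power_mult_distrib)
    also have "\<dots> \<le> \<delta>\<^sup>2 / 2 * (real k)\<^sup>2" by (rule mult_right_mono[OF \<eta>2]) simp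
    finally have "(?d (E ((\<beta> * real k) *\<^sub>R u)) (y k))\<^sup>2 \<le> (\<delta> * real k)\<^sup>2" using u[of k] 1 by (simp add: power_mult_distrib)
    then have "?d (E ((\<beta> * real k) *\<^sub>R u)) (y k) \<le> \<delta> * real k" by (rule power2_le_imp_le) (use \<delta> in simp)
    then show "?d (E (real k *\<^sub>R (\<beta> *\<^sub>R u))) (y k) \<le> \<delta> * real k" by (simp add: mult.commute)
  qed
  then show ?thesis by blast
qed

text \<open>By convexity, the quotient of the left hand side by \<open>k\<close> is nondecreasing in \<open>k\<close>.\<close>

lemma tracking_close:
  assumes v: "\<forall>\<^sub>F k in sequentially. riem_dist R (E (real k *\<^sub>R v)) (y k) \<le> \<delta> * real k"
    and w: "\<forall>\<^sub>F k in sequentially. riem_dist R (E (real k *\<^sub>R w)) (y k) \<le> \<epsilon> * real k"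
  shows "riem_dist R (E (real k *\<^sub>R v)) (E (real k *\<^sub>R w)) \<le> (\<delta> + \<epsilon>) * real k"
proof -
  let ?d = "riem_dist R"
  have "\<forall>\<^sub>F n in sequentially. n > k \<and> ?d (E (real n *\<^sub>R v)) (y n) \<le> \<delta> * real n \<and> ?d (E (real n *\<^sub>R w)) (y n) \<le> \<epsilon> * real n"
    by (intro eventually_conj v w eventually_gt_at_top)
  then obtain n where n: "n > k" "?d (E (real n *\<^sub>R v)) (y n) \<le> \<delta> * real n" "?d (E (real n *\<^sub>R w)) (y n) \<le> \<epsilon> * real n"
    using eventually_happens'[OF sequentially_bot] by blast
  define s where "s = real k / real n"
  have s: "s \<in> {0..1}" "s * real n = real k" using n(1) by (auto simp: s_def)
  have "?d (E (real k *\<^sub>R v)) (E (real k *\<^sub>R w)) \<le> s * ?d (E (real n *\<^sub>R v)) (E (real n *\<^sub>R w))"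
    using dist_E_scale[OF s(1), of "real n *\<^sub>R v" "real n *\<^sub>R w"] s(2) by simp
  also have "\<dots> \<le> s * (\<delta> * real n + \<epsilon> * real n)"
    using s(1) n(2,3) dist_triangle[of "E (real n *\<^sub>R v)" "E (real n *\<^sub>R w)" "y n"] dist_sym[of "y n"] by (intro mult_left_mono) auto
  also have "\<dots> = (\<delta> + \<epsilon>) * (s * real n)" by (simp add: algebra_simps)
  finally show ?thesis using s(2) by simp
qed

lemma smallo_real_iff:
  fixes g :: "nat \<Rightarrow> real"
  assumes "\<And>n. g n \<ge> 0"
  shows "g \<in> o(\<lambda>n. real n) \<longleftrightarrow> (\<forall>e>0. \<forall>\<^sub>F n in sequentially. g n \<le> e * real n)"
  using assms by (auto simp: smallo_def)

text \<open>Vectors that track with errors \<open>\<delta> m\<close> form a Cauchy sequence by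
  \<open>tracking_close\<close> at \<open>k = 1\<close> and \<open>E_expands\<close>. Passing to the
  limit in \<open>tracking_close\<close> for each \<open>k\<close> shows that the limit vector is as
  close to \<open>v m\<close> as needed, uniformly relative to \<open>k\<close>.\<close>

lemma tracking:
  assumes "A \<ge> 0" "\<And>e. e > 0 \<Longrightarrow> \<forall>\<^sub>F n in sequentially. riem_dist R x0 (y n) \<le> (A + e) * real n"
    and "\<And>\<beta>. 0 < \<beta> \<Longrightarrow> \<beta> < A \<Longrightarrow> \<exists>C. \<exists>\<^sub>\<infinity>n. \<forall>k\<le>n. \<beta> * real k - C \<le> riem_dist R x0 (y n) - riem_dist R (y k) (y n)"
  shows "\<exists>v. (\<lambda>k. riem_dist R (E (real k *\<^sub>R v)) (y k)) \<in> o(\<lambda>n. real n)"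
proof -
  let ?d = "riem_dist R"
  define \<delta> where "\<delta> m = 1 / real (m + 1)" for m
  have "\<exists>v. \<forall>\<^sub>F k in sequentially. ?d (E (real k *\<^sub>R v)) (y k) \<le> \<delta> m * real k" for m
    by (rule approximate_tracking[OF assms]) (auto simp: \<delta>_def)
  then obtain v where v: "\<And>m. \<forall>\<^sub>F k in sequentially. ?d (E (real k *\<^sub>R v m)) (y k) \<le> \<delta> m * real k" by metis
  have cl: "?d (E (real k *\<^sub>R v m)) (E (real k *\<^sub>R v m')) \<le> (\<delta> m + \<delta> m') * real k" for k m m'
    by (rule tracking_close[OF v v])
  have \<delta>0: "\<delta> \<longlonglongrightarrow> 0" unfolding \<delta>_def by (rule LIMSEQ_ignore_initial_segment[OF lim_1_over_n])
  obtain \<mu> where \<mu>: "\<mu> > 0" "\<And>w. \<mu> * norm w \<le> N w" by (rule N_lower) blast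
  have N1: "\<mu> * norm (v m - v m') \<le> \<delta> m + \<delta> m'" for m m'
    using \<mu>(2)[of "v m - v m'"] E_expands[of "v m" "v m'"] cl[of 1 m' m] dist_sym[of "E (v m')"] by simp
  have "Cauchy v"
  proof (rule CauchyI)
    fix e :: real assume e: "e > 0"
    then obtain K where K: "\<And>m. m \<ge> K \<Longrightarrow> \<delta> m < \<mu> * e / 2"
      using order_tendstoD(2)[OF \<delta>0, of "\<mu> * e / 2"] \<mu>(1) by (auto simp: eventually_sequentially)
    show "\<exists>K. \<forall>m\<ge>K. \<forall>n\<ge>K. norm (v m - v n) < e"
    proof (intro exI[of _ K] allI impI)
      fix m n assume "K \<le> m" "K \<le> n"
      then have "\<mu> * norm (v m - v n) < \<mu> * e" using N1[of m n] K[of m] K[of n] by simp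
      then show "norm (v m - v n) < e" using \<mu>(1) by simp
    qed
  qed
  then obtain l where l: "v \<longlonglongrightarrow> l" using Cauchy_convergent convergent_def by metis
  have lim: "?d (E (real k *\<^sub>R v m)) (E (real k *\<^sub>R l)) \<le> \<delta> m * real k" for k m
  proof -
    have "(\<lambda>m'. ?d (E (real k *\<^sub>R v m)) (E (real k *\<^sub>R v m'))) \<longlonglongrightarrow> ?d (E (real k *\<^sub>R v m)) (E (real k *\<^sub>R l))"
      by (intro tendsto_dist tendsto_const isCont_tendsto_compose[OF E_cont_at] tendsto_scaleR l)
    moreover have "(\<lambda>m'. (\<delta> m + \<delta> m') * real k) \<longlonglongrightarrow> (\<delta> m + 0) * real k" by (intro tendsto_intros \<delta>0)
    ultimately have "?d (E (real k *\<^sub>R v m)) (E (real k *\<^sub>R l)) \<le> (\<delta> m + 0) * real k"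
      by (rule LIMSEQ_le) (use cl in auto)
    then show ?thesis by simp
  qed
  have "\<forall>\<^sub>F k in sequentially. ?d (E (real k *\<^sub>R l)) (y k) \<le> e * real k" if e: "e > 0" for e
  proof -
    obtain m where m: "\<delta> m < e / 2"
      using eventually_happens'[OF sequentially_bot order_tendstoD(2)[OF \<delta>0, of "e / 2"]] e by auto
    show ?thesis using v[of m]
    proof eventually_elim
      fix k assume k: "?d (E (real k *\<^sub>R v m)) (y k) \<le> \<delta> m * real k"
      have "?d (E (real k *\<^sub>R l)) (y k) \<le> (2 * \<delta> m) * real k"
        using k lim[of k m] dist_triangle[of "E (real k *\<^sub>R l)" "y k" "E (real k *\<^sub>R v m)"] dist_sym[of "E (real k *\<^sub>R l)"] by simp
      also have "\<dots> \<le> e * real k" using m by (intro mult_right_mono) auto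
      finally show "?d (E (real k *\<^sub>R l)) (y k) \<le> e * real k" .
    qed
  qed
  then show ?thesis using smallo_real_iff dist_nonneg by (intro exI[of _ l]) simp
qed

lemma tracking_unique:
  assumes "(\<lambda>k. riem_dist R (E (real k *\<^sub>R v)) (y k)) \<in> o(\<lambda>n. real n)" "(\<lambda>k. riem_dist R (E (real k *\<^sub>R w)) (y k)) \<in> o(\<lambda>n. real n)"
  shows "v = w"
proof -
  have "N (v - w) \<le> 0 + e" if e: "e > 0" for e
  proof -
    have "\<forall>\<^sub>F k in sequentially. riem_dist R (E (real k *\<^sub>R v)) (y k) \<le> e/2 * real k" "\<forall>\<^sub>F k in sequentially. riem_dist R (E (real k *\<^sub>R w)) (y k) \<le> e/2 * real k"
      using assms e unfolding smallo_real_iff[OF dist_nonneg] by (meson half_gt_zero)+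
    from tracking_close[OF this, of 1] show ?thesis using E_expands[of v w] dist_sym[of "E v"] by simp
  qed
  then have "N (v - w) \<le> 0" by (rule field_le_epsilon)
  then show ?thesis using N_nonneg[of "v - w"] N_zero_iff[of "v - w"] by simp
qed

end

section \<open>Subadditive cocycles\<close>

text \<open>The index \<open>k\<close> is kept if no sum of consecutive terms starting at \<open>k\<close> is negative; the other indices
  are covered by disjoint blocks with negative sums.\<close>

lemma riesz_leaders:
  fixes c :: "nat \<Rightarrow> real"
  assumes "m \<le> n"
  shows "sum c {m..<n} \<le> (\<Sum>k\<in>{m..<n}. if \<forall>j\<in>{k..n}. 0 \<le> sum c {k..<j} then c k else 0)"
  using assms
proof (induction "n - m" arbitrary: m rule: less_induct)
  case less
  let ?good = "\<lambda>k. \<forall>j\<in>{k..n}. 0 \<le> sum c {k..<j}"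
  let ?b = "\<lambda>k. if ?good k then c k else 0"
  consider "m = n" | "m < n" "?good m" | "m < n" "\<not> ?good m" using less(2) by linarith
  then show ?case
  proof cases
    case 1
    then show ?thesis by simp
  next
    case 2
    then have "sum c {Suc m..<n} \<le> sum ?b {Suc m..<n}" by (intro less(1)) auto
    moreover have "?b m = c m" using 2(2) by simp
    ultimately show ?thesis unfolding sum.atLeast_Suc_lessThan[OF 2(1)] by linarith
  next
    case 3
    \<comment> \<open>The first \<open>j\<close> with a negative sum. From each index of
      \<open>{m..<j}\<close> the sum up to \<open>j\<close> is negative too, so the block
      contributes nothing to the right hand side and a negative amount to the left.\<close>
    define j where "j = (LEAST j. m \<le> j \<and> j \<le> n \<and> sum c {m..<j} < 0)"
    have ex: "\<exists>j. m \<le> j \<and> j \<le> n \<and> sum c {m..<j} < 0" using 3(2) by (auto simp: not_le)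
    have j: "m \<le> j" "j \<le> n" "sum c {m..<j} < 0" using LeastI_ex[OF ex] unfolding j_def by blast+
    have min: "0 \<le> sum c {m..<i}" if "m \<le> i" "i < j" for i
      using not_less_Least[of i] that j(2) unfolding j_def by fastforce
    have "m \<noteq> j" using j(3) by auto
    then have mj: "m < j" using j(1) by simp
    have "\<not> ?good i" if i: "i \<in> {m..<j}" for i
    proof -
      have "sum c {m..<i} + sum c {i..<j} = sum c {m..<j}" by (rule sum.atLeastLessThan_concat) (use i in auto)
      then have "sum c {i..<j} < 0" using min[of i] i j(3) by auto
      then show ?thesis using i j(2) by (intro notI) (drule bspec[of _ _ j], auto)
    qed
    then have z: "sum ?b {m..<j} = 0" by (intro sum.neutral ballI if_not_P)
    have "sum c {j..<n} \<le> sum ?b {j..<n}" by (rule less(1)) (use mj j in auto)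
    moreover have "sum c {m..<j} + sum c {j..<n} = sum c {m..<n}" "sum ?b {m..<j} + sum ?b {j..<n} = sum ?b {m..<n}"
      by (rule sum.atLeastLessThan_concat; use j in simp)+
    ultimately show ?thesis using z j(3) by linarith
  qed
qed

section \<open>The maximal ergodic theorem and leading times\<close>

locale measure_preserving = prob_space +
  fixes f :: "'a \<Rightarrow> 'a"
  assumes f_measurable [measurable]: "f \<in> measurable M M" and preserving: "distr M M f = M"
begin

lemma f_space: "x \<in> space M \<Longrightarrow> f x \<in> space M"
  using measurable_space[OF f_measurable] .

lemma funpow_measurable [measurable]: "(f ^^ k) \<in> measurable M M"
  by (induction k) (auto intro: measurable_comp)

lemma integrable_compose: "integrable M g \<Longrightarrow> integrable M (\<lambda>x. g (f x))" for g :: "'a \<Rightarrow> real"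
  using integrable_distr[OF f_measurable, of g] preserving by simp

lemma integral_compose:
  fixes g :: "'a \<Rightarrow> real"
  assumes "g \<in> borel_measurable M"
  shows "(\<integral>x. g (f x) \<partial>M) = (\<integral>x. g x \<partial>M)"
  using integral_distr[OF f_measurable, of g] preserving assms by simp

text \<open>Garsia's proof of the maximal ergodic theorem; \<open>mx Q\<close> is the maximum of the first \<open>Q + 1\<close> Birkhoff sums.\<close>

lemma maximal_ergodic:
  fixes g :: "'a \<Rightarrow> real"
  assumes g: "integrable M g" and D [measurable]: "D \<in> sets M" and inv: "\<And>x. x \<in> space M \<Longrightarrow> f x \<in> D \<longleftrightarrow> x \<in> D"
    and pos: "\<And>x. x \<in> D \<Longrightarrow> \<exists>q. 0 < (\<Sum>i<q. g ((f ^^ i) x))"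
  shows "0 \<le> (\<integral>x. indicator D x * g x \<partial>M)"
proof -
  have [measurable]: "g \<in> borel_measurable M" using g by simp
  define mx where "mx = rec_nat (\<lambda>x. 0) (\<lambda>Q m x. max 0 (g x + m (f x)))"
  have mx: "mx 0 x = 0" "mx (Suc Q) x = max 0 (g x + mx Q (f x))" for Q x by (simp_all add: mx_def)
  have int: "integrable M (mx Q)" for Q
  proof (induction Q)
    case 0
    then show ?case by (simp add: mx_def)
  next
    case (Suc Q)
    have "mx (Suc Q) = (\<lambda>x. max 0 (g x + mx Q (f x)))" using mx(2) by blast
    then show ?case using g integrable_compose[OF Suc] by (auto intro!: Bochner_Integration.integrable_max)
  qed
  have [measurable]: "mx Q \<in> borel_measurable M" for Q using int by auto
  have nonneg: "mx Q x \<ge> 0" for Q x by (cases Q) (auto simp: mx)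
  have mono: "mx Q x \<le> mx (Suc Q) x" for Q x
  proof (induction Q arbitrary: x)
    case (Suc Q)
    then show ?case unfolding mx(2)[of "Suc Q" x] mx(2)[of Q x] by (intro max.mono add_left_mono order_refl)
  qed (simp add: mx)
  have sum_le: "(\<Sum>i<q. g ((f ^^ i) x)) \<le> mx q x" for q x
  proof (induction q arbitrary: x)
    case (Suc q)
    have "(\<Sum>i<Suc q. g ((f ^^ i) x)) = g x + (\<Sum>i<q. g ((f ^^ i) (f x)))"
      unfolding sum.lessThan_Suc_shift by (simp add: funpow_swap1)
    then show ?case using Suc[of "f x"] by (simp add: mx)
  qed (simp add: mx)
  define h where "h Q x = indicator D x * (if mx Q x > 0 then g x else 0)" for Q x
  have "0 \<le> (\<integral>x. h (Suc Q) x \<partial>M)" for Q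
  proof -
    let ?m = "mx (Suc Q)"
    have i1: "integrable M (\<lambda>x. indicator D x * ?m x)"
      by (rule Bochner_Integration.integrable_bound[OF int[of "Suc Q"]]) (auto simp: indicator_def)
    have i2: "integrable M (\<lambda>x. indicator D (f x) * ?m (f x))" using integrable_compose[OF i1] .
    have "(\<integral>x. indicator D x * ?m x - indicator D (f x) * ?m (f x) \<partial>M) = 0"
      unfolding Bochner_Integration.integral_diff[OF i1 i2] by (subst integral_compose) auto
    moreover have "(\<integral>x. indicator D x * ?m x - indicator D (f x) * ?m (f x) \<partial>M) \<le> (\<integral>x. h (Suc Q) x \<partial>M)"
    proof (rule integral_mono)
      show "integrable M (h (Suc Q))"
        unfolding h_def[abs_def] by (rule Bochner_Integration.integrable_bound[OF g]) (auto simp: indicator_def)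
      fix x assume x: "x \<in> space M"
      \<comment> \<open>Where \<open>?m x\<close> is positive, it equals
        \<open>g x + mx Q (f x)\<close>, which is at most \<open>g x + ?m (f x)\<close>; elsewhere
        \<open>?m x\<close> is zero and \<open>?m (f x)\<close> is nonnegative.\<close>
      have "?m x - ?m (f x) \<le> (if ?m x > 0 then g x else 0)"
        using mono[of Q "f x"] nonneg[of "Suc Q" "f x"] mx(2)[of Q x] by (auto simp: max_def split: if_splits)
      then show "indicator D x * ?m x - indicator D (f x) * ?m (f x) \<le> h (Suc Q) x"
        using inv[OF x] by (auto simp: h_def indicator_def)
    qed (use i1 i2 in auto)
    ultimately show ?thesis by simp
  qed
  moreover have "(\<lambda>Q. \<integral>x. h (Suc Q) x \<partial>M) \<longlonglongrightarrow> (\<integral>x. indicator D x * g x \<partial>M)"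
  proof (rule integral_dominated_convergence[where w="\<lambda>x. norm (g x)"])
    show "AE x in M. (\<lambda>Q. h (Suc Q) x) \<longlonglongrightarrow> indicator D x * g x"
    proof (rule AE_I2)
      fix x
      show "(\<lambda>Q. h (Suc Q) x) \<longlonglongrightarrow> indicator D x * g x"
      proof (cases "x \<in> D")
        case True
        then obtain q where q: "0 < (\<Sum>i<q. g ((f ^^ i) x))" using pos by blast
        have "mx Q x > 0" if "Q \<ge> q" for Q
          using q sum_le[of x q] lift_Suc_mono_le[where f="\<lambda>Q. mx Q x", OF mono that] by linarith
        then have "\<forall>\<^sub>F Q in sequentially. h (Suc Q) x = indicator D x * g x"
          by (intro eventually_sequentiallyI[of q]) (simp add: h_def)
        then show ?thesis by (rule tendsto_eventually)
      qed (simp add: h_def)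
    qed
  qed (use g in \<open>auto simp: h_def[abs_def] indicator_def\<close>)
  ultimately show ?thesis by (auto intro: LIMSEQ_le_const)
qed

end

text \<open>Both \<open>subadd\<close> and \<open>subadd'\<close> express the triangle inequality
  for displacements. Together they show that passing from \<open>x\<close> to \<open>f x\<close>
  changes the sequence by a bounded amount and a shift, whence the invariance of \<open>hi\<close>
  and \<open>good\<close>.\<close>

locale subadditive_cocycle = measure_preserving +
  fixes a :: "nat \<Rightarrow> 'a \<Rightarrow> real"
  assumes a_measurable [measurable]: "a n \<in> borel_measurable M"
    and a_0: "a 0 x = 0" and a_nonneg: "a n x \<ge> 0"
    and subadd: "a (Suc n) x \<le> a 1 x + a n (f x)" and subadd': "a n (f x) \<le> a 1 x + a (Suc n) x"
    and integrable_a: "integrable M (a 1)"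
begin

text \<open>\<open>hi \<alpha> x\<close> means that the upper limit of \<open>a n x / n\<close> is larger than \<open>\<alpha>\<close>. The constant \<open>C\<close> makes
  the set of points that satisfy \<open>good \<beta>\<close> exactly invariant under \<open>f\<close>.\<close>

definition hi :: "real \<Rightarrow> 'a \<Rightarrow> bool" where
  "hi \<alpha> x \<longleftrightarrow> (\<exists>m::nat. \<forall>N. \<exists>n\<ge>N. (\<alpha> + 1 / real (Suc m)) * real n < a n x)"

definition lead :: "real \<Rightarrow> real \<Rightarrow> nat \<Rightarrow> 'a \<Rightarrow> bool" where
  "lead \<beta> C n x \<longleftrightarrow> (\<forall>k\<le>n. \<beta> * real k - C \<le> a n x - a (n - k) ((f ^^ k) x))"

definition good :: "real \<Rightarrow> 'a \<Rightarrow> bool" where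
  "good \<beta> x \<longleftrightarrow> (\<exists>C::nat. \<forall>N. \<exists>n\<ge>N. lead \<beta> (real C) n x)"

lemma lead_measurable [measurable]: "Measurable.pred M (lead \<beta> C n)"
  unfolding lead_def by measurable

text \<open>The bounds and constants in \<open>hi\<close> and \<open>good\<close> are quantified
  over natural numbers, so that countable unions and intersections suffice for
  measurability.\<close>

lemma good_measurable [measurable]: "Measurable.pred M (good \<beta>)"
  unfolding good_def by measurable

lemma hi_measurable [measurable]: "Measurable.pred M (hi \<alpha>)"
  unfolding hi_def by measurable

text \<open>An upper limit of quotients by \<open>n\<close> ignores a bounded term and a shift of
  \<open>n\<close> by at most one. The gap \<open>e\<close> between the margins for \<open>m\<close>
  and for \<open>Suc m\<close> absorbs both when \<open>n\<close> is large.\<close>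

lemma hi_transfer:
  assumes h: "hi \<alpha> x" and N: "\<And>n. n \<ge> 1 \<Longrightarrow> a n x \<le> c + a (s n) y" and s: "\<And>n. n \<ge> 1 \<Longrightarrow> s n + 1 \<ge> n \<and> s n \<le> n + 1"
    and \<alpha>: "\<alpha> \<ge> 0"
  shows "hi \<alpha> y"
proof -
  obtain m where m: "\<And>N. \<exists>n\<ge>N. (\<alpha> + 1 / real (Suc m)) * real n < a n x" using h unfolding hi_def by blast
  define e where "e = 1 / real (Suc m) - 1 / real (Suc (Suc m))"
  have e: "e > 0" unfolding e_def by (simp add: frac_less2)
  define b where "b = \<alpha> + 1 / real (Suc (Suc m))"
  have b: "b \<ge> 0" using \<alpha> by (simp add: b_def)
  obtain N0 :: nat where N0: "real N0 > (c + b) / e" using reals_Archimedean2 by blast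
  have "\<exists>n\<ge>N. b * real n < a n y" for N
  proof -
    obtain n where n: "n \<ge> N + N0 + 1" "(\<alpha> + 1 / real (Suc m)) * real n < a n x" using m by blast
    have "(c + b) / e < real n" using N0 n(1) by (simp add: less_le_trans)
    then have 1: "c + b < e * real n" using e by (simp add: field_simps)
    have 2: "(b + e) * real n < a n x" using n(2) by (simp add: b_def e_def)
    have 3: "b * real (s n) \<le> b * (real n + 1)" using s[of n] n(1) b by (intro mult_left_mono) auto
    have "b * real (s n) < a (s n) y" using 1 2 3 N[of n] n(1) by (simp add: algebra_simps)
    then show ?thesis using s[of n] n(1) by (intro exI[of _ "s n"]) auto
  qed
  then show ?thesis unfolding hi_def b_def by blast
qed

lemma hi_invariant:
  assumes "\<alpha> \<ge> 0"
  shows "hi \<alpha> (f x) \<longleftrightarrow> hi \<alpha> x"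
proof
  show "hi \<alpha> x" if "hi \<alpha> (f x)"
    by (rule hi_transfer[OF that, of "a 1 x" Suc]) (use subadd' assms in auto)
  show "hi \<alpha> (f x)" if "hi \<alpha> x"
  proof (rule hi_transfer[OF that, of "a 1 x" "\<lambda>n. n - 1"])
    show "a n x \<le> a 1 x + a (n - 1) (f x)" if "n \<ge> 1" for n using subadd[of "n - 1" x] that by simp
  qed (use assms in auto)
qed

lemma lead_Suc:
  assumes \<beta>: "\<beta> \<ge> 0"
  shows "lead \<beta> C n (f x) \<Longrightarrow> C \<ge> 0 \<Longrightarrow> lead \<beta> (C + a 1 x + \<beta>) (Suc n) x"
    and "lead \<beta> C (Suc n) x \<Longrightarrow> lead \<beta> (C + a 1 x) n (f x)"
proof -
  assume l: "lead \<beta> C n (f x)" and C: "C \<ge> 0"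
  show "lead \<beta> (C + a 1 x + \<beta>) (Suc n) x" unfolding lead_def
  proof (intro allI impI)
    fix k assume k: "k \<le> Suc n"
    show "\<beta> * real k - (C + a 1 x + \<beta>) \<le> a (Suc n) x - a (Suc n - k) ((f ^^ k) x)"
    proof (cases k)
      case 0
      then show ?thesis using a_nonneg[of 1 x] C \<beta> by simp
    next
      case (Suc j)
      then have "\<beta> * real j - C \<le> a n (f x) - a (n - j) ((f ^^ j) (f x))" using l k unfolding lead_def by auto
      then show ?thesis using subadd'[of n x] Suc by (simp add: funpow_swap1 algebra_simps)
    qed
  qed
next
  assume l: "lead \<beta> C (Suc n) x"
  show "lead \<beta> (C + a 1 x) n (f x)" unfolding lead_def
  proof (intro allI impI)
    fix k assume k: "k \<le> n"
    then have "\<beta> * real (Suc k) - C \<le> a (Suc n) x - a (Suc n - Suc k) ((f ^^ Suc k) x)" using l unfolding lead_def by (meson Suc_le_mono)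
    then show "\<beta> * real k - (C + a 1 x) \<le> a n (f x) - a (n - k) ((f ^^ k) (f x))"
      using subadd[of n x] \<beta> by (simp add: funpow_swap1 algebra_simps)
  qed
qed

lemma lead_mono: "lead \<beta> C n x \<Longrightarrow> C \<le> C' \<Longrightarrow> lead \<beta> C' n x"
  unfolding lead_def by (meson diff_left_mono order_trans)

lemma good_invariant:
  assumes \<beta>: "\<beta> \<ge> 0"
  shows "good \<beta> (f x) \<longleftrightarrow> good \<beta> x"
proof
  assume "good \<beta> (f x)"
  then obtain C :: nat where C: "\<And>N. \<exists>n\<ge>N. lead \<beta> (real C) n (f x)" unfolding good_def by blast
  obtain C' :: nat where C': "real C + a 1 x + \<beta> \<le> real C'" using real_arch_simple by blast
  have "\<exists>n\<ge>N. lead \<beta> (real C') n x" for N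
  proof -
    obtain n where n: "n \<ge> N" "lead \<beta> (real C) n (f x)" using C by blast
    from lead_mono[OF lead_Suc(1)[OF \<beta> n(2)] C'] show ?thesis using n(1) by (intro exI[of _ "Suc n"]) auto
  qed
  then show "good \<beta> x" unfolding good_def by blast
next
  assume "good \<beta> x"
  then obtain C :: nat where C: "\<And>N. \<exists>n\<ge>N. lead \<beta> (real C) n x" unfolding good_def by blast
  obtain C' :: nat where C': "real C + a 1 x \<le> real C'" using real_arch_simple by blast
  have "\<exists>n\<ge>N. lead \<beta> (real C') n (f x)" for N
  proof -
    obtain n where n: "n \<ge> Suc N" "lead \<beta> (real C) n x" using C by blast
    then obtain n' where n': "n = Suc n'" by (cases n) auto
    from lead_mono[OF lead_Suc(2)[OF \<beta> n(2)[unfolded n']] C'] show ?thesis using n n' by (intro exI[of _ n']) auto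
  qed
  then show "good \<beta> (f x)" unfolding good_def by blast
qed

text \<open>\<open>riesz_leaders\<close> for differences \<open>c k\<close> whose sums telescope. An
  index \<open>k\<close> is kept exactly when \<open>n - k\<close> is a leading time of
  \<open>(f ^^ k) x\<close>, and subadditivity bounds \<open>c k\<close> by the value of
  \<open>a 1 - \<beta>\<close> at that point.\<close>

lemma leaders_bound: "a n x - \<beta> * real n \<le> (\<Sum>k<n. if lead \<beta> 0 (n - k) ((f ^^ k) x) then a 1 ((f ^^ k) x) - \<beta> else 0)"
proof -
  define b where "b k = a (n - k) ((f ^^ k) x) + \<beta> * real k" for k
  define c where "c k = b k - b (Suc k)" for k
  have tel: "sum c {i..<j} = b i - b j" if "i \<le> j" for i j
    unfolding c_def using sum_Suc_diff'[of i j "\<lambda>k. - b k"] that by simp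
  have "a n x - \<beta> * real n = sum c {0..<n}" using tel[of 0 n] by (simp add: b_def a_0)
  also have "\<dots> \<le> (\<Sum>k\<in>{0..<n}. if \<forall>j\<in>{k..n}. 0 \<le> sum c {k..<j} then c k else 0)" by (rule riesz_leaders) simp
  also have "\<dots> \<le> (\<Sum>k\<in>{0..<n}. if lead \<beta> 0 (n - k) ((f ^^ k) x) then a 1 ((f ^^ k) x) - \<beta> else 0)"
  proof (rule sum_mono)
    fix k assume k: "k \<in> {0..<n}"
    have "(\<forall>j\<in>{k..n}. 0 \<le> sum c {k..<j}) \<longleftrightarrow> lead \<beta> 0 (n - k) ((f ^^ k) x)"
    proof -
      have "(\<forall>j\<in>{k..n}. 0 \<le> sum c {k..<j}) \<longleftrightarrow> (\<forall>i\<le>n - k. 0 \<le> sum c {k..<k + i})"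
      proof (intro iffI ballI allI impI)
        fix j assume "\<forall>i\<le>n - k. 0 \<le> sum c {k..<k + i}" "j \<in> {k..n}"
        then show "0 \<le> sum c {k..<j}" by (auto dest!: spec[of _ "j - k"])
      qed auto
      also have "\<dots> \<longleftrightarrow> lead \<beta> 0 (n - k) ((f ^^ k) x)"
      proof -
        have "sum c {k..<k + i} = a (n - k) ((f ^^ k) x) - a (n - k - i) ((f ^^ i) ((f ^^ k) x)) - \<beta> * real i" if "i \<le> n - k" for i
          using tel[of k "k + i"] funpow_add[of i k f] by (simp add: b_def algebra_simps)
        then show ?thesis unfolding lead_def by auto
      qed
      finally show ?thesis .
    qed
    moreover have "c k \<le> a 1 ((f ^^ k) x) - \<beta>"
    proof -
      obtain m where m: "n - k = Suc m" using k by (metis atLeastLessThan_iff Suc_diff_Suc)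
      then have "n - Suc k = m" by simp
      then show ?thesis using subadd[of m "(f ^^ k) x"] m by (simp add: c_def b_def algebra_simps)
    qed
    ultimately show "(if \<forall>j\<in>{k..n}. 0 \<le> sum c {k..<j} then c k else 0) \<le> (if lead \<beta> 0 (n - k) ((f ^^ k) x) then a 1 ((f ^^ k) x) - \<beta> else 0)"
      by simp
  qed
  finally show ?thesis by (simp add: atLeast0LessThan)
qed

text \<open>On the invariant set where this fails, the indicator of \<open>F J\<close> tends to \<open>0\<close>, while the maximal ergodic theorem
  bounds the integral of \<open>indicator (F J) * a 1 + h J\<close> from below.\<close>

lemma AE_good:
  assumes \<beta>: "0 \<le> \<beta>" "\<beta> < \<alpha>"
  shows "AE x in M. hi \<alpha> x \<longrightarrow> good \<beta> x"
proof -
  define D where "D = {x \<in> space M. hi \<alpha> x \<and> \<not> good \<beta> x}"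
  have [measurable]: "D \<in> sets M" unfolding D_def by measurable
  define F where "F J = {x \<in> space M. \<exists>j\<ge>J. lead \<beta> 0 j x}" for J
  have [measurable]: "F J \<in> sets M" for J unfolding F_def by measurable
  \<comment> \<open>The part of \<open>a 1\<close> above the level \<open>K\<close>. At an index
    with \<open>n - k < J\<close>, a leading time does not put the point into \<open>F J\<close>;
    there \<open>a 1\<close> is bounded by \<open>h J\<close> plus the constant
    \<open>J\<close>.\<close>
  define h where "h K x = max 0 (a 1 x - real K)" for K :: nat and x
  have h: "0 \<le> h K x" "h K x \<le> a 1 x" "a 1 x \<le> h K x + real K" for K x using a_nonneg[of 1 x] by (auto simp: h_def)
  have [measurable]: "h K \<in> borel_measurable M" for K unfolding h_def[abs_def] by measurable
  define g where "g J x = indicator (F J) x * a 1 x + h J x - (\<alpha> - \<beta>)" for J x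
  have int: "integrable M (\<lambda>x. indicator (F J) x * a 1 x)" "integrable M (h J)" for J
    by (rule Bochner_Integration.integrable_bound[OF integrable_a]; use h a_nonneg in \<open>auto simp: indicator_def\<close>)+
  have ge: "0 \<le> (\<integral>x. indicator D x * g J x \<partial>M)" for J
  proof (rule maximal_ergodic)
    show "integrable M (g J)" unfolding g_def[abs_def] using int by auto
    show "f x \<in> D \<longleftrightarrow> x \<in> D" if "x \<in> space M" for x
      using that f_space hi_invariant[of \<alpha>] good_invariant[of \<beta>] \<beta> by (auto simp: D_def)
    fix x assume x: "x \<in> D"
    then obtain m where m: "\<And>N. \<exists>n\<ge>N. (\<alpha> + 1 / real (Suc m)) * real n < a n x" unfolding D_def hi_def by blast
    \<comment> \<open>At most \<open>J\<close> indices satisfy \<open>n - k < J\<close>, and each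
      costs at most \<open>J\<close>. For this \<open>n\<close> the margin
      \<open>n / (m + 1)\<close> exceeds the total cost \<open>J * J\<close>.\<close>
    obtain n where n: "n \<ge> Suc m * (J * J) + 1" "(\<alpha> + 1 / real (Suc m)) * real n < a n x" using m by blast
    have xs: "(f ^^ k) x \<in> space M" for k using x funpow_measurable measurable_space unfolding D_def by (metis (no_types, lifting) mem_Collect_eq)
    have "a n x - \<beta> * real n \<le> (\<Sum>k<n. if lead \<beta> 0 (n - k) ((f ^^ k) x) then a 1 ((f ^^ k) x) - \<beta> else 0)" by (rule leaders_bound)
    also have "\<dots> \<le> (\<Sum>k<n. (g J ((f ^^ k) x) + (\<alpha> - \<beta>)) + (if n - k < J then real J else 0))"
    proof (rule sum_mono)
      fix k assume "k \<in> {..<n}"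
      let ?y = "(f ^^ k) x"
      show "(if lead \<beta> 0 (n - k) ?y then a 1 ?y - \<beta> else 0) \<le> (g J ?y + (\<alpha> - \<beta>)) + (if n - k < J then real J else 0)"
      proof (cases "n - k < J")
        case True
        then show ?thesis using h(1)[of J ?y] h(2)[of J ?y] h(3)[of ?y J] \<beta> a_nonneg[of 1 ?y] by (auto simp: g_def indicator_def)
      next
        case False
        then show ?thesis using h(1)[of J ?y] h(2)[of J ?y] h(3)[of ?y J] \<beta> a_nonneg[of 1 ?y] xs[of k] by (auto simp: g_def indicator_def F_def not_less)
      qed
    qed
    also have "\<dots> = (\<Sum>k<n. g J ((f ^^ k) x)) + real n * (\<alpha> - \<beta>) + real J * real (card {k \<in> {..<n}. n - k < J})"
      by (simp add: sum.distrib sum.If_cases Int_def)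
    also have "real J * real (card {k \<in> {..<n}. n - k < J}) \<le> real J * real J"
    proof (intro mult_left_mono)
      have "{k \<in> {..<n}. n - k < J} \<subseteq> (\<lambda>j. n - j) ` {..<J}"
      proof
        fix k assume "k \<in> {k \<in> {..<n}. n - k < J}"
        then show "k \<in> (\<lambda>j. n - j) ` {..<J}" by (intro image_eqI[of _ _ "n - k"]) auto
      qed
      then show "real (card {k \<in> {..<n}. n - k < J}) \<le> real J" using surj_card_le[of "{..<J}"] by fastforce
    qed simp
    finally have 1: "a n x - \<beta> * real n \<le> (\<Sum>k<n. g J ((f ^^ k) x)) + real n * (\<alpha> - \<beta>) + real J * real J" by simp
    have "real (Suc m * (J * J)) < real n" using n(1) by linarith
    then have "real J * real J < 1 / real (Suc m) * real n" by (simp add: field_simps)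
    then have "0 < (\<Sum>k<n. g J ((f ^^ k) x))" using 1 n(2) by (simp add: algebra_simps)
    then show "\<exists>q. 0 < (\<Sum>k<q. g J ((f ^^ k) x))" by blast
  qed simp
  let ?h = "\<lambda>J x. indicator D x * (indicator (F J) x * a 1 x + h J x)"
  have eq: "(\<integral>x. indicator D x * g J x \<partial>M) = (\<integral>x. ?h J x \<partial>M) - (\<alpha> - \<beta>) * measure M D" for J
  proof -
    have "(\<lambda>x. indicator D x * g J x) = (\<lambda>x. ?h J x - (\<alpha> - \<beta>) * indicator D x)" by (auto simp: g_def algebra_simps)
    moreover have "integrable M (?h J)"
      using integrable_real_mult_indicator[OF \<open>D \<in> sets M\<close> Bochner_Integration.integrable_add[OF int, of J J]] by (simp add: mult.commute)
    moreover have "integrable M (\<lambda>x. (\<alpha> - \<beta>) * indicator D x)"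
      by (rule integrable_const_bound[of _ "\<alpha> - \<beta>"]) (use \<beta> in \<open>auto simp: indicator_def\<close>)
    ultimately show ?thesis using sets.sets_into_space[OF \<open>D \<in> sets M\<close>]
      by (simp add: Bochner_Integration.integral_diff Int_absorb2)
  qed
  have "(\<lambda>J. \<integral>x. ?h J x \<partial>M) \<longlonglongrightarrow> (\<integral>x. 0 \<partial>M)"
  proof (rule integral_dominated_convergence[where w="\<lambda>x. 2 * a 1 x"])
    show "AE x in M. (\<lambda>J. ?h J x) \<longlonglongrightarrow> 0"
    proof (rule AE_I2)
      fix x
      show "(\<lambda>J. ?h J x) \<longlonglongrightarrow> 0"
      proof (cases "x \<in> D")
        case True
        then have "\<not> good \<beta> x" by (simp add: D_def)
        then obtain N where N: "\<And>n. n \<ge> N \<Longrightarrow> \<not> lead \<beta> 0 n x" unfolding good_def by (metis of_nat_0)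
        obtain K :: nat where K: "a 1 x \<le> real K" using real_arch_simple by blast
        have "?h J x = 0" if "J \<ge> max N K" for J
        proof -
          have "x \<notin> F J" using N that by (auto simp: F_def)
          moreover have "h J x = 0" using K that by (simp add: h_def)
          ultimately show ?thesis by simp
        qed
        then have "\<forall>\<^sub>F J in sequentially. ?h J x = 0" by (rule eventually_sequentiallyI)
        then show ?thesis by (rule tendsto_eventually)
      qed simp
    qed
    show "AE x in M. norm (?h J x) \<le> 2 * a 1 x" for J
    proof (rule AE_I2)
      fix x
      show "norm (?h J x) \<le> 2 * a 1 x" using h(1)[of J x] h(2)[of J x] a_nonneg[of 1 x] by (auto simp: indicator_def)
    qed
  qed (use integrable_a in auto)
  moreover have "(\<alpha> - \<beta>) * measure M D \<le> (\<integral>x. ?h J x \<partial>M)" for J using ge[of J] eq[of J] by simp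
  ultimately have "(\<alpha> - \<beta>) * measure M D \<le> 0" using LIMSEQ_le_const by fastforce
  then have "measure M D = 0" using \<beta> measure_nonneg[of M D] by (simp add: mult_le_0_iff)
  then have "AE x in M. x \<notin> D" using AE_iff_measurable[OF \<open>D \<in> sets M\<close>, of "\<lambda>x. x \<notin> D"] sets.sets_into_space[OF \<open>D \<in> sets M\<close>] by (auto simp: emeasure_eq_measure)
  then show ?thesis using AE_space by eventually_elim (auto simp: D_def)
qed

lemma a_le_sum: "a n x \<le> (\<Sum>k<n. a 1 ((f ^^ k) x))"
proof (induction n arbitrary: x)
  case (Suc n)
  have "(\<Sum>k<Suc n. a 1 ((f ^^ k) x)) = a 1 x + (\<Sum>k<n. a 1 ((f ^^ k) (f x)))"
    unfolding sum.lessThan_Suc_shift by (simp add: funpow_swap1)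
  then show ?case using subadd[of n x] Suc[of "f x"] by simp
qed (simp add: a_0)

text \<open>The maximal ergodic theorem for \<open>a 1 - \<alpha>\<close> on the invariant set
  \<open>D\<close> bounds \<open>\<alpha> * measure M D\<close> by the integral of
  \<open>a 1\<close>. As this holds for all \<open>\<alpha>\<close>, \<open>D\<close> is a null set;
  so the upper limit is finite almost everywhere.\<close>

lemma AE_not_hi: "AE x in M. \<exists>\<alpha>::nat. \<not> hi (real \<alpha>) x"
proof -
  define D where "D = {x \<in> space M. \<forall>\<alpha>::nat. hi (real \<alpha>) x}"
  have D [measurable]: "D \<in> sets M" unfolding D_def by measurable
  have le: "real \<alpha> * measure M D \<le> (\<integral>x. a 1 x \<partial>M)" for \<alpha> :: nat
  proof -
    have iD: "integrable M (\<lambda>x. real \<alpha> * indicator D x)"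
      by (rule integrable_const_bound[of _ "real \<alpha>"]) (auto simp: indicator_def)
    then have int: "integrable M (\<lambda>x. a 1 x - real \<alpha> * indicator D x)" by (rule Bochner_Integration.integrable_diff[OF integrable_a])
    have "0 \<le> (\<integral>x. indicator D x * (a 1 x - real \<alpha>) \<partial>M)"
    proof (rule maximal_ergodic)
      show "integrable M (\<lambda>x. a 1 x - real \<alpha>)" using integrable_a by simp
      show "f x \<in> D \<longleftrightarrow> x \<in> D" if "x \<in> space M" for x
        using that f_space hi_invariant by (auto simp: D_def)
      fix x assume "x \<in> D"
      then obtain m :: nat where m: "\<And>N. \<exists>n\<ge>N. (real \<alpha> + 1 / real (Suc m)) * real n < a n x" unfolding D_def hi_def by blast
      obtain n where n: "n \<ge> 1" "(real \<alpha> + 1 / real (Suc m)) * real n < a n x" using m by blast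
      have "real \<alpha> * real n \<le> (real \<alpha> + 1 / real (Suc m)) * real n" by (rule mult_right_mono) auto
      then have "0 < (\<Sum>i<n. a 1 ((f ^^ i) x) - real \<alpha>)" using n(2) a_le_sum[of n x] by (simp add: sum_subtractf mult.commute)
      then show "\<exists>q. 0 < (\<Sum>i<q. a 1 ((f ^^ i) x) - real \<alpha>)" by blast
    qed simp
    also have "(\<integral>x. indicator D x * (a 1 x - real \<alpha>) \<partial>M) \<le> (\<integral>x. a 1 x - real \<alpha> * indicator D x \<partial>M)"
    proof (rule integral_mono)
      show "integrable M (\<lambda>x. indicator D x * (a 1 x - real \<alpha>))"
        using integrable_real_mult_indicator[OF D, of "\<lambda>x. a 1 x - real \<alpha>"] integrable_a by (simp add: mult.commute)
      fix x
      show "indicator D x * (a 1 x - real \<alpha>) \<le> a 1 x - real \<alpha> * indicator D x"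
        using a_nonneg[of 1 x] by (simp add: indicator_def)
    qed (use int in auto)
    also have "\<dots> = (\<integral>x. a 1 x \<partial>M) - real \<alpha> * measure M D"
      unfolding Bochner_Integration.integral_diff[OF integrable_a iD] using sets.sets_into_space[OF D] by (simp add: Int_absorb2)
    finally show ?thesis by simp
  qed
  have "measure M D = 0"
  proof (rule ccontr)
    assume "measure M D \<noteq> 0"
    then have "measure M D > 0" using measure_nonneg[of M D] by linarith
    then obtain \<alpha> :: nat where "(\<integral>x. a 1 x \<partial>M) < real \<alpha> * measure M D" using reals_Archimedean3 by blast
    then show False using le[of \<alpha>] by simp
  qed
  then have "AE x in M. x \<notin> D" using AE_iff_measurable[OF D, of "\<lambda>x. x \<notin> D"] sets.sets_into_space[OF D] by (auto simp: emeasure_eq_measure)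
  then show ?thesis using AE_space by eventually_elim (auto simp: D_def)
qed

text \<open>\<open>AE_good\<close> is collected over the countably many rational pairs. Any
  \<open>\<beta>\<close> below \<open>A\<close> lies below two rationals \<open>b < b' < A\<close>,
  and a leading time for \<open>b\<close> is one for \<open>\<beta>\<close>.\<close>

theorem AE_leading_times:
  "AE x in M. \<exists>A\<ge>0. (\<forall>e>0. \<forall>\<^sub>F n in sequentially. a n x \<le> (A + e) * real n) \<and>
     (\<forall>\<beta>. 0 < \<beta> \<and> \<beta> < A \<longrightarrow> (\<exists>C. \<exists>\<^sub>\<infinity>n. \<forall>k\<le>n. \<beta> * real k - C \<le> a n x - a (n - k) ((f ^^ k) x)))"
proof -
  have "AE x in M. \<forall>\<beta> \<alpha> :: rat. 0 \<le> (of_rat \<beta> :: real) \<and> of_rat \<beta> < (of_rat \<alpha> :: real) \<longrightarrow> hi (of_rat \<alpha>) x \<longrightarrow> good (of_rat \<beta>) x"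
    unfolding AE_all_countable
  proof (intro allI)
    fix \<beta> \<alpha> :: rat
    show "AE x in M. 0 \<le> (of_rat \<beta> :: real) \<and> of_rat \<beta> < (of_rat \<alpha> :: real) \<longrightarrow> hi (of_rat \<alpha>) x \<longrightarrow> good (of_rat \<beta>) x"
      using AE_good[of "of_rat \<beta>" "of_rat \<alpha>"] by (cases "0 \<le> (of_rat \<beta> :: real) \<and> of_rat \<beta> < (of_rat \<alpha> :: real)") auto
  qed
  with AE_not_hi show ?thesis
  proof eventually_elim
    fix x assume "\<exists>\<alpha>::nat. \<not> hi (real \<alpha>) x" and G: "\<forall>\<beta> \<alpha> :: rat. 0 \<le> (of_rat \<beta> :: real) \<and> of_rat \<beta> < (of_rat \<alpha> :: real) \<longrightarrow> hi (of_rat \<alpha>) x \<longrightarrow> good (of_rat \<beta>) x"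
    then obtain \<alpha>0 :: nat where \<alpha>0: "\<not> hi (real \<alpha>0) x" by blast
    \<comment> \<open>Its infimum is the upper limit of \<open>a n x / n\<close>.\<close>
    define S where "S = {\<alpha>. 0 \<le> \<alpha> \<and> \<not> hi \<alpha> x}"
    define A where "A = Inf S"
    have S: "S \<noteq> {}" "bdd_below S" using \<alpha>0 by (auto simp: S_def intro!: bdd_belowI[of _ 0] exI[of _ "real \<alpha>0"])
    have A0: "0 \<le> A" unfolding A_def by (rule cInf_greatest[OF S(1)]) (simp add: S_def)
    have up: "\<forall>\<^sub>F n in sequentially. a n x \<le> (A + e) * real n" if e: "e > 0" for e
    proof -
      obtain \<alpha> where \<alpha>: "\<alpha> \<in> S" "\<alpha> < A + e / 2" using cInf_lessD[OF S(1), of "A + e / 2"] e by (auto simp: A_def)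
      obtain m where m: "1 / real (Suc m) < e / 2" using nat_approx_posE[of "e / 2"] e by (metis half_gt_zero)
      obtain N where N: "\<And>n. n \<ge> N \<Longrightarrow> a n x \<le> (\<alpha> + 1 / real (Suc m)) * real n" using \<alpha>(1) by (auto simp: S_def hi_def not_less)
      have "a n x \<le> (A + e) * real n" if "n \<ge> N" for n
        using N[OF that] mult_right_mono[of "\<alpha> + 1 / real (Suc m)" "A + e" "real n"] \<alpha>(2) m by simp
      then show ?thesis by (rule eventually_sequentiallyI)
    qed
    have "\<exists>C. \<exists>\<^sub>\<infinity>n. \<forall>k\<le>n. \<beta> * real k - C \<le> a n x - a (n - k) ((f ^^ k) x)" if \<beta>: "0 < \<beta>" "\<beta> < A" for \<beta>
    proof -
      obtain b where b: "b \<in> \<rat>" "\<beta> < b" "b < A" using Rats_dense_in_real[OF \<beta>(2)] by blast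
      obtain q where q: "b = of_rat q" using b(1) by (rule Rats_cases)
      obtain b' where b': "b' \<in> \<rat>" "b < b'" "b' < A" using Rats_dense_in_real[OF b(3)] by blast
      obtain q' where q': "b' = of_rat q'" using b'(1) by (rule Rats_cases)
      have "b' \<notin> S" using cInf_lower[OF _ S(2), of b'] b'(3) by (auto simp: A_def)
      then have "hi b' x" using b b' \<beta> by (simp add: S_def)
      moreover have "0 \<le> b" using b(2) \<beta>(1) by simp
      ultimately have "good b x" using G b'(2) unfolding q q' by blast
      then obtain C :: nat where C: "\<And>N. \<exists>n\<ge>N. lead b (real C) n x" unfolding good_def by blast
      have "\<beta> * real k \<le> b * real k" for k using b(2) by (intro mult_right_mono) auto
      then have "\<forall>k\<le>n. \<beta> * real k - real C \<le> a n x - a (n - k) ((f ^^ k) x)" if "lead b (real C) n x" for n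
        using that unfolding lead_def by (meson diff_right_mono order_trans)
      then show ?thesis using C unfolding INFM_nat_le by blast
    qed
    then show "\<exists>A\<ge>0. (\<forall>e>0. \<forall>\<^sub>F n in sequentially. a n x \<le> (A + e) * real n) \<and>
       (\<forall>\<beta>. 0 < \<beta> \<and> \<beta> < A \<longrightarrow> (\<exists>C. \<exists>\<^sub>\<infinity>n. \<forall>k\<le>n. \<beta> * real k - C \<le> a n x - a (n - k) ((f ^^ k) x)))"
      using A0 up by blast
  qed
qed

end

section \<open>Riemannian coverings\<close>

lemma covering_section_nbhd:
  fixes p :: "'a::topological_space \<Rightarrow> 'b::topological_space"
  assumes "covering_space UNIV p UNIV"
  shows "\<exists>B. b \<in> B \<and> section_nbhd p B"
proof -
  obtain T v where T: "b \<in> T" "open T" and v: "\<Union>v = p -` T" "\<And>u. u \<in> v \<Longrightarrow> \<exists>q. homeomorphism u T p q"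
    using assms unfolding covering_space_def by (metis (no_types, lifting) Int_UNIV_left UNIV_I openin_open_eq open_openin subtopology_UNIV)
  have "\<exists>\<sigma>. local_section p a T \<sigma>" if a: "p a \<in> T" for a
  proof -
    obtain u where u: "u \<in> v" "a \<in> u" using v(1) a by blast
    obtain q where q: "homeomorphism u T p q" using v(2)[OF u(1)] by blast
    then show ?thesis using T(2) a u(2) unfolding local_section_def homeomorphism_def by blast
  qed
  then show ?thesis using T unfolding section_nbhd_def by blast
qed

text \<open>The velocity of the image is defined as a derivative in the target chart, so that it
  does not depend on a chart of the source. The assumption that no time is isolated in
  \<open>I\<close> makes this derivative unique.\<close>

lemma geo_push:
  fixes R :: "('m::{t2_space, second_countable_topology}, 'e::euclidean_space) riemannian"
    and R' :: "('n::{t2_space, second_countable_topology}, 'e) riemannian"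
  assumes R: "riem R" and R': "riem R'" and g: "riem.geo R I \<gamma> V"
    and h: "\<And>t. t \<in> I \<Longrightarrow> \<exists>U. \<gamma> t \<in> U \<and> local_iso_on R R' h U" and nt: "\<And>t. t \<in> I \<Longrightarrow> at t within I \<noteq> bot"
  obtains V' where "riem.geo R' I (h \<circ> \<gamma>) V'"
    "\<And>t c c'. t \<in> I \<Longrightarrow> c \<in> charts R \<Longrightarrow> c' \<in> charts R' \<Longrightarrow> \<gamma> t \<in> chart_dom c \<Longrightarrow> h (\<gamma> t) \<in> chart_dom c' \<Longrightarrow>
       V' t c' = chart_D c c' h (\<gamma> t) (V t c)"
proof -
  interpret R: riem R by (rule R)
  interpret R': riem R' by (rule R')
  define V' where "V' t c' = vector_derivative (coord c' \<circ> (h \<circ> \<gamma>)) (at t within I)" for t and c' :: "('n, 'e) chart"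
  have push: "((coord c' \<circ> (h \<circ> \<gamma>)) has_vector_derivative chart_D c c' h (\<gamma> t) (V t c)) (at t within I)"
    if "t \<in> I" "c \<in> charts R" "c' \<in> charts R'" "\<gamma> t \<in> chart_dom c" "h (\<gamma> t) \<in> chart_dom c'" for t c c'
  proof -
    obtain U where U: "\<gamma> t \<in> U" "local_iso_on R R' h U" using h \<open>t \<in> I\<close> by blast
    note gd = R.geoD[OF g that(2,1,4)]
    show ?thesis by (rule curve_push(1)[OF R R' U(2) that(2,3,1,4) U(1) that(5) gd(3,1)])
  qed
  have V': "V' t c' = chart_D c c' h (\<gamma> t) (V t c)"
    if "t \<in> I" "c \<in> charts R" "c' \<in> charts R'" "\<gamma> t \<in> chart_dom c" "h (\<gamma> t) \<in> chart_dom c'" for t c c'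
    unfolding V'_def by (rule vector_derivative_within[OF nt[OF that(1)] push[OF that]])
  have "R'.geo I (h \<circ> \<gamma>) V'" unfolding R'.geo_def
  proof (intro conjI ballI impI)
    show "continuous_on I (h \<circ> \<gamma>)"
      unfolding continuous_on_eq_continuous_within
    proof
      fix t assume t: "t \<in> I"
      obtain U where U: "\<gamma> t \<in> U" "open U" "continuous_on U h" using h[OF t] by (auto simp: local_iso_on_def smooth_map_on_def)
      then have "isCont h (\<gamma> t)" by (simp add: continuous_on_eq_continuous_at)
      moreover have "continuous (at t within I) \<gamma>" using R.geo_continuous[OF g] t continuous_on_eq_continuous_within by blast
      ultimately show "continuous (at t within I) (h \<circ> \<gamma>)"
        using continuous_within_compose[of t I \<gamma> h] continuous_at_imp_continuous_at_within by blast
    qed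
    fix c' t assume c': "c' \<in> charts R'" and t: "t \<in> I" and d: "(h \<circ> \<gamma>) t \<in> chart_dom c'"
    obtain c where c: "c \<in> charts R" "\<gamma> t \<in> chart_dom c" using R.chart_exists by blast
    have d': "h (\<gamma> t) \<in> chart_dom c'" using d by simp
    show "((coord c' \<circ> (h \<circ> \<gamma>)) has_vector_derivative V' t c') (at t within I)"
      using push[OF t c(1) c' c(2) d'] V'[OF t c(1) c' c(2) d'] by simp
    obtain U where U: "\<gamma> t \<in> U" "local_iso_on R R' h U" using h t by blast
    let ?A = "coord c ` (chart_dom c \<inter> U \<inter> h -` chart_dom c')"
    interpret I: isometry_patch "chart_im c" "chart_im c'" "metric_at R c" "metric_at R' c'" ?A "coord_rep c c' h"
      by (rule isometry_patch_charts[OF R R' U(2) c(1) c'])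
    have "open U" "continuous_on U h" using U(2) by (auto simp: local_iso_on_def smooth_map_on_def)
    then have "open (U \<inter> h -` chart_dom c')" using R'.chart_open(1)[OF c'] continuous_open_preimage by blast
    then have oW: "open (chart_dom c \<inter> (U \<inter> h -` chart_dom c'))" using R.chart_open(1)[OF c(1)] by blast
    have tW: "\<gamma> t \<in> chart_dom c \<inter> (U \<inter> h -` chart_dom c')" using c U d' by simp
    obtain r where r: "r > 0" "\<And>s. s \<in> I \<Longrightarrow> \<bar>s - t\<bar> < r \<Longrightarrow> \<gamma> s \<in> chart_dom c \<inter> (U \<inter> h -` chart_dom c')"
      by (rule R.geo_stays[OF g t oW tW]) blast
    have A: "coord c (\<gamma> t) \<in> ?A" using tW by blast
    have gd: "((\<lambda>s. coord c (\<gamma> s)) has_vector_derivative V t c) (at t within I)"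
      "((\<lambda>s. V s c) has_vector_derivative - chr (metric_at R c) (coord c (\<gamma> t)) (V t c) (V t c)) (at t within I)"
      using R.geoD(1,2)[OF g c(1) t c(2)] by (simp_all add: comp_def)
    from I.geodesic_transform(2)[OF gd A]
    have "((\<lambda>s. I.D (coord c (\<gamma> s)) (V s c)) has_vector_derivative - chr (metric_at R' c') (coord c' (h (\<gamma> t))) (V' t c') (V' t c')) (at t within I)"
      using coord_rep_coord[OF R c, of c' h] V'[OF t c(1) c' c(2) d'] by (simp add: I.D_def)
    then show "((\<lambda>s. V' s c') has_vector_derivative - chr (metric_at R' c') (coord c' ((h \<circ> \<gamma>) t)) (V' t c') (V' t c')) (at t within I)"
      unfolding comp_apply
      by (rule has_vector_derivative_transform_within[OF _ r(1) t])
         (use r(2) V'[OF _ c(1) c'] in \<open>auto simp: I.D_def dist_real_def\<close>)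
  qed
  then show ?thesis using that V' by blast
qed

context riem
begin

text \<open>Uniqueness of geodesics justifies the definite description in
  \<open>riem_exp\<close>.\<close>

lemma riem_exp_eq:
  assumes g: "geo {0..1} \<gamma> V" and w: "\<And>c. c \<in> charts R \<Longrightarrow> \<gamma> 0 \<in> chart_dom c \<Longrightarrow> V 0 c = w c"
  shows "riem_exp R (\<gamma> 0) w = \<gamma> 1"
  unfolding riem_exp_def
proof (rule the_equality)
  show "\<exists>\<gamma>'. geodesic_on R {0..1} \<gamma>' \<and> \<gamma>' 0 = \<gamma> 0 \<and>
     (\<forall>c\<in>charts R. \<gamma> 0 \<in> chart_dom c \<longrightarrow> ((coord c \<circ> \<gamma>') has_vector_derivative w c) (at 0 within {0..1})) \<and> \<gamma>' 1 = \<gamma> 1"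
    using g geoD(1)[OF g, of _ 0] w by (intro exI[of _ \<gamma>]) (auto simp: geodesic_on_iff)
  fix y assume "\<exists>\<gamma>'. geodesic_on R {0..1} \<gamma>' \<and> \<gamma>' 0 = \<gamma> 0 \<and>
     (\<forall>c\<in>charts R. \<gamma> 0 \<in> chart_dom c \<longrightarrow> ((coord c \<circ> \<gamma>') has_vector_derivative w c) (at 0 within {0..1})) \<and> \<gamma>' 1 = y"
  then obtain \<gamma>' V' where g': "geo {0..1} \<gamma>' V'" "\<gamma>' 0 = \<gamma> 0" "\<gamma>' 1 = y"
    and w': "\<And>c. c \<in> charts R \<Longrightarrow> \<gamma> 0 \<in> chart_dom c \<Longrightarrow> ((coord c \<circ> \<gamma>') has_vector_derivative w c) (at 0 within {0..1})"
    unfolding geodesic_on_iff by blast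
  obtain c where c: "c \<in> charts R" "\<gamma> 0 \<in> chart_dom c" using chart_exists by blast
  have "((coord c \<circ> \<gamma>') has_vector_derivative V' 0 c) (at 0 within {0..1})" using geoD(1)[OF g'(1) c(1), of 0] c(2) g'(2) by simp
  then have "V' 0 c = w c" using vector_derivative_unique_within[OF interval_nontrivial[of 0 1 0] _ w'[OF c]] by simp
  then show "y = \<gamma> 1" using geo_unique[of 0 1 \<gamma> V \<gamma>' V' 0 c 1] g g' c w by simp
qed

end

section \<open>Tangent vectors, geodesics and transformations of a covering by a Hadamard
  manifold\<close>

locale covered_hadamard = hadamard R c0 x0
  for R :: "('c::{t2_space, second_countable_topology}, 'e::euclidean_space) riemannian" and c0 x0 +
  fixes R' :: "('m::{t2_space, second_countable_topology}, 'e) riemannian" and p :: "'c \<Rightarrow> 'm"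
  assumes cover: "riemannian_covering R R' p"
begin

sublocale R': riem R'
  using cover by unfold_locales (simp add: riemannian_covering_def)

lemma covering: "covering_space UNIV p UNIV"
  using cover by (simp add: riemannian_covering_def)

lemma p_continuous: "continuous_on UNIV p"
  using covering by (simp add: covering_space_def)

lemma local_iso: "\<exists>U. y \<in> U \<and> inj_on p U \<and> local_iso_on R R' p U"
  using local_isometry_at_imp_on cover unfolding riemannian_covering_def by metis

lemma p_locally_inj: "locally_inj p"
  unfolding locally_inj_def
proof
  fix y
  obtain U where "y \<in> U" "inj_on p U" "local_iso_on R R' p U" using local_iso by blast
  then show "\<exists>V. open V \<and> y \<in> V \<and> inj_on p V" unfolding local_iso_on_def by blast
qed

lemma chart_D_bij:
  assumes "c \<in> charts R" "c' \<in> charts R'" "y \<in> chart_dom c" "p y \<in> chart_dom c'"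
  shows "bij (chart_D c c' p y)"
    "metric_at R' c' (coord c' (p y)) (chart_D c c' p y u) (chart_D c c' p y u) = metric_at R c (coord c y) u u"
proof -
  obtain U where U: "y \<in> U" "local_iso_on R R' p U" using local_iso by blast
  interpret I: isometry_patch "chart_im c" "chart_im c'" "metric_at R c" "metric_at R' c'"
    "coord c ` (chart_dom c \<inter> U \<inter> p -` chart_dom c')" "coord_rep c c' p"
    by (rule isometry_patch_charts[OF riem_axioms R'.riem_axioms U(2) assms(1,2)])
  have A: "coord c y \<in> coord c ` (chart_dom c \<inter> U \<inter> p -` chart_dom c')" using assms U by blast
  show "bij (chart_D c c' p y)" using I.D_bij[OF A] by (simp add: I.D_def)
  show "metric_at R' c' (coord c' (p y)) (chart_D c c' p y u) (chart_D c c' p y u) = metric_at R c (coord c y) u u"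
    using I.iso'[OF A, of u u] coord_rep_coord[OF riem_axioms assms(1,3), of c' p] by (simp add: I.D_def)
qed

lemma ray_nontrivial: "t \<in> {0..} \<Longrightarrow> at t within {0::real..} \<noteq> bot"
  using interval_nontrivial[of t "t + 1" t] islimpt_subset[of t "{t..t+1}" "{0..}"] by (auto simp: trivial_limit_within)

lemma geod_push:
  obtains V where "R'.geo {0..} (p \<circ> geod u) V"
    "\<And>c'. c' \<in> charts R' \<Longrightarrow> p x0 \<in> chart_dom c' \<Longrightarrow> V 0 c' = chart_D c0 c' p x0 u"
proof -
  obtain V where V: "R'.geo {0..} (p \<circ> geod u) V"
    "\<And>t c c'. t \<in> {0..} \<Longrightarrow> c \<in> charts R \<Longrightarrow> c' \<in> charts R' \<Longrightarrow> geod u t \<in> chart_dom c \<Longrightarrow> p (geod u t) \<in> chart_dom c' \<Longrightarrow>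
       V t c' = chart_D c c' p (geod u t) (vel u t c)"
    by (rule geo_push[OF riem_axioms R'.riem_axioms geod(1) _ ray_nontrivial, of u p]) (use local_iso in blast)+
  show ?thesis
  proof (rule that[OF V(1)])
    fix c' assume "c' \<in> charts R'" "p x0 \<in> chart_dom c'"
    then show "V 0 c' = chart_D c0 c' p x0 u" using V(2)[of 0 c0 c'] c0 geod by simp
  qed
qed

text \<open>The derivative of the covering map at \<open>x0\<close>, with values normalized as in
  \<open>tangent_space\<close>.\<close>

definition dp :: "'e \<Rightarrow> ('m, 'e) chart \<Rightarrow> 'e" where
  "dp u c' = (if c' \<in> charts R' \<and> p x0 \<in> chart_dom c' then chart_D c0 c' p x0 u else 0)"

text \<open>The compatibility of the components in two charts is read off from the initial velocity
  of the image of a geodesic.\<close>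

lemma dp_tangent: "dp u \<in> tangent_space R' (p x0)"
proof -
  obtain V where V: "R'.geo {0..} (p \<circ> geod u) V"
    "\<And>c'. c' \<in> charts R' \<Longrightarrow> p x0 \<in> chart_dom c' \<Longrightarrow> V 0 c' = chart_D c0 c' p x0 u" by (rule geod_push) blast
  have "dp u c'' = chart_D c' c'' id (p x0) (dp u c')"
    if c: "c' \<in> charts R'" "c'' \<in> charts R'" "p x0 \<in> chart_dom c'" "p x0 \<in> chart_dom c''" for c' c''
    using R'.geo_change[OF V(1) c(1,2), of 0] c V(2)[of c'] V(2)[of c''] ray_nontrivial geod(2)[of u] by (simp add: dp_def)
  moreover have "dp u c = 0" if "c \<notin> charts R' \<or> p x0 \<notin> chart_dom c" for c using that unfolding dp_def by presburger
  ultimately show ?thesis unfolding tangent_space_def mem_Collect_eq by (metis IntD1 IntD2)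
qed

text \<open>A tangent vector is determined by its component in one chart, and there the derivative
  of the covering map is bijective.\<close>

lemma tangent_dp:
  assumes v: "v \<in> tangent_space R' (p x0)"
  obtains u where "v = dp u"
proof -
  obtain c' where c': "c' \<in> charts R'" "p x0 \<in> chart_dom c'" using R'.chart_exists by blast
  define u where "u = inv (chart_D c0 c' p x0) (v c')"
  have u: "chart_D c0 c' p x0 u = v c'"
    unfolding u_def using chart_D_bij(1)[OF c0(1) c'(1) c0(2) c'(2)] by (simp add: bij_def surj_f_inv_f)
  have "v c'' = dp u c''" for c''
  proof (cases "c'' \<in> charts R' \<and> p x0 \<in> chart_dom c''")
    case True
    then have "v c'' = chart_D c' c'' id (p x0) (v c')" "dp u c'' = chart_D c' c'' id (p x0) (dp u c')"
      using v dp_tangent[of u] c' unfolding tangent_space_def by blast+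
    then show ?thesis using u c' by (simp add: dp_def)
  next
    case False
    then have "v c'' = 0" using v unfolding tangent_space_def by blast
    then show ?thesis using False unfolding dp_def by presburger
  qed
  then have "v = dp u" by (rule ext)
  then show ?thesis by (rule that)
qed

lemma exp_dp:
  assumes t: "t \<ge> 0"
  shows "riem_exp R' (p x0) (tangent_scale t (dp u)) = p (E (t *\<^sub>R u))"
proof -
  obtain V where V: "R'.geo {0..} (p \<circ> geod u) V"
    "\<And>c'. c' \<in> charts R' \<Longrightarrow> p x0 \<in> chart_dom c' \<Longrightarrow> V 0 c' = chart_D c0 c' p x0 u" by (rule geod_push) blast
  have g: "R'.geo {0..1} (\<lambda>s. (p \<circ> geod u) (t * s + 0)) (\<lambda>s c. t *\<^sub>R V (t * s + 0) c)"
    by (rule R'.geo_affine[OF V(1)]) (use t in auto)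
  have "riem_exp R' ((p \<circ> geod u) (t * 0 + 0)) (tangent_scale t (dp u)) = (p \<circ> geod u) (t * 1 + 0)"
    by (rule R'.riem_exp_eq[OF g]) (use V(2) geod in \<open>simp add: tangent_scale_def dp_def\<close>)
  then show ?thesis using geod geod_E[OF t] by simp
qed

text \<open>Identifies the lift that occurs in the definition of a rotation vector with a geodesic
  of the Hadamard manifold.\<close>

lemma lift_ray:
  assumes "continuous_on {0..} \<alpha>" "\<alpha> 0 = x0" "\<And>t. t \<ge> 0 \<Longrightarrow> p (\<alpha> t) = riem_exp R' (p x0) (tangent_scale t (dp u))" "t \<ge> 0"
  shows "\<alpha> t = E (t *\<^sub>R u)"
proof (rule lift_unique[OF p_locally_inj, of "{0..}" 0 t])
  show "continuous_on {0..} (\<lambda>t. E (t *\<^sub>R u))"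
    by (rule continuous_on_compose2[OF E_continuous]) (auto intro!: continuous_intros)
qed (use assms exp_dp E_zero in auto)

lemma covering_maps_agree:
  assumes "continuous_on UNIV g" "continuous_on UNIV h" "\<And>y. p (g y) = p (h y)" "g a = h a"
  shows "g y = h (y :: 'c)"
  by (rule lift_unique[OF p_locally_inj conn, of a y]) (use assms in auto)

text \<open>Through \<open>inv E\<close> the covering space is a vector space. Hence
  \<open>p \<circ> E\<close> lifts through \<open>p\<close> with any prescribed starting point in
  the fibre.\<close>

lemma deck_map:
  assumes "p x0 = p y"
  obtains \<tau> where "continuous_on UNIV \<tau>" "\<And>z. p (\<tau> z) = p z" "\<tau> x0 = y"
proof -
  have "continuous_on UNIV (\<lambda>u. p (E u))" by (rule continuous_on_compose2[OF p_continuous E_continuous]) auto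
  moreover have "p y = p (E 0)" using assms E_zero by simp
  ultimately obtain g where g: "continuous_on UNIV g" "g 0 = y" "\<And>u. p (g u) = p (E u)"
    using convex_lift_sections[OF p_locally_inj covering_section_nbhd[OF covering] convex_UNIV UNIV_I, of "\<lambda>u. p (E u)" y 0] by (metis UNIV_I)
  have "inv E x0 = 0" using inv_E(1)[of 0] E_zero by simp
  then show ?thesis
    by (intro that[of "\<lambda>z. g (inv E z)"]) (use g continuous_on_compose2[OF g(1) inv_E_continuous] in auto)
qed

text \<open>The geodesics from \<open>x0\<close> and from \<open>\<tau> x0\<close> with the same image under \<open>p\<close> are mapped to each other by \<open>\<tau>\<close>.\<close>

lemma deck_isometry:
  assumes \<tau>: "continuous_on UNIV \<tau>" "\<And>z. p (\<tau> z) = p z"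
  shows "riem_dist R (\<tau> x0) (\<tau> y) = riem_dist R x0 y"
proof -
  obtain c1 where c1: "c1 \<in> charts R" "\<tau> x0 \<in> chart_dom c1" using chart_exists by blast
  interpret T: covered_hadamard R c1 "\<tau> x0" R' p
    by unfold_locales (use c1 npc sc cover in auto)
  obtain c' where c': "c' \<in> charts R'" "p x0 \<in> chart_dom c'" using R'.chart_exists by blast
  define u where "u = inv E y"
  \<comment> \<open>The vector at \<open>\<tau> x0\<close> with the same image as \<open>u\<close>
    under the derivative of \<open>p\<close>. It exists because that derivative is
    bijective.\<close>
  define u' where "u' = inv (chart_D c1 c' p (\<tau> x0)) (chart_D c0 c' p x0 u)"
  have c'': "p (\<tau> x0) \<in> chart_dom c'" using c' \<tau> by simp
  have eq: "chart_D c1 c' p (\<tau> x0) u' = chart_D c0 c' p x0 u"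
    unfolding u'_def using chart_D_bij(1)[OF c1(1) c'(1) c1(2) c''] by (simp add: bij_def surj_f_inv_f)
  obtain V where V: "R'.geo {0..} (p \<circ> geod u) V"
    "\<And>c'. c' \<in> charts R' \<Longrightarrow> p x0 \<in> chart_dom c' \<Longrightarrow> V 0 c' = chart_D c0 c' p x0 u" by (rule geod_push) blast
  obtain V' where V': "R'.geo {0..} (p \<circ> T.geod u') V'"
    "\<And>c'. c' \<in> charts R' \<Longrightarrow> p (\<tau> x0) \<in> chart_dom c' \<Longrightarrow> V' 0 c' = chart_D c1 c' p (\<tau> x0) u'" by (rule T.geod_push) blast
  have pE: "p (geod u t) = p (T.geod u' t)" if "t \<in> {0..1}" for t
    using R'.geo_unique[of 0 1 "p \<circ> geod u" V "p \<circ> T.geod u'" V' 0 c' t] R'.geo_subset[OF V(1), of "{0..1}"] R'.geo_subset[OF V'(1), of "{0..1}"]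
      V(2)[OF c'] V'(2)[OF c'(1) c''] eq that c' geod T.geod \<tau>(2) by simp
  have "\<tau> (geod u 1) = T.geod u' 1"
  proof (rule lift_unique[OF p_locally_inj, of "{0..1}" 0 1])
    show "continuous_on {0..1} (\<lambda>t. \<tau> (geod u t))"
      by (rule continuous_on_compose2[OF \<tau>(1) geo_continuous[OF geod_sub]]) auto
    show "continuous_on {0..1} (T.geod u')" by (rule geo_continuous[OF T.geod_sub]) auto
  qed (use pE \<tau> geod T.geod in auto)
  then have "\<tau> y = T.E u'" by (simp add: T.E_def E_def[symmetric] u_def)
  then have "riem_dist R (\<tau> x0) (\<tau> y) = T.N u'" by (simp add: T.dist_E)
  also have "\<dots> = N u"
    using chart_D_bij(2)[OF c0(1) c'(1) c0(2) c'(2), of u] chart_D_bij(2)[OF c1(1) c'(1) c1(2) c'', of u'] eq \<tau>(2)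
    by (simp add: N_def G0_def T.N_def T.G0_def)
  also have "\<dots> = riem_dist R x0 y" using dist_E[of u] by (simp add: u_def)
  finally show ?thesis .
qed

end

section \<open>Existence and uniqueness of rotation vectors\<close>

context covered_hadamard
begin

lemma rotation_vector_smallo:
  assumes "is_rotation_vector R R' p F (p x0) (dp u)"
  shows "(\<lambda>n. riem_dist R (E (real n *\<^sub>R u)) ((F ^^ n) x0)) \<in> o(\<lambda>n. real n)"
proof -
  obtain \<alpha> where "continuous_on {0..} \<alpha>" "\<alpha> 0 = x0" "\<And>t. t \<ge> 0 \<Longrightarrow> p (\<alpha> t) = riem_exp R' (p x0) (tangent_scale t (dp u))"
    and o: "(\<lambda>n. riem_dist R (\<alpha> (real n)) ((F ^^ n) x0)) \<in> o(\<lambda>n. real n)"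
    using assms unfolding is_rotation_vector_def by blast
  from lift_ray[OF this(1-3)] o show ?thesis by simp
qed

lemma rotation_vector_unique:
  assumes "is_rotation_vector R R' p F (p x0) v" "is_rotation_vector R R' p F (p x0) w"
  shows "v = w"
proof -
  obtain u where u: "v = dp u" using assms(1) tangent_dp unfolding is_rotation_vector_def by blast
  obtain u' where u': "w = dp u'" using assms(2) tangent_dp unfolding is_rotation_vector_def by blast
  show ?thesis
    using tracking_unique[OF rotation_vector_smallo rotation_vector_smallo] assms unfolding u u' by blast
qed

text \<open>Every other lift of \<open>p x0\<close> is \<open>\<tau> x0\<close> for a map
  \<open>\<tau>\<close> as in \<open>deck_map\<close>, which carries both the tracking geodesic and
  the orbit of \<open>F\<close> along.\<close>

lemma rotation_vector_dp:
  assumes F: "\<And>\<tau> z. continuous_on UNIV \<tau> \<Longrightarrow> (\<And>z. p (\<tau> z) = p z) \<Longrightarrow> F (\<tau> z) = \<tau> (F z)"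
    and o: "(\<lambda>n. riem_dist R (E (real n *\<^sub>R u)) ((F ^^ n) x0)) \<in> o(\<lambda>n. real n)"
    and iso: "\<And>\<tau> y z. continuous_on UNIV \<tau> \<Longrightarrow> (\<And>z. p (\<tau> z) = p z) \<Longrightarrow> riem_dist R (\<tau> y) (\<tau> z) = riem_dist R y z"
  shows "is_rotation_vector R R' p F (p x0) (dp u)"
  unfolding is_rotation_vector_def
proof (intro conjI allI impI dp_tangent)
  fix y assume "p y = p x0"
  then obtain \<tau> where \<tau>: "continuous_on UNIV \<tau>" "\<And>z. p (\<tau> z) = p z" "\<tau> x0 = y" using deck_map by metis
  have Fn: "(F ^^ n) (\<tau> z) = \<tau> ((F ^^ n) z)" for n z
    by (induction n) (simp_all add: F[OF \<tau>(1,2)])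
  show "\<exists>\<alpha>. continuous_on {0..} \<alpha> \<and> \<alpha> 0 = y \<and> (\<forall>t\<ge>0. p (\<alpha> t) = riem_exp R' (p x0) (tangent_scale t (dp u))) \<and>
      (\<lambda>n. riem_dist R (\<alpha> (real n)) ((F ^^ n) y)) \<in> o(\<lambda>n. real n)"
  proof (intro exI[of _ "\<lambda>t. \<tau> (E (t *\<^sub>R u))"] conjI allI impI)
    show "continuous_on {0..} (\<lambda>t. \<tau> (E (t *\<^sub>R u)))"
      by (intro continuous_on_compose2[OF \<tau>(1)] continuous_on_compose2[OF E_continuous]) (auto intro!: continuous_intros)
    show "\<tau> (E (0 *\<^sub>R u)) = y" using \<tau>(3) E_zero by simp
    show "p (\<tau> (E (t *\<^sub>R u))) = riem_exp R' (p x0) (tangent_scale t (dp u))" if "t \<ge> 0" for t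
      using exp_dp[OF that] \<tau>(2) by simp
    show "(\<lambda>n. riem_dist R (\<tau> (E (real n *\<^sub>R u))) ((F ^^ n) y)) \<in> o(\<lambda>n. real n)"
      using o unfolding \<tau>(3)[symmetric] Fn iso[OF \<tau>(1,2)] .
  qed
qed

end

theorem theorem2:
  fixes Mt :: "('c::{t2_space, second_countable_topology}, 'e::euclidean_space) riemannian"
    and M :: "('m::{t2_space, second_countable_topology}, 'e) riemannian"
    and \<pi> :: "'c \<Rightarrow> 'm" and f :: "'m \<Rightarrow> 'm" and F :: "'c \<Rightarrow> 'c"
    and \<mu> :: "'m measure" and lft :: "'m \<Rightarrow> 'c"
  assumes "hadamard_manifold Mt"
    and "riemannian_covering Mt M \<pi>"
    and "\<And>x. \<pi> (lft x) = x"
    and "\<exists>k. homeomorphism UNIV UNIV f k"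
    and "isotopic_to_id f"
    and "lift_of \<pi> f F"
    and "\<And>\<tau>. covering_transformation \<pi> \<tau> \<Longrightarrow> F \<circ> \<tau> = \<tau> \<circ> F"
    and "prob_space \<mu>" and "sets \<mu> = sets borel"
    and "distr \<mu> borel f = \<mu>"
    and "(\<integral>\<^sup>+ x. ennreal (riem_dist Mt (lft x) (F (lft x))) \<partial>\<mu>) < \<infinity>"
  shows "AE x in \<mu>. \<exists>!v. is_rotation_vector Mt M \<pi> F x v"
proof -
  let ?d = "riem_dist Mt"
  interpret Mt: complete_riem Mt
    using assms(1) unfolding hadamard_manifold_def by unfold_locales auto
  define ch where "ch y = (SOME c. c \<in> charts Mt \<and> y \<in> chart_dom c)" for y
  have C: "covered_hadamard Mt (ch y) y M \<pi>" for y
  proof unfold_locales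
    show "ch y \<in> charts Mt" "y \<in> chart_dom (ch y)" unfolding ch_def by (rule Mt.some_chart)+
  qed (use assms(1,2) in \<open>auto simp: hadamard_manifold_def\<close>)
  have deck: "\<exists>\<tau>. continuous_on UNIV \<tau> \<and> (\<forall>z. \<pi> (\<tau> z) = \<pi> z) \<and> \<tau> y = z" if "\<pi> y = \<pi> z" for y z
    using covered_hadamard.deck_map[OF C that] by metis
  have iso: "?d (\<tau> y) (\<tau> z) = ?d y z" if "continuous_on UNIV \<tau>" "\<And>z. \<pi> (\<tau> z) = \<pi> z" for \<tau> y z
    using covered_hadamard.deck_isometry[OF C that] .
  have F\<tau>: "F (\<tau> z) = \<tau> (F z)" if \<tau>: "continuous_on UNIV \<tau>" "\<And>z. \<pi> (\<tau> z) = \<pi> z" for \<tau> z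
  proof -
    \<comment> \<open>The hypothesis on \<open>F\<close> concerns homeomorphisms, whereas
      \<open>\<tau>\<close> is so far just a continuous lift of \<open>\<pi>\<close>. A second such
      lift that sends \<open>\<tau> z\<close> back to \<open>z\<close> is its inverse, by uniqueness
      of lifts.\<close>
    obtain \<sigma> where \<sigma>: "continuous_on UNIV \<sigma>" "\<And>y. \<pi> (\<sigma> y) = \<pi> y" "\<sigma> (\<tau> z) = z" using deck[of "\<tau> z" z] \<tau>(2) by metis
    have "\<sigma> (\<tau> y) = id y" for y
      by (rule covered_hadamard.covering_maps_agree[OF C, where a=z])
         (use \<sigma> \<tau> continuous_on_compose2[OF \<sigma>(1) \<tau>(1)] in \<open>auto simp: continuous_on_id\<close>)
    moreover have "\<tau> (\<sigma> y) = id y" for y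
      by (rule covered_hadamard.covering_maps_agree[OF C, where a="\<tau> z"])
         (use \<sigma> \<tau> continuous_on_compose2[OF \<tau>(1) \<sigma>(1)] in \<open>auto simp: continuous_on_id\<close>)
    ultimately have "homeomorphism UNIV UNIV \<tau> \<sigma>" using \<sigma>(1) \<tau>(1) unfolding homeomorphism_def by (metis UNIV_I id_apply surj_def top.extremum_unique subset_UNIV subsetI rangeI)
    then have "covering_transformation \<pi> \<tau>" using \<tau>(2) unfolding covering_transformation_def by auto
    from assms(7)[OF this] show ?thesis by (metis comp_apply)
  qed
  have F: "continuous_on UNIV F" "\<And>y. \<pi> (F y) = f (\<pi> y)" using assms(6) unfolding lift_of_def by (auto dest: fun_cong)
  have \<pi>F: "\<pi> ((F ^^ n) y) = (f ^^ n) (\<pi> y)" for n y by (induction n) (simp_all add: F)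
  have Fn: "continuous_on UNIV (F ^^ n)" for n
    by (induction n) (auto simp: continuous_on_id id_def[symmetric] intro: continuous_on_compose2[OF F(1)])
  define a where "a n x = ?d (lft x) ((F ^^ n) (lft x))" for n x
  \<comment> \<open>A covering transformation takes \<open>y\<close> to the chosen lift; it commutes
    with the powers of \<open>F\<close> and preserves distances. So the displacement is a function
    on \<open>M\<close>.\<close>
  have a: "?d y ((F ^^ n) y) = a n (\<pi> y)" for n y
  proof -
    obtain \<tau> where \<tau>: "continuous_on UNIV \<tau>" "\<And>z. \<pi> (\<tau> z) = \<pi> z" "\<tau> y = lft (\<pi> y)"
      using deck[of y "lft (\<pi> y)"] assms(3) by auto
    have "(F ^^ n) (\<tau> z) = \<tau> ((F ^^ n) z)" for z by (induction n) (simp_all add: F\<tau>[OF \<tau>(1,2)])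
    then show ?thesis using iso[OF \<tau>(1,2), of y "(F ^^ n) y"] by (simp add: a_def \<tau>(3)[symmetric])
  qed
  have a_shift: "?d ((F ^^ k) y) ((F ^^ n) y) = a (n - k) ((f ^^ k) (\<pi> y))" if "k \<le> n" for k n y
    using a[of "(F ^^ k) y" "n - k"] that by (simp add: \<pi>F funpow_add[symmetric, unfolded comp_def, THEN fun_cong] flip: funpow_add)
  \<comment> \<open>\<open>lft\<close> is an arbitrary choice of lifts and may be discontinuous.
    Near each point it can be replaced by a continuous local section of \<open>\<pi>\<close>,
    because the displacement is the same for all lifts.\<close>
  have a_cont: "continuous_on UNIV (a n)" for n
    unfolding continuous_on_eq_continuous_at[OF open_UNIV]
  proof
    fix x
    have "\<exists>B. x \<in> B \<and> section_nbhd \<pi> B" by (rule covering_section_nbhd[OF covered_hadamard.covering[OF C]])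
    then obtain B \<sigma> where B: "open B" "x \<in> B" "continuous_on B \<sigma>" "\<And>z. z \<in> B \<Longrightarrow> \<pi> (\<sigma> z) = z"
      unfolding section_nbhd_def local_section_def using assms(3) by metis
    have "continuous_on B (\<lambda>z. ?d (\<sigma> z) ((F ^^ n) (\<sigma> z)))"
      using B(3) continuous_on_compose2[OF Fn[of n] B(3)] unfolding continuous_on_def by (auto intro: Mt.tendsto_dist)
    then have "continuous_on B (a n)" by (rule continuous_on_eq) (use a[of "\<sigma> _" n] B(4) in auto)
    then show "isCont (a n) x" using B(1,2) by (simp add: continuous_on_eq_continuous_at)
  qed
  have f_cont: "continuous_on UNIV f" using assms(4) homeomorphism_cont1 by blast
  have f_meas: "f \<in> measurable \<mu> \<mu>"
    using borel_measurable_continuous_onI[OF f_cont] measurable_cong_sets[OF assms(9) assms(9)] by blast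
  have a_meas: "a n \<in> borel_measurable \<mu>" for n
    using borel_measurable_continuous_onI[OF a_cont[of n]] measurable_cong_sets[OF assms(9) refl] by blast
  interpret P: prob_space \<mu> by (rule assms(8))
  interpret S: subadditive_cocycle \<mu> f a
  proof unfold_locales
    show "f \<in> measurable \<mu> \<mu>" by (rule f_meas)
    have "distr \<mu> \<mu> f = distr \<mu> borel f" by (rule distr_cong) (use assms(9) in auto)
    then show "distr \<mu> \<mu> f = \<mu>" using assms(10) by simp
    show "a n \<in> borel_measurable \<mu>" for n by (rule a_meas)
    show "a 0 x = 0" for x by (simp add: a_def Mt.dist_self)
    show "a n x \<ge> 0" for n x by (simp add: a_def Mt.dist_nonneg)
    fix n x
    have 1: "a (Suc n) x = ?d (lft x) ((F ^^ Suc n) (lft x))" "a 1 x = ?d (lft x) (F (lft x))" by (simp_all add: a_def)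
    have 2: "?d (F (lft x)) ((F ^^ Suc n) (lft x)) = a n (f x)" using a_shift[of 1 "Suc n" "lft x"] assms(3) by simp
    show "a (Suc n) x \<le> a 1 x + a n (f x)" unfolding 1 2[symmetric] by (rule Mt.dist_triangle)
    show "a n (f x) \<le> a 1 x + a (Suc n) x" unfolding 1 2[symmetric]
      using Mt.dist_triangle[of "F (lft x)" "(F ^^ Suc n) (lft x)" "lft x"] Mt.dist_sym[of "F (lft x)"] by simp
  next
    show "integrable \<mu> (a 1)"
      by (rule integrableI_nonneg[OF a_meas]) (use assms(11) in \<open>simp_all add: a_def Mt.dist_nonneg\<close>)
  qed
  from S.AE_leading_times show ?thesis
  proof eventually_elim
    fix x
    interpret H: covered_hadamard Mt "ch (lft x)" "lft x" M \<pi> by (rule C)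
    assume "\<exists>A\<ge>0. (\<forall>e>0. \<forall>\<^sub>F n in sequentially. a n x \<le> (A + e) * real n) \<and>
     (\<forall>\<beta>. 0 < \<beta> \<and> \<beta> < A \<longrightarrow> (\<exists>C. \<exists>\<^sub>\<infinity>n. \<forall>k\<le>n. \<beta> * real k - C \<le> a n x - a (n - k) ((f ^^ k) x)))"
    then obtain A where A: "A \<ge> 0" "\<And>e. e > 0 \<Longrightarrow> \<forall>\<^sub>F n in sequentially. a n x \<le> (A + e) * real n"
      "\<And>\<beta>. 0 < \<beta> \<Longrightarrow> \<beta> < A \<Longrightarrow> \<exists>C. \<exists>\<^sub>\<infinity>n. \<forall>k\<le>n. \<beta> * real k - C \<le> a n x - a (n - k) ((f ^^ k) x)" by blast
    let ?y = "\<lambda>n. (F ^^ n) (lft x)"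
    have 1: "?d (lft x) (?y n) = a n x" for n by (simp add: a_def)
    have 2: "?d (?y k) (?y n) = a (n - k) ((f ^^ k) x)" if "k \<le> n" for k n using a_shift[OF that, of "lft x"] assms(3) by simp
    have "\<exists>u. (\<lambda>k. ?d (H.E (real k *\<^sub>R u)) (?y k)) \<in> o(\<lambda>n. real n)"
    proof (rule H.tracking[OF A(1)])
      show "\<forall>\<^sub>F n in sequentially. ?d (lft x) (?y n) \<le> (A + e) * real n" if "e > 0" for e using A(2)[OF that] by (simp add: 1)
      show "\<exists>C. \<exists>\<^sub>\<infinity>n. \<forall>k\<le>n. \<beta> * real k - C \<le> ?d (lft x) (?y n) - ?d (?y k) (?y n)" if "0 < \<beta>" "\<beta> < A" for \<beta>
        using A(3)[OF that] by (simp add: 1 2 cong: imp_cong)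
    qed
    then obtain u where u: "(\<lambda>k. ?d (H.E (real k *\<^sub>R u)) (?y k)) \<in> o(\<lambda>n. real n)" by blast
    have "is_rotation_vector Mt M \<pi> F (\<pi> (lft x)) (H.dp u)"
      by (rule H.rotation_vector_dp[OF F\<tau> u iso])
    then show "\<exists>!v. is_rotation_vector Mt M \<pi> F x v"
      using H.rotation_vector_unique[of F] unfolding assms(3) by blast
  qed
qed

end
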